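(* In the framework described in the context, let $$M_k=J(ik)LJ(ik)+J(ik)S(ik)J(ik),$$ a symmetric operator on $L^2$ whose domain contains $H^4$. Assume that for every $k$ and every real-valued $u$, $J(ik)u$ and $S(ik)u$ are also real-valued. Assume that there exists $k_0\ne0$ such that zero is a simple eigenvalue of $M_{k_0}$ with corresponding real-valued nontrivial eigenvector $\varphi\in H^\infty$ normalized so that $\|\varphi\|_{L^2(\mathbb{R})}=1$. Finally, assume that $M_{k_0}$ is a Fredholm map of index zero, that $M_k$ depends smoothly on $k$ for $k$ close to $k_0$, and that the non-degeneracy condition $$\Big(\Big[\frac{d}{dk}M_k\Big]_{k=k_0}\varphi,\varphi\Big)\ne0$$ holds. Then there exist $k$ in a vicinity of $k_0$ and $\sigma>0$ such that there exists an unstable mode with amplification parameter $\sigma$ and transverse frequency $k$.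
   Context: **Notation.** $d\ge1$ is an integer. $H^s$ is the Sobolev space on $\mathbb{R}$ of $\mathbb{R}^d$-valued (or $\mathbb{C}^d$-valued) functions, with norm $|\cdot|_s$; $|\cdot|=|\cdot|_0$; $(\cdot,\cdot)$ is the (complex) $L^2(\mathbb{R})$ scalar product; $H^\infty=\bigcap_sH^s$; $\mathcal{B}(X,Y)$ denotes bounded linear operators; $[A,B]=AB-BA$. **One-dimensional model.** $\partial_tu=J(L_0u+\nabla F(u))$, where $F\in C^\infty(\mathbb{R}^d;\mathbb{R})$, $F(0)=0$; $J$ is a Fourier multiplier in $x$, skew-symmetric for the $L^2$ scalar product, with domain containing $H^1$ (order at most one) and $\mathrm{Ker}\,J=\{0\}$; $L_0$ is a Fourier multiplier, symmetric, with a self-adjoint realisation on $L^2$ with domain $D(L_0)\supset H^2$, and $C^{-1}|u|_1^2\le(L_0u,u)\le C|u|_1^2$. $Q\in H^\infty$ satisfies $L_0Q+\nabla F(Q)=0$. Set $L=L_0+R$, $Ru=\nabla^2F(Q)u$. The spectrum of $L$ is $\{\mu\}\cup\{0\}\cup\Sigma$ with $\mu<0$ a simple eigenvalue, $0$ an eigenvalue of finite multiplicity, $\Sigma\subset[\alpha,+\infty)$, $\alpha>0$; the eigenspaces of $\mu$ and $0$ consist of $H^\infty$ functions. **Transverse model.** $\partial_tu=\mathcal{J}(\partial_y)(L_0u+\nabla F(u)+\mathcal{S}(\partial_y)u)$, where $\mathcal{J}(\partial_y),\mathcal{S}(\partial_y)$ are operator-valued Fourier multipliers in $y$ with symbols $J(ik),S(ik)$,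 which are Fourier multipliers in $x$. *On $J(ik)$*, for every $k$: $J(ik)$ and $J(ik)L_0$ are skew-symmetric on $L^2(\mathbb{R})$, $J(0)=J$; the domain of $J(ik)$ contains $H^1$, $\mathrm{Ker}\,J(ik)=\{0\}$, $|J(ik)u|\le C|u|_1$ for $u\in H^1$ with $C$ independent of $k$; $|([R,J(ik)]w,w)|\le C|w|^2$ with $C$ independent of $k$. *On $S(ik)$*, for every $k$: $S(ik)$ is non-negative and symmetric, $J(ik)S(ik)$ is skew-symmetric, $S(0)=0$; $S(ik)$ has a self-adjoint realisation on $L^2$ with domain $\mathcal{D}_S=\mathcal{D}(S(ik))$ independent of $k\ne0$; $J(ik)S(ik)J(ik)$ and $J(ik)S(ik)\partial_x$ belong to $\mathcal{B}(H^2,L^2)$; with $|w|_{S(ik)}^2=(w,S(ik)w)$, $|J(ik)S(ik)u|\le C(k)|u|_{S(ik)}$ for $u\in\mathcal{D}_S$, with $C(k)\ge0$ continuous. *Compatibility*: there exist $K$, $c_0>0$ such that for $|k|\ge K$, $(Lv,v)+(S(ik)v,v)\ge c_0|v|_1^2$ for all $v\in H^2\cap\mathcal{D}_S$. **Unstable modes.** An unstable mode is a nontrivial $U\in L^2\cap\mathcal{D}(S(ik))$ such that $\sigma U=J(ik)(L+S(ik))U$ for some $\sigma\in\mathbb{C}$ with $\mathrm{Re}\,\sigma>0$ (amplification parameter) and $k\in\mathbb{R}$ (transverse frequency). *)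

theory Defs
  imports "HOL-Analysis.Analysis"
begin

section \<open>Square-integrable vector-valued functions on the line\<close>

text \<open>
  Elements of \<open>L\<^sup>2(\<real>; \<complex>\<^sup>d)\<close> are represented by functions, \<open>'d\<close> being an index type with \<open>d\<close>
  elements, and equality in \<open>L\<^sup>2\<close> is equality almost everywhere, written \<open>\<doteq>\<close>.
  An unbounded operator is given by its domain and by a function on representatives which is
  only meaningful on that domain.
\<close>

type_synonym 'd vfun = "real \<Rightarrow> complex ^ 'd"
type_synonym 'd symbol = "real \<Rightarrow> complex ^ 'd ^ 'd"

definition ae_eq :: "'d::finite vfun \<Rightarrow> 'd vfun \<Rightarrow> bool"  (infix "\<doteq>" 50) where
  "u \<doteq> v \<longleftrightarrow> (AE x in lborel. u x = v x)"

definition L2 :: "'d::finite vfun set" where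
  "L2 = {u \<in> borel_measurable lborel. integrable lborel (\<lambda>x. (norm (u x))\<^sup>2)}"

definition l2_inner :: "'d::finite vfun \<Rightarrow> 'd vfun \<Rightarrow> complex" where
  "l2_inner u v = (LINT x|lborel. (\<Sum>i\<in>UNIV. u x $ i * cnj (v x $ i)))"

definition l2_norm :: "'d::finite vfun \<Rightarrow> real" where
  "l2_norm u = sqrt (LINT x|lborel. (norm (u x))\<^sup>2)"

definition real_valued :: "'d::finite vfun \<Rightarrow> bool" where
  "real_valued u \<longleftrightarrow> (AE x in lborel. \<forall>i. u x $ i \<in> \<real>)"

definition cvec :: "real ^ 'd::finite \<Rightarrow> complex ^ 'd" where
  "cvec a = (\<chi> i. complex_of_real (a $ i))"

definition cmat :: "real ^ 'd ^ 'd::finite \<Rightarrow> complex ^ 'd ^ 'd" where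
  "cmat A = (\<chi> i j. complex_of_real (A $ i $ j))"


section \<open>Fourier transform, Sobolev spaces and Fourier multipliers\<close>

text \<open>
  Plancherel's extension of \<open>u \<mapsto> \<integral> e\<^bsup>-ix\<xi>\<^esup> u(x) dx\<close> to \<open>L\<^sup>2\<close>: the \<open>L\<^sup>2\<close>-limit of the transforms of
  the truncations of \<open>u\<close> to \<open>[-n, n]\<close>.  With this normalisation
  \<open>\<parallel>fourier u\<parallel>\<^sup>2 = 2\<pi> \<parallel>u\<parallel>\<^sup>2\<close>, whence the factor in the Sobolev norms below.
\<close>

definition is_fourier :: "'d::finite vfun \<Rightarrow> 'd vfun \<Rightarrow> bool" where
  "is_fourier u v \<longleftrightarrow> u \<in> L2 \<and> v \<in> L2 \<and>
     (\<lambda>n::nat. \<integral>\<^sup>+\<xi>. ennreal ((norm ((LINT x:{-real n..real n}|lborel.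
         exp (- (\<i> * complex_of_real (x * \<xi>))) *s u x) - v \<xi>))\<^sup>2) \<partial>lborel) \<longlonglongrightarrow> 0"

definition fourier :: "'d::finite vfun \<Rightarrow> 'd vfun" where
  "fourier u = (SOME v. is_fourier u v)"

definition inv_fourier :: "'d::finite vfun \<Rightarrow> 'd vfun" where
  "inv_fourier v = (SOME u. is_fourier u v)"

definition bessel :: "real \<Rightarrow> 'd::finite vfun \<Rightarrow> 'd vfun" where
  "bessel s u = (\<lambda>\<xi>. ((1 + \<xi>\<^sup>2) powr (s / 2)) *\<^sub>R fourier u \<xi>)"

text \<open>Subspaces of \<open>L\<^sup>2\<close>: only exponents \<open>s \<ge> 0\<close> are used.\<close>

definition sobolev :: "real \<Rightarrow> 'd::finite vfun set" where
  "sobolev s = {u \<in> L2. bessel s u \<in> L2}"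

definition sobolev_norm :: "real \<Rightarrow> 'd::finite vfun \<Rightarrow> real" where
  "sobolev_norm s u = l2_norm (bessel s u) / sqrt (2 * pi)"

definition sobolev_inf :: "'d::finite vfun set" where
  "sobolev_inf = (\<Inter>s\<in>{0..}. sobolev s)"

text \<open>Fourier multipliers carry their maximal domain.\<close>

definition fm_dom :: "'d::finite symbol \<Rightarrow> 'd vfun set" where
  "fm_dom m = {u \<in> L2. (\<lambda>\<xi>. m \<xi> *v fourier u \<xi>) \<in> L2}"

definition fm :: "'d::finite symbol \<Rightarrow> 'd vfun \<Rightarrow> 'd vfun" where
  "fm m u = inv_fourier (\<lambda>\<xi>. m \<xi> *v fourier u \<xi>)"

text \<open>
  Products of Fourier multipliers are again Fourier multipliers, with the product symbol and the
  corresponding maximal domain.  This is how \<open>J(ik)S(ik)J(ik)\<close> etc. have to be understood: for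
  the KP-I equation \<open>J(ik) = \<partial>\<^sub>x\<close>, \<open>S(ik) = -k\<^sup>2\<partial>\<^sub>x\<^sup>-\<^sup>2\<close>, the product is the bounded operator \<open>-k\<^sup>2\<close>,
  whereas a composition of the unbounded operators would not be defined on all of \<open>H\<^sup>2\<close>.
\<close>

definition sym_prod :: "'d::finite symbol \<Rightarrow> 'd symbol \<Rightarrow> 'd symbol"  (infixr "\<odot>" 70) where
  "m \<odot> n = (\<lambda>\<xi>. m \<xi> ** n \<xi>)"

definition sym_dx :: "'d::finite symbol" where
  "sym_dx \<xi> = mat (\<i> * complex_of_real \<xi>)"


section \<open>Notions for operators on \<open>L\<^sup>2\<close>\<close>

definition symmetric_op :: "'d::finite vfun set \<Rightarrow> ('d vfun \<Rightarrow> 'd vfun) \<Rightarrow> bool" where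
  "symmetric_op D T \<longleftrightarrow> (\<forall>u\<in>D. \<forall>v\<in>D. l2_inner (T u) v = l2_inner u (T v))"

definition skew_op :: "'d::finite vfun set \<Rightarrow> ('d vfun \<Rightarrow> 'd vfun) \<Rightarrow> bool" where
  "skew_op D T \<longleftrightarrow> (\<forall>u\<in>D. \<forall>v\<in>D. l2_inner (T u) v = - l2_inner u (T v))"

definition selfadjoint_op :: "'d::finite vfun set \<Rightarrow> ('d vfun \<Rightarrow> 'd vfun) \<Rightarrow> bool" where
  "selfadjoint_op D T \<longleftrightarrow>
     (\<forall>u\<in>L2. \<forall>e>0. \<exists>v\<in>D. l2_norm (\<lambda>x. u x - v x) < e) \<and>
     symmetric_op D T \<and>
     (\<forall>v\<in>L2. \<forall>w\<in>L2. (\<forall>u\<in>D. l2_inner (T u) v = l2_inner u w) \<longrightarrow> v \<in> D \<and> T v \<doteq> w)"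

definition in_resolvent_set ::
    "'d::finite vfun set \<Rightarrow> ('d vfun \<Rightarrow> 'd vfun) \<Rightarrow> complex \<Rightarrow> bool" where
  "in_resolvent_set D T z \<longleftrightarrow>
     (\<forall>f\<in>L2. \<exists>u\<in>D. (\<lambda>x. T u x - z *s u x) \<doteq> f) \<and>
     (\<exists>C. \<forall>u\<in>D. l2_norm u \<le> C * l2_norm (\<lambda>x. T u x - z *s u x))"

definition op_spectrum :: "'d::finite vfun set \<Rightarrow> ('d vfun \<Rightarrow> 'd vfun) \<Rightarrow> complex set" where
  "op_spectrum D T = {z. \<not> in_resolvent_set D T z}"

text \<open>
  \<open>eigdim D T z p\<close>: the eigenspace of \<open>T\<close> for \<open>z\<close> (the kernel of \<open>T\<close>, if \<open>z = 0\<close>) has dimension \<open>p\<close>,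
  linear independence and spanning being understood up to null sets.
\<close>

definition eigdim ::
    "'d::finite vfun set \<Rightarrow> ('d vfun \<Rightarrow> 'd vfun) \<Rightarrow> complex \<Rightarrow> nat \<Rightarrow> bool" where
  "eigdim D T z p \<longleftrightarrow> (\<exists>e :: nat \<Rightarrow> 'd vfun.
     (\<forall>i<p. e i \<in> D \<and> T (e i) \<doteq> (\<lambda>x. z *s e i x)) \<and>
     (\<forall>c. (\<lambda>x. \<Sum>i<p. c i *s e i x) \<doteq> (\<lambda>x. 0) \<longrightarrow> (\<forall>i<p. c i = 0)) \<and>
     (\<forall>u\<in>D. T u \<doteq> (\<lambda>x. z *s u x) \<longrightarrow> (\<exists>c. u \<doteq> (\<lambda>x. \<Sum>i<p. c i *s e i x))))"

text \<open>
  Used for symmetric operators only, for which geometric and algebraic multiplicities agree.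
\<close>

definition simple_eigenvalue ::
    "'d::finite vfun set \<Rightarrow> ('d vfun \<Rightarrow> 'd vfun) \<Rightarrow> complex \<Rightarrow> bool" where
  "simple_eigenvalue D T z \<longleftrightarrow> eigdim D T z 1"

definition closed_op :: "'d::finite vfun set \<Rightarrow> ('d vfun \<Rightarrow> 'd vfun) \<Rightarrow> bool" where
  "closed_op D T \<longleftrightarrow> (\<forall>(w :: nat \<Rightarrow> 'd vfun) u f.
     (\<forall>n. w n \<in> D) \<and> u \<in> L2 \<and> f \<in> L2 \<and>
     (\<lambda>n. l2_norm (\<lambda>x. w n x - u x)) \<longlonglongrightarrow> 0 \<and>
     (\<lambda>n. l2_norm (\<lambda>x. T (w n) x - f x)) \<longlonglongrightarrow> 0
     \<longrightarrow> u \<in> D \<and> T u \<doteq> f)"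

definition closed_range :: "'d::finite vfun set \<Rightarrow> ('d vfun \<Rightarrow> 'd vfun) \<Rightarrow> bool" where
  "closed_range D T \<longleftrightarrow> (\<forall>(w :: nat \<Rightarrow> 'd vfun) f.
     (\<forall>n. w n \<in> D) \<and> f \<in> L2 \<and> (\<lambda>n. l2_norm (\<lambda>x. T (w n) x - f x)) \<longlonglongrightarrow> 0
     \<longrightarrow> (\<exists>u\<in>D. T u \<doteq> f))"

text \<open>The range of \<open>T\<close> has codimension \<open>q\<close> in \<open>L\<^sup>2\<close>: it has a complement with basis \<open>e\<close>.\<close>

definition range_codim ::
    "'d::finite vfun set \<Rightarrow> ('d vfun \<Rightarrow> 'd vfun) \<Rightarrow> nat \<Rightarrow> bool" where
  "range_codim D T q \<longleftrightarrow> (\<exists>e :: nat \<Rightarrow> 'd vfun.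
     (\<forall>i<q. e i \<in> L2) \<and>
     (\<forall>f\<in>L2. \<exists>u\<in>D. \<exists>c. f \<doteq> (\<lambda>x. T u x + (\<Sum>i<q. c i *s e i x))) \<and>
     (\<forall>u\<in>D. \<forall>c. (\<lambda>x. T u x + (\<Sum>i<q. c i *s e i x)) \<doteq> (\<lambda>x. 0) \<longrightarrow> (\<forall>i<q. c i = 0)))"

definition fredholm_index ::
    "'d::finite vfun set \<Rightarrow> ('d vfun \<Rightarrow> 'd vfun) \<Rightarrow> int \<Rightarrow> bool" where
  "fredholm_index D T ind \<longleftrightarrow> closed_op D T \<and> closed_range D T \<and>
     (\<exists>p q. eigdim D T 0 p \<and> range_codim D T q \<and> ind = int p - int q)"

definition graph_norm :: "('d::finite vfun \<Rightarrow> 'd vfun) \<Rightarrow> 'd vfun \<Rightarrow> real" where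
  "graph_norm T u = l2_norm u + l2_norm (T u)"

text \<open>\<open>A \<in> \<B>(D, L\<^sup>2)\<close>, where \<open>D\<close> carries the norm \<open>N\<close>.\<close>

definition bounded_op ::
    "'d::finite vfun set \<Rightarrow> ('d vfun \<Rightarrow> real) \<Rightarrow> ('d vfun \<Rightarrow> 'd vfun) \<Rightarrow> bool" where
  "bounded_op D N A \<longleftrightarrow>
     (\<forall>u\<in>D. A u \<in> L2) \<and>
     (\<forall>u\<in>D. \<forall>v\<in>D. \<forall>a b. A (\<lambda>x. a *s u x + b *s v x) \<doteq> (\<lambda>x. a *s A u x + b *s A v x)) \<and>
     (\<exists>C. \<forall>u\<in>D. l2_norm (A u) \<le> C * N u)"

text \<open>\<open>B\<close> is the derivative at \<open>k\<close> of the family \<open>A\<close>, in the operator norm of \<open>\<B>(D, L\<^sup>2)\<close>.\<close>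

definition has_op_derivative ::
    "'d::finite vfun set \<Rightarrow> ('d vfun \<Rightarrow> real) \<Rightarrow> (real \<Rightarrow> 'd vfun \<Rightarrow> 'd vfun) \<Rightarrow>
     ('d vfun \<Rightarrow> 'd vfun) \<Rightarrow> real \<Rightarrow> bool" where
  "has_op_derivative D N A B k \<longleftrightarrow> bounded_op D N B \<and>
     (\<forall>e>0. \<exists>r>0. \<forall>h. 0 < \<bar>h\<bar> \<and> \<bar>h\<bar> < r \<longrightarrow> (\<forall>u\<in>D.
        l2_norm (\<lambda>x. (1 / h) *\<^sub>R (A (k + h) u x - A k u x) - B u x) \<le> e * N u))"

text \<open>
  Smooth dependence on \<open>k\<close> close to \<open>k0\<close> of operators \<open>T k\<close> with domains \<open>D k\<close>: on the domain of
  \<open>T k0\<close> with its graph norm, they form a \<open>C\<^sup>\<infinity>\<close> family of bounded operators into \<open>L\<^sup>2\<close>;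
  \<open>A n\<close> is the \<open>n\<close>-th derivative.
\<close>

definition smooth_family_near ::
    "(real \<Rightarrow> 'd::finite vfun set) \<Rightarrow> (real \<Rightarrow> 'd vfun \<Rightarrow> 'd vfun) \<Rightarrow> real \<Rightarrow> bool" where
  "smooth_family_near D T k0 \<longleftrightarrow> (\<exists>r>0. \<exists>A :: nat \<Rightarrow> real \<Rightarrow> 'd vfun \<Rightarrow> 'd vfun.
     (\<forall>k. \<bar>k - k0\<bar> < r \<longrightarrow> D k0 \<subseteq> D k \<and> (\<forall>u\<in>D k0. A 0 k u \<doteq> T k u)) \<and>
     (\<forall>n k. \<bar>k - k0\<bar> < r \<longrightarrow>
        bounded_op (D k0) (graph_norm (T k0)) (A n k) \<and>
        has_op_derivative (D k0) (graph_norm (T k0)) (A n) (A (Suc n) k) k))"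


section \<open>The nonlinearity\<close>

definition partial_deriv :: "'d::finite \<Rightarrow> (real ^ 'd \<Rightarrow> real) \<Rightarrow> real ^ 'd \<Rightarrow> real" where
  "partial_deriv i F a = frechet_derivative F (at a) (axis i 1)"

primrec Ck :: "nat \<Rightarrow> (real ^ 'd::finite \<Rightarrow> real) \<Rightarrow> bool" where
  "Ck 0 F \<longleftrightarrow> continuous_on UNIV F"
| "Ck (Suc n) F \<longleftrightarrow> (\<forall>a. F differentiable (at a)) \<and> (\<forall>i. Ck n (partial_deriv i F))"

definition smooth_fun :: "(real ^ 'd::finite \<Rightarrow> real) \<Rightarrow> bool" where
  "smooth_fun F \<longleftrightarrow> (\<forall>n. Ck n F)"

definition gradient :: "(real ^ 'd::finite \<Rightarrow> real) \<Rightarrow> real ^ 'd \<Rightarrow> real ^ 'd" where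
  "gradient F a = (\<chi> i. partial_deriv i F a)"

definition hessian :: "(real ^ 'd::finite \<Rightarrow> real) \<Rightarrow> real ^ 'd \<Rightarrow> real ^ 'd ^ 'd" where
  "hessian F a = (\<chi> i j. partial_deriv i (partial_deriv j F) a)"


section \<open>The operators \<open>R\<close>, \<open>L\<close> and \<open>M\<^sub>k\<close>\<close>

text \<open>
  \<open>l0\<close> is the symbol of \<open>L\<^sub>0\<close>; \<open>jk k\<close> and \<open>sk k\<close> are the symbols (in \<open>\<xi>\<close>) of the Fourier multipliers
  \<open>J(ik)\<close> and \<open>S(ik)\<close>.
\<close>

definition R_op :: "(real ^ 'd::finite \<Rightarrow> real) \<Rightarrow> (real \<Rightarrow> real ^ 'd) \<Rightarrow> 'd vfun \<Rightarrow> 'd vfun" where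
  "R_op F Q u = (\<lambda>x. cmat (hessian F (Q x)) *v u x)"

definition L_dom :: "'d::finite symbol \<Rightarrow> 'd vfun set" where
  "L_dom l0 = fm_dom l0"

definition L_op :: "(real ^ 'd::finite \<Rightarrow> real) \<Rightarrow> (real \<Rightarrow> real ^ 'd) \<Rightarrow> 'd symbol \<Rightarrow>
    'd vfun \<Rightarrow> 'd vfun" where
  "L_op F Q l0 u = (\<lambda>x. fm l0 u x + R_op F Q u x)"

text \<open>
  \<open>J(ik)LJ(ik)\<close> is a composition of operators, \<open>J(ik)S(ik)J(ik)\<close> is the Fourier multiplier with the
  product symbol.  \<open>M\<^sub>k\<close> has the natural domain of the sum of the two.
\<close>

definition M_dom :: "(real ^ 'd::finite \<Rightarrow> real) \<Rightarrow> (real \<Rightarrow> real ^ 'd) \<Rightarrow> 'd symbol \<Rightarrow>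
    (real \<Rightarrow> 'd symbol) \<Rightarrow> (real \<Rightarrow> 'd symbol) \<Rightarrow> real \<Rightarrow> 'd vfun set" where
  "M_dom F Q l0 jk sk k =
     {u \<in> fm_dom (jk k). fm (jk k) u \<in> L_dom l0 \<and> L_op F Q l0 (fm (jk k) u) \<in> fm_dom (jk k)}
     \<inter> fm_dom (jk k \<odot> sk k \<odot> jk k)"

definition M_op :: "(real ^ 'd::finite \<Rightarrow> real) \<Rightarrow> (real \<Rightarrow> real ^ 'd) \<Rightarrow> 'd symbol \<Rightarrow>
    (real \<Rightarrow> 'd symbol) \<Rightarrow> (real \<Rightarrow> 'd symbol) \<Rightarrow> real \<Rightarrow> 'd vfun \<Rightarrow> 'd vfun" where
  "M_op F Q l0 jk sk k u =
     (\<lambda>x. fm (jk k) (L_op F Q l0 (fm (jk k) u)) x + fm (jk k \<odot> sk k \<odot> jk k) u x)"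

definition unstable_mode :: "(real ^ 'd::finite \<Rightarrow> real) \<Rightarrow> (real \<Rightarrow> real ^ 'd) \<Rightarrow> 'd symbol \<Rightarrow>
    (real \<Rightarrow> 'd symbol) \<Rightarrow> (real \<Rightarrow> 'd symbol) \<Rightarrow> complex \<Rightarrow> real \<Rightarrow> 'd vfun \<Rightarrow> bool" where
  "unstable_mode F Q l0 jk sk \<sigma> k U \<longleftrightarrow>
     U \<in> L2 \<and> U \<in> fm_dom (sk k) \<and> U \<in> L_dom l0 \<and> \<not> U \<doteq> (\<lambda>x. 0) \<and> Re \<sigma> > 0 \<and>
     (\<lambda>x. L_op F Q l0 U x + fm (sk k) U x) \<in> fm_dom (jk k) \<and>
     (\<lambda>x. \<sigma> *s U x) \<doteq> fm (jk k) (\<lambda>x. L_op F Q l0 U x + fm (sk k) U x)"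


section \<open>The framework\<close>

text \<open>
  The unknown of the one-dimensional model \<open>\<partial>\<^sub>tu = J(L\<^sub>0u + \<nabla>F(u))\<close> is \<open>\<real>\<^sup>d\<close>-valued; accordingly
  \<open>L\<^sub>0\<close> maps real-valued functions to real-valued ones.
\<close>

locale one_dim_model =
  fixes F :: "real ^ 'd::finite \<Rightarrow> real"
    and Q :: "real \<Rightarrow> real ^ 'd"
    and l0 j0 :: "'d symbol"
    and \<mu> \<alpha> :: real
    and \<Sigma> :: "real set"
  assumes F_smooth: "smooth_fun F"
    and F_zero: "F 0 = 0"
    and J_measurable: "j0 \<in> borel_measurable lborel"
    and J_skew: "skew_op (fm_dom j0) (fm j0)"
    and J_dom: "sobolev 1 \<subseteq> fm_dom j0"
    and J_inj: "u \<in> fm_dom j0 \<Longrightarrow> fm j0 u \<doteq> (\<lambda>x. 0) \<Longrightarrow> u \<doteq> (\<lambda>x. 0)"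
    and L0_measurable: "l0 \<in> borel_measurable lborel"
    and L0_selfadjoint: "selfadjoint_op (fm_dom l0) (fm l0)"
    and L0_dom: "sobolev 2 \<subseteq> fm_dom l0"
    and L0_real: "u \<in> fm_dom l0 \<Longrightarrow> real_valued u \<Longrightarrow> real_valued (fm l0 u)"
    and L0_form: "\<exists>C>0. \<forall>u\<in>sobolev 2.
          (sobolev_norm 1 u)\<^sup>2 / C \<le> Re (l2_inner (fm l0 u) u) \<and>
          Re (l2_inner (fm l0 u) u) \<le> C * (sobolev_norm 1 u)\<^sup>2"
    and Q_smooth: "(\<lambda>x. cvec (Q x)) \<in> sobolev_inf"
    and Q_stationary: "(\<lambda>x. fm l0 (\<lambda>y. cvec (Q y)) x + cvec (gradient F (Q x))) \<doteq> (\<lambda>x. 0)"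
    and \<mu>_neg: "\<mu> < 0"
    and \<alpha>_pos: "\<alpha> > 0"
    and \<Sigma>_bound: "\<Sigma> \<subseteq> {\<alpha>..}"
    and L_spectrum: "op_spectrum (L_dom l0) (L_op F Q l0) =
          {complex_of_real \<mu>} \<union> {0} \<union> complex_of_real ` \<Sigma>"
    and \<mu>_simple: "simple_eigenvalue (L_dom l0) (L_op F Q l0) (complex_of_real \<mu>)"
    and zero_eigenvalue: "\<exists>p>0. eigdim (L_dom l0) (L_op F Q l0) 0 p"
    and eigenvectors_smooth: "\<And>z u. z \<in> {complex_of_real \<mu>, 0} \<Longrightarrow> u \<in> L_dom l0 \<Longrightarrow>
          L_op F Q l0 u \<doteq> (\<lambda>x. z *s u x) \<Longrightarrow> u \<in> sobolev_inf"

locale transverse_model = one_dim_model F Q l0 j0 \<mu> \<alpha> \<Sigma>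
  for F :: "real ^ 'd::finite \<Rightarrow> real" and Q l0 j0 \<mu> \<alpha> \<Sigma> +
  fixes jk sk :: "real \<Rightarrow> 'd symbol"
  assumes Jk_measurable: "jk k \<in> borel_measurable lborel"
    and Jk_skew: "skew_op (fm_dom (jk k)) (fm (jk k))"
    and JkL0_skew: "skew_op (fm_dom (jk k \<odot> l0)) (fm (jk k \<odot> l0))"
    and J0_eq: "AE \<xi> in lborel. jk 0 \<xi> = j0 \<xi>"
    and Jk_dom: "sobolev 1 \<subseteq> fm_dom (jk k)"
    and Jk_inj: "u \<in> fm_dom (jk k) \<Longrightarrow> fm (jk k) u \<doteq> (\<lambda>x. 0) \<Longrightarrow> u \<doteq> (\<lambda>x. 0)"
    and Jk_bound: "\<exists>C. \<forall>k. \<forall>u\<in>sobolev 1. l2_norm (fm (jk k) u) \<le> C * sobolev_norm 1 u"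
    and Jk_commutator: "\<exists>C. \<forall>k. \<forall>w\<in>sobolev 1.
          norm (l2_inner (\<lambda>x. R_op F Q (fm (jk k) w) x - fm (jk k) (R_op F Q w) x) w)
            \<le> C * (l2_norm w)\<^sup>2"
    and Sk_measurable: "sk k \<in> borel_measurable lborel"
    and Sk_symmetric: "symmetric_op (fm_dom (sk k)) (fm (sk k))"
    and Sk_nonneg: "u \<in> fm_dom (sk k) \<Longrightarrow> 0 \<le> Re (l2_inner u (fm (sk k) u))"
    and JkSk_skew: "skew_op (fm_dom (jk k \<odot> sk k)) (fm (jk k \<odot> sk k))"
    and S0_eq: "AE \<xi> in lborel. sk 0 \<xi> = 0"
    and Sk_selfadjoint: "k \<noteq> 0 \<Longrightarrow> selfadjoint_op (fm_dom (sk k)) (fm (sk k))"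
    and Sk_dom: "k \<noteq> 0 \<Longrightarrow> k' \<noteq> 0 \<Longrightarrow> fm_dom (sk k) = fm_dom (sk k')"
    and JkSkJk_dom: "sobolev 2 \<subseteq> fm_dom (jk k \<odot> sk k \<odot> jk k)"
    and JkSkJk_bounded:
          "bounded_op (sobolev 2) (sobolev_norm 2) (fm (jk k \<odot> sk k \<odot> jk k))"
    and JkSkdx_dom: "sobolev 2 \<subseteq> fm_dom (jk k \<odot> sk k \<odot> sym_dx)"
    and JkSkdx_bounded:
          "bounded_op (sobolev 2) (sobolev_norm 2) (fm (jk k \<odot> sk k \<odot> sym_dx))"
    and JkSk_bound: "\<exists>C. continuous_on UNIV C \<and> (\<forall>k. 0 \<le> C k) \<and>
          (\<forall>k. \<forall>u\<in>fm_dom (sk k). u \<in> fm_dom (jk k \<odot> sk k) \<and>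
             l2_norm (fm (jk k \<odot> sk k) u) \<le> C k * sqrt (Re (l2_inner u (fm (sk k) u))))"
    and compatibility: "\<exists>K>0. \<exists>c>0. \<forall>k. \<bar>k\<bar> \<ge> K \<longrightarrow>
          (\<forall>v\<in>sobolev 2 \<inter> fm_dom (sk k).
             c * (sobolev_norm 1 v)\<^sup>2
               \<le> Re (l2_inner (L_op F Q l0 v) v) + Re (l2_inner (fm (sk k) v) v))"

end

theory Submission
  imports Defs "HOL-Probability.Characteristic_Functions" "HOL-Probability.Sinc_Integral"
begin

text \<open>
  Write \<open>U = J(ik)V\<close>.  Since \<open>J(ik)\<close> is injective, the equation \<open>\<sigma>U = J(ik)(L + S(ik))U\<close> of an
  unstable mode becomes the pencil equation \<open>M\<^sub>k V = \<sigma> J(ik)V\<close>, in which \<open>M\<^sub>k\<close> is symmetric and \<open>J(ik)\<close>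
  is skew-symmetric.  The form of \<open>M\<^sub>k\<close> is \<open>(M\<^sub>k u, u) = -(LJu, Ju) - (S J u, J u)\<close>, where \<open>S\<close> is
  non-negative and \<open>L\<close> has exactly one negative direction; hence \<open>M\<^sub>k\<close> has at most one positive
  direction.  At \<open>k\<^sub>0\<close> it has a simple kernel spanned by \<open>\<phi>\<close>.  By the non-degeneracy condition
  \<open>(M\<^sub>k \<phi>, \<phi>)\<close> changes sign at \<open>k\<^sub>0\<close>, so that on one side of \<open>k\<^sub>0\<close>, arbitrarily close to it, \<open>M\<^sub>k\<close> is
  invertible and has precisely one positive direction
  (\<open>surj_after_simple_kernel_splits\<close>, \<open>Mop_one_positive_direction\<close>).

  For such a \<open>k\<close>, which is kept fixed from now on, the pencil has a positive eigenvalue \<open>\<sigma>\<close>; this is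
  \<open>positive_eigenvalue_of_indefinite_pencil\<close>.  With \<open>\<psi> = M\<phi>\<close> the form of \<open>-M\<close> is coercive on the
  hyperplane orthogonal to \<open>\<psi>\<close>, and adding the skew operator \<open>J\<close> does not change the form.  So for every
  \<open>s \<ge> 0\<close> there is a unique \<open>V(s)\<close> in \<open>\<phi>\<close> plus the hyperplane for which \<open>(M - sJ)V(s) = g(s)\<psi>\<close> with a scalar
  \<open>g(s)\<close>.  The function \<open>g\<close> is continuous with \<open>g(0) = 1\<close>, and a zero \<open>s > 0\<close> of \<open>g\<close> is an eigenvalue.  If \<open>g\<close>
  remained positive, then \<open>V(s)\<close> and \<open>J V(s)\<close> would be bounded, and the equation divided by \<open>s\<close> would show
  that \<open>J V(s)\<close> tends to zero weakly; as the range of \<open>J\<close> is dense, \<open>V(s)\<close> would tend to zero weakly too,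
  whereas \<open>(V(s), \<psi>)\<close> is a positive constant.

  The spectral information on \<open>L\<close> is given by resolvents, not by a spectral decomposition.  Its form is
  reached in \<open>nonneg_on_complement_of_negative_eigenspace\<close>: a lower bound of the form of a symmetric
  operator can be moved up across every gap of its spectrum (\<open>form_bound_across_gap\<close>).

  To apply these Hilbert space arguments, \<open>L\<^sup>2\<close> is made a complete real inner product space of classes of
  functions, and Plancherel's theorem is proved for it.  Operator properties of Fourier multipliers
  (symmetry, positivity, order, reality) then become pointwise properties of their symbols almost
  everywhere, by testing with functions whose transforms are cut down by a weight.  Pointwise, the
  products of multipliers behave like the formal compositions; in particular \<open>S(ik)J(ik)V\<close> is in \<open>L\<^sup>2\<close> for
  a solution \<open>V\<close> of the pencil equation because \<open>J(ik)\<close> is injective (\<open>unstable_mode_of_pencil\<close>).  The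
  abstract results are applied in the real subspace of real-valued functions, where the kernel of
  \<open>M\<close> at \<open>k\<^sub>0\<close> is a real line.
\<close>

section \<open>Symmetric operators on subspaces\<close>

text \<open>Unbounded operators are total functions that are only meaningful on a subspace \<open>D\<close>; linearity is
  required there and nowhere else.\<close>

definition lin_on :: "'a::real_vector set \<Rightarrow> ('a \<Rightarrow> 'b::real_vector) \<Rightarrow> bool" where
  "lin_on D T \<longleftrightarrow> subspace D \<and> (\<forall>x\<in>D. \<forall>y\<in>D. T (x + y) = T x + T y) \<and>
     (\<forall>c. \<forall>x\<in>D. T (c *\<^sub>R x) = c *\<^sub>R T x)"

lemma lin_onD:
  assumes "lin_on D T"
  shows "subspace D" "x \<in> D \<Longrightarrow> y \<in> D \<Longrightarrow> T (x + y) = T x + T y"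
    "x \<in> D \<Longrightarrow> T (c *\<^sub>R x) = c *\<^sub>R T x"
    "x \<in> D \<Longrightarrow> y \<in> D \<Longrightarrow> T (x - y) = T x - T y"
    "T 0 = 0" "x \<in> D \<Longrightarrow> T (- x) = - T x"
proof -
  show *: "subspace D" "\<And>x y. x \<in> D \<Longrightarrow> y \<in> D \<Longrightarrow> T (x + y) = T x + T y"
    "\<And>x c. x \<in> D \<Longrightarrow> T (c *\<^sub>R x) = c *\<^sub>R T x" using assms by (auto simp: lin_on_def)
  show "T 0 = 0" using *(3)[of 0 0] subspace_0[OF *(1)] by simp
  show n: "x \<in> D \<Longrightarrow> T (- x) = - T x" for x using *(3)[of x "-1"] by simp
  show "x \<in> D \<Longrightarrow> y \<in> D \<Longrightarrow> T (x - y) = T x - T y"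
    using *(2)[of x "- y"] n[of y] subspace_neg[OF *(1), of y] by simp
qed

lemma lin_on_subset: "lin_on D T \<Longrightarrow> subspace E \<Longrightarrow> E \<subseteq> D \<Longrightarrow> lin_on E T"
  unfolding lin_on_def by (meson subsetD)

lemma lin_on_add_scaled:
  assumes "lin_on D T" "lin_on D E"
  shows "lin_on D (\<lambda>u. T u + c *\<^sub>R E u)"
  using assms by (auto simp: lin_on_def algebra_simps)

lemma lin_on_shift: "lin_on D T \<Longrightarrow> lin_on D (\<lambda>u. T u - c *\<^sub>R u)"
  by (auto simp: lin_on_def algebra_simps)

lemma lin_on_comp:
  "lin_on D S \<Longrightarrow> lin_on E T \<Longrightarrow> (\<And>x. x \<in> D \<Longrightarrow> S x \<in> E) \<Longrightarrow> lin_on D (\<lambda>x. T (S x))"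
  by (auto simp: lin_on_def)

lemma nonneg_affine_imp_zero:
  assumes "\<And>c::real. 0 \<le> a + 2 * c * b" shows "b = 0"
proof (rule ccontr)
  assume b: "b \<noteq> 0"
  from assms[of "- (a + 1) / (2 * b)"] b show False by (simp add: field_simps)
qed

text \<open>A non-negative symmetric form satisfies the Cauchy--Schwarz inequality because its value on
  \<open>u + c v\<close> is a non-negative quadratic polynomial in \<open>c\<close>.\<close>

lemma form_Cauchy_Schwarz:
  fixes A :: "'a::real_inner \<Rightarrow> 'a"
  assumes lin: "lin_on D A" and sym: "\<And>u v. u \<in> D \<Longrightarrow> v \<in> D \<Longrightarrow> A u \<bullet> v = u \<bullet> A v"
    and nonneg: "\<And>u. u \<in> D \<Longrightarrow> 0 \<le> A u \<bullet> u" and D: "u \<in> D" "v \<in> D"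
  shows "(A v \<bullet> u)\<^sup>2 \<le> (A v \<bullet> v) * (A u \<bullet> u)"
proof -
  have exp: "0 \<le> A u \<bullet> u + 2 * c * (A v \<bullet> u) + c\<^sup>2 * (A v \<bullet> v)" for c
  proof -
    have "u + c *\<^sub>R v \<in> D" using D lin_onD(1)[OF lin] by (simp add: subspace_add subspace_scale)
    from nonneg[OF this] have "0 \<le> (A u + c *\<^sub>R A v) \<bullet> (u + c *\<^sub>R v)"
      using D lin_onD[OF lin] by (simp add: subspace_scale)
    also have "\<dots> = A u \<bullet> u + 2 * c * (A v \<bullet> u) + c\<^sup>2 * (A v \<bullet> v)"
      using sym[OF D] by (simp add: inner_add_left inner_add_right power2_eq_square inner_commute algebra_simps)
    finally show ?thesis .
  qed
  show ?thesis
  proof (cases "A v \<bullet> v = 0")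
    case True
    have "A v \<bullet> u = 0" by (rule nonneg_affine_imp_zero[of "A u \<bullet> u"]) (use exp True in simp)
    with True show ?thesis by simp
  next
    case False
    then have pos: "A v \<bullet> v > 0" using nonneg[OF D(2)] by simp
    have "0 \<le> A u \<bullet> u - (A v \<bullet> u)\<^sup>2 / (A v \<bullet> v)"
      using exp[of "- (A v \<bullet> u) / (A v \<bullet> v)"] pos by (simp add: field_simps power2_eq_square)
    with pos show ?thesis by (simp add: field_simps)
  qed
qed

text \<open>If \<open>f\<close> had positive distance from \<open>S\<close>, a minimizing sequence would converge to a point \<open>p\<close> of \<open>X\<close>,
  and \<open>f - p\<close> would be a non-zero vector orthogonal to \<open>S\<close>.\<close>

lemma dense_if_trivial_complement:
  fixes S X :: "'a::{real_inner,complete_space} set"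
  assumes S: "subspace S" "S \<subseteq> X" and X: "subspace X" "closed X"
    and triv: "\<And>v. v \<in> X \<Longrightarrow> (\<And>s. s \<in> S \<Longrightarrow> v \<bullet> s = 0) \<Longrightarrow> v = 0"
    and f: "f \<in> X" and e: "0 < e"
  shows "\<exists>s\<in>S. norm (f - s) < e"
proof (rule ccontr)
  assume "\<not> ?thesis"
  then have ge: "e \<le> norm (f - s)" if "s \<in> S" for s using that by force
  define d where "d = (INF s\<in>S. (norm (f - s))\<^sup>2)"
  have ne: "S \<noteq> {}" using S(1) subspace_0 by blast
  have bdd: "bdd_below ((\<lambda>s. (norm (f - s))\<^sup>2) ` S)" by (auto intro!: bdd_belowI[of _ 0])
  have d_le: "d \<le> (norm (f - s))\<^sup>2" if "s \<in> S" for s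
    unfolding d_def using bdd that by (rule cINF_lower)
  have "e\<^sup>2 \<le> d" unfolding d_def
    by (rule cINF_greatest[OF ne]) (use ge e in \<open>auto intro!: power_mono\<close>)
  then have d_pos: "d > 0" using e by (meson less_le_trans zero_less_power)
  have "\<exists>s\<in>S. (norm (f - s))\<^sup>2 < d + 1 / real (Suc n)" for n
  proof -
    have "Inf ((\<lambda>s. (norm (f - s))\<^sup>2) ` S) < d + 1 / real (Suc n)" unfolding d_def by simp
    then show ?thesis using cInf_less_iff[of "(\<lambda>s. (norm (f - s))\<^sup>2) ` S"] ne bdd by auto
  qed
  then obtain s where s: "\<And>n. s n \<in> S" "\<And>n. (norm (f - s n))\<^sup>2 < d + 1 / real (Suc n)" by metis
  \<comment> \<open>The parallelogram law makes every minimizing sequence Cauchy.\<close>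
  have par: "(norm (s n - s m))\<^sup>2 \<le> 2 / real (Suc n) + 2 / real (Suc m)" for n m
  proof -
    have "(1/2) *\<^sub>R (s n + s m) \<in> S" using s S(1) by (simp add: subspace_add subspace_scale)
    from d_le[OF this] have *: "d \<le> (norm (f - (1/2) *\<^sub>R (s n + s m)))\<^sup>2" .
    have "(norm (s n - s m))\<^sup>2 = 2 * (norm (f - s n))\<^sup>2 + 2 * (norm (f - s m))\<^sup>2
        - 4 * (norm (f - (1/2) *\<^sub>R (s n + s m)))\<^sup>2"
      by (simp add: power2_norm_eq_inner inner_diff_left inner_diff_right inner_add_left
          inner_add_right inner_commute algebra_simps)
    with * s(2)[of n] s(2)[of m] show ?thesis by linarith
  qed
  have "Cauchy s"
  proof (rule metric_CauchyI)
    fix r :: real assume r: "0 < r"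
    obtain N where N: "4 / r\<^sup>2 < real N" using reals_Archimedean2 by blast
    have "dist (s m) (s n) < r" if "m \<ge> N" "n \<ge> N" for m n
    proof -
      have N0: "real N > 0" using N r by (meson divide_nonneg_nonneg less_le_trans not_le zero_le_numeral zero_le_power2 order_le_less_trans)
      have "2 / real (Suc n) \<le> 2 / real (Suc N)" "2 / real (Suc m) \<le> 2 / real (Suc N)"
        using that by (auto intro!: divide_left_mono)
      then have "(norm (s m - s n))\<^sup>2 \<le> 4 / real (Suc N)" using par[of m n] by linarith
      also have "\<dots> < 4 / real N" using N0 by (simp add: divide_strict_left_mono)
      also have "\<dots> < r\<^sup>2" using N N0 r by (simp add: field_simps)
      finally show ?thesis using r by (simp add: dist_norm power_less_imp_less_base)
    qed
    then show "\<exists>N. \<forall>m\<ge>N. \<forall>n\<ge>N. dist (s m) (s n) < r" by blast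
  qed
  then obtain p where p: "s \<longlonglongrightarrow> p" using convergent_eq_Cauchy by blast
  have pX: "p \<in> X" by (rule closed_sequentially[OF X(2) _ p]) (use s(1) S(2) in auto)
  have min: "d \<le> (norm (f - p - t))\<^sup>2" if "t \<in> S" for t
  proof (rule LIMSEQ_le_const)
    show "(\<lambda>n. (norm (f - s n - t))\<^sup>2) \<longlonglongrightarrow> (norm (f - p - t))\<^sup>2" by (intro tendsto_intros p)
    have "d \<le> (norm (f - s n - t))\<^sup>2" for n
      using d_le[of "s n + t"] s(1) that S(1) by (simp add: subspace_add algebra_simps)
    then show "\<exists>N. \<forall>n\<ge>N. d \<le> (norm (f - s n - t))\<^sup>2" by blast
  qed
  have lim_le: "(norm (f - p))\<^sup>2 \<le> d"
  proof (rule LIMSEQ_le)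
    show "(\<lambda>n. (norm (f - s n))\<^sup>2) \<longlonglongrightarrow> (norm (f - p))\<^sup>2" by (intro tendsto_intros p)
    show "(\<lambda>n. d + 1 / real (Suc n)) \<longlonglongrightarrow> d"
      using tendsto_add[OF tendsto_const LIMSEQ_inverse_real_of_nat, of d] by (simp add: inverse_eq_divide)
  qed (use s(2) less_imp_le in blast)
  have "(f - p) \<bullet> t = 0" if t: "t \<in> S" for t
  proof -
    have quad: "0 \<le> c\<^sup>2 * (t \<bullet> t) - 2 * c * ((f - p) \<bullet> t)" for c
    proof -
      have "d \<le> (norm (f - p - c *\<^sub>R t))\<^sup>2" using min t S(1) by (simp add: subspace_scale)
      also have "\<dots> = (norm (f - p))\<^sup>2 - 2 * c * ((f - p) \<bullet> t) + c\<^sup>2 * (t \<bullet> t)"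
        unfolding power2_norm_eq_inner
        by (simp add: inner_diff_left inner_diff_right inner_commute power2_eq_square algebra_simps)
      finally show ?thesis using lim_le by linarith
    qed
    show ?thesis
    proof (cases "t = 0")
      case False
      then have tt: "t \<bullet> t > 0" by simp
      have "0 \<le> - (((f - p) \<bullet> t)\<^sup>2) / (t \<bullet> t)"
        using quad[of "((f - p) \<bullet> t) / (t \<bullet> t)"] tt by (simp add: field_simps power2_eq_square)
      then have "((f - p) \<bullet> t)\<^sup>2 \<le> 0" using tt by (simp add: field_simps)
      then show ?thesis by simp
    qed simp
  qed
  then have "f - p = 0" using triv[of "f - p"] f pX X(1) by (simp add: subspace_diff)
  then show False using min[of 0] subspace_0[OF S(1)] d_pos by simp
qed

text \<open>A gliding hump instead of Baire's theorem: from \<open>u\<^sub>n \<in> U\<close> of norm at least \<open>4\<^sup>n\<close> a series with terms of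
  norm \<open>3\<^sup>-\<^sup>n\<close> is built, with signs such that each partial sum keeps what its last term gained against \<open>u\<^sub>n\<close>.
  The sum of the series has unbounded products with the \<open>u\<^sub>n\<close>.\<close>

lemma uniform_boundedness:
  fixes X :: "'a::{real_inner,complete_space} set"
  assumes X: "subspace X" "closed X" and U: "U \<subseteq> X"
    and pw: "\<And>f. f \<in> X \<Longrightarrow> \<exists>c. \<forall>u\<in>U. \<bar>u \<bullet> f\<bar> \<le> c"
  shows "\<exists>K. \<forall>u\<in>U. norm u \<le> K"
proof (rule ccontr)
  assume "\<not> ?thesis"
  then have "\<exists>u\<in>U. norm u > 4 ^ n" for n :: nat by (meson not_le)
  then obtain u where u: "\<And>n. u n \<in> U" "\<And>n::nat. norm (u n) > 4 ^ n" by metis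
  define y where "y n = (1 / 3 ^ n) *\<^sub>R sgn (u n)" for n
  define x where "x = rec_nat 0 (\<lambda>n z. if 0 \<le> u n \<bullet> z then z + y n else z - y n)"
  have x_Suc: "x (Suc n) = (if 0 \<le> u n \<bullet> x n then x n + y n else x n - y n)" and x0: "x 0 = 0" for n
    by (simp_all add: x_def)
  have un: "norm (u n) > 0" for n using u(2)[of n] by (meson less_trans zero_less_numeral zero_less_power)
  have ny: "norm (y n) = 1 / 3 ^ n" for n
    using un[of n] by (simp add: y_def norm_sgn)
  have yX: "y n \<in> X" for n unfolding y_def sgn_div_norm using u(1) U X(1) by (intro subspace_scale) auto
  have xX: "x n \<in> X" for n
    by (induction n) (auto simp: x_Suc x0 subspace_0 X(1) subspace_add subspace_diff yX)
  have uy: "u n \<bullet> y n = norm (u n) / 3 ^ n" for n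
    using un[of n] by (simp add: y_def sgn_div_norm dot_square_norm power2_eq_square field_simps)
  \<comment> \<open>The sign in the recursion for \<open>x\<close> prevents cancellation in \<open>u n \<bullet> x (Suc n)\<close>.\<close>
  have gain: "norm (u n) / 3 ^ n \<le> \<bar>u n \<bullet> x (Suc n)\<bar>" for n
    using uy[of n] by (auto simp: x_Suc inner_add_right inner_diff_right abs_if split: if_splits)
  have step: "norm (x (Suc n) - x n) = 1 / 3 ^ n" for n
    using ny[of n] by (simp add: x_Suc)
  have tail: "norm (x (n + m) - x n) \<le> (3/2) * (1 / 3 ^ n - 1 / 3 ^ (n + m))" for n m
  proof (induction m)
    case (Suc m)
    have "norm (x (n + Suc m) - x n) \<le> norm (x (n + m) - x n) + norm (x (Suc (n + m)) - x (n + m))"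
      using norm_triangle_ineq[of "x (n + m) - x n" "x (Suc (n + m)) - x (n + m)"] by simp
    also have "\<dots> \<le> (3/2) * (1 / 3 ^ n - 1 / 3 ^ (n + m)) + 1 / 3 ^ (n + m)" using Suc step by simp
    also have "\<dots> = (3/2) * (1 / 3 ^ n - 1 / 3 ^ (n + Suc m))" by (simp add: field_simps)
    finally show ?case .
  qed simp
  have tail': "norm (x m - x n) \<le> (3/2) / 3 ^ n" if "n \<le> m" for n m
  proof -
    have "norm (x m - x n) \<le> (3/2) * (1 / 3 ^ n - 1 / 3 ^ m)"
      using tail[of n "m - n"] that by simp
    also have "\<dots> \<le> (3/2) * (1 / 3 ^ n)" by (intro mult_left_mono) auto
    finally show ?thesis by simp
  qed
  have lim3: "(\<lambda>n. (3/2) / 3 ^ n :: real) \<longlonglongrightarrow> 0" by (rule LIMSEQ_divide_realpow_zero) simp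
  have "Cauchy x"
  proof (rule metric_CauchyI)
    fix r :: real assume "0 < r"
    then obtain N where N: "(3/2) / 3 ^ N < r / 2"
      using order_tendstoD(2)[OF lim3, of "r/2"] by (auto simp: eventually_sequentially)
    have "dist (x m) (x n) < r" if "m \<ge> N" "n \<ge> N" for m n
      using dist_triangle2[of "x m" "x n" "x N"] tail'[OF that(1)] tail'[OF that(2)] N
      by (simp add: dist_norm)
    then show "\<exists>N. \<forall>m\<ge>N. \<forall>n\<ge>N. dist (x m) (x n) < r" by blast
  qed
  then obtain p where p: "x \<longlonglongrightarrow> p" using convergent_eq_Cauchy by blast
  have pX: "p \<in> X" by (rule closed_sequentially[OF X(2) xX p])
  then obtain c where c: "\<And>v. v \<in> U \<Longrightarrow> \<bar>v \<bullet> p\<bar> \<le> c" using pw by blast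
  \<comment> \<open>The tail after step \<open>n\<close> has norm at most \<open>(1/2) 3\<^sup>-\<^sup>n\<close>, half of the step itself.\<close>
  have big: "(1/2) * (4/3) ^ n \<le> c" for n
  proof -
    have "norm (p - x (Suc n)) \<le> (3/2) / 3 ^ Suc n"
    proof (rule LIMSEQ_le_const2)
      show "(\<lambda>m. norm (x m - x (Suc n))) \<longlonglongrightarrow> norm (p - x (Suc n))" by (intro tendsto_intros p)
    qed (use tail' in blast)
    then have "\<bar>u n \<bullet> (p - x (Suc n))\<bar> \<le> norm (u n) * ((3/2) / 3 ^ Suc n)"
      using Cauchy_Schwarz_ineq2[of "u n" "p - x (Suc n)"]
      by (meson mult_left_mono norm_ge_zero order_trans)
    then have "norm (u n) / 3 ^ n - norm (u n) * ((3/2) / 3 ^ Suc n) \<le> \<bar>u n \<bullet> p\<bar>"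
      using gain[of n] by (simp add: inner_diff_right)
    moreover have "norm (u n) / 3 ^ n - norm (u n) * ((3/2) / 3 ^ Suc n) = (1/2) * (norm (u n) / 3 ^ n)"
      by (simp add: field_simps)
    moreover have "(4/3) ^ n \<le> norm (u n) / 3 ^ n"
      using u(2)[of n] by (simp add: power_divide divide_right_mono less_imp_le)
    ultimately show ?thesis using c[OF u(1)[of n]] by linarith
  qed
  obtain n where "(4/3::real) ^ n > 2 * c" using real_arch_pow[of "4/3" "2*c"] by auto
  with big[of n] show False by simp
qed

text \<open>The Hellinger--Toeplitz phenomenon for the inverse: the vectors \<open>u\<close> with \<open>\<parallel>T u\<parallel> \<le> 1\<close> are weakly bounded,
  since \<open>u \<bullet> T v = T u \<bullet> v\<close> and every vector is of the form \<open>T v\<close>.\<close>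

lemma symmetric_surj_bounded_below:
  fixes T :: "'a::{real_inner,complete_space} \<Rightarrow> 'a"
  assumes X: "subspace X" "closed X" and lin: "lin_on D T" and DX: "D \<subseteq> X"
    and sym: "\<And>u v. u \<in> D \<Longrightarrow> v \<in> D \<Longrightarrow> T u \<bullet> v = u \<bullet> T v"
    and surj: "\<And>f. f \<in> X \<Longrightarrow> \<exists>u\<in>D. T u = f"
  shows "\<exists>K>0. \<forall>u\<in>D. norm u \<le> K * norm (T u)"
proof -
  define U where "U = {u \<in> D. norm (T u) \<le> 1}"
  have "\<exists>c. \<forall>u\<in>U. \<bar>u \<bullet> f\<bar> \<le> c" if "f \<in> X" for f
  proof -
    obtain v where v: "v \<in> D" "T v = f" using surj[OF \<open>f \<in> X\<close>] by blast
    have "\<bar>u \<bullet> f\<bar> \<le> norm v" if "u \<in> U" for u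
    proof -
      have "\<bar>u \<bullet> f\<bar> = \<bar>T u \<bullet> v\<bar>" using sym[of u v] v that by (simp add: U_def)
      also have "\<dots> \<le> norm (T u) * norm v" by (rule Cauchy_Schwarz_ineq2)
      also have "\<dots> \<le> norm v" using that by (simp add: U_def mult_left_le_one_le)
      finally show ?thesis .
    qed
    then show ?thesis by blast
  qed
  with uniform_boundedness[OF X, of U] obtain K where K: "\<And>u. u \<in> U \<Longrightarrow> norm u \<le> K"
    using DX by (auto simp: U_def)
  have inj: "u = 0" if u: "u \<in> D" "T u = 0" for u
  proof -
    obtain v where v: "v \<in> D" "T v = u" using surj u DX by blast
    have "u \<bullet> u = T u \<bullet> v" using sym[OF u(1) v(1)] v by simp
    with u show ?thesis by simp
  qed
  have "norm u \<le> max K 1 * norm (T u)" if u: "u \<in> D" for u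
  proof (cases "T u = 0")
    case False
    have "(1 / norm (T u)) *\<^sub>R u \<in> U"
      using u False lin_onD[OF lin] by (simp add: U_def subspace_scale)
    from K[OF this] have "norm u \<le> K * norm (T u)" using False by (simp add: field_simps)
    also have "\<dots> \<le> max K 1 * norm (T u)" by (simp add: mult_right_mono)
    finally show ?thesis .
  qed (use inj[OF u] in simp)
  then show ?thesis by (intro exI[of _ "max K 1"]) auto
qed

section \<open>Spectral gaps and forms\<close>

text \<open>A symmetric operator has no form values below a gap of its spectrum: at the infimum \<open>m\<close> of the
  Rayleigh quotients the form of \<open>T - m\<close> is non-negative, and Cauchy--Schwarz for it together with a
  bounded right inverse pushes the infimum up.  The right inverse acts on \<open>D\<close>, with values in
  \<open>D\<close>; in this form it can be found for the square of an operator on its natural domain.\<close>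

lemma form_bound_across_gap:
  fixes T :: "'a::real_inner \<Rightarrow> 'a"
  assumes lin: "lin_on D T" and sym: "\<And>u v. u \<in> D \<Longrightarrow> v \<in> D \<Longrightarrow> T u \<bullet> v = u \<bullet> T v"
    and low: "\<And>u. u \<in> D \<Longrightarrow> m1 * (u \<bullet> u) \<le> T u \<bullet> u"
    and gap: "\<And>m. m1 \<le> m \<Longrightarrow> m < m2 \<Longrightarrow>
       \<exists>K. \<forall>u\<in>D. \<exists>v\<in>D. T v - m *\<^sub>R v = u \<and> norm v \<le> K * norm u"
    and u: "u \<in> D"
  shows "m2 * (u \<bullet> u) \<le> T u \<bullet> u"
proof (rule ccontr)
  assume not: "\<not> ?thesis"
  define R where "R = (\<lambda>u. T u \<bullet> u / (u \<bullet> u)) ` (D - {0})"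
  define m where "m = Inf R"
  have u0: "u \<noteq> 0" using not lin_onD(5)[OF lin] by auto
  have R_low: "m1 \<le> r" if "r \<in> R" for r
  proof -
    obtain v where v: "v \<in> D" "v \<noteq> 0" "r = T v \<bullet> v / (v \<bullet> v)" using \<open>r \<in> R\<close> unfolding R_def by blast
    have "0 < v \<bullet> v" using v(2) by simp
    then show ?thesis using low[OF v(1)] unfolding v(3) by (subst pos_le_divide_eq)
  qed
  then have bdd: "bdd_below R" by (rule bdd_belowI)
  have ne: "R \<noteq> {}" using u u0 by (auto simp: R_def)
  have "m1 \<le> m" unfolding m_def using ne R_low by (rule cInf_greatest)
  have m_le: "m \<le> T w \<bullet> w / (w \<bullet> w)" if "w \<in> D" "w \<noteq> 0" for w
    unfolding m_def by (rule cInf_lower[OF _ bdd]) (use that in \<open>auto simp: R_def\<close>)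
  have "m < m2"
    using m_le[OF u u0] not u0 by (smt (verit) divide_less_eq inner_gt_zero_iff)
  from gap[OF \<open>m1 \<le> m\<close> this] obtain K0 where
    K0: "\<And>w. w \<in> D \<Longrightarrow> \<exists>v\<in>D. T v - m *\<^sub>R v = w \<and> norm v \<le> K0 * norm w" by blast
  define K where "K = max K0 1"
  have Kpos: "K > 0" by (simp add: K_def)
  let ?A = "\<lambda>u. T u - m *\<^sub>R u"
  have qlow: "1 / K \<le> (T w \<bullet> w) / (w \<bullet> w) - m" if w: "w \<in> D" "w \<noteq> 0" for w
  proof -
    obtain v where v: "v \<in> D" "?A v = w" "norm v \<le> K0 * norm w" using K0 w by blast
    have vK: "norm v \<le> K * norm w" using v(3) by (smt (verit) K_def mult_right_mono norm_ge_zero)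
    have ww: "w \<bullet> w > 0" using w by simp
    have "(?A v \<bullet> w)\<^sup>2 \<le> (?A v \<bullet> v) * (?A w \<bullet> w)"
    proof (rule form_Cauchy_Schwarz[OF lin_on_shift[OF lin]])
      show "?A a \<bullet> b = a \<bullet> ?A b" if "a \<in> D" "b \<in> D" for a b
        using sym[OF that] by (simp add: inner_diff_left inner_diff_right)
      show "0 \<le> ?A a \<bullet> a" if "a \<in> D" for a
        using m_le[OF that] by (cases "a = 0") (auto simp: inner_diff_left field_simps)
    qed (use v w in auto)
    then have 1: "(w \<bullet> w)\<^sup>2 \<le> (w \<bullet> v) * (?A w \<bullet> w)" using v(2) by simp
    have Aw: "0 \<le> ?A w \<bullet> w" using m_le[OF w] ww by (auto simp: inner_diff_left field_simps)
    have "w \<bullet> v \<le> norm w * norm v" by (rule norm_cauchy_schwarz)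
    also have "\<dots> \<le> norm w * (K * norm w)" using vK by (intro mult_left_mono) auto
    also have "\<dots> = K * (w \<bullet> w)" by (simp add: dot_square_norm power2_eq_square)
    finally have "(w \<bullet> w)\<^sup>2 \<le> K * (w \<bullet> w) * (?A w \<bullet> w)"
      using 1 Aw by (meson mult_right_mono order_trans)
    then have "w \<bullet> w \<le> K * (?A w \<bullet> w)" using ww by (simp add: power2_eq_square mult.assoc mult.left_commute)
    then show ?thesis using ww Kpos by (simp add: field_simps inner_diff_left)
  qed
  have "m + 1 / K \<le> Inf R" by (rule cInf_greatest[OF ne]) (use qlow in \<open>force simp: R_def\<close>)
  then show False using Kpos by (simp add: m_def[symmetric])
qed

section \<open>Perturbation of surjectivity\<close>

text \<open>With a right inverse \<open>g\<close> of \<open>T\<close>, the equation is \<open>h + E (g h) = f\<close> for \<open>h = T u\<close>.  The right inverse need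
  not be linear: \<open>T\<close> dominates \<open>E\<close>, so that \<open>h \<mapsto> f - E (g h)\<close> is a contraction all the same.\<close>

lemma surj_small_perturbation:
  fixes T E :: "'a::real_normed_vector \<Rightarrow> 'b::{real_normed_vector,complete_space}"
  assumes X: "subspace X" "closed X" and lin: "lin_on D T" "lin_on D E"
    and EX: "\<And>u. u \<in> D \<Longrightarrow> E u \<in> X"
    and small: "\<And>u. u \<in> D \<Longrightarrow> norm (E u) \<le> \<theta> * norm (T u)" and \<theta>: "0 \<le> \<theta>" "\<theta> < 1"
    and surj: "\<And>f. f \<in> X \<Longrightarrow> \<exists>u\<in>D. T u = f" and f: "f \<in> X"
  shows "\<exists>u\<in>D. T u + E u = f"
proof -
  obtain g where g: "\<And>h. h \<in> X \<Longrightarrow> g h \<in> D" "\<And>h. h \<in> X \<Longrightarrow> T (g h) = h" using surj by metis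
  have "\<exists>!h. h \<in> X \<and> f - E (g h) = h"
  proof (rule Banach_fix)
    show "complete X" using X(2) by (simp add: complete_eq_closed)
    show "X \<noteq> {}" using f by blast
    show "(\<lambda>h. f - E (g h)) ` X \<subseteq> X" using f EX g X(1) by (auto intro!: subspace_diff)
    fix h k assume hk: "h \<in> X" "k \<in> X"
    have "dist (f - E (g h)) (f - E (g k)) = norm (E (g h - g k))"
      using lin_onD(4)[OF lin(2) g(1)[OF hk(1)] g(1)[OF hk(2)]]
      by (simp add: dist_norm norm_minus_commute)
    also have "\<dots> \<le> \<theta> * norm (T (g h - g k))"
      using hk g(1) lin_onD(1)[OF lin(1)] by (intro small) (simp add: subspace_diff)
    also have "\<dots> = \<theta> * dist h k"
      using lin_onD(4)[OF lin(1) g(1)[OF hk(1)] g(1)[OF hk(2)]] g(2) hk by (simp add: dist_norm)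
    finally show "dist (f - E (g h)) (f - E (g k)) \<le> \<theta> * dist h k" .
  qed (use \<theta> in auto)
  then obtain h where h: "h \<in> X" "f - E (g h) = h" by blast
  show ?thesis by (rule bexI[of _ "g h"]) (use h g in \<open>auto simp: algebra_simps\<close>)
qed

text \<open>The a priori estimate makes each of \<open>N > C\<close> steps of length \<open>1/N\<close> from \<open>T\<close> to \<open>T + E\<close> a small
  perturbation.\<close>

lemma continuity_method:
  fixes T E :: "'a::real_normed_vector \<Rightarrow> 'b::{real_normed_vector,complete_space}"
  assumes X: "subspace X" "closed X" and lin: "lin_on D T" "lin_on D E"
    and EX: "\<And>u. u \<in> D \<Longrightarrow> E u \<in> X"
    and bound: "\<And>u t. u \<in> D \<Longrightarrow> 0 \<le> t \<Longrightarrow> t \<le> 1 \<Longrightarrow> norm (E u) \<le> C * norm (T u + t *\<^sub>R E u)"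
    and surj: "\<And>f. f \<in> X \<Longrightarrow> \<exists>u\<in>D. T u = f" and f: "f \<in> X"
  shows "\<exists>u\<in>D. T u + E u = f"
proof -
  obtain N where N: "max C 0 < real N" using reals_Archimedean2 by blast
  have N0: "real N > 0" using N by linarith
  have "j \<le> N \<Longrightarrow> (\<forall>f\<in>X. \<exists>u\<in>D. T u + (real j / real N) *\<^sub>R E u = f)" for j
  proof (induction j)
    case (Suc j)
    show ?case
    proof
      fix f assume f: "f \<in> X"
      have "\<exists>u\<in>D. (T u + (real j / real N) *\<^sub>R E u) + (0 + (1 / real N) *\<^sub>R E u) = f"
      proof (rule surj_small_perturbation[OF X lin_on_add_scaled[OF lin] lin_on_add_scaled[OF _ lin(2)], where \<theta> = "max C 0 / real N"])
        show "lin_on D (\<lambda>u. 0)" using lin_onD(1)[OF lin(1)] by (auto simp: lin_on_def)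
        show "0 + (1 / real N) *\<^sub>R E u \<in> X" if "u \<in> D" for u
          using EX[OF that] X(1) by (simp add: subspace_scale)
        show "norm (0 + (1 / real N) *\<^sub>R E u)
            \<le> max C 0 / real N * norm (T u + (real j / real N) *\<^sub>R E u)" if "u \<in> D" for u
        proof -
          have "norm (E u) \<le> C * norm (T u + (real j / real N) *\<^sub>R E u)"
            using bound[OF that, of "real j / real N"] Suc.prems N0 by simp
          also have "\<dots> \<le> max C 0 * norm (T u + (real j / real N) *\<^sub>R E u)" by (simp add: mult_right_mono)
          finally show ?thesis using N0 by (simp add: divide_right_mono)
        qed
      qed (use Suc f N N0 in auto)
      then obtain u where u: "u \<in> D" "T u + (real j / real N) *\<^sub>R E u + (1 / real N) *\<^sub>R E u = f" by auto
      moreover have "(real (Suc j) / real N) *\<^sub>R E u = (real j / real N) *\<^sub>R E u + (1 / real N) *\<^sub>R E u"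
        by (simp add: scaleR_left_distrib[symmetric] add_divide_distrib)
      ultimately show "\<exists>u\<in>D. T u + (real (Suc j) / real N) *\<^sub>R E u = f"
        by (intro bexI[of _ u]) (auto simp: add.assoc)
    qed
  qed (use surj in auto)
  from this[of N] f N0 show ?thesis by simp
qed

text \<open>The form of an operator whose only negative spectrum is the eigenvalue \<open>\<mu>\<close>.  Put \<open>A = T - \<mu>\<close> and
  \<open>a = -\<mu>\<close>; then \<open>A \<ge> 0\<close>, and the claim is \<open>A \<ge> a\<close> on the complement of the kernel of \<open>A\<close>.  The gap \<open>(0, a)\<close>
  of \<open>A\<close> is symmetric about \<open>a/2\<close> and becomes a gap \<open>[0, a\<^sup>2/4)\<close> at the bottom of \<open>(A - a/2)\<^sup>2\<close>.  The resulting bound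
  \<open>(A - a/2)\<^sup>2 \<ge> a\<^sup>2/4\<close> says \<open>\<parallel>A w\<parallel>\<^sup>2 \<ge> a (A w, w)\<close>, which is \<open>(A v, v) \<ge> a (v, v)\<close> for \<open>v = A w\<close> by Cauchy--Schwarz
  for the form of \<open>A\<close>.  The range of \<open>A\<close> is dense in the complement of its kernel.\<close>

lemma nonneg_on_complement_of_negative_eigenspace:
  fixes T :: "'a::{real_inner,complete_space} \<Rightarrow> 'a"
  assumes lin: "lin_on D T" and sym: "\<And>u v. u \<in> D \<Longrightarrow> v \<in> D \<Longrightarrow> T u \<bullet> v = u \<bullet> T v"
    and low: "\<And>u. u \<in> D \<Longrightarrow> m1 * (u \<bullet> u) \<le> T u \<bullet> u" and \<mu>: "\<mu> < 0"
    and res: "\<And>l. l < 0 \<Longrightarrow> l \<noteq> \<mu> \<Longrightarrow>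
       \<exists>K. \<forall>f. \<exists>u\<in>D. T u - l *\<^sub>R u = f \<and> norm u \<le> K * norm f"
    and u: "u \<in> D" and orth: "\<And>v. v \<in> D \<Longrightarrow> T v = \<mu> *\<^sub>R v \<Longrightarrow> u \<bullet> v = 0"
  shows "0 \<le> T u \<bullet> u"
proof -
  note linT = lin_onD[OF lin]
  define A where "A u = T u - \<mu> *\<^sub>R u" for u
  define a where "a = - \<mu>"
  have a: "a > 0" using \<mu> by (simp add: a_def)
  have linA: "lin_on D A" unfolding A_def by (rule lin_on_shift[OF lin])
  note lA = lin_onD[OF linA]
  have symA: "A u \<bullet> v = u \<bullet> A v" if "u \<in> D" "v \<in> D" for u v
    using sym[OF that] by (simp add: A_def inner_diff_left inner_diff_right)
  have posA: "0 \<le> A u \<bullet> u" if "u \<in> D" for u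
  proof -
    have "\<mu> * (u \<bullet> u) \<le> T u \<bullet> u"
    proof (rule form_bound_across_gap[OF lin sym low _ that])
      fix m assume "m1 \<le> m" "m < \<mu>"
      then have "m < 0" "m \<noteq> \<mu>" using \<mu> by auto
      from res[OF this] show "\<exists>K. \<forall>u\<in>D. \<exists>v\<in>D. T v - m *\<^sub>R v = u \<and> norm v \<le> K * norm u" by blast
    qed auto
    then show ?thesis by (simp add: A_def inner_diff_left)
  qed
  have resA: "\<exists>K\<ge>0. \<forall>f. \<exists>u\<in>D. A u - l *\<^sub>R u = f \<and> norm u \<le> K * norm f" if "l < a" "l \<noteq> 0" for l
  proof -
    have "l + \<mu> < 0" "l + \<mu> \<noteq> \<mu>" using that by (auto simp: a_def)
    then obtain K where K: "\<And>f. \<exists>u\<in>D. T u - (l + \<mu>) *\<^sub>R u = f \<and> norm u \<le> K * norm f" using res by blast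
    have "norm u \<le> K * norm f \<Longrightarrow> norm u \<le> max K 0 * norm f" for u f :: 'a
      by (meson max.cobounded1 mult_right_mono norm_ge_zero order_trans)
    moreover have "T u - (l + \<mu>) *\<^sub>R u = A u - l *\<^sub>R u" for u by (simp add: A_def algebra_simps)
    ultimately show ?thesis using K by (intro exI[of _ "max K 0"]) (metis max.cobounded2)
  qed
  define D2 where "D2 = {u \<in> D. A u \<in> D}"
  define G where "G u = A (A u - (a/2) *\<^sub>R u) - (a/2) *\<^sub>R (A u - (a/2) *\<^sub>R u)" for u
  have D2: "subspace D2" unfolding D2_def subspace_def
    using lA subspace_0[OF lA(1)] by (auto simp: subspace_add subspace_scale)
  have in_D: "A u - c *\<^sub>R u \<in> D" if "u \<in> D2" for u c
    using that lA(1) by (auto simp: D2_def intro!: subspace_diff subspace_scale)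
  have gapA: "a * (A w \<bullet> w) \<le> A w \<bullet> A w" if w: "w \<in> D2" for w
  proof -
    have lin_shift: "lin_on D (\<lambda>u. A u - (a/2) *\<^sub>R u)" by (rule lin_on_shift[OF linA])
    have linG: "lin_on D2 G"
      unfolding G_def
      by (rule lin_on_comp[OF lin_on_subset[OF lin_shift D2] lin_shift]) (auto simp: D2_def in_D)
    have G_form: "G u \<bullet> v = (A u - (a/2) *\<^sub>R u) \<bullet> (A v - (a/2) *\<^sub>R v)" if "u \<in> D2" "v \<in> D2" for u v
    proof -
      have "v \<in> D" using that by (auto simp: D2_def)
      from symA[OF in_D[OF that(1)] this, of "a/2"] show ?thesis
        by (simp add: G_def inner_diff_left inner_diff_right)
    qed
    have "a\<^sup>2 / 4 * (w \<bullet> w) \<le> G w \<bullet> w"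
    proof (rule form_bound_across_gap[OF linG _ _ _ w, where ?m1.0 = 0])
      show "G u \<bullet> v = u \<bullet> G v" if "u \<in> D2" "v \<in> D2" for u v
        using G_form[OF that] G_form[OF that(2,1)] by (simp add: inner_commute)
      show "0 * (u \<bullet> u) \<le> G u \<bullet> u" if "u \<in> D2" for u using G_form[OF that that] by simp
      fix m :: real assume m: "0 \<le> m" "m < a\<^sup>2 / 4"
      define s where "s = sqrt m"
      have s: "0 \<le> s" "s < a / 2" "s * s = m" using m a real_sqrt_less_mono[OF m(2)]
        by (auto simp: s_def real_sqrt_divide)
      obtain K1 where K1: "0 \<le> K1" "\<And>f. \<exists>u\<in>D. A u - (a/2 + s) *\<^sub>R u = f \<and> norm u \<le> K1 * norm f"
        using resA[of "a/2 + s"] s a by auto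
      obtain K2 where K2: "0 \<le> K2" "\<And>f. \<exists>u\<in>D. A u - (a/2 - s) *\<^sub>R u = f \<and> norm u \<le> K2 * norm f"
        using resA[of "a/2 - s"] s a by auto
      \<comment> \<open>With \<open>m = s\<^sup>2\<close>, \<open>(A - a/2)\<^sup>2 - m\<close> is the product of \<open>A - (a/2 + s)\<close> and \<open>A - (a/2 - s)\<close>.\<close>
      have "\<exists>v\<in>D2. G v - m *\<^sub>R v = u \<and> norm v \<le> K2 * K1 * norm u" for u
      proof -
        obtain x where x: "x \<in> D" "A x - (a/2 + s) *\<^sub>R x = u" "norm x \<le> K1 * norm u" using K1 by blast
        obtain v where v: "v \<in> D" "A v - (a/2 - s) *\<^sub>R v = x" "norm v \<le> K2 * norm x" using K2 by blast
        have Av: "A v = x + (a/2 - s) *\<^sub>R v" using v(2) by (simp add: algebra_simps)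
        have "v \<in> D2" using v(1) x(1) lA(1) by (auto simp: D2_def Av intro!: subspace_add subspace_scale)
        moreover have "G v - m *\<^sub>R v = u"
        proof -
          have "A v - (a/2) *\<^sub>R v = x - s *\<^sub>R v" using Av by (simp add: algebra_simps)
          then have "G v = A x - s *\<^sub>R A v - (a/2) *\<^sub>R (x - s *\<^sub>R v)"
            using x(1) v(1) lA by (simp add: G_def subspace_scale)
          then show ?thesis using x(2) unfolding Av s(3)[symmetric] by (simp add: algebra_simps)
        qed
        moreover have "norm v \<le> K2 * K1 * norm u"
          using v(3) x(3) K2(1) by (smt (verit) mult.assoc mult_left_mono)
        ultimately show ?thesis by blast
      qed
      then show "\<exists>K. \<forall>u\<in>D2. \<exists>v\<in>D2. G v - m *\<^sub>R v = u \<and> norm v \<le> K * norm u" by blast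
    qed
    also have "G w \<bullet> w = A w \<bullet> A w - a * (A w \<bullet> w) + a\<^sup>2 / 4 * (w \<bullet> w)"
      unfolding G_form[OF w w]
      by (simp add: inner_diff_left inner_diff_right inner_commute power2_eq_square algebra_simps)
    finally show ?thesis by simp
  qed
  have on_range: "a * (v \<bullet> v) \<le> A v \<bullet> v" if w: "w \<in> D2" and v: "v = A w" for w v
  proof (cases "v = 0")
    case False
    have wD: "w \<in> D" "v \<in> D" using w v by (auto simp: D2_def)
    have "(A w \<bullet> v)\<^sup>2 \<le> (A w \<bullet> w) * (A v \<bullet> v)"
      by (rule form_Cauchy_Schwarz[OF linA symA posA]) (use wD in auto)
    then have 1: "(v \<bullet> v)\<^sup>2 \<le> (A w \<bullet> w) * (A v \<bullet> v)" using v by simp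
    have 2: "a * (A w \<bullet> w) \<le> v \<bullet> v" using gapA[OF w] v by simp
    have "a * (v \<bullet> v)\<^sup>2 \<le> (a * (A w \<bullet> w)) * (A v \<bullet> v)" using 1 a by (simp add: mult.assoc)
    also have "\<dots> \<le> (v \<bullet> v) * (A v \<bullet> v)" using 2 posA[OF wD(2)] by (rule mult_right_mono)
    finally show ?thesis using False by (simp add: power2_eq_square mult.left_commute)
  qed (use lA in simp)
  \<comment> \<open>The bound on the range extends to \<open>u\<close> if \<open>u\<close> is approximated by elements of the range in the
    graph norm.  To this end \<open>A u + u\<close> is approximated by \<open>A (g n)\<close>, and \<open>v n = (A + 1)\<^sup>-\<^sup>1 A (g n) = A ((A + 1)\<^sup>-\<^sup>1 g n)\<close>.\<close>
  define N where "N = {v \<in> D. A v = 0}"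
  define X where "X = {x. \<forall>v\<in>N. x \<bullet> v = 0}"
  have X: "subspace X" "closed X"
  proof -
    show "subspace X" by (auto simp: X_def subspace_def inner_add_left)
    have "X = (\<Inter>v\<in>N. {x. x \<bullet> v = 0})" by (auto simp: X_def)
    also have "closed \<dots>" by (intro closed_INT ballI closed_Collect_eq continuous_intros)
    finally show "closed X" .
  qed
  have ran: "subspace (A ` D)" "A ` D \<subseteq> X"
  proof -
    show "subspace (A ` D)" unfolding subspace_def
      using lA subspace_0[OF lA(1)] by (auto simp: image_iff) (metis subspace_add, metis subspace_scale)
    show "A ` D \<subseteq> X" using symA by (auto simp: X_def N_def)
  qed
  have res1: "\<exists>w\<in>D. A w + w = f" for f
    using resA[of "-1"] a by fastforce
  have contr: "norm x \<le> norm (A x + x)" if "x \<in> D" for x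
  proof -
    have "(norm x)\<^sup>2 \<le> (A x + x) \<bullet> x" using posA[OF that] by (simp add: inner_add_left power2_norm_eq_inner)
    also have "\<dots> \<le> norm (A x + x) * norm x" by (rule norm_cauchy_schwarz)
    finally show ?thesis by (cases "x = 0") (auto simp: power2_eq_square)
  qed
  have perp: "v = 0" if v: "v \<in> X" "\<And>s. s \<in> A ` D \<Longrightarrow> v \<bullet> s = 0" for v
  proof -
    obtain w where w: "w \<in> D" "A w + w = v" using res1 by blast
    have "(v - w) \<bullet> (A x + x) = 0" if x: "x \<in> D" for x
    proof -
      have "w \<bullet> (A x + x) = (A w + w) \<bullet> x" using symA[OF w(1) x] by (simp add: inner_add_left inner_add_right)
      moreover have "v \<bullet> (A x + x) = v \<bullet> x" using v(2)[of "A x"] x by (simp add: inner_add_right)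
      ultimately show ?thesis using w(2) by (simp add: inner_diff_left)
    qed
    then have "v = w" using res1[of "v - w"] by (metis eq_iff_diff_eq_0 inner_eq_zero_iff)
    then have "v \<in> N" using w by (auto simp: N_def)
    with v(1) show ?thesis by (auto simp: X_def)
  qed
  have fX: "A u + u \<in> X"
    unfolding X_def N_def using orth u symA by (force simp: A_def inner_add_left)
  have "\<exists>s\<in>A ` D. norm (A u + u - s) < 1 / real (Suc n)" for n
    by (rule dense_if_trivial_complement[OF ran X perp fX]) auto
  then have "\<exists>g\<in>D. norm (A u + u - A g) < 1 / real (Suc n)" for n by blast
  then obtain g where g: "\<And>n. g n \<in> D" "\<And>n. norm (A u + u - A (g n)) < 1 / real (Suc n)" by metis
  have "\<forall>n. \<exists>w. w \<in> D \<and> A w + w = g n" using res1 by blast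
  then obtain w where w: "\<And>n. w n \<in> D" "\<And>n. A (w n) + w n = g n" by metis
  define v where "v n = A (w n)" for n
  have vD: "v n \<in> D" for n
    using w[of n] g(1)[of n] lA(1) by (metis add_diff_cancel_right' subspace_diff v_def)
  have eq: "A (v n) + v n = A (g n)" for n
    using lA(2)[OF vD w(1), of n n] w(2)[of n] by (simp add: v_def)
  have conv: "(\<lambda>n. A u + u - A (g n)) \<longlonglongrightarrow> 0"
  proof (rule Lim_null_comparison)
    show "(\<lambda>n. 1 / real (Suc n)) \<longlonglongrightarrow> 0" using LIMSEQ_inverse_real_of_nat by (simp add: inverse_eq_divide)
    show "\<forall>\<^sub>F n in sequentially. norm (A u + u - A (g n)) \<le> 1 / real (Suc n)"
      by (intro always_eventually allI less_imp_le g(2))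
  qed
  have vu: "norm (u - v n) \<le> norm (A u + u - A (g n))" for n
    using contr[of "u - v n"] u vD[of n] eq[of n] lA(1) lA(4)[OF u vD[of n]]
    by (simp add: subspace_diff algebra_simps)
  have "(\<lambda>n. u - v n) \<longlonglongrightarrow> 0"
    by (rule Lim_null_comparison[OF _ tendsto_norm_zero[OF conv]]) (use vu in auto)
  then have v_lim: "v \<longlonglongrightarrow> u" using tendsto_diff[OF tendsto_const[of u]] by fastforce
  have "(\<lambda>n. A u + u - (A u + u - A (g n)) - v n) \<longlonglongrightarrow> A u + u - 0 - u"
    by (intro tendsto_intros conv v_lim)
  moreover have "A (v n) = A u + u - (A u + u - A (g n)) - v n" for n
    using eq[of n] by (simp add: algebra_simps)
  ultimately have Av_lim: "(\<lambda>n. A (v n)) \<longlonglongrightarrow> A u" by simp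
  have "a * (u \<bullet> u) \<le> A u \<bullet> u"
  proof (rule LIMSEQ_le)
    show "(\<lambda>n. a * (v n \<bullet> v n)) \<longlonglongrightarrow> a * (u \<bullet> u)" by (intro tendsto_intros v_lim)
    show "(\<lambda>n. A (v n) \<bullet> v n) \<longlonglongrightarrow> A u \<bullet> u" by (intro tendsto_intros v_lim Av_lim)
    have "w n \<in> D2" for n using w(1) vD by (auto simp: D2_def v_def)
    then show "\<exists>N. \<forall>n\<ge>N. a * (v n \<bullet> v n) \<le> A (v n) \<bullet> v n" using on_range v_def by blast
  qed
  then show ?thesis by (simp add: A_def a_def inner_diff_left)
qed

section \<open>A positive eigenvalue of an indefinite pencil\<close>

text \<open>The eigenvalue is found on a curve \<open>V s = \<phi> + w s\<close> with \<open>w s \<bullet> \<psi> = 0\<close>, \<open>\<psi> = M \<phi>\<close>, that solves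
  \<open>(M - s J) (V s) = g s \<psi>\<close>; it is a zero of \<open>g\<close>.  The estimate \<open>est\<close> makes \<open>J\<close> small relative to \<open>M\<close>,
  so that the continuity method solves for \<open>w s\<close>, and bounds \<open>J (V s)\<close> as long as \<open>M (V s) \<bullet> V s \<ge> 0\<close>.\<close>

lemma positive_eigenvalue_of_indefinite_pencil:
  fixes M J :: "'a::{real_inner,complete_space} \<Rightarrow> 'a"
  assumes X: "subspace X" "closed X" and DX: "D \<subseteq> X"
    and linM: "lin_on D M" and MX: "\<And>u. u \<in> D \<Longrightarrow> M u \<in> X"
    and symM: "\<And>u v. u \<in> D \<Longrightarrow> v \<in> D \<Longrightarrow> M u \<bullet> v = u \<bullet> M v"
    and surjM: "\<And>f. f \<in> X \<Longrightarrow> \<exists>u\<in>D. M u = f"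
    and linJ: "lin_on DJ J" and DJ: "D \<subseteq> DJ" and JX: "\<And>u. u \<in> DJ \<Longrightarrow> J u \<in> X" and DJX: "DJ \<subseteq> X"
    and skewJ: "\<And>u v. u \<in> DJ \<Longrightarrow> v \<in> DJ \<Longrightarrow> J u \<bullet> v = - (u \<bullet> J v)"
    and denseJ: "\<And>f e. f \<in> X \<Longrightarrow> 0 < e \<Longrightarrow> \<exists>u\<in>DJ. norm (f - J u) < e"
    and est: "\<And>u. u \<in> D \<Longrightarrow> M u \<bullet> u + c * (J u \<bullet> J u) \<le> C * (u \<bullet> u)" and c: "c > 0"
    and \<phi>: "\<phi> \<in> D" "M \<phi> \<bullet> \<phi> > 0"
    and one_pos: "\<And>w. w \<in> D \<Longrightarrow> w \<bullet> M \<phi> = 0 \<Longrightarrow> M w \<bullet> w \<le> 0"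
  shows "\<exists>\<sigma>>0. \<exists>V\<in>D. V \<noteq> 0 \<and> M V = \<sigma> *\<^sub>R J V"
proof -
  note lM = lin_onD[OF linM]
  have linJD: "lin_on D J" by (rule lin_on_subset[OF linJ lM(1) DJ])
  note lJ = lin_onD[OF linJD]
  define \<psi> where "\<psi> = M \<phi>"
  define lam where "lam = \<psi> \<bullet> \<phi>"
  have lam: "lam > 0" using \<phi> by (simp add: lam_def \<psi>_def)
  have \<psi>0: "\<psi> \<bullet> \<psi> > 0" using lam by (auto simp: lam_def)
  have \<psi>X: "\<psi> \<in> X" using \<phi> MX by (simp add: \<psi>_def)
  define W where "W = {w \<in> D. w \<bullet> \<psi> = 0}"
  define Y where "Y = {f \<in> X. f \<bullet> \<psi> = 0}"
  define P where "P f = f - (f \<bullet> \<psi> / (\<psi> \<bullet> \<psi>)) *\<^sub>R \<psi>" for f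
  have WD: "w \<in> D" "w \<bullet> \<psi> = 0" if "w \<in> W" for w using that by (auto simp: W_def)
  have W: "subspace W" using lM(1) by (auto simp: W_def subspace_def inner_add_left)
  have Y: "subspace Y" "closed Y"
  proof -
    show "subspace Y" using X(1) by (auto simp: Y_def subspace_def inner_add_left)
    have "Y = X \<inter> {f. f \<bullet> \<psi> = 0}" by (auto simp: Y_def)
    then show "closed Y" using X(2) by (auto intro!: closed_Int closed_Collect_eq continuous_intros)
  qed
  have linP: "P (f + g) = P f + P g" "P (r *\<^sub>R f) = r *\<^sub>R P f" for f g r
    by (auto simp: P_def inner_add_left algebra_simps add_divide_distrib)
  have PY: "P f \<in> Y" if "f \<in> X" for f
    using that \<psi>X X(1) \<psi>0 by (auto simp: P_def Y_def inner_diff_left subspace_diff subspace_scale)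
  have Pid: "P f = f" if "f \<in> Y" for f using that by (simp add: P_def Y_def)
  have Pinner: "P f \<bullet> w = f \<bullet> w" if "w \<in> W" for f w
    using WD(2)[OF that] inner_commute[of \<psi> w] by (simp add: P_def inner_diff_left)
  have norm_P: "norm (P f) \<le> norm f" for f
  proof -
    have "(norm f)\<^sup>2 = (norm (P f))\<^sup>2 + (f \<bullet> \<psi>)\<^sup>2 / (\<psi> \<bullet> \<psi>)"
      unfolding power2_norm_eq_inner using \<psi>0
      by (simp add: P_def inner_diff_left inner_diff_right inner_commute power2_eq_square field_simps)
    then show ?thesis using \<psi>0 by (smt (verit) divide_nonneg_pos norm_ge_zero power2_le_imp_le zero_le_power2)
  qed
  have PM0: "P \<psi> = 0" using \<psi>0 by (simp add: P_def)
  have linPM: "lin_on W (\<lambda>w. P (M w))" and linPJ: "lin_on W (\<lambda>w. P (J w))"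
    using W WD(1) lM lJ linP by (auto simp: lin_on_def)
  obtain K where K: "K > 0" "\<And>u. u \<in> D \<Longrightarrow> norm u \<le> K * norm (M u)"
    using symmetric_surj_bounded_below[OF X linM DX symM surjM] by blast
  have solve: "\<exists>v\<in>W. P (M v) = f \<and> norm v \<le> (K + K * norm \<psi> / lam * norm \<phi>) * norm f" if f: "f \<in> Y" for f
  proof -
    obtain v where v: "v \<in> D" "M v = f" using surjM f by (auto simp: Y_def)
    have nv: "norm v \<le> K * norm f" using K(2)[OF v(1)] v(2) by simp
    define r where "r = - (v \<bullet> \<psi>) / lam"
    let ?v = "v + r *\<^sub>R \<phi>"
    have r: "\<bar>r\<bar> \<le> K * norm f * norm \<psi> / lam"
    proof -
      have "\<bar>v \<bullet> \<psi>\<bar> \<le> norm v * norm \<psi>" by (rule Cauchy_Schwarz_ineq2)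
      also have "\<dots> \<le> K * norm f * norm \<psi>" using nv by (simp add: mult_right_mono)
      finally show ?thesis using lam by (simp add: r_def abs_div divide_right_mono)
    qed
    have "?v \<bullet> \<psi> = v \<bullet> \<psi> + r * lam" by (simp add: inner_add_left inner_add_right lam_def inner_commute)
    then have "?v \<in> W" using v(1) \<phi>(1) lM(1) lam
      unfolding W_def by (auto simp: r_def intro!: subspace_add subspace_diff subspace_scale)
    moreover have "P (M ?v) = f"
      using v \<phi>(1) lM PM0 Pid[OF f] by (simp add: linP subspace_scale \<psi>_def)
    moreover have "norm ?v \<le> K * norm f + K * norm f * norm \<psi> / lam * norm \<phi>"
      using norm_triangle_ineq[of v "r *\<^sub>R \<phi>"] nv mult_right_mono[OF r, of "norm \<phi>"] by simp
    ultimately show ?thesis by (intro bexI[of _ ?v]) (auto simp: algebra_simps)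
  qed
  \<comment> \<open>On the hyperplane \<open>W\<close>, \<open>-P M\<close> is non-negative and has a bounded right inverse, hence it is coercive.\<close>
  obtain \<delta> where \<delta>: "\<delta> > 0" "\<And>w. w \<in> W \<Longrightarrow> \<delta> * (w \<bullet> w) \<le> - (M w \<bullet> w)"
  proof -
    define K' where "K' = K + K * norm \<psi> / lam * norm \<phi>"
    have K': "K' > 0" using K lam by (simp add: K'_def add_pos_nonneg)
    have "(1 / K') * (w \<bullet> w) \<le> - (M w \<bullet> w)" if w: "w \<in> W" for w
    proof (cases "w = 0")
      case False
      have wY: "w \<in> Y" using w DX by (auto simp: W_def Y_def)
      obtain v where v: "v \<in> W" "P (M v) = w" "norm v \<le> K' * norm w" using solve[OF wY] by (auto simp: K'_def)
      have "((\<lambda>w. - P (M w)) v \<bullet> w)\<^sup>2 \<le> ((\<lambda>w. - P (M w)) v \<bullet> v) * ((\<lambda>w. - P (M w)) w \<bullet> w)"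
      proof (rule form_Cauchy_Schwarz[of W])
        show "lin_on W (\<lambda>w. - P (M w))" using linPM by (auto simp: lin_on_def)
        show "- P (M x) \<bullet> y = x \<bullet> - P (M y)" if "x \<in> W" "y \<in> W" for x y
          using Pinner that symM WD(1) by (simp add: inner_commute)
        show "0 \<le> - P (M x) \<bullet> x" if "x \<in> W" for x
          using Pinner that one_pos[of x] WD by (simp add: \<psi>_def)
      qed (use v w in auto)
      then have 1: "(w \<bullet> w)\<^sup>2 \<le> - (w \<bullet> v) * - (M w \<bullet> w)" using v(1,2) w Pinner by simp
      have 2: "- (w \<bullet> v) \<le> K' * (w \<bullet> w)"
      proof -
        have "- (w \<bullet> v) \<le> norm w * norm v" using Cauchy_Schwarz_ineq2[of w v] by linarith
        also have "\<dots> \<le> norm w * (K' * norm w)" using v(3) by (intro mult_left_mono) auto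
        finally show ?thesis by (simp add: dot_square_norm power2_eq_square mult.left_commute)
      qed
      have "0 \<le> - (M w \<bullet> w)" using one_pos[of w] WD[OF w] by (simp add: \<psi>_def)
      then have "(w \<bullet> w)\<^sup>2 \<le> K' * (w \<bullet> w) * - (M w \<bullet> w)" using 1 2 by (meson mult_right_mono order_trans)
      then have "(w \<bullet> w) * (w \<bullet> w) \<le> (w \<bullet> w) * (K' * - (M w \<bullet> w))"
        by (simp add: power2_eq_square mult.assoc mult.left_commute)
      then have "w \<bullet> w \<le> K' * - (M w \<bullet> w)" using False by (metis inner_gt_zero_iff mult_le_cancel_left_pos)
      then show ?thesis using K' by (simp add: field_simps)
    qed (use lM in simp)
    with K' that[of "1 / K'"] show ?thesis by simp
  qed
  have Jww: "J u \<bullet> u = 0" if "u \<in> D" for u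
    using skewJ[of u u] that DJ by (auto simp: inner_commute)
  \<comment> \<open>The skew part drops out of the form, so the coercivity does not depend on \<open>s\<close>.\<close>
  have coer: "\<delta> * norm w \<le> norm (P (M w) - s *\<^sub>R P (J w))" if w: "w \<in> W" for w s
  proof -
    have "\<delta> * (norm w)\<^sup>2 \<le> - ((P (M w) - s *\<^sub>R P (J w)) \<bullet> w)"
      using \<delta>(2)[OF w] Pinner[OF w] Jww[OF WD(1)[OF w]] by (simp add: inner_diff_left power2_norm_eq_inner)
    also have "\<dots> \<le> norm (P (M w) - s *\<^sub>R P (J w)) * norm w"
      using Cauchy_Schwarz_ineq2[of "P (M w) - s *\<^sub>R P (J w)" w] by linarith
    finally show ?thesis by (cases "w = 0") (auto simp: power2_eq_square)
  qed
  \<comment> \<open>\<open>J\<close> is relatively bounded with arbitrarily small bound.\<close>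
  have Jrel: "c * (norm (J u))\<^sup>2 \<le> norm (M u) * norm u + \<bar>C\<bar> * (norm u)\<^sup>2" if u: "u \<in> D" for u
  proof -
    have "- (M u \<bullet> u) \<le> norm (M u) * norm u" using Cauchy_Schwarz_ineq2[of "M u" u] by linarith
    moreover have "C * (norm u)\<^sup>2 \<le> \<bar>C\<bar> * (norm u)\<^sup>2" by (simp add: mult_right_mono)
    ultimately show ?thesis using est[OF u] by (simp add: power2_norm_eq_inner)
  qed
  define b where "b = 1 + norm \<phi> * norm \<psi> / lam"
  have b: "b \<ge> 1" using lam by (simp add: b_def)
  \<comment> \<open>The component of \<open>M w\<close> along \<open>\<psi>\<close> is determined by the others, because \<open>M w \<bullet> \<phi> = w \<bullet> \<psi> = 0\<close>.\<close>
  have M_le: "norm (M w) \<le> b * norm (P (M w))" if w: "w \<in> W" for w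
  proof -
    define r where "r = (M w \<bullet> \<psi>) / (\<psi> \<bullet> \<psi>)"
    have dec: "M w = P (M w) + r *\<^sub>R \<psi>" by (simp add: P_def r_def)
    have "0 = M w \<bullet> \<phi>" using symM[OF WD(1)[OF w] \<phi>(1)] WD(2)[OF w] by (simp add: \<psi>_def)
    also have "\<dots> = P (M w) \<bullet> \<phi> + r * lam" by (subst dec) (simp add: inner_add_left lam_def)
    finally have "r = - (P (M w) \<bullet> \<phi>) / lam" using lam by (simp add: field_simps)
    then have "\<bar>r\<bar> = \<bar>P (M w) \<bullet> \<phi>\<bar> / lam" using lam by (simp add: abs_div)
    also have "\<dots> \<le> norm (P (M w)) * norm \<phi> / lam"
      using lam by (intro divide_right_mono Cauchy_Schwarz_ineq2) auto
    finally have r: "\<bar>r\<bar> \<le> norm (P (M w)) * norm \<phi> / lam" .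
    have "norm (M w) \<le> norm (P (M w)) + \<bar>r\<bar> * norm \<psi>"
      by (subst dec) (rule order_trans[OF norm_triangle_ineq], simp)
    also have "\<dots> \<le> norm (P (M w)) + norm (P (M w)) * norm \<phi> / lam * norm \<psi>"
      using mult_right_mono[OF r, of "norm \<psi>"] by simp
    finally show ?thesis by (simp add: b_def algebra_simps)
  qed
  \<comment> \<open>An a priori bound of \<open>J w\<close>, to be used with \<open>x = \<parallel>P (M w) - s P (J w)\<parallel>\<close>: the terms of the interpolation inequality
    for \<open>J\<close> are at most of first order in \<open>\<parallel>J w\<parallel>\<close>, whose square they dominate.\<close>
  have Jsmall: "norm (J w) \<le> max 1 ((b * s / \<delta> + (b / \<delta> + \<bar>C\<bar> / \<delta>\<^sup>2)) / c) * x"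
    if w: "w \<in> W" and s: "0 \<le> s" and x: "norm w \<le> x / \<delta>" "norm (P (M w)) \<le> x + s * norm (J w)" for w s x
  proof (cases "norm (J w) \<le> x")
    case True
    have "0 \<le> x" using True norm_ge_zero order_trans by blast
    then have "1 * x \<le> max 1 ((b * s / \<delta> + (b / \<delta> + \<bar>C\<bar> / \<delta>\<^sup>2)) / c) * x" by (intro mult_right_mono) auto
    with True show ?thesis by simp
  next
    case False
    let ?j = "norm (J w)"
    have x0: "0 \<le> x" using x(1) \<delta>(1) norm_ge_zero[of w] by (metis divide_le_0_iff linorder_not_le order_trans zero_le_divide_iff)
    have j: "?j > 0" using False x0 by linarith
    have M1: "norm (M w) \<le> b * (x + s * ?j)" using M_le[OF w] mult_left_mono[OF x(2), of b] b by linarith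
    have "norm (M w) * norm w \<le> b * (x + s * ?j) * (x / \<delta>)"
      by (rule mult_mono[OF M1 x(1)]) (use b s x0 in auto)
    moreover have "\<bar>C\<bar> * (norm w)\<^sup>2 \<le> \<bar>C\<bar> * (x / \<delta>)\<^sup>2"
      by (intro mult_left_mono power_mono x(1)) auto
    ultimately have "c * ?j\<^sup>2 \<le> b * (x + s * ?j) * (x / \<delta>) + \<bar>C\<bar> * (x / \<delta>)\<^sup>2"
      using Jrel[OF WD(1)[OF w]] by linarith
    also have "\<dots> = (b * s / \<delta>) * (x * ?j) + (b / \<delta> + \<bar>C\<bar> / \<delta>\<^sup>2) * (x * x)"
      by (simp add: algebra_simps power2_eq_square add_divide_distrib)
    also have "\<dots> \<le> (b * s / \<delta>) * (x * ?j) + (b / \<delta> + \<bar>C\<bar> / \<delta>\<^sup>2) * (x * ?j)"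
      using False x0 b \<delta>(1) by (intro add_left_mono mult_left_mono) auto
    finally have "c * ?j * ?j \<le> ((b * s / \<delta> + (b / \<delta> + \<bar>C\<bar> / \<delta>\<^sup>2)) * x) * ?j"
      by (simp add: algebra_simps power2_eq_square)
    then have "c * ?j \<le> (b * s / \<delta> + (b / \<delta> + \<bar>C\<bar> / \<delta>\<^sup>2)) * x" using j by (rule mult_right_le_imp_le)
    then have "?j \<le> ((b * s / \<delta> + (b / \<delta> + \<bar>C\<bar> / \<delta>\<^sup>2)) / c) * x" using c by (simp add: field_simps)
    also have "\<dots> \<le> max 1 ((b * s / \<delta> + (b / \<delta> + \<bar>C\<bar> / \<delta>\<^sup>2)) / c) * x"
      using x0 by (intro mult_right_mono) auto
    finally show ?thesis .
  qed
  have surjA: "\<exists>w\<in>W. P (M w) - s *\<^sub>R P (J w) = f" if s: "0 \<le> s" and f: "f \<in> Y" for s f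
  proof -
    have "\<exists>w\<in>W. P (M w) + (- s) *\<^sub>R P (J w) = f"
    proof (rule continuity_method[OF Y linPM])
      show "lin_on W (\<lambda>w. (- s) *\<^sub>R P (J w))"
        using linPJ by (auto simp: lin_on_def algebra_simps)
      show "(- s) *\<^sub>R P (J w) \<in> Y" if "w \<in> W" for w
        using PY[of "J w"] JX WD(1)[OF that] DJ Y(1) by (intro subspace_scale) auto
      show "\<exists>w\<in>W. P (M w) = f" if "f \<in> Y" for f using solve[OF that] by blast
      fix w t :: _ assume w: "w \<in> W" and t: "(0::real) \<le> t" "t \<le> 1"
      define x where "x = norm (P (M w) - (t * s) *\<^sub>R P (J w))"
      have tsJ: "t * s * norm (P (J w)) \<le> s * norm (J w)"
        using t s norm_P[of "J w"] by (intro mult_mono) (auto intro: mult_left_le_one_le)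
      have "norm (P (M w)) \<le> x + norm ((t * s) *\<^sub>R P (J w))"
        using norm_triangle_ineq[of "P (M w) - (t * s) *\<^sub>R P (J w)" "(t * s) *\<^sub>R P (J w)"] by (simp add: x_def)
      then have x2: "norm (P (M w)) \<le> x + s * norm (J w)" using tsJ t s by simp
      have x1: "norm w \<le> x / \<delta>" using coer[OF w, of "t * s"] \<delta>(1) by (simp add: x_def field_simps)
      have "norm ((- s) *\<^sub>R P (J w)) \<le> s * norm (J w)" using norm_P[of "J w"] s by (simp add: mult_left_mono)
      also have "\<dots> \<le> s * (max 1 ((b * s / \<delta> + (b / \<delta> + \<bar>C\<bar> / \<delta>\<^sup>2)) / c) * x)"
        using Jsmall[OF w s x1 x2] s by (rule mult_left_mono)
      finally show "norm ((- s) *\<^sub>R P (J w)) \<le> (s * max 1 ((b * s / \<delta> + (b / \<delta> + \<bar>C\<bar> / \<delta>\<^sup>2)) / c))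
          * norm (P (M w) + t *\<^sub>R (- s) *\<^sub>R P (J w))"
        by (simp add: x_def mult.assoc)
    qed (use f in auto)
    then show ?thesis by simp
  qed
  have "P (J \<phi>) \<in> Y" using PY JX \<phi>(1) DJ by auto
  then have "\<exists>w\<in>W. P (M w) - s *\<^sub>R P (J w) = s *\<^sub>R P (J \<phi>)" if "0 \<le> s" for s
    using surjA[OF that, of "s *\<^sub>R P (J \<phi>)"] Y(1) by (simp add: subspace_scale)
  then obtain w where w: "\<And>s. 0 \<le> s \<Longrightarrow> w s \<in> W"
      "\<And>s. 0 \<le> s \<Longrightarrow> P (M (w s)) - s *\<^sub>R P (J (w s)) = s *\<^sub>R P (J \<phi>)" by metis
  define V where "V s = \<phi> + w s" for s
  define g where "g s = 1 + s * (w s \<bullet> J \<phi>) / lam" for s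
  have VD: "V s \<in> D" if "0 \<le> s" for s using WD(1)[OF w(1)[OF that]] \<phi>(1) lM(1) by (simp add: V_def subspace_add)
  have V\<psi>: "V s \<bullet> \<psi> = lam" if "0 \<le> s" for s
    using WD(2)[OF w(1)[OF that]] by (simp add: V_def inner_add_left inner_add_right lam_def inner_commute)
  \<comment> \<open>The projection of the left-hand side vanishes; its product with \<open>\<phi>\<close> gives the factor \<open>g s\<close>.\<close>
  have eq: "M (V s) - s *\<^sub>R J (V s) = g s *\<^sub>R \<psi>" if s: "0 \<le> s" for s
  proof -
    have wD: "w s \<in> D" using WD w s by blast
    let ?f = "M (V s) - s *\<^sub>R J (V s)"
    have f: "?f = \<psi> + M (w s) + (- s) *\<^sub>R J \<phi> + (- s) *\<^sub>R J (w s)"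
      using lM(2)[OF \<phi>(1) wD] lJ(2)[OF \<phi>(1) wD] by (simp add: V_def \<psi>_def algebra_simps)
    have "P ?f = P (M (w s)) - s *\<^sub>R P (J (w s)) - s *\<^sub>R P (J \<phi>)" unfolding f linP PM0 by (simp add: algebra_simps)
    then have "P ?f = 0" using w(2)[OF s] by simp
    then obtain r where r: "?f = r *\<^sub>R \<psi>" by (auto simp: P_def)
    have "?f \<bullet> \<phi> = V s \<bullet> \<psi> + s * (V s \<bullet> J \<phi>)"
    proof -
      have "J (V s) \<bullet> \<phi> = - (V s \<bullet> J \<phi>)" using skewJ VD[OF s] \<phi>(1) DJ by blast
      then show ?thesis using symM[OF VD[OF s] \<phi>(1)] by (simp add: inner_diff_left \<psi>_def)
    qed
    also have "V s \<bullet> J \<phi> = w s \<bullet> J \<phi>" using Jww[OF \<phi>(1)] by (simp add: V_def inner_add_left inner_add_right inner_commute)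
    finally have "r * lam = lam + s * (w s \<bullet> J \<phi>)" unfolding r V\<psi>[OF s] by (simp add: lam_def)
    then have "r = g s" using lam by (simp add: g_def field_simps)
    with r show ?thesis by simp
  qed
  have MVV: "M (V s) \<bullet> V s = g s * lam" if s: "0 \<le> s" for s
  proof -
    have "M (V s) \<bullet> V s = (M (V s) - s *\<^sub>R J (V s)) \<bullet> V s" using Jww[OF VD[OF s]] by (simp add: inner_diff_left)
    also have "\<dots> = g s * lam" unfolding eq[OF s] using V\<psi>[OF s] by (simp add: inner_commute)
    finally show ?thesis .
  qed
  have Mww: "M (w s) \<bullet> w s = g s * lam - lam" if s: "0 \<le> s" for s
  proof -
    have wD: "w s \<in> D" "w s \<bullet> \<psi> = 0" using WD w s by auto
    have "M (V s) \<bullet> V s = lam + M (w s) \<bullet> w s"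
      using lM(2)[OF \<phi>(1) wD(1)] symM[OF wD(1) \<phi>(1)] wD(2)
      by (simp add: V_def inner_add_left inner_add_right \<psi>_def lam_def inner_commute)
    then show ?thesis using MVV[OF s] by simp
  qed
  have w0: "w 0 = 0" using coer[OF w(1), of 0 0] w(2)[of 0] \<delta>(1) by (simp add: mult_le_0_iff)
  have g0: "g 0 = 1" by (simp add: g_def)
  \<comment> \<open>Local Lipschitz continuity, from the equation for the difference \<open>w s - w t\<close>.\<close>
  have lip: "\<delta> * norm (w s - w t) \<le> \<bar>s - t\<bar> * norm (J (V t))" if st: "0 \<le> s" "0 \<le> t" for s t
  proof -
    have ws: "w s \<in> W" "w t \<in> W" using w st by auto
    have PMd: "P (M (w s - w t)) = P (M (w s)) - P (M (w t))"
      and PJd: "P (J (w s - w t)) = P (J (w s)) - P (J (w t))"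
      using lin_onD(4)[OF linPM ws] lin_onD(4)[OF linPJ ws] by auto
    have PMs: "P (M (w s)) = s *\<^sub>R P (J (w s)) + s *\<^sub>R P (J \<phi>)"
      "P (M (w t)) = t *\<^sub>R P (J (w t)) + t *\<^sub>R P (J \<phi>)" using w(2)[OF st(1)] w(2)[OF st(2)]
      by (metis add.commute diff_add_cancel)+
    have PJV: "P (J (V t)) = P (J \<phi>) + P (J (w t))"
      using lJ(2)[OF \<phi>(1) WD(1)[OF ws(2)]] linP by (simp add: V_def)
    have "P (M (w s - w t)) - s *\<^sub>R P (J (w s - w t)) = (s - t) *\<^sub>R P (J (V t))"
      unfolding PMd PJd PMs PJV by (simp add: algebra_simps)
    then have "\<delta> * norm (w s - w t) \<le> \<bar>s - t\<bar> * norm (P (J (V t)))"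
      using coer[OF subspace_diff[OF W ws], of s] by simp
    also have "\<dots> \<le> \<bar>s - t\<bar> * norm (J (V t))" by (intro mult_left_mono norm_P) auto
    finally show ?thesis .
  qed
  have cont_w: "continuous_on {0..} w"
    unfolding continuous_on_iff
  proof (intro ballI allI impI)
    fix t e :: real assume t: "t \<in> {0..}" and e: "0 < e"
    define d where "d = e * \<delta> / (norm (J (V t)) + 1)"
    have n1: "norm (J (V t)) + 1 > 0" by (simp add: add_nonneg_pos)
    have d: "d > 0" using e \<delta>(1) n1 by (simp add: d_def)
    have "dist (w s) (w t) < e" if s: "s \<in> {0..}" "dist s t < d" for s
    proof -
      have "\<delta> * norm (w s - w t) \<le> \<bar>s - t\<bar> * norm (J (V t))" using lip s t by auto
      also have "\<dots> \<le> d * norm (J (V t))" using s by (intro mult_right_mono) (auto simp: dist_real_def)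
      also have "\<dots> < d * (norm (J (V t)) + 1)" using d by simp
      also have "\<dots> = \<delta> * e" using n1 by (simp add: d_def)
      finally show ?thesis using \<delta>(1) by (simp add: dist_norm)
    qed
    with d show "\<exists>d>0. \<forall>s\<in>{0..}. dist s t < d \<longrightarrow> dist (w s) (w t) < e" by blast
  qed
  have cont_g: "continuous_on {0..s} g" for s
    unfolding g_def using lam
    by (intro continuous_intros continuous_on_subset[OF cont_w]) auto
  have D_dense: "\<exists>d\<in>D. norm (f - d) < e" if "f \<in> X" "0 < e" for f e
  proof (rule dense_if_trivial_complement[OF lM(1) DX X _ that])
    fix v assume v: "v \<in> X" "\<And>d. d \<in> D \<Longrightarrow> v \<bullet> d = 0"
    obtain u where u: "u \<in> D" "M u = v" using surjM v(1) by blast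
    obtain d where d: "d \<in> D" "M d = u" using surjM u(1) DX by blast
    have "u \<bullet> u = M u \<bullet> d" using symM[OF u(1) d(1)] d(2) by simp
    then have "u = 0" using v(2)[OF d(1)] u(2) by simp
    then show "v = 0" using u(2) lM(5) by simp
  qed
  \<comment> \<open>If \<open>g\<close> never vanished, it would be positive, by continuity and \<open>g 0 = 1\<close>.\<close>
  have "\<exists>s>0. g s = 0"
  proof (rule ccontr)
    assume none: "\<not> ?thesis"
    have gpos: "0 < g s" if s: "0 \<le> s" for s
    proof (rule ccontr)
      assume "\<not> 0 < g s"
      then obtain r where r: "0 \<le> r" "g r = 0"
        using IVT2'[of g s 0 0] s g0 cont_g by auto
      then show False using none g0 by (cases "r = 0") auto
    qed
    have w_bd: "(norm (w s))\<^sup>2 \<le> lam / \<delta>" and g_le: "g s \<le> 1" if s: "0 \<le> s" for s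
    proof -
      have "\<delta> * (norm (w s))\<^sup>2 \<le> lam - g s * lam"
        using \<delta>(2)[OF w(1)[OF s]] Mww[OF s] by (simp add: power2_norm_eq_inner)
      moreover have "0 \<le> \<delta> * (norm (w s))\<^sup>2" using \<delta>(1) by simp
      moreover have "0 < g s * lam" using gpos[OF s] lam by simp
      ultimately have 1: "\<delta> * (norm (w s))\<^sup>2 \<le> lam" and 2: "g s * lam \<le> 1 * lam" by linarith+
      show "(norm (w s))\<^sup>2 \<le> lam / \<delta>" using 1 \<delta>(1) by (simp add: field_simps)
      show "g s \<le> 1" using 2 lam by (rule mult_right_le_imp_le)
    qed
    define B where "B = norm \<phi> + sqrt (lam / \<delta>)"
    have B0: "B \<ge> 0" using lam \<delta>(1) by (simp add: B_def)
    have V_bd: "norm (V s) \<le> B" if s: "0 \<le> s" for s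
      using norm_triangle_ineq[of \<phi> "w s"] real_le_rsqrt[OF w_bd[OF s]] by (simp add: V_def B_def)
    define B2 where "B2 = sqrt (\<bar>C\<bar> * B\<^sup>2 / c)"
    have B20: "B2 \<ge> 0" using c by (simp add: B2_def)
    have JV_bd: "norm (J (V s)) \<le> B2" if s: "0 \<le> s" for s
    proof -
      have "0 \<le> M (V s) \<bullet> V s" using MVV[OF s] gpos[OF s] lam by simp
      then have "c * (norm (J (V s)))\<^sup>2 \<le> C * (norm (V s))\<^sup>2"
        using est[OF VD[OF s]] by (simp add: power2_norm_eq_inner)
      also have "\<dots> \<le> \<bar>C\<bar> * B\<^sup>2"
        using V_bd[OF s] by (intro mult_mono power_mono) auto
      finally have "(norm (J (V s)))\<^sup>2 \<le> \<bar>C\<bar> * B\<^sup>2 / c" using c by (simp add: field_simps)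
      then show ?thesis unfolding B2_def by (rule real_le_rsqrt)
    qed
    \<comment> \<open>The constant \<open>lam = V s \<bullet> \<psi>\<close> is split with \<open>J v\<close> close to \<open>\<psi>\<close> and \<open>d \<in> D\<close> close to \<open>v\<close>;
      for \<open>s\<close> large enough each of the three parts is at most \<open>lam / 4\<close>.\<close>
    obtain v where v: "v \<in> DJ" "norm (\<psi> - J v) < lam / (4 * (B + 1))"
      using denseJ[OF \<psi>X, of "lam / (4 * (B + 1))"] lam B0 by auto
    obtain d where d: "d \<in> D" "norm (v - d) < lam / (4 * (B2 + 1))"
      using D_dense[of v "lam / (4 * (B2 + 1))"] v(1) DJX lam B20 by auto
    define E where "E = B * norm (M d) + \<bar>\<psi> \<bullet> d\<bar>"
    have E0: "0 \<le> E" using B0 by (simp add: E_def)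
    define s where "s = 4 * E / lam + 1"
    have s: "0 < s" using E0 lam by (simp add: s_def add_nonneg_pos)
    have 1: "V s \<bullet> (\<psi> - J v) \<le> lam / 4"
    proof -
      have "V s \<bullet> (\<psi> - J v) \<le> norm (V s) * norm (\<psi> - J v)" by (rule norm_cauchy_schwarz)
      also have "\<dots> \<le> (B + 1) * (lam / (4 * (B + 1)))"
        using V_bd[of s] s v(2) B0 by (intro mult_mono) auto
      also have "\<dots> = lam / 4" using B0 by (simp add: field_simps)
      finally show ?thesis .
    qed
    have 2: "- (J (V s) \<bullet> (v - d)) \<le> lam / 4"
    proof -
      have "- (J (V s) \<bullet> (v - d)) \<le> norm (J (V s)) * norm (v - d)"
        using Cauchy_Schwarz_ineq2[of "J (V s)" "v - d"] by linarith
      also have "\<dots> \<le> (B2 + 1) * (lam / (4 * (B2 + 1)))"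
        using JV_bd[of s] s d(2) B20 by (intro mult_mono) auto
      also have "\<dots> = lam / 4" using B20 by (simp add: field_simps)
      finally show ?thesis .
    qed
    have 3: "- (J (V s) \<bullet> d) \<le> lam / 4"
    proof -
      have "s *\<^sub>R J (V s) = M (V s) - g s *\<^sub>R \<psi>" using eq[of s] s by (simp add: algebra_simps)
      then have "s * (J (V s) \<bullet> d) = (M (V s) - g s *\<^sub>R \<psi>) \<bullet> d" by (metis inner_scaleR_left)
      also have "\<dots> = V s \<bullet> M d - g s * (\<psi> \<bullet> d)"
        using symM[OF VD d(1), of s] s by (simp add: inner_diff_left)
      finally have "s * - (J (V s) \<bullet> d) = g s * (\<psi> \<bullet> d) - V s \<bullet> M d" by simp
      also have "\<dots> \<le> \<bar>\<psi> \<bullet> d\<bar> + B * norm (M d)"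
      proof -
        have "g s * (\<psi> \<bullet> d) \<le> g s * \<bar>\<psi> \<bullet> d\<bar>" using gpos[of s] s by (intro mult_left_mono) auto
        also have "\<dots> \<le> \<bar>\<psi> \<bullet> d\<bar>" using g_le[of s] gpos[of s] s by (intro mult_left_le_one_le) auto
        finally have "g s * (\<psi> \<bullet> d) \<le> \<bar>\<psi> \<bullet> d\<bar>" .
        moreover have "- (V s \<bullet> M d) \<le> norm (V s) * norm (M d)"
          using Cauchy_Schwarz_ineq2[of "V s" "M d"] by linarith
        moreover have "norm (V s) * norm (M d) \<le> B * norm (M d)"
          using V_bd[of s] s by (intro mult_right_mono) auto
        ultimately show ?thesis by linarith
      qed
      also have "\<dots> = E" by (simp add: E_def)
      also have "E \<le> s * (lam / 4)" using lam by (simp add: s_def field_simps)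
      finally show ?thesis using s by (rule mult_left_le_imp_le)
    qed
    have "lam = V s \<bullet> (\<psi> - J v) + V s \<bullet> J v" using V\<psi>[of s] s by (simp add: inner_diff_right)
    also have "V s \<bullet> J v = - (J (V s) \<bullet> (v - d)) - J (V s) \<bullet> d"
      using skewJ[of "V s" v] VD[of s] s v(1) DJ by (auto simp: inner_diff_right)
    finally show False using 1 2 3 lam by linarith
  qed
  then obtain s where s: "s > 0" "g s = 0" by blast
  have "M (V s) = s *\<^sub>R J (V s)" using eq[of s] s by simp
  moreover have "V s \<noteq> 0" using V\<psi>[of s] s lam by auto
  ultimately show ?thesis using s(1) VD[of s] by (intro exI[of _ s]) auto
qed

section \<open>Splitting of a simple kernel\<close>

text \<open>A Lyapunov--Schmidt reduction that uses first differences only.  On the complement of \<open>\<phi>\<close> the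
  compression \<open>P (M h)\<close> stays onto as a small perturbation of \<open>M 0\<close>.  The remaining scalar equation
  has the coefficient \<open>d = M h \<phi> \<bullet> \<phi> - M h w1 \<bullet> \<phi>\<close>; its first term is \<open>h (M' \<phi> \<bullet> \<phi>)\<close> up to a quarter, and the
  second is of order \<open>h\<^sup>2\<close>, because both \<open>w1\<close> and \<open>M h \<phi>\<close> are of order \<open>h\<close>.\<close>

lemma surj_after_simple_kernel_splits:
  fixes M :: "real \<Rightarrow> 'a::{real_inner,complete_space} \<Rightarrow> 'a"
  assumes X: "subspace X" "closed X" and DX: "D \<subseteq> X" and r0: "r0 > 0"
    and lin: "\<And>h. \<bar>h\<bar> < r0 \<Longrightarrow> lin_on D (M h)" and MX: "\<And>h u. \<bar>h\<bar> < r0 \<Longrightarrow> u \<in> D \<Longrightarrow> M h u \<in> X"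
    and sym: "\<And>h u v. \<bar>h\<bar> < r0 \<Longrightarrow> u \<in> D \<Longrightarrow> v \<in> D \<Longrightarrow> M h u \<bullet> v = u \<bullet> M h v"
    and \<phi>: "\<phi> \<in> D" "M 0 \<phi> = 0" "norm \<phi> = 1"
    and ran: "\<And>f. f \<in> X \<Longrightarrow> f \<bullet> \<phi> = 0 \<Longrightarrow> \<exists>u\<in>D. M 0 u = f"
    and der: "\<And>e. 0 < e \<Longrightarrow> \<exists>r>0. \<forall>h. 0 < \<bar>h\<bar> \<and> \<bar>h\<bar> < r \<longrightarrow> (\<forall>u\<in>D.
        norm ((1 / h) *\<^sub>R (M h u - M 0 u) - M' u) \<le> e * (norm u + norm (M 0 u)))"
    and M': "\<And>u. u \<in> D \<Longrightarrow> norm (M' u) \<le> C * (norm u + norm (M 0 u))"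
    and nondeg: "M' \<phi> \<bullet> \<phi> \<noteq> 0"
  shows "\<exists>r>0. \<forall>h. \<bar>h\<bar> < r \<and> 0 < h * (M' \<phi> \<bullet> \<phi>) \<longrightarrow> \<bar>h\<bar> < r0 \<and> 0 < M h \<phi> \<bullet> \<phi> \<and> (\<forall>f\<in>X. \<exists>u\<in>D. M h u = f)"
proof -
  define \<kappa> where "\<kappa> = M' \<phi> \<bullet> \<phi>"
  have \<kappa>: "\<kappa> \<noteq> 0" using nondeg by (simp add: \<kappa>_def)
  have "\<bar>0::real\<bar> < r0" using r0 by simp
  note lin0 = lin[OF this] and sym0 = sym[OF this] and M0X = MX[OF this]
  note l0 = lin_onD[OF lin0]
  have \<phi>\<phi>: "\<phi> \<bullet> \<phi> = 1" using \<phi>(3) by (simp add: norm_eq_1)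
  define W where "W = {w \<in> D. w \<bullet> \<phi> = 0}"
  define Y where "Y = {f \<in> X. f \<bullet> \<phi> = 0}"
  define P where "P f = f - (f \<bullet> \<phi>) *\<^sub>R \<phi>" for f
  have WD: "w \<in> D" "w \<bullet> \<phi> = 0" if "w \<in> W" for w using that by (auto simp: W_def)
  have W: "subspace W" "W \<subseteq> Y" using l0(1) DX by (auto simp: W_def Y_def subspace_def inner_add_left)
  have Y: "subspace Y" "closed Y"
  proof -
    show "subspace Y" using X(1) by (auto simp: Y_def subspace_def inner_add_left)
    have "Y = X \<inter> {f. f \<bullet> \<phi> = 0}" by (auto simp: Y_def)
    then show "closed Y" using X(2) by (auto intro!: closed_Int closed_Collect_eq continuous_intros)
  qed
  have linP: "P (f + g) = P f + P g" "P (r *\<^sub>R f) = r *\<^sub>R P f" "P (f - g) = P f - P g" for f g r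
    by (auto simp: P_def inner_add_left inner_diff_left algebra_simps)
  have PY: "P f \<in> Y" if "f \<in> X" for f
    using that \<phi>(1) DX X(1) \<phi>\<phi> by (auto simp: P_def Y_def inner_diff_left subspace_diff subspace_scale)
  have Pid: "P f = f" if "f \<in> Y" for f using that by (simp add: P_def Y_def)
  have norm_P: "norm (P f) \<le> norm f" for f
  proof -
    have "(norm f)\<^sup>2 = (norm (P f))\<^sup>2 + (f \<bullet> \<phi>)\<^sup>2"
      unfolding power2_norm_eq_inner using \<phi>\<phi>
      by (simp add: P_def inner_diff_left inner_diff_right inner_commute power2_eq_square algebra_simps)
    then show ?thesis by (smt (verit) norm_ge_zero power2_le_imp_le zero_le_power2)
  qed
  have M0Y: "M 0 w \<in> Y" if "w \<in> D" for w
    using M0X[OF that] sym0[OF that \<phi>(1)] \<phi>(2) by (simp add: Y_def)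
  have surj0: "\<exists>w\<in>W. M 0 w = f" if f: "f \<in> Y" for f
  proof -
    obtain u where u: "u \<in> D" "M 0 u = f" using ran f by (auto simp: Y_def)
    let ?w = "u - (u \<bullet> \<phi>) *\<^sub>R \<phi>"
    have "?w \<in> W" using u(1) \<phi>(1) \<phi>\<phi> l0(1) by (auto simp: W_def inner_diff_left intro!: subspace_diff subspace_scale)
    moreover have "M 0 ?w = f" using u \<phi> l0 by (simp add: subspace_scale)
    ultimately show ?thesis by blast
  qed
  obtain K where K: "K > 0" "\<And>w. w \<in> W \<Longrightarrow> norm w \<le> K * norm (M 0 w)"
  proof -
    have "\<exists>K>0. \<forall>w\<in>W. norm w \<le> K * norm (M 0 w)"
      by (rule symmetric_surj_bounded_below[OF Y lin_on_subset[OF lin0 W(1)] W(2)])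
        (use WD sym0 surj0 in auto)
    then show ?thesis using that by blast
  qed
  define C1 where "C1 = max C 0 + 1"
  have C1: "C1 > 0" by (simp add: C1_def)
  obtain r1 where r1: "r1 > 0" and der1: "\<And>h u. 0 < \<bar>h\<bar> \<Longrightarrow> \<bar>h\<bar> < r1 \<Longrightarrow> u \<in> D \<Longrightarrow>
       norm ((1 / h) *\<^sub>R (M h u - M 0 u) - M' u) \<le> 1 * (norm u + norm (M 0 u))"
    using der[of 1] by auto
  obtain r2 where r2: "r2 > 0" and der2: "\<And>h u. 0 < \<bar>h\<bar> \<Longrightarrow> \<bar>h\<bar> < r2 \<Longrightarrow> u \<in> D \<Longrightarrow>
       norm ((1 / h) *\<^sub>R (M h u - M 0 u) - M' u) \<le> (\<bar>\<kappa>\<bar> / 4) * (norm u + norm (M 0 u))"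
    using der[of "\<bar>\<kappa>\<bar> / 4"] \<kappa> by auto
  \<comment> \<open>\<open>r3\<close> makes the perturbation of \<open>M 0\<close> on \<open>W\<close> a contraction, \<open>r4\<close> the second-order term at most half of \<open>h \<kappa>\<close>.\<close>
  define r3 where "r3 = 1 / (2 * (C1 * (K + 1)))"
  define r4 where "r4 = \<bar>\<kappa>\<bar> / (4 * (K * C1\<^sup>2))"
  have r34: "r3 > 0" "r4 > 0" using C1 K(1) \<kappa> by (auto simp: r3_def r4_def intro!: divide_pos_pos mult_pos_pos add_pos_pos)
  define r where "r = min (min r0 (min r1 r2)) (min r3 r4)"
  have r: "r > 0" using r0 r1 r2 r34 by (simp add: r_def)
  have main: "\<bar>h\<bar> < r0 \<and> 0 < M h \<phi> \<bullet> \<phi> \<and> (\<forall>f\<in>X. \<exists>u\<in>D. M h u = f)" if h: "\<bar>h\<bar> < r" "0 < h * \<kappa>" for h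
  proof -
    have h0: "0 < \<bar>h\<bar>" using h(2) by auto
    have hr: "\<bar>h\<bar> < r0" "\<bar>h\<bar> < r1" "\<bar>h\<bar> < r2" "\<bar>h\<bar> < r3" "\<bar>h\<bar> < r4" using h(1) by (auto simp: r_def)
    note lh = lin_onD[OF lin[OF hr(1)]]
    have diff: "norm (M h u - M 0 u) \<le> \<bar>h\<bar> * (C1 * (norm u + norm (M 0 u)))" if u: "u \<in> D" for u
    proof -
      let ?N = "norm u + norm (M 0 u)"
      have "norm ((1 / h) *\<^sub>R (M h u - M 0 u)) \<le> norm ((1 / h) *\<^sub>R (M h u - M 0 u) - M' u) + norm (M' u)"
        using norm_triangle_ineq[of "(1 / h) *\<^sub>R (M h u - M 0 u) - M' u" "M' u"] by simp
      also have "\<dots> \<le> 1 * ?N + C * ?N" using der1[OF h0 hr(2) u] M'[OF u] by linarith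
      also have "\<dots> \<le> 1 * ?N + max C 0 * ?N" by (intro add_left_mono mult_right_mono) auto
      also have "\<dots> = C1 * ?N" by (simp add: C1_def algebra_simps)
      finally have "\<bar>h\<bar> * norm ((1 / h) *\<^sub>R (M h u - M 0 u)) \<le> \<bar>h\<bar> * (C1 * ?N)" by (rule mult_left_mono) simp
      moreover have "\<bar>h\<bar> * norm ((1 / h) *\<^sub>R (M h u - M 0 u)) = norm (M h u - M 0 u)"
        using h0 by simp
      ultimately show ?thesis by linarith
    qed
    have near_W: "norm (P (M h w) - M 0 w) \<le> (1/2) * norm (M 0 w)" if w: "w \<in> W" for w
    proof -
      have "P (M h w) - M 0 w = P (M h w - M 0 w)" using Pid[OF M0Y[OF WD(1)[OF w]]] linP by simp
      then have "norm (P (M h w) - M 0 w) \<le> norm (M h w - M 0 w)" using norm_P by simp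
      also have "\<dots> \<le> \<bar>h\<bar> * (C1 * (norm w + norm (M 0 w)))" using diff WD[OF w] by blast
      also have "\<dots> \<le> \<bar>h\<bar> * (C1 * (K * norm (M 0 w) + norm (M 0 w)))"
        using K(2)[OF w] C1 by (intro mult_left_mono add_right_mono) auto
      also have "\<dots> = (\<bar>h\<bar> * (C1 * (K + 1))) * norm (M 0 w)" by (simp add: algebra_simps)
      also have "\<dots> \<le> (1/2) * norm (M 0 w)"
      proof (rule mult_right_mono)
        have "\<bar>h\<bar> * (C1 * (K + 1)) \<le> r3 * (C1 * (K + 1))" using hr(4) C1 K(1) by (intro mult_right_mono) auto
        also have "\<dots> = 1/2" using C1 K(1) by (simp add: r3_def)
        finally show "\<bar>h\<bar> * (C1 * (K + 1)) \<le> 1/2" .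
      qed simp
      finally show ?thesis .
    qed
    have surjW: "\<exists>w\<in>W. P (M h w) = f" if f: "f \<in> Y" for f
    proof -
      have "\<exists>w\<in>W. M 0 w + (P (M h w) - M 0 w) = f"
      proof (rule surj_small_perturbation[OF Y lin_on_subset[OF lin0 W(1)], where \<theta> = "1/2"])
        show "W \<subseteq> D" using WD by blast
        show "lin_on W (\<lambda>w. P (M h w) - M 0 w)"
          using W(1) WD(1) lh l0 linP by (auto simp: lin_on_def algebra_simps)
        show "P (M h w) - M 0 w \<in> Y" if "w \<in> W" for w
          using PY[OF MX[OF hr(1) WD(1)[OF that]]] M0Y[OF WD(1)[OF that]] Y(1) by (simp add: subspace_diff)
      qed (use near_W surj0 f in auto)
      then show ?thesis by simp
    qed
    have half: "norm (M 0 w) \<le> 2 * norm (P (M h w))" if w: "w \<in> W" for w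
      using near_W[OF w] norm_triangle_ineq2[of "M 0 w" "P (M h w)"] by (simp add: norm_minus_commute)
    have M\<phi>: "norm (M h \<phi>) \<le> \<bar>h\<bar> * C1" using diff[OF \<phi>(1)] \<phi> by simp
    have a_near: "\<bar>M h \<phi> \<bullet> \<phi> - h * \<kappa>\<bar> \<le> \<bar>h\<bar> * (\<bar>\<kappa>\<bar> / 4)"
    proof -
      have "norm ((1 / h) *\<^sub>R M h \<phi> - M' \<phi>) \<le> \<bar>\<kappa>\<bar> / 4" using der2[OF h0 hr(3) \<phi>(1)] \<phi> by simp
      then have "\<bar>((1 / h) *\<^sub>R M h \<phi> - M' \<phi>) \<bullet> \<phi>\<bar> \<le> \<bar>\<kappa>\<bar> / 4"
        using Cauchy_Schwarz_ineq2[of "(1 / h) *\<^sub>R M h \<phi> - M' \<phi>" \<phi>] \<phi>(3) by simp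
      then have "\<bar>h\<bar> * \<bar>(1 / h) * (M h \<phi> \<bullet> \<phi>) - \<kappa>\<bar> \<le> \<bar>h\<bar> * (\<bar>\<kappa>\<bar> / 4)"
        by (intro mult_left_mono) (auto simp: inner_diff_left \<kappa>_def)
      moreover have "\<bar>h\<bar> * \<bar>(1 / h) * (M h \<phi> \<bullet> \<phi>) - \<kappa>\<bar> = \<bar>M h \<phi> \<bullet> \<phi> - h * \<kappa>\<bar>"
        using h0 by (simp add: abs_mult[symmetric] algebra_simps)
      ultimately show ?thesis by simp
    qed
    have h\<kappa>: "\<bar>h\<bar> * \<bar>\<kappa>\<bar> = h * \<kappa>" using h(2) by (simp add: abs_mult[symmetric])
    have a_low: "3/4 * (h * \<kappa>) \<le> M h \<phi> \<bullet> \<phi>" using a_near h\<kappa> by linarith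
    \<comment> \<open>\<open>\<phi> - w1\<close> is the perturbed kernel direction: \<open>M h\<close> maps it to a multiple of \<open>\<phi>\<close>.\<close>
    obtain w1 where w1: "w1 \<in> W" "P (M h w1) = P (M h \<phi>)" using surjW[OF PY[OF MX[OF hr(1) \<phi>(1)]]] by blast
    have w1_bd: "norm w1 \<le> 2 * K * (\<bar>h\<bar> * C1)"
    proof -
      have "norm w1 \<le> K * norm (M 0 w1)" by (rule K(2)[OF w1(1)])
      also have "\<dots> \<le> K * (2 * norm (P (M h \<phi>)))" using half[OF w1(1)] w1(2) K(1) by simp
      also have "\<dots> \<le> K * (2 * (\<bar>h\<bar> * C1))" using norm_P[of "M h \<phi>"] M\<phi> K(1) by (intro mult_left_mono) auto
      finally show ?thesis by simp
    qed
    define d where "d = M h \<phi> \<bullet> \<phi> - M h w1 \<bullet> \<phi>"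
    have "\<bar>M h w1 \<bullet> \<phi>\<bar> \<le> norm w1 * norm (M h \<phi>)"
      using sym[OF hr(1) WD(1)[OF w1(1)] \<phi>(1)] Cauchy_Schwarz_ineq2[of w1 "M h \<phi>"] by simp
    also have "\<dots> \<le> (2 * K * (\<bar>h\<bar> * C1)) * (\<bar>h\<bar> * C1)"
      using w1_bd M\<phi> K(1) C1 by (intro mult_mono) auto
    also have "\<dots> = 2 * (\<bar>h\<bar> * (\<bar>h\<bar> * (K * C1\<^sup>2)))" by (simp add: power2_eq_square)
    also have "\<dots> \<le> 2 * (\<bar>h\<bar> * (\<bar>\<kappa>\<bar> / 4))"
    proof -
      have "\<bar>h\<bar> * (K * C1\<^sup>2) \<le> r4 * (K * C1\<^sup>2)" using hr(5) K(1) C1 by (intro mult_right_mono) auto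
      also have "\<dots> = \<bar>\<kappa>\<bar> / 4" using K(1) C1 by (simp add: r4_def)
      finally show ?thesis by (intro mult_left_mono) auto
    qed
    finally have "\<bar>M h w1 \<bullet> \<phi>\<bar> \<le> 1/2 * (h * \<kappa>)" using h\<kappa> by linarith
    then have d: "d > 0" using a_low h(2) by (simp add: d_def)
    have "\<exists>u\<in>D. M h u = f" if f: "f \<in> X" for f
    proof -
      obtain w0 where w0: "w0 \<in> W" "P (M h w0) = P f" using surjW[OF PY[OF f]] by blast
      define c where "c = (f \<bullet> \<phi> - M h w0 \<bullet> \<phi>) / d"
      define u where "u = w0 + c *\<^sub>R (\<phi> - w1)"
      have D: "w0 \<in> D" "w1 \<in> D" "\<phi> - w1 \<in> D" using WD w0 w1 \<phi>(1) l0(1) by (auto simp: subspace_diff)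
      have Mu: "M h u = M h w0 + c *\<^sub>R (M h \<phi> - M h w1)"
        using D \<phi>(1) lh by (simp add: u_def subspace_scale)
      have "P (M h u) = P f" unfolding Mu linP using w0(2) w1(2) by simp
      moreover have "M h u \<bullet> \<phi> = M h w0 \<bullet> \<phi> + c * d"
        unfolding Mu by (simp add: inner_add_left inner_diff_left d_def)
      then have "M h u \<bullet> \<phi> = f \<bullet> \<phi>" using d by (simp add: c_def)
      ultimately have "M h u = f" by (simp add: P_def)
      moreover have "u \<in> D" using D l0(1) by (simp add: u_def subspace_add subspace_scale)
      ultimately show ?thesis by blast
    qed
    moreover have "0 < M h \<phi> \<bullet> \<phi>" using a_low h(2) by linarith
    ultimately show ?thesis using hr(1) by blast
  qed
  show ?thesis using r main by (intro exI[of _ r]) (auto simp: \<kappa>_def)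
qed

section \<open>Square-integrable functions\<close>

lemma L2_measurable_borel [measurable_dest]: "u \<in> L2 \<Longrightarrow> u \<in> borel_measurable borel"
  by (simp add: L2_def)

lemma L2_integrable: "u \<in> L2 \<Longrightarrow> integrable lborel (\<lambda>x. (norm (u x))\<^sup>2)"
  by (simp add: L2_def)

lemma L2_I:
  assumes "u \<in> borel_measurable borel" "(\<integral>\<^sup>+x. ennreal ((norm (u x))\<^sup>2) \<partial>lborel) < \<infinity>"
  shows "u \<in> L2"
  unfolding L2_def using assms by (auto intro!: integrableI_bounded)

lemma L2_bound:
  assumes u: "u \<in> borel_measurable borel" and g: "integrable lborel g"
    and le: "AE x in lborel. (norm (u x))\<^sup>2 \<le> g x"
  shows "u \<in> L2"
proof -
  have "integrable lborel (\<lambda>x. (norm (u x))\<^sup>2)"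
    by (rule Bochner_Integration.integrable_bound[OF g]) (use u le in auto)
  then show ?thesis using u by (simp add: L2_def)
qed

lemma L2_dominated:
  assumes u: "u \<in> borel_measurable borel" and v: "v \<in> L2"
    and le: "AE x in lborel. norm (u x) \<le> C * norm (v x)"
  shows "u \<in> L2"
proof (rule L2_bound[OF u])
  show "integrable lborel (\<lambda>x. C\<^sup>2 * (norm (v x))\<^sup>2)" using L2_integrable[OF v] by simp
  show "AE x in lborel. (norm (u x))\<^sup>2 \<le> C\<^sup>2 * (norm (v x))\<^sup>2"
    using le by eventually_elim (simp add: power_mult_distrib[symmetric] power_mono)
qed

lemma L2_zero [simp]: "(\<lambda>x. 0) \<in> L2"
  by (auto simp: L2_def)

lemma L2_add:
  assumes "u \<in> L2" "v \<in> L2" shows "(\<lambda>x. u x + v x) \<in> L2"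
proof (rule L2_bound)
  show "(\<lambda>x. u x + v x) \<in> borel_measurable borel" using assms by measurable
  show "integrable lborel (\<lambda>x. 2 * (norm (u x))\<^sup>2 + 2 * (norm (v x))\<^sup>2)"
    using L2_integrable assms by (intro Bochner_Integration.integrable_add integrable_mult_right) auto
  have "(norm (a + b))\<^sup>2 \<le> 2 * (norm a)\<^sup>2 + 2 * (norm b)\<^sup>2" for a b :: "complex^'a"
  proof -
    have "(norm (a + b))\<^sup>2 \<le> (norm a + norm b)\<^sup>2" by (intro power_mono norm_triangle_ineq) auto
    also have "\<dots> \<le> 2 * (norm a)\<^sup>2 + 2 * (norm b)\<^sup>2"
      using zero_le_power2[of "norm a - norm b"] by (simp add: power2_eq_square algebra_simps)
    finally show ?thesis .
  qed
  then show "AE x in lborel. (norm (u x + v x))\<^sup>2 \<le> 2 * (norm (u x))\<^sup>2 + 2 * (norm (v x))\<^sup>2" by simp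
qed

lemma norm_vector_cscale: "norm (c *s x) = cmod c * norm (x :: complex^'d::finite)"
  by (simp add: norm_vec_def L2_set_def norm_mult power_mult_distrib sum_distrib_left[symmetric] real_sqrt_mult)

lemma measurable_vec_nth [measurable]: "u \<in> borel_measurable M \<Longrightarrow> (\<lambda>x. (u x :: complex^'d::finite) $ i) \<in> borel_measurable M"
  by (rule borel_measurable_continuous_on[where f = "\<lambda>z. z $ i"]) (auto intro: continuous_intros)

lemma measurable_vecI:
  fixes u :: "'a \<Rightarrow> complex^'d::finite"
  assumes "\<And>i. (\<lambda>x. u x $ i) \<in> borel_measurable M" shows "u \<in> borel_measurable M"
proof (subst borel_measurable_euclidean_space, intro ballI)
  fix b :: "complex^'d" assume "b \<in> Basis"
  then obtain i c where "b = axis i c" by (auto simp: Basis_vec_def)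
  then show "(\<lambda>x. u x \<bullet> b) \<in> borel_measurable M"
    using assms[of i] by (simp add: inner_axis)
qed

lemma measurable_vec_lambda [measurable]:
  "(\<And>i. (\<lambda>x. f x i :: complex) \<in> borel_measurable M) \<Longrightarrow> (\<lambda>x. (\<chi> i. f x i) :: complex^'d::finite) \<in> borel_measurable M"
  by (rule measurable_vecI) simp

lemma measurable_cscale [measurable]:
  "c \<in> borel_measurable M \<Longrightarrow> u \<in> borel_measurable M \<Longrightarrow> (\<lambda>x. c x *s (u x :: complex^'d::finite)) \<in> borel_measurable M"
  by (rule measurable_vecI) (simp, measurable)

lemma L2_cscale: assumes "u \<in> L2" shows "(\<lambda>x. c *s u x) \<in> L2"
  by (rule L2_dominated[OF _ assms, of _ "cmod c"]) (use assms in \<open>auto simp: norm_vector_cscale\<close>)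

lemma L2_scaleR: assumes "u \<in> L2" shows "(\<lambda>x. c *\<^sub>R u x) \<in> L2"
  by (rule L2_dominated[OF _ assms, of _ "\<bar>c\<bar>"]) (use assms in auto)

lemma L2_uminus: "u \<in> L2 \<Longrightarrow> (\<lambda>x. - u x) \<in> L2"
  using L2_scaleR[of u "-1"] by simp

lemma L2_diff: "u \<in> L2 \<Longrightarrow> v \<in> L2 \<Longrightarrow> (\<lambda>x. u x - v x) \<in> L2"
  using L2_add[OF _ L2_uminus, of u v] by simp

lemma integrable_inner_L2:
  assumes "u \<in> L2" "v \<in> L2" shows "integrable lborel (\<lambda>x. u x \<bullet> v x)"
proof (rule Bochner_Integration.integrable_bound)
  show "integrable lborel (\<lambda>x. (norm (u x))\<^sup>2 + (norm (v x))\<^sup>2)"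
    by (intro Bochner_Integration.integrable_add L2_integrable assms)
  show "(\<lambda>x. u x \<bullet> v x) \<in> borel_measurable lborel" using assms by measurable
  have "\<bar>a \<bullet> b\<bar> \<le> (norm a)\<^sup>2 + (norm b)\<^sup>2" for a b :: "complex^'a"
  proof -
    have "\<bar>a \<bullet> b\<bar> \<le> norm a * norm b" by (rule Cauchy_Schwarz_ineq2)
    moreover have "2 * (norm a * norm b) \<le> (norm a)\<^sup>2 + (norm b)\<^sup>2"
      using zero_le_power2[of "norm a - norm b"] by (simp add: power2_eq_square algebra_simps)
    moreover have "0 \<le> norm a * norm b" by simp
    ultimately show ?thesis by linarith
  qed
  then show "AE x in lborel. norm (u x \<bullet> v x) \<le> norm ((norm (u x))\<^sup>2 + (norm (v x))\<^sup>2)" by simp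
qed

lemma ae_eq_refl [simp]: "u \<doteq> u" by (simp add: ae_eq_def)
lemma ae_eq_sym: "u \<doteq> v \<Longrightarrow> v \<doteq> u" unfolding ae_eq_def by (rule eventually_mono) auto
lemma ae_eq_trans [trans]: "u \<doteq> v \<Longrightarrow> v \<doteq> w \<Longrightarrow> u \<doteq> w" unfolding ae_eq_def by (erule (1) eventually_elim2) simp
lemma ae_eq_add: "u \<doteq> u' \<Longrightarrow> v \<doteq> v' \<Longrightarrow> (\<lambda>x. u x + v x) \<doteq> (\<lambda>x. u' x + v' x)"
  unfolding ae_eq_def by (erule (1) eventually_elim2) simp
lemma ae_eq_diff: "u \<doteq> u' \<Longrightarrow> v \<doteq> v' \<Longrightarrow> (\<lambda>x. u x - v x) \<doteq> (\<lambda>x. u' x - v' x)"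
  unfolding ae_eq_def by (erule (1) eventually_elim2) simp
lemma ae_eq_uminus: "u \<doteq> u' \<Longrightarrow> (\<lambda>x. - u x) \<doteq> (\<lambda>x. - u' x)"
  unfolding ae_eq_def by (erule eventually_mono) simp
lemma ae_eq_fun: "u \<doteq> u' \<Longrightarrow> (\<lambda>x. f x (u x)) \<doteq> (\<lambda>x. f x (u' x))"
  unfolding ae_eq_def by (erule eventually_mono) simp

section \<open>The Hilbert space of classes\<close>

definition l2_rel :: "'d::finite vfun \<Rightarrow> 'd vfun \<Rightarrow> bool" where
  "l2_rel u v \<longleftrightarrow> u \<in> L2 \<and> v \<in> L2 \<and> u \<doteq> v"

text \<open>The quotient is partial because \<open>\<doteq>\<close> relates all functions, whereas the classes are those of
  square-integrable ones.  Only real scalars and the real part of the inner product are part of the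
  Hilbert space structure; the complex structure is added by operators on it.\<close>

quotient_type 'd lsq = "'d::finite vfun" / partial: l2_rel
proof (rule part_equivpI)
  show "\<exists>x. l2_rel x x" by (rule exI[of _ "\<lambda>x. 0"]) (simp add: l2_rel_def)
  show "symp l2_rel" by (auto simp: symp_def l2_rel_def ae_eq_sym)
  show "transp l2_rel" by (auto simp: transp_def l2_rel_def intro: ae_eq_trans)
qed

instantiation lsq :: (finite) real_vector
begin
lift_definition zero_lsq :: "'a lsq" is "\<lambda>x. 0" by (simp add: l2_rel_def)
lift_definition plus_lsq :: "'a lsq \<Rightarrow> 'a lsq \<Rightarrow> 'a lsq" is "\<lambda>u v x. u x + v x"
  by (simp add: l2_rel_def L2_add ae_eq_add)
lift_definition minus_lsq :: "'a lsq \<Rightarrow> 'a lsq \<Rightarrow> 'a lsq" is "\<lambda>u v x. u x - v x"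
  by (simp add: l2_rel_def L2_diff ae_eq_diff)
lift_definition uminus_lsq :: "'a lsq \<Rightarrow> 'a lsq" is "\<lambda>u x. - u x"
  by (simp add: l2_rel_def L2_uminus ae_eq_uminus)
lift_definition scaleR_lsq :: "real \<Rightarrow> 'a lsq \<Rightarrow> 'a lsq" is "\<lambda>c u x. c *\<^sub>R u x"
  by (auto simp: l2_rel_def L2_scaleR intro: ae_eq_fun)
instance
  by (intro_classes; transfer)
    (auto simp: l2_rel_def algebra_simps intro!: L2_add L2_diff L2_uminus L2_scaleR)
end

instantiation lsq :: (finite) real_inner
begin
lift_definition inner_lsq :: "'a lsq \<Rightarrow> 'a lsq \<Rightarrow> real" is "\<lambda>u v. LINT x|lborel. u x \<bullet> v x"
proof -
  fix u u' v v' :: "'a vfun" assume *: "l2_rel u u'" "l2_rel v v'"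
  then show "(LINT x|lborel. u x \<bullet> v x) = (LINT x|lborel. u' x \<bullet> v' x)"
  proof (intro integral_cong_AE)
    show "AE x in lborel. u x \<bullet> v x = u' x \<bullet> v' x"
      using * unfolding l2_rel_def ae_eq_def by (auto elim: eventually_elim2)
  qed (use * in \<open>auto simp: l2_rel_def\<close>)
qed
definition "norm_lsq (x :: 'a lsq) = sqrt (inner x x)"
definition "dist_lsq (x :: 'a lsq) y = norm (x - y)"
definition "sgn_lsq (x :: 'a lsq) = x /\<^sub>R norm x"
definition uniformity_lsq :: "('a lsq \<times> 'a lsq) filter" where
  "uniformity_lsq = (INF e\<in>{0<..}. principal {(x, y). dist x y < e})"
definition open_lsq :: "'a lsq set \<Rightarrow> bool" where
  "open_lsq U \<longleftrightarrow> (\<forall>x\<in>U. eventually (\<lambda>(x', y). x' = x \<longrightarrow> y \<in> U) uniformity)"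
instance
proof
  fix x y z :: "'a lsq" and r :: real
  show "dist x y = norm (x - y)" by (rule dist_lsq_def)
  show "sgn x = x /\<^sub>R norm x" by (rule sgn_lsq_def)
  show "uniformity = (INF e\<in>{0<..}. principal {(x, y :: 'a lsq). dist x y < e})" by (rule uniformity_lsq_def)
  show "open U \<longleftrightarrow> (\<forall>x\<in>U. eventually (\<lambda>(x', y). x' = x \<longrightarrow> y \<in> U) uniformity)" for U :: "'a lsq set"
    by (rule open_lsq_def)
  show "inner x y = inner y x" by transfer (simp add: inner_commute)
  show "inner (x + y) z = inner x z + inner y z"
    by transfer (simp add: l2_rel_def inner_add_left integrable_inner_L2)
  show "inner (r *\<^sub>R x) y = r * inner x y" by transfer simp
  show "0 \<le> inner x x" by transfer simp
  show "inner x x = 0 \<longleftrightarrow> x = 0"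
  proof transfer
    fix x :: "'a vfun" assume "l2_rel x x"
    then have x: "x \<in> L2" by (simp add: l2_rel_def)
    have "(LINT t|lborel. x t \<bullet> x t) = 0 \<longleftrightarrow> (AE t in lborel. x t \<bullet> x t = 0)"
      by (rule integral_nonneg_eq_0_iff_AE) (use integrable_inner_L2[OF x x] in auto)
    then show "(LINT t|lborel. x t \<bullet> x t) = 0 \<longleftrightarrow> l2_rel x (\<lambda>x. 0)"
      using x by (simp add: l2_rel_def ae_eq_def)
  qed
  show "norm x = sqrt (inner x x)" by (rule norm_lsq_def)
qed
end

lemma l2_rel_self: "l2_rel u u \<longleftrightarrow> u \<in> L2" by (simp add: l2_rel_def)

abbreviation "cls \<equiv> abs_lsq"
abbreviation "rep \<equiv> rep_lsq"

lemma rep_L2 [simp]: "rep f \<in> L2"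
  using Quotient3_rep_reflp[OF Quotient3_lsq, of f] by (simp add: l2_rel_def)

lemma cls_rep [simp]: "cls (rep f) = f"
  using Quotient3_abs_rep[OF Quotient3_lsq] .

lemma cls_eq_iff: "u \<in> L2 \<Longrightarrow> v \<in> L2 \<Longrightarrow> cls u = cls v \<longleftrightarrow> u \<doteq> v"
  using Quotient3_rel[OF Quotient3_lsq, of u v] by (simp add: l2_rel_def)

lemma rep_cls: "u \<in> L2 \<Longrightarrow> rep (cls u) \<doteq> u"
  using cls_eq_iff[of "rep (cls u)" u] by simp

lemma cls_add: "u \<in> L2 \<Longrightarrow> v \<in> L2 \<Longrightarrow> cls u + cls v = cls (\<lambda>x. u x + v x)"
  by (simp add: plus_lsq.abs_eq l2_rel_self)
lemma cls_diff: "u \<in> L2 \<Longrightarrow> v \<in> L2 \<Longrightarrow> cls u - cls v = cls (\<lambda>x. u x - v x)"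
  by (simp add: minus_lsq.abs_eq l2_rel_self)
lemma cls_scaleR: "u \<in> L2 \<Longrightarrow> c *\<^sub>R cls u = cls (\<lambda>x. c *\<^sub>R u x)"
  by (simp add: scaleR_lsq.abs_eq l2_rel_self)
lemma cls_zero: "cls (\<lambda>x. 0) = 0"
  by (simp add: zero_lsq_def)
lemma cls_inner: "u \<in> L2 \<Longrightarrow> v \<in> L2 \<Longrightarrow> cls u \<bullet> cls v = (LINT x|lborel. u x \<bullet> v x)"
  by (simp add: inner_lsq.abs_eq l2_rel_self)
lemma cls_norm: "u \<in> L2 \<Longrightarrow> norm (cls u) = l2_norm u"
  by (simp add: norm_eq_sqrt_inner cls_inner l2_norm_def power2_norm_eq_inner)

lemma nn_integral_L2: "u \<in> L2 \<Longrightarrow> (\<integral>\<^sup>+x. ennreal ((norm (u x))\<^sup>2) \<partial>lborel) = ennreal ((norm (cls u))\<^sup>2)"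
  by (simp add: cls_norm l2_norm_def nn_integral_eq_integral[OF L2_integrable])

text \<open>Turns square-summability of increments of a sequence of functions, weighted by \<open>2\<^sup>n\<close>, into pointwise
  absolute convergence.\<close>

lemma summable_of_weighted_squares:
  fixes a :: "nat \<Rightarrow> real"
  assumes fin: "(\<Sum>n. ennreal (2 ^ n * (a n)\<^sup>2)) \<noteq> \<infinity>"
  shows "summable a"
proof -
  let ?S = "\<Sum>n. ennreal (2 ^ n * (a n)\<^sup>2)"
  define c where "c = enn2real ?S"
  have S: "?S = ennreal c" using fin unfolding c_def by (intro ennreal_enn2real[symmetric]) (simp add: less_top)
  have c0: "c \<ge> 0" by (simp add: c_def)
  have bd: "norm (a n) \<le> sqrt c * (sqrt (1/2)) ^ n" for n
  proof -
    have "sum (\<lambda>n. ennreal (2 ^ n * (a n)\<^sup>2)) {n} \<le> ?S" by (rule sum_le_suminf) auto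
    then have "ennreal (2 ^ n * (a n)\<^sup>2) \<le> ennreal c" by (simp only: S) simp
    then have "2 ^ n * (a n)\<^sup>2 \<le> c" by (subst (asm) ennreal_le_iff[OF c0])
    then have "(a n)\<^sup>2 \<le> c * (1/2) ^ n" by (simp add: power_one_over pos_le_divide_eq mult.commute)
    then have "\<bar>a n\<bar> \<le> sqrt (c * (1/2) ^ n)" by (intro real_le_rsqrt) simp
    then show ?thesis by (simp add: real_sqrt_mult real_sqrt_power)
  qed
  show ?thesis
  proof (rule summable_comparison_test'[where N = 0])
    have "sqrt (1/2) < (1::real)" by simp
    then show "summable (\<lambda>n. sqrt c * (sqrt (1/2)) ^ n)" by (intro summable_mult summable_geometric) simp
    show "norm (a n) \<le> sqrt c * sqrt (1/2) ^ n" if "0 \<le> n" for n by (rule bd)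
  qed
qed

text \<open>Riesz--Fischer: a subsequence with geometrically decreasing increments converges almost everywhere,
  and Fatou's lemma identifies the limit in norm.\<close>

instance lsq :: (finite) complete_space
proof
  fix X :: "nat \<Rightarrow> 'a lsq" assume C: "Cauchy X"
  have "\<forall>n::nat. \<exists>N. \<forall>m\<ge>N. \<forall>k\<ge>N. dist (X m) (X k) < (1/2) ^ n"
    using C by (auto simp: Cauchy_def)
  then obtain N where N: "\<And>n m k. m \<ge> N n \<Longrightarrow> k \<ge> N n \<Longrightarrow> dist (X m) (X k) < (1/2) ^ n" by metis
  define r where "r n = (\<Sum>i\<le>n. N i)" for n
  have r: "N n \<le> r m" if "n \<le> m" for n m unfolding r_def using that by (intro member_le_sum) auto
  define u where "u n = rep (X (r n))" for n
  have u: "u n \<in> L2" "cls (u n) = X (r n)" for n by (auto simp: u_def)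
  note [measurable] = L2_measurable_borel[OF u(1)]
  have close: "(\<integral>\<^sup>+x. ennreal ((norm (u m x - u n x))\<^sup>2) \<partial>lborel) \<le> ennreal ((1/4) ^ n)" if "n \<le> m" for n m
  proof -
    have "norm (cls (\<lambda>x. u m x - u n x)) \<le> (1/2) ^ n"
      using N[OF r[OF that] r[OF order_refl]] u by (simp add: cls_diff[symmetric] dist_norm less_imp_le)
    then have "(norm (cls (\<lambda>x. u m x - u n x)))\<^sup>2 \<le> ((1/2) ^ n)\<^sup>2" by (intro power_mono) auto
    also have "((1/2::real) ^ n)\<^sup>2 = (1/4) ^ n" by (subst power_mult[symmetric], subst mult.commute, subst power_mult) (simp add: power2_eq_square)
    finally show ?thesis by (subst nn_integral_L2[OF L2_diff]) (use u in auto)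
  qed
  \<comment> \<open>The increments have squared norms below \<open>4\<^sup>-\<^sup>n\<close>, which leaves room for the weights \<open>2\<^sup>n\<close>.\<close>
  have "(\<integral>\<^sup>+x. (\<Sum>n. ennreal (2 ^ n * (norm (u (Suc n) x - u n x))\<^sup>2)) \<partial>lborel)
      = (\<Sum>n. \<integral>\<^sup>+x. ennreal (2 ^ n * (norm (u (Suc n) x - u n x))\<^sup>2) \<partial>lborel)"
    by (rule nn_integral_suminf) measurable
  also have "\<dots> \<le> (\<Sum>n. ennreal ((1/2) ^ n))"
  proof (intro suminf_le)
    fix n
    have "(\<integral>\<^sup>+x. ennreal (2 ^ n * (norm (u (Suc n) x - u n x))\<^sup>2) \<partial>lborel)
       = ennreal (2 ^ n) * (\<integral>\<^sup>+x. ennreal ((norm (u (Suc n) x - u n x))\<^sup>2) \<partial>lborel)"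
      by (simp add: ennreal_mult nn_integral_cmult)
    also have "\<dots> \<le> ennreal (2 ^ n) * ennreal ((1/4) ^ n)" by (intro mult_left_mono close) auto
    also have "\<dots> = ennreal ((1/2) ^ n)" by (simp add: ennreal_mult[symmetric] power_mult_distrib[symmetric])
    finally show "(\<integral>\<^sup>+x. ennreal (2 ^ n * (norm (u (Suc n) x - u n x))\<^sup>2) \<partial>lborel) \<le> ennreal ((1/2) ^ n)" .
  qed auto
  also have "\<dots> < \<infinity>" by (subst suminf_ennreal2) (auto intro!: summable_geometric)
  finally have "AE x in lborel. (\<Sum>n. ennreal (2 ^ n * (norm (u (Suc n) x - u n x))\<^sup>2)) \<noteq> \<infinity>"
    by (intro nn_integral_noteq_infinite) auto
  then have conv: "AE x in lborel. convergent (\<lambda>n. u n x)"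
  proof eventually_elim
    fix x assume "(\<Sum>n. ennreal (2 ^ n * (norm (u (Suc n) x - u n x))\<^sup>2)) \<noteq> \<infinity>"
    then have "summable (\<lambda>n. norm (u (Suc n) x - u n x))" by (rule summable_of_weighted_squares)
    then have "summable (\<lambda>n. u (Suc n) x - u n x)" by (rule summable_norm_cancel)
    then have "convergent (\<lambda>n. \<Sum>i<n. u (Suc i) x - u i x)" by (simp add: summable_iff_convergent)
    moreover have "(\<Sum>i<n. u (Suc i) x - u i x) = u n x - u 0 x" for n
      by (induction n) auto
    ultimately have "convergent (\<lambda>n. u n x - u 0 x)" by (simp only:)
    then show "convergent (\<lambda>n. u n x)" by (simp only: convergent_diff_const_right_iff)
  qed
  define v where "v x = lim (\<lambda>n. u n x)" for x
  have [measurable]: "v \<in> borel_measurable borel" unfolding v_def by (rule borel_measurable_lim_metric) (use L2_measurable_borel[OF u(1)] in simp)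
  have v_close: "(\<integral>\<^sup>+x. ennreal ((norm (v x - u n x))\<^sup>2) \<partial>lborel) \<le> ennreal ((1/4) ^ n)" for n
  proof -
    have "(\<integral>\<^sup>+x. ennreal ((norm (v x - u n x))\<^sup>2) \<partial>lborel)
        = (\<integral>\<^sup>+x. liminf (\<lambda>m. ennreal ((norm (u m x - u n x))\<^sup>2)) \<partial>lborel)"
    proof (rule nn_integral_cong_AE)
      show "AE x in lborel. ennreal ((norm (v x - u n x))\<^sup>2) = liminf (\<lambda>m. ennreal ((norm (u m x - u n x))\<^sup>2))"
        using conv
      proof eventually_elim
        fix x assume "convergent (\<lambda>n. u n x)"
        then have "(\<lambda>m. u m x) \<longlonglongrightarrow> v x" by (simp add: v_def convergent_LIMSEQ_iff)
        then have "(\<lambda>m. ennreal ((norm (u m x - u n x))\<^sup>2)) \<longlonglongrightarrow> ennreal ((norm (v x - u n x))\<^sup>2)"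
          by (intro tendsto_ennrealI tendsto_intros)
        then show "ennreal ((norm (v x - u n x))\<^sup>2) = liminf (\<lambda>m. ennreal ((norm (u m x - u n x))\<^sup>2))"
          by (intro lim_imp_Liminf[symmetric]) auto
      qed
    qed
    also have "\<dots> \<le> liminf (\<lambda>m. \<integral>\<^sup>+x. ennreal ((norm (u m x - u n x))\<^sup>2) \<partial>lborel)"
      by (rule nn_integral_liminf) measurable
    also have "\<dots> \<le> ennreal ((1/4) ^ n)"
    proof -
      have "liminf (\<lambda>m. \<integral>\<^sup>+x. ennreal ((norm (u m x - u n x))\<^sup>2) \<partial>lborel) \<le> liminf (\<lambda>m::nat. ennreal ((1/4) ^ n))"
        by (rule Liminf_mono, rule eventually_mono[OF eventually_ge_at_top[of n]]) (rule close)
      then show ?thesis by (simp add: Liminf_const)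
    qed
    finally show ?thesis .
  qed
  have dL2: "(\<lambda>x. v x - u n x) \<in> L2" for n
    using le_less_trans[OF v_close[of n], of \<infinity>] by (intro L2_I) auto
  have vL2: "v \<in> L2" using L2_add[OF dL2[of 0] u(1)[of 0]] by simp
  have nv: "norm (cls v - X (r n)) \<le> (1/2) ^ n" for n
  proof -
    have "(norm (cls (\<lambda>x. v x - u n x)))\<^sup>2 \<le> (1/4) ^ n"
      using v_close[of n] unfolding nn_integral_L2[OF dL2] by (simp add: ennreal_le_iff)
    also have "(1/4::real) ^ n = ((1/2) ^ n)\<^sup>2" by (subst power_mult[symmetric], subst mult.commute, subst power_mult) (simp add: power2_eq_square)
    finally have "norm (cls (\<lambda>x. v x - u n x)) \<le> (1/2) ^ n" by (rule power2_le_imp_le) simp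
    then show ?thesis using cls_diff[OF vL2 u(1)[of n]] u(2)[of n] by simp
  qed
  have "X \<longlonglongrightarrow> cls v"
  proof (rule metric_LIMSEQ_I)
    fix e :: real assume "0 < e"
    then obtain n where n: "(1/2::real) ^ n < e / 2" using real_arch_pow_inv[of "e/2" "1/2"] by auto
    have "dist (X m) (cls v) < e" if "m \<ge> r n" for m
    proof -
      have "dist (X m) (cls v) \<le> dist (X m) (X (r n)) + dist (X (r n)) (cls v)" by (rule dist_triangle)
      also have "\<dots> \<le> (1/2) ^ n + (1/2) ^ n"
        using N[of n m "r n"] r[of n n] that nv[of n] by (intro add_mono) (auto simp: dist_norm norm_minus_commute intro: less_imp_le)
      finally show ?thesis using n by simp
    qed
    then show "\<exists>no. \<forall>m\<ge>no. dist (X m) (cls v) < e" by blast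
  qed
  then show "convergent X" by (rule convergentI)
qed

section \<open>The Fourier transform of integrable functions\<close>

definition ft :: "(real \<Rightarrow> complex) \<Rightarrow> real \<Rightarrow> complex" where
  "ft f \<xi> = (LINT x|lborel. exp (- (\<i> * complex_of_real (x * \<xi>))) * f x)"

lemma norm_exp_i [simp]: "cmod (exp (- (\<i> * complex_of_real t))) = 1" "cmod (exp (\<i> * complex_of_real t)) = 1"
  by simp_all

lemma ft_measurable [measurable]:
  assumes [measurable]: "f \<in> borel_measurable borel" shows "ft f \<in> borel_measurable borel"
  unfolding ft_def by measurable

lemma measurable_cnj [measurable]: "f \<in> borel_measurable M \<Longrightarrow> (\<lambda>x. cnj (f x)) \<in> borel_measurable M"
  by (rule borel_measurable_continuous_on[where f = cnj]) (auto intro: continuous_intros)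

lemma norm_integral_le_nn_integral:
  fixes f :: "real \<Rightarrow> complex"
  shows "ennreal (cmod (LINT x|lborel. f x)) \<le> (\<integral>\<^sup>+x. ennreal (cmod (f x)) \<partial>lborel)"
  by (cases "integrable lborel f") (auto simp: integral_norm_bound_ennreal not_integrable_integral_eq)

lemma integrable_exp_mult:
  assumes f: "integrable lborel f"
  shows "integrable lborel (\<lambda>x. exp (- (\<i> * complex_of_real (x * t))) * f x)"
    "integrable lborel (\<lambda>x. exp (\<i> * complex_of_real (x * t)) * f x)"
proof -
  have [measurable]: "f \<in> borel_measurable borel" using borel_measurable_integrable[OF f] by simp
  show "integrable lborel (\<lambda>x. exp (- (\<i> * complex_of_real (x * t))) * f x)"
    by (rule Bochner_Integration.integrable_bound[OF f]) (simp_all add: norm_mult)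
  show "integrable lborel (\<lambda>x. exp (\<i> * complex_of_real (x * t)) * f x)"
    by (rule Bochner_Integration.integrable_bound[OF f]) (simp_all add: norm_mult)
qed

lemma norm_ft_le: "cmod (ft f \<xi>) \<le> (LINT x|lborel. cmod (f x))"
proof -
  have "cmod (ft f \<xi>) \<le> (LINT x|lborel. cmod (exp (- (\<i> * complex_of_real (x * \<xi>))) * f x))"
    unfolding ft_def by (rule integral_norm_bound)
  then show ?thesis by (simp add: norm_mult)
qed

text \<open>By Fubini for the kernel of the transform; this multiplication formula later determines the adjoint of
  the transform on \<open>L\<^sup>2\<close>.\<close>

lemma ft_multiplication:
  assumes f: "integrable lborel f" and g: "integrable lborel g"
  shows "(LINT \<xi>|lborel. ft f \<xi> * g \<xi>) = (LINT x|lborel. f x * ft g x)"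
proof -
  have [measurable]: "f \<in> borel_measurable borel" "g \<in> borel_measurable borel"
    using borel_measurable_integrable[OF f] borel_measurable_integrable[OF g] by simp_all
  let ?K = "\<lambda>x \<xi>. exp (- (\<i> * complex_of_real (x * \<xi>))) * f x * g \<xi>"
  have "integrable (lborel \<Otimes>\<^sub>M lborel) (case_prod ?K)"
  proof (rule lborel_pair.Fubini_integrable)
    show "case_prod ?K \<in> borel_measurable (lborel \<Otimes>\<^sub>M lborel)" by measurable
    have "(LINT \<xi>|lborel. norm (case_prod ?K (x, \<xi>))) = cmod (f x) * (LINT \<xi>|lborel. cmod (g \<xi>))" for x
      by (simp add: norm_mult)
    then show "integrable lborel (\<lambda>x. LINT \<xi>|lborel. norm (case_prod ?K (x, \<xi>)))"
      using f by (simp only: integrable_mult_left integrable_norm)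
    have "integrable lborel (\<lambda>\<xi>. case_prod ?K (x, \<xi>))" for x
    proof (rule Bochner_Integration.integrable_bound)
      show "integrable lborel (\<lambda>\<xi>. f x * g \<xi>)" using g by (rule integrable_mult_right)
    qed (simp_all add: norm_mult)
    then show "AE x in lborel. integrable lborel (\<lambda>\<xi>. case_prod ?K (x, \<xi>))" by simp
  qed
  from lborel_pair.Fubini_integral[OF this]
  have "(LINT \<xi>|lborel. LINT x|lborel. ?K x \<xi>) = (LINT x|lborel. LINT \<xi>|lborel. ?K x \<xi>)" .
  moreover have "(LINT x|lborel. ?K x \<xi>) = ft f \<xi> * g \<xi>" for \<xi>
    unfolding ft_def by (rule integral_mult_left_zero)
  moreover have "(LINT \<xi>|lborel. ?K x \<xi>) = f x * ft g x" for x
  proof -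
    have "(LINT \<xi>|lborel. ?K x \<xi>) = (LINT \<xi>|lborel. f x * (exp (- (\<i> * complex_of_real (\<xi> * x))) * g \<xi>))"
      by (intro Bochner_Integration.integral_cong) (simp_all add: mult_ac)
    also have "\<dots> = f x * ft g x" unfolding ft_def by (rule integral_mult_right_zero)
    finally show ?thesis .
  qed
  ultimately show ?thesis by (simp only:)
qed

definition gauss :: "real \<Rightarrow> real \<Rightarrow> real" where
  "gauss s \<xi> = exp (- (s * \<xi>)\<^sup>2 / 2)"

text \<open>The transform of \<open>gauss s\<close> (\<open>gauss_fourier\<close>): an approximate identity of total mass \<open>2\<pi>\<close> as \<open>s\<close> tends
  to zero.\<close>

definition heat :: "real \<Rightarrow> real \<Rightarrow> real" where
  "heat s t = 2 * pi / s * std_normal_density (t / s)"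

lemma heat_nonneg: "s > 0 \<Longrightarrow> 0 \<le> heat s t" by (simp add: heat_def)

lemma heat_even: "heat s (- t) = heat s t" by (simp add: heat_def std_normal_density_def)

lemma gauss_measurable [measurable]: "gauss s \<in> borel_measurable borel"
  unfolding gauss_def by measurable

lemma heat_measurable [measurable]: "heat s \<in> borel_measurable borel"
  unfolding heat_def by measurable

lemma gauss_eq_density: "gauss s \<xi> = sqrt (2 * pi) * std_normal_density (s * \<xi>)"
  by (simp add: gauss_def std_normal_density_def)

lemma integrable_gauss: assumes "s > 0" shows "integrable lborel (gauss s)"
proof -
  have "integrable lborel (\<lambda>\<xi>. std_normal_density (0 + s * \<xi>))"
    by (subst lborel_integrable_real_affine_iff) (use assms in simp_all)
  then show ?thesis by (simp add: gauss_eq_density[abs_def])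
qed

lemma gauss_fourier:
  assumes s: "s > 0"
  shows "(LINT \<xi>|lborel. exp (\<i> * complex_of_real (\<xi> * t)) * complex_of_real (gauss s \<xi>)) = complex_of_real (heat s t)"
proof -
  have "char std_normal_distribution (t / s) = (LINT z|lborel. std_normal_density z *\<^sub>R iexp (t / s * z))"
    unfolding char_def by (subst integral_density) simp_all
  then have *: "(LINT z|lborel. std_normal_density z *\<^sub>R iexp (t / s * z)) = complex_of_real (exp (- ((t / s)\<^sup>2) / 2))"
    by (simp add: char_std_normal_distribution)
  have "(LINT \<xi>|lborel. exp (\<i> * complex_of_real (\<xi> * t)) * complex_of_real (gauss s \<xi>))
     = \<bar>1 / s\<bar> *\<^sub>R (LINT z|lborel. exp (\<i> * complex_of_real ((0 + 1 / s * z) * t)) * complex_of_real (gauss s (0 + 1 / s * z)))"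
    using s by (intro lborel_integral_real_affine) simp
  also have "(LINT z|lborel. exp (\<i> * complex_of_real ((0 + 1 / s * z) * t)) * complex_of_real (gauss s (0 + 1 / s * z)))
     = (LINT z|lborel. complex_of_real (sqrt (2 * pi)) * (std_normal_density z *\<^sub>R iexp (t / s * z)))"
    using s by (intro Bochner_Integration.integral_cong) (simp_all add: gauss_eq_density scaleR_conv_of_real mult_ac)
  also have "\<dots> = complex_of_real (sqrt (2 * pi)) * complex_of_real (exp (- ((t / s)\<^sup>2) / 2))"
    unfolding *[symmetric] by (rule integral_mult_right_zero)
  also have "\<bar>1 / s\<bar> *\<^sub>R \<dots> = complex_of_real (1 / s * (sqrt (2 * pi) * exp (- ((t / s)\<^sup>2) / 2)))"
    using s by (simp add: scaleR_conv_of_real)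
  also have "1 / s * (sqrt (2 * pi) * exp (- ((t / s)\<^sup>2) / 2)) = heat s t"
  proof -
    have *: "2 * pi / sqrt (2 * pi) = sqrt (2 * pi)" by (rule real_div_sqrt) simp
    have "heat s t = 1 / s * (2 * pi / sqrt (2 * pi) * exp (- ((t / s)\<^sup>2) / 2))"
      by (simp add: heat_def std_normal_density_def)
    then show ?thesis unfolding * ..
  qed
  finally show ?thesis .
qed

lemma nn_integral_heat:
  assumes s: "s > 0"
  shows "(\<integral>\<^sup>+y. ennreal (heat s (y - x)) \<partial>lborel) = ennreal (2 * pi)"
    "(\<integral>\<^sup>+x. ennreal (heat s (y - x)) \<partial>lborel) = ennreal (2 * pi)"
proof -
  have 1: "(\<integral>\<^sup>+z. ennreal (std_normal_density z) \<partial>lborel) = 1"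
    by (subst nn_integral_eq_integral) simp_all
  have *: "(\<integral>\<^sup>+y. ennreal (heat s (y - x)) \<partial>lborel) = ennreal (2 * pi)" for x
  proof -
    have "(\<integral>\<^sup>+y. ennreal (heat s (y - x)) \<partial>lborel) = ennreal \<bar>s\<bar> * (\<integral>\<^sup>+z. ennreal (heat s ((x + s * z) - x)) \<partial>lborel)"
      using s by (intro nn_integral_real_affine) simp_all
    also have "(\<integral>\<^sup>+z. ennreal (heat s ((x + s * z) - x)) \<partial>lborel) = (\<integral>\<^sup>+z. ennreal (2 * pi / s) * ennreal (std_normal_density z) \<partial>lborel)"
      using s by (intro nn_integral_cong) (simp add: heat_def ennreal_mult[symmetric])
    also have "\<dots> = ennreal (2 * pi / s)" by (subst nn_integral_cmult) (simp_all add: 1)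
    also have "ennreal \<bar>s\<bar> * \<dots> = ennreal (2 * pi)" using s by (simp add: ennreal_mult[symmetric])
    finally show ?thesis .
  qed
  show "(\<integral>\<^sup>+y. ennreal (heat s (y - x)) \<partial>lborel) = ennreal (2 * pi)" by (rule *)
  show "(\<integral>\<^sup>+x. ennreal (heat s (y - x)) \<partial>lborel) = ennreal (2 * pi)"
  proof -
    have "heat s (y - x) = heat s (x - y)" for x using heat_even[of s "x - y"] by simp
    then show ?thesis using *[of y] by (simp only:)
  qed
qed

text \<open>Plancherel with a Gaussian weight, which makes all integrals absolutely convergent: the weight turns
  into a convolution with its transform.\<close>

lemma gauss_pairing:
  assumes f: "integrable lborel f" and h: "integrable lborel h" and s: "s > 0"
  shows "(LINT \<xi>|lborel. ft f \<xi> * (complex_of_real (gauss s \<xi>) * cnj (ft h \<xi>)))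
     = (LINT x|lborel. f x * cnj (LINT y|lborel. h y * complex_of_real (heat s (y - x))))"
    "integrable lborel (\<lambda>\<xi>. ft f \<xi> * (complex_of_real (gauss s \<xi>) * cnj (ft h \<xi>)))"
proof -
  have [measurable]: "f \<in> borel_measurable borel" "h \<in> borel_measurable borel"
    using borel_measurable_integrable[OF f] borel_measurable_integrable[OF h] by simp_all
  have cg: "integrable lborel (\<lambda>\<xi>. complex_of_real (gauss s \<xi>))" using integrable_gauss[OF s] by simp
  have g: "integrable lborel (\<lambda>\<xi>. complex_of_real (gauss s \<xi>) * cnj (ft h \<xi>))"
  proof (rule Bochner_Integration.integrable_bound)
    show "integrable lborel (\<lambda>\<xi>. gauss s \<xi> * (LINT x|lborel. cmod (h x)))" using integrable_gauss[OF s] by simp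
    show "AE \<xi> in lborel. norm (complex_of_real (gauss s \<xi>) * cnj (ft h \<xi>)) \<le> norm (gauss s \<xi> * (LINT x|lborel. cmod (h x)))"
      by (intro AE_I2) (auto simp: norm_mult abs_mult intro!: mult_left_mono order_trans[OF norm_ft_le])
  qed measurable
  show "integrable lborel (\<lambda>\<xi>. ft f \<xi> * (complex_of_real (gauss s \<xi>) * cnj (ft h \<xi>)))"
  proof (rule Bochner_Integration.integrable_bound)
    show "integrable lborel (\<lambda>\<xi>. (LINT x|lborel. cmod (f x)) *\<^sub>R (complex_of_real (gauss s \<xi>) * cnj (ft h \<xi>)))"
      using g by (rule integrable_scaleR_right)
    show "AE \<xi> in lborel. norm (ft f \<xi> * (complex_of_real (gauss s \<xi>) * cnj (ft h \<xi>)))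
       \<le> norm ((LINT x|lborel. cmod (f x)) *\<^sub>R (complex_of_real (gauss s \<xi>) * cnj (ft h \<xi>)))"
      by (intro AE_I2) (auto simp: norm_mult intro!: mult_right_mono order_trans[OF norm_ft_le])
  qed measurable
  have "ft (\<lambda>\<xi>. complex_of_real (gauss s \<xi>) * cnj (ft h \<xi>)) x
      = cnj (LINT y|lborel. h y * complex_of_real (heat s (y - x)))" for x
  proof -
    let ?m = "\<lambda>\<xi>. exp (\<i> * complex_of_real (\<xi> * x)) * complex_of_real (gauss s \<xi>)"
    have "ft (\<lambda>\<xi>. complex_of_real (gauss s \<xi>) * cnj (ft h \<xi>)) x = (LINT \<xi>|lborel. cnj (ft h \<xi> * ?m \<xi>))"
      unfolding ft_def[of "\<lambda>\<xi>. complex_of_real (gauss s \<xi>) * cnj (ft h \<xi>)"]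
      by (intro Bochner_Integration.integral_cong) (simp_all add: exp_cnj mult_ac)
    also have "\<dots> = cnj (LINT \<xi>|lborel. ft h \<xi> * ?m \<xi>)" by (rule Bochner_Integration.integral_cnj)
    also have "(LINT \<xi>|lborel. ft h \<xi> * ?m \<xi>) = (LINT y|lborel. h y * ft ?m y)"
      by (rule ft_multiplication[OF h integrable_exp_mult(2)[OF cg]])
    also have "(\<lambda>y. h y * ft ?m y) = (\<lambda>y. h y * complex_of_real (heat s (y - x)))"
    proof
      fix y
      have e: "exp (- (\<i> * complex_of_real (\<xi> * y))) * exp (\<i> * complex_of_real (\<xi> * x))
          = exp (\<i> * complex_of_real (\<xi> * (x - y)))" for \<xi>
      proof -
        have "- (\<i> * complex_of_real (\<xi> * y)) + \<i> * complex_of_real (\<xi> * x) = \<i> * complex_of_real (\<xi> * (x - y))"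
          by (simp add: right_diff_distrib)
        then show ?thesis by (simp only: exp_add[symmetric])
      qed
      have "ft ?m y = (LINT \<xi>|lborel. exp (\<i> * complex_of_real (\<xi> * (x - y))) * complex_of_real (gauss s \<xi>))"
        unfolding ft_def mult.assoc[symmetric] e ..
      also have "\<dots> = complex_of_real (heat s (x - y))" by (rule gauss_fourier[OF s])
      finally show "h y * ft ?m y = h y * complex_of_real (heat s (y - x))" using heat_even[of s "y - x"] by simp
    qed
    finally show ?thesis .
  qed
  then show "(LINT \<xi>|lborel. ft f \<xi> * (complex_of_real (gauss s \<xi>) * cnj (ft h \<xi>)))
     = (LINT x|lborel. f x * cnj (LINT y|lborel. h y * complex_of_real (heat s (y - x))))"
    using ft_multiplication[OF f g] by simp
qed

text \<open>Half of Plancherel: the Gaussian weight is removed by Fatou's lemma, and the convolution is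
  estimated with \<open>2ab \<le> a\<^sup>2 + b\<^sup>2\<close>, since its kernel has mass \<open>2\<pi>\<close> in each variable.\<close>

lemma nn_integral_ft_le:
  assumes f: "integrable lborel f"
  shows "(\<integral>\<^sup>+\<xi>. ennreal ((cmod (ft f \<xi>))\<^sup>2) \<partial>lborel) \<le> ennreal (2 * pi) * (\<integral>\<^sup>+x. ennreal ((cmod (f x))\<^sup>2) \<partial>lborel)"
proof -
  have [measurable]: "f \<in> borel_measurable borel" using borel_measurable_integrable[OF f] by simp
  let ?B = "\<integral>\<^sup>+x. ennreal ((cmod (f x))\<^sup>2) \<partial>lborel"
  have weighted: "(\<integral>\<^sup>+\<xi>. ennreal ((cmod (ft f \<xi>))\<^sup>2 * gauss s \<xi>) \<partial>lborel) \<le> ennreal (2 * pi) * ?B" if s: "s > 0" for s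
  proof -
    let ?P = "\<lambda>x y. ennreal (1/2 * (cmod (f x))\<^sup>2) * ennreal (heat s (y - x))"
    let ?P' = "\<lambda>x y. ennreal (1/2 * (cmod (f y))\<^sup>2) * ennreal (heat s (y - x))"
    let ?g = "\<lambda>\<xi>. ft f \<xi> * (complex_of_real (gauss s \<xi>) * cnj (ft f \<xi>))"
    have g: "?g \<xi> = complex_of_real ((cmod (ft f \<xi>))\<^sup>2 * gauss s \<xi>)" for \<xi>
      using complex_norm_square[of "ft f \<xi>"] by (simp add: mult_ac)
    have int: "integrable lborel (\<lambda>\<xi>. (cmod (ft f \<xi>))\<^sup>2 * gauss s \<xi>)"
      using gauss_pairing(2)[OF f f s] unfolding g by (simp only: complex_of_real_integrable_eq)
    have "(\<integral>\<^sup>+\<xi>. ennreal ((cmod (ft f \<xi>))\<^sup>2 * gauss s \<xi>) \<partial>lborel) = ennreal (LINT \<xi>|lborel. (cmod (ft f \<xi>))\<^sup>2 * gauss s \<xi>)"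
      by (rule nn_integral_eq_integral[OF int]) (simp add: gauss_def)
    also have "\<dots> \<le> ennreal (cmod (LINT \<xi>|lborel. ?g \<xi>))"
      unfolding g integral_complex_of_real by (rule ennreal_leI) simp
    also have "\<dots> = ennreal (cmod (LINT x|lborel. f x * cnj (LINT y|lborel. f y * complex_of_real (heat s (y - x)))))"
      unfolding gauss_pairing(1)[OF f f s] ..
    also have "\<dots> \<le> (\<integral>\<^sup>+x. ennreal (cmod (f x * cnj (LINT y|lborel. f y * complex_of_real (heat s (y - x))))) \<partial>lborel)"
      by (rule norm_integral_le_nn_integral)
    also have "\<dots> \<le> (\<integral>\<^sup>+x. (\<integral>\<^sup>+y. ?P x y + ?P' x y \<partial>lborel) \<partial>lborel)"
    proof (rule nn_integral_mono)
      fix x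
      have "ennreal (cmod (f x * cnj (LINT y|lborel. f y * complex_of_real (heat s (y - x)))))
         = ennreal (cmod (f x)) * ennreal (cmod (LINT y|lborel. f y * complex_of_real (heat s (y - x))))"
        by (simp add: norm_mult ennreal_mult)
      also have "\<dots> \<le> ennreal (cmod (f x)) * (\<integral>\<^sup>+y. ennreal (cmod (f y * complex_of_real (heat s (y - x)))) \<partial>lborel)"
        by (intro mult_left_mono norm_integral_le_nn_integral) simp
      also have "\<dots> = (\<integral>\<^sup>+y. ennreal (cmod (f x)) * ennreal (cmod (f y * complex_of_real (heat s (y - x)))) \<partial>lborel)"
        by (rule nn_integral_cmult[symmetric]) measurable
      also have "\<dots> \<le> (\<integral>\<^sup>+y. ?P x y + ?P' x y \<partial>lborel)"
      proof (rule nn_integral_mono)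
        fix y
        let ?h = "heat s (y - x)"
        have h: "0 \<le> ?h" by (rule heat_nonneg[OF s])
        have "cmod (f x) * cmod (f y) \<le> 1/2 * (cmod (f x))\<^sup>2 + 1/2 * (cmod (f y))\<^sup>2"
          using zero_le_power2[of "cmod (f x) - cmod (f y)"] by (simp add: power2_eq_square algebra_simps)
        from mult_right_mono[OF this h]
        have le: "cmod (f x) * (cmod (f y) * ?h) \<le> 1/2 * (cmod (f x))\<^sup>2 * ?h + 1/2 * (cmod (f y))\<^sup>2 * ?h"
          by (simp only: distrib_right mult.assoc)
        have "ennreal (cmod (f x)) * ennreal (cmod (f y * complex_of_real ?h)) = ennreal (cmod (f x) * (cmod (f y) * ?h))"
          using h by (simp add: norm_mult ennreal_mult)
        also have "\<dots> \<le> ennreal (1/2 * (cmod (f x))\<^sup>2 * ?h + 1/2 * (cmod (f y))\<^sup>2 * ?h)" by (rule ennreal_leI[OF le])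
        also have "\<dots> = ?P x y + ?P' x y" using h by (subst ennreal_plus) (simp_all add: ennreal_mult[symmetric])
        finally show "ennreal (cmod (f x)) * ennreal (cmod (f y * complex_of_real ?h)) \<le> ?P x y + ?P' x y" .
      qed
      finally show "ennreal (cmod (f x * cnj (LINT y|lborel. f y * complex_of_real (heat s (y - x)))))
         \<le> (\<integral>\<^sup>+y. ?P x y + ?P' x y \<partial>lborel)" .
    qed
    also have "\<dots> = (\<integral>\<^sup>+x. (\<integral>\<^sup>+y. ?P x y \<partial>lborel) + (\<integral>\<^sup>+y. ?P' x y \<partial>lborel) \<partial>lborel)"
      by (intro nn_integral_cong nn_integral_add) measurable
    also have "\<dots> = (\<integral>\<^sup>+x. (\<integral>\<^sup>+y. ?P x y \<partial>lborel) \<partial>lborel) + (\<integral>\<^sup>+x. (\<integral>\<^sup>+y. ?P' x y \<partial>lborel) \<partial>lborel)"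
      by (rule nn_integral_add) measurable
    also have "(\<integral>\<^sup>+x. (\<integral>\<^sup>+y. ?P' x y \<partial>lborel) \<partial>lborel) = (\<integral>\<^sup>+y. (\<integral>\<^sup>+x. ?P' x y \<partial>lborel) \<partial>lborel)"
      by (rule lborel_pair.Fubini'[symmetric]) measurable
    also have "\<dots> = (\<integral>\<^sup>+x. ennreal (1/2 * (cmod (f x))\<^sup>2) * ennreal (2 * pi) \<partial>lborel)"
      by (rule nn_integral_cong, subst nn_integral_cmult) (simp_all add: nn_integral_heat[OF s])
    also have "(\<integral>\<^sup>+x. (\<integral>\<^sup>+y. ?P x y \<partial>lborel) \<partial>lborel) = (\<integral>\<^sup>+x. ennreal (1/2 * (cmod (f x))\<^sup>2) * ennreal (2 * pi) \<partial>lborel)"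
      by (rule nn_integral_cong, subst nn_integral_cmult) (simp_all add: nn_integral_heat[OF s])
    also have "(\<integral>\<^sup>+x. ennreal (1/2 * (cmod (f x))\<^sup>2) * ennreal (2 * pi) \<partial>lborel)
        + (\<integral>\<^sup>+x. ennreal (1/2 * (cmod (f x))\<^sup>2) * ennreal (2 * pi) \<partial>lborel)
        = (\<integral>\<^sup>+x. ennreal (1/2 * (cmod (f x))\<^sup>2) * ennreal (2 * pi) + ennreal (1/2 * (cmod (f x))\<^sup>2) * ennreal (2 * pi) \<partial>lborel)"
      by (rule nn_integral_add[symmetric]) measurable
    also have "\<dots> = (\<integral>\<^sup>+x. ennreal (2 * pi) * ennreal ((cmod (f x))\<^sup>2) \<partial>lborel)"
    proof (rule nn_integral_cong)
      fix x
      have "ennreal (1/2 * (cmod (f x))\<^sup>2) * ennreal (2 * pi) + ennreal (1/2 * (cmod (f x))\<^sup>2) * ennreal (2 * pi)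
         = ennreal (1/2 * (cmod (f x))\<^sup>2 * (2 * pi) + 1/2 * (cmod (f x))\<^sup>2 * (2 * pi))"
        by (subst ennreal_plus) (simp_all add: ennreal_mult[symmetric])
      also have "1/2 * (cmod (f x))\<^sup>2 * (2 * pi) + 1/2 * (cmod (f x))\<^sup>2 * (2 * pi) = 2 * pi * (cmod (f x))\<^sup>2" by simp
      finally show "ennreal (1/2 * (cmod (f x))\<^sup>2) * ennreal (2 * pi) + ennreal (1/2 * (cmod (f x))\<^sup>2) * ennreal (2 * pi)
         = ennreal (2 * pi) * ennreal ((cmod (f x))\<^sup>2)" by (simp add: ennreal_mult)
    qed
    also have "\<dots> = ennreal (2 * pi) * ?B" by (rule nn_integral_cmult) measurable
    finally show ?thesis .
  qed
  have lim: "(\<lambda>n. gauss (1 / real (Suc n)) \<xi>) \<longlonglongrightarrow> 1" for \<xi>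
  proof -
    have "(\<lambda>n. gauss (inverse (real (Suc n))) \<xi>) \<longlonglongrightarrow> exp (- (0 * \<xi>)\<^sup>2 / 2)"
      unfolding gauss_def by (intro tendsto_intros LIMSEQ_inverse_real_of_nat) simp
    then show ?thesis by (simp add: inverse_eq_divide)
  qed
  have "(\<integral>\<^sup>+\<xi>. ennreal ((cmod (ft f \<xi>))\<^sup>2) \<partial>lborel)
     = (\<integral>\<^sup>+\<xi>. liminf (\<lambda>n. ennreal ((cmod (ft f \<xi>))\<^sup>2 * gauss (1 / real (Suc n)) \<xi>)) \<partial>lborel)"
  proof (rule nn_integral_cong)
    fix \<xi>
    have "(\<lambda>n. (cmod (ft f \<xi>))\<^sup>2 * gauss (1 / real (Suc n)) \<xi>) \<longlonglongrightarrow> (cmod (ft f \<xi>))\<^sup>2 * 1"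
      by (intro tendsto_intros lim)
    then have "(\<lambda>n. ennreal ((cmod (ft f \<xi>))\<^sup>2 * gauss (1 / real (Suc n)) \<xi>)) \<longlonglongrightarrow> ennreal ((cmod (ft f \<xi>))\<^sup>2)"
      by (intro tendsto_ennrealI) simp
    then show "ennreal ((cmod (ft f \<xi>))\<^sup>2) = liminf (\<lambda>n. ennreal ((cmod (ft f \<xi>))\<^sup>2 * gauss (1 / real (Suc n)) \<xi>))"
      by (rule lim_imp_Liminf[symmetric, rotated]) simp
  qed
  also have "\<dots> \<le> liminf (\<lambda>n. \<integral>\<^sup>+\<xi>. ennreal ((cmod (ft f \<xi>))\<^sup>2 * gauss (1 / real (Suc n)) \<xi>) \<partial>lborel)"
    by (rule nn_integral_liminf) measurable
  also have "\<dots> \<le> liminf (\<lambda>n::nat. ennreal (2 * pi) * ?B)"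
    by (rule Liminf_mono, rule always_eventually, rule allI, rule weighted) simp
  also have "\<dots> = ennreal (2 * pi) * ?B" by (simp add: Liminf_const)
  finally show ?thesis .
qed

definition L2_scalar :: "(real \<Rightarrow> complex) \<Rightarrow> bool" where
  "L2_scalar f \<longleftrightarrow> f \<in> borel_measurable borel \<and> integrable lborel (\<lambda>x. (cmod (f x))\<^sup>2)"

lemma L2_scalarD: "L2_scalar f \<Longrightarrow> f \<in> borel_measurable borel" "L2_scalar f \<Longrightarrow> integrable lborel (\<lambda>x. (cmod (f x))\<^sup>2)"
  by (simp_all add: L2_scalar_def)

lemma L2_scalar_cnj: "L2_scalar f \<Longrightarrow> L2_scalar (\<lambda>x. cnj (f x))"
  using measurable_cnj[of f borel] by (simp add: L2_scalar_def)

lemma integrable_mult_L2_scalar: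
  assumes f: "L2_scalar f" and g: "L2_scalar g" shows "integrable lborel (\<lambda>x. f x * g x)"
proof (rule Bochner_Integration.integrable_bound)
  show "integrable lborel (\<lambda>x. (cmod (f x))\<^sup>2 + (cmod (g x))\<^sup>2)"
    using L2_scalarD(2)[OF f] L2_scalarD(2)[OF g] by (rule Bochner_Integration.integrable_add)
  show "(\<lambda>x. f x * g x) \<in> borel_measurable lborel"
    using L2_scalarD(1)[OF f] L2_scalarD(1)[OF g] by simp
  have "a * b \<le> a\<^sup>2 + b\<^sup>2" if "0 \<le> a" "0 \<le> b" for a b :: real
  proof -
    have "2 * (a * b) \<le> a\<^sup>2 + b\<^sup>2" using zero_le_power2[of "a - b"] by (simp add: power2_eq_square algebra_simps)
    moreover have "0 \<le> a * b" using that by simp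
    ultimately show ?thesis by linarith
  qed
  then show "AE x in lborel. norm (f x * g x) \<le> norm ((cmod (f x))\<^sup>2 + (cmod (g x))\<^sup>2)"
    by (intro AE_I2) (simp add: norm_mult)
qed

lemma L2_scalar_ft:
  assumes f: "integrable lborel f" "L2_scalar f" shows "L2_scalar (ft f)"
proof -
  have [measurable]: "f \<in> borel_measurable borel" using L2_scalarD(1)[OF f(2)] .
  have "(\<integral>\<^sup>+x. ennreal ((cmod (f x))\<^sup>2) \<partial>lborel) < \<infinity>"
    using L2_scalarD(2)[OF f(2)] by (subst nn_integral_eq_integral) simp_all
  then have "(\<integral>\<^sup>+\<xi>. ennreal ((cmod (ft f \<xi>))\<^sup>2) \<partial>lborel) < \<infinity>"
    by (intro le_less_trans[OF nn_integral_ft_le[OF f(1)]]) (simp add: ennreal_mult_less_top)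
  then have "integrable lborel (\<lambda>\<xi>. (cmod (ft f \<xi>))\<^sup>2)" by (intro integrableI_bounded) simp_all
  then show ?thesis by (simp add: L2_scalar_def)
qed

lemma inverse_Suc_lim: "(\<lambda>n. 1 / real (Suc n)) \<longlonglongrightarrow> 0"
  using LIMSEQ_inverse_real_of_nat by (simp add: inverse_eq_divide)

lemma gauss_lim: "(\<lambda>n. gauss (1 / real (Suc n)) \<xi>) \<longlonglongrightarrow> 1"
proof -
  have "(\<lambda>n. gauss (1 / real (Suc n)) \<xi>) \<longlonglongrightarrow> exp (- (0 * \<xi>)\<^sup>2 / 2)"
    unfolding gauss_def by (intro tendsto_intros inverse_Suc_lim) simp
  then show ?thesis by simp
qed

lemma gauss_le_1: "0 \<le> gauss s \<xi>" "gauss s \<xi> \<le> 1" by (simp_all add: gauss_def)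

lemma interval_indicator_lim:
  assumes x: "x \<noteq> a" "x \<noteq> b"
  shows "(\<lambda>n. indicator {a<..<b} (x + 1 / real (Suc n) * z) :: real) \<longlonglongrightarrow> indicator {a<..<b} x"
proof -
  have "(\<lambda>n. x + 1 / real (Suc n) * z) \<longlonglongrightarrow> x + 0 * z" by (intro tendsto_intros inverse_Suc_lim)
  then have lim: "(\<lambda>n. x + 1 / real (Suc n) * z) \<longlonglongrightarrow> x" by simp
  have "eventually (\<lambda>n. indicator {a<..<b} (x + 1 / real (Suc n) * z) = (indicator {a<..<b} x :: real)) sequentially"
  proof (cases "x \<in> {a<..<b}")
    case True
    from topological_tendstoD[OF lim _ True] show ?thesis by (rule eventually_mono) (use True in auto)
  next
    case False
    then have "x \<in> - {a..b}" using x by auto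
    from topological_tendstoD[OF lim _ this] show ?thesis
      by (rule eventually_mono) (use False in \<open>auto simp: indicator_def\<close>)
  qed
  then show ?thesis by (rule tendsto_eventually)
qed

lemma heat_interval:
  assumes s: "s > 0"
  shows "(LINT y|lborel. complex_of_real (indicator {a<..<b} y) * complex_of_real (heat s (y - x)))
    = complex_of_real (LINT z|lborel. 2 * pi * std_normal_density z * indicator {a<..<b} (x + s * z))"
proof -
  have "(LINT y|lborel. complex_of_real (indicator {a<..<b} y) * complex_of_real (heat s (y - x)))
     = (LINT y|lborel. complex_of_real (indicator {a<..<b} y * heat s (y - x)))" by simp
  also have "\<dots> = complex_of_real (LINT y|lborel. indicator {a<..<b} y * heat s (y - x))"
    by (rule integral_complex_of_real)
  also have "(LINT y|lborel. indicator {a<..<b} y * heat s (y - x))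
     = \<bar>s\<bar> *\<^sub>R (LINT z|lborel. indicator {a<..<b} (x + s * z) * heat s ((x + s * z) - x))"
    using s by (intro lborel_integral_real_affine) simp
  also have "\<dots> = (LINT z|lborel. \<bar>s\<bar> *\<^sub>R (indicator {a<..<b} (x + s * z) * heat s ((x + s * z) - x)))"
    by (rule integral_scaleR_right[symmetric])
  also have "\<dots> = (LINT z|lborel. 2 * pi * std_normal_density z * indicator {a<..<b} (x + s * z))"
    using s by (intro Bochner_Integration.integral_cong) (simp_all add: heat_def)
  finally show ?thesis .
qed

lemma heat_interval_lim:
  assumes x: "x \<noteq> a" "x \<noteq> b"
  shows "(\<lambda>n. LINT z|lborel. 2 * pi * std_normal_density z * indicator {a<..<b} (x + 1 / real (Suc n) * z))
    \<longlonglongrightarrow> 2 * pi * indicator {a<..<b} x"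
proof -
  have "(\<lambda>n. LINT z|lborel. 2 * pi * std_normal_density z * indicator {a<..<b} (x + 1 / real (Suc n) * z))
    \<longlonglongrightarrow> (LINT z|lborel. 2 * pi * std_normal_density z * indicator {a<..<b} x)"
  proof (rule integral_dominated_convergence)
    show "integrable lborel (\<lambda>z. 2 * pi * std_normal_density z)" by simp
    show "AE z in lborel. (\<lambda>n. 2 * pi * std_normal_density z * indicator {a<..<b} (x + 1 / real (Suc n) * z))
        \<longlonglongrightarrow> 2 * pi * std_normal_density z * indicator {a<..<b} x"
      by (intro AE_I2 tendsto_intros interval_indicator_lim x)
    show "AE z in lborel. norm (2 * pi * std_normal_density z * indicator {a<..<b} (x + 1 / real (Suc n) * z))
        \<le> 2 * pi * std_normal_density z" for n
      by (intro AE_I2) (simp add: indicator_def)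
  qed simp_all
  then show ?thesis by simp
qed

text \<open>The other half of Plancherel, first against indicators of intervals: for them the convolution with the
  approximate identity is bounded and converges pointwise off the end points.\<close>

lemma ft_interval_pairing:
  assumes f: "integrable lborel f" "L2_scalar f"
  shows "(LINT \<xi>|lborel. ft f \<xi> * cnj (ft (\<lambda>x. complex_of_real (indicator {a<..<b} x)) \<xi>))
    = 2 * complex_of_real pi * (LINT x|lborel. f x * complex_of_real (indicator {a<..<b} x))"
proof -
  let ?w = "\<lambda>x. complex_of_real (indicator {a<..<b} x)"
  let ?s = "\<lambda>n. 1 / real (Suc n)"
  let ?H = "\<lambda>n x. LINT z|lborel. 2 * pi * std_normal_density z * indicator {a<..<b} (x + ?s n * z)"
  have [measurable]: "f \<in> borel_measurable borel" using L2_scalarD(1)[OF f(2)] .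
  have ir: "integrable lborel (\<lambda>x. indicator {a<..<b} x :: real)"
    by (rule integrable_real_indicator) (simp, cases "a \<le> b", simp_all)
  then have w: "integrable lborel ?w" by simp
  have "(\<lambda>x. (cmod (?w x))\<^sup>2) = (\<lambda>x. indicator {a<..<b} x :: real)" by (auto simp: indicator_def)
  then have w2: "L2_scalar ?w" using ir by (simp add: L2_scalar_def)
  have eq: "(LINT \<xi>|lborel. ft f \<xi> * (complex_of_real (gauss (?s n) \<xi>) * cnj (ft ?w \<xi>)))
      = (LINT x|lborel. f x * complex_of_real (?H n x))" for n
    using gauss_pairing(1)[OF f(1) w, of "?s n"] heat_interval[of "?s n" a b] by simp
  have L: "(\<lambda>n. LINT \<xi>|lborel. ft f \<xi> * (complex_of_real (gauss (?s n) \<xi>) * cnj (ft ?w \<xi>)))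
      \<longlonglongrightarrow> (LINT \<xi>|lborel. ft f \<xi> * cnj (ft ?w \<xi>))"
  proof (rule integral_dominated_convergence)
    show "integrable lborel (\<lambda>\<xi>. cmod (ft f \<xi> * cnj (ft ?w \<xi>)))"
      by (intro integrable_norm integrable_mult_L2_scalar L2_scalar_cnj L2_scalar_ft f w w2)
    have "(\<lambda>n. ft f \<xi> * (complex_of_real (gauss (?s n) \<xi>) * cnj (ft ?w \<xi>)))
        \<longlonglongrightarrow> ft f \<xi> * (complex_of_real 1 * cnj (ft ?w \<xi>))" for \<xi>
      by (intro tendsto_intros gauss_lim)
    then show "AE \<xi> in lborel. (\<lambda>n. ft f \<xi> * (complex_of_real (gauss (?s n) \<xi>) * cnj (ft ?w \<xi>)))
        \<longlonglongrightarrow> ft f \<xi> * cnj (ft ?w \<xi>)" by simp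
    show "AE \<xi> in lborel. norm (ft f \<xi> * (complex_of_real (gauss (?s n) \<xi>) * cnj (ft ?w \<xi>)))
        \<le> cmod (ft f \<xi> * cnj (ft ?w \<xi>))" for n
    proof (rule AE_I2)
      fix \<xi>
      have "gauss (?s n) \<xi> * cmod (ft ?w \<xi>) \<le> 1 * cmod (ft ?w \<xi>)" by (intro mult_right_mono gauss_le_1) simp
      then have "cmod (ft f \<xi>) * (gauss (?s n) \<xi> * cmod (ft ?w \<xi>)) \<le> cmod (ft f \<xi>) * cmod (ft ?w \<xi>)"
        by (intro mult_left_mono) simp_all
      then show "norm (ft f \<xi> * (complex_of_real (gauss (?s n) \<xi>) * cnj (ft ?w \<xi>))) \<le> cmod (ft f \<xi> * cnj (ft ?w \<xi>))"
        using gauss_le_1(1)[of "?s n" \<xi>] by (simp add: norm_mult)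
    qed
  qed measurable
  have R: "(\<lambda>n. LINT x|lborel. f x * complex_of_real (?H n x))
      \<longlonglongrightarrow> (LINT x|lborel. f x * complex_of_real (2 * pi * indicator {a<..<b} x))"
  proof (rule integral_dominated_convergence)
    show "integrable lborel (\<lambda>x. 2 * pi * cmod (f x))" using f(1) by simp
    have "AE x in lborel. x \<noteq> a \<and> x \<noteq> b" using AE_lborel_singleton[of a] AE_lborel_singleton[of b] by eventually_elim simp
    then show "AE x in lborel. (\<lambda>n. f x * complex_of_real (?H n x)) \<longlonglongrightarrow> f x * complex_of_real (2 * pi * indicator {a<..<b} x)"
      by eventually_elim (intro tendsto_intros heat_interval_lim; simp)
    show "AE x in lborel. norm (f x * complex_of_real (?H n x)) \<le> 2 * pi * cmod (f x)" for n
    proof (rule AE_I2)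
      fix x
      have "\<bar>?H n x\<bar> \<le> (LINT z|lborel. 2 * pi * std_normal_density z)"
      proof (rule order_trans[OF integral_abs_bound integral_mono'])
        show "integrable lborel (\<lambda>z. 2 * pi * std_normal_density z)" by simp
      qed (simp_all add: indicator_def)
      then have "\<bar>?H n x\<bar> \<le> 2 * pi" by simp
      then have "cmod (f x) * \<bar>?H n x\<bar> \<le> cmod (f x) * (2 * pi)" by (rule mult_left_mono) simp
      then show "norm (f x * complex_of_real (?H n x)) \<le> 2 * pi * cmod (f x)" by (simp add: norm_mult mult.commute)
    qed
  qed measurable
  have "(LINT \<xi>|lborel. ft f \<xi> * cnj (ft ?w \<xi>)) = (LINT x|lborel. f x * complex_of_real (2 * pi * indicator {a<..<b} x))"
    using LIMSEQ_unique[OF L] R unfolding eq by blast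
  also have "\<dots> = (LINT x|lborel. 2 * complex_of_real pi * (f x * ?w x))"
    by (intro Bochner_Integration.integral_cong) (simp_all add: mult_ac)
  also have "\<dots> = 2 * complex_of_real pi * (LINT x|lborel. f x * ?w x)" by (rule integral_mult_right_zero)
  finally show ?thesis .
qed

text \<open>Intervals form a generator of the Borel sets that is stable under intersection, so the integrals over
  all Borel subsets of a bounded interval vanish.\<close>

lemma zero_if_interval_integrals_zero:
  fixes g :: "real \<Rightarrow> real"
  assumes loc: "\<And>n::nat. integrable lborel (\<lambda>x. indicator {-real n<..<real n} x * g x)"
    and zero: "\<And>a b. (LINT x|lborel. indicator {a<..<b} x * g x) = 0"
  shows "AE x in lborel. g x = 0"
proof -
  have "AE x in lborel. indicator {-real n<..<real n} x * g x = 0" for n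
  proof (rule density_unique_real[OF loc])
    let ?f = "\<lambda>x. indicator {-real n<..<real n} x * g x"
    show "integrable lborel (\<lambda>x::real. 0::real)" by simp
    let ?G = "range (\<lambda>(a, b). {a<..<b::real})"
    have sub: "?G \<subseteq> Pow UNIV" by simp
    have borel: "sets borel = sigma_sets UNIV ?G"
    proof -
      have "(\<lambda>(a, b). box a (b::real)) = (\<lambda>(a, b). {a<..<b})" by auto
      then have "borel = sigma UNIV ?G" using borel_eq_box[where 'a = real] by simp
      then show ?thesis by (metis sets_measure_of sub)
    qed
    have stable: "Int_stable ?G" by (auto simp: Int_stable_def)
    fix A :: "real set" assume "A \<in> sets lborel"
    then have "A \<in> sigma_sets UNIV ?G" using borel by (simp only: sets_lborel)
    from stable sub this have "(LINT x:A|lborel. ?f x) = 0"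
    proof (induction rule: sigma_sets_induct_disjoint)
      case (basic A)
      then obtain a b where A: "A = {a<..<b}" by auto
      have eq: "(\<lambda>x. indicator A x *\<^sub>R ?f x) = (\<lambda>x. indicator {max a (-real n)<..<min b (real n)} x * g x)"
        by (auto simp: A indicator_def)
      show ?case unfolding set_lebesgue_integral_def eq by (rule zero)
    next
      case empty
      show ?case by (simp add: set_lebesgue_integral_def)
    next
      case (compl A)
      have [measurable]: "A \<in> sets borel" using compl(1) by (simp only: borel)
      have iA: "integrable lborel (\<lambda>x. indicator A x *\<^sub>R ?f x)"
        using loc[of n] by (intro integrable_mult_indicator) simp_all
      have "(LINT x:UNIV - A|lborel. ?f x) = (LINT x|lborel. ?f x - indicator A x *\<^sub>R ?f x)"
        unfolding set_lebesgue_integral_def by (intro Bochner_Integration.integral_cong) (auto simp: indicator_def)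
      also have "\<dots> = (LINT x|lborel. ?f x) - (LINT x:A|lborel. ?f x)"
        unfolding set_lebesgue_integral_def by (rule Bochner_Integration.integral_diff[OF loc iA])
      finally show ?case using compl(2) zero[of "-real n" "real n"] by simp
    next
      case (union A)
      have [measurable]: "A i \<in> sets borel" for i using union(2) by (auto simp only: borel)
      have "(LINT x:(\<Union>i. A i)|lborel. ?f x) = (\<Sum>i. LINT x:A i|lborel. ?f x)"
      proof (rule lebesgue_integral_countable_add)
        show "set_integrable lborel (\<Union>i. A i) ?f"
          unfolding set_integrable_def using loc[of n] by (intro integrable_mult_indicator) simp_all
        show "A i \<inter> A j = {}" if "i \<noteq> j" for i j using union(1) that by (auto simp: disjoint_family_on_def)
      qed simp
      then show ?case using union(3) by simp
    qed
    then show "(LINT x:A|lborel. ?f x) = (LINT x:A|lborel. 0)" by (simp add: set_lebesgue_integral_def)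
  qed
  then have "AE x in lborel. \<forall>n. indicator {-real n<..<real n} x * g x = 0" by (simp only: AE_all_countable) simp
  then show ?thesis
  proof eventually_elim
    fix x assume *: "\<forall>n. indicator {-real n<..<real n} x * g x = 0"
    obtain n where "\<bar>x\<bar> < real n" using reals_Archimedean2 by blast
    then have "x \<in> {-real n<..<real n}" by auto
    with *[rule_format, of n] show "g x = 0" by simp
  qed
qed

section \<open>The Fourier transform on classes\<close>

lemma norm_sq_vec: "(norm (z :: complex^'d::finite))\<^sup>2 = (\<Sum>i\<in>UNIV. (cmod (z $ i))\<^sup>2)"
  by (simp add: norm_vec_def L2_set_def sum_nonneg)

lemma L2_scalar_nth: assumes "u \<in> L2" shows "L2_scalar (\<lambda>x. u x $ i)"
proof -
  have [measurable]: "u \<in> borel_measurable borel" using L2_measurable_borel[OF assms] .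
  have "integrable lborel (\<lambda>x. (cmod (u x $ i))\<^sup>2)"
  proof (rule Bochner_Integration.integrable_bound[OF L2_integrable[OF assms]])
    show "AE x in lborel. norm ((cmod (u x $ i))\<^sup>2) \<le> norm ((norm (u x))\<^sup>2)"
      by (intro AE_I2) (simp add: power_mono Finite_Cartesian_Product.norm_nth_le)
  qed measurable
  then show ?thesis by (simp add: L2_scalar_def)
qed

lemma L2_vecI: assumes "\<And>i. L2_scalar (\<lambda>x. u x $ i)" shows "u \<in> L2"
proof -
  have "u \<in> borel_measurable borel" by (rule measurable_vecI) (rule L2_scalarD(1)[OF assms])
  moreover have "integrable lborel (\<lambda>x. (norm (u x))\<^sup>2)"
    unfolding norm_sq_vec by (intro Bochner_Integration.integrable_sum L2_scalarD(2)[OF assms])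
  ultimately show ?thesis by (simp add: L2_def)
qed

text \<open>The transform of an integrable function; the square-integrable ones are reached through \<open>trunc\<close>.\<close>

definition fourier_integral :: "'d::finite vfun \<Rightarrow> 'd vfun" where
  "fourier_integral u \<xi> = (LINT x|lborel. exp (- (\<i> * complex_of_real (x * \<xi>))) *s u x)"

definition trunc :: "nat \<Rightarrow> 'd::finite vfun \<Rightarrow> 'd vfun" where
  "trunc n u x = indicator {-real n..real n} x *\<^sub>R u x"

definition L1_L2 :: "'d::finite vfun set" where
  "L1_L2 = {u \<in> L2. integrable lborel u}"

lemma L1_L2D: "u \<in> L1_L2 \<Longrightarrow> u \<in> L2" "u \<in> L1_L2 \<Longrightarrow> integrable lborel u"
  by (simp_all add: L1_L2_def)

lemma integrable_exp_vec:
  assumes "integrable lborel u" shows "integrable lborel (\<lambda>x. exp (- (\<i> * complex_of_real (x * \<xi>))) *s (u x :: complex^'d::finite))"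
proof (rule Bochner_Integration.integrable_bound[OF assms])
  have [measurable]: "u \<in> borel_measurable borel" using borel_measurable_integrable[OF assms] by simp
  show "(\<lambda>x. exp (- (\<i> * complex_of_real (x * \<xi>))) *s u x) \<in> borel_measurable lborel" by measurable
qed (simp add: norm_vector_cscale)

lemma integrable_nth: "integrable lborel u \<Longrightarrow> integrable lborel (\<lambda>x. (u x :: complex^'d::finite) $ i)"
  by (rule integrable_bounded_linear[OF bounded_linear_vec_nth])

lemma fourier_integral_nth:
  assumes "integrable lborel u" shows "fourier_integral u \<xi> $ i = ft (\<lambda>x. u x $ i) \<xi>"
  unfolding fourier_integral_def ft_def
  by (subst integral_bounded_linear[OF bounded_linear_vec_nth integrable_exp_vec[OF assms], symmetric]) simp

lemma fourier_integral_diff: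
  assumes "integrable lborel u" "integrable lborel v"
  shows "fourier_integral (\<lambda>x. u x - v x) = (\<lambda>\<xi>. fourier_integral u \<xi> - fourier_integral v \<xi>)"
  using assms
  by (intro ext) (simp only: fourier_integral_def vector_ssub_ldistrib Bochner_Integration.integral_diff integrable_exp_vec)

lemma bounded_linear_cscale: "bounded_linear (\<lambda>x. c *s (x :: complex^'d::finite))"
proof (rule bounded_linear_intro[where K = "cmod c"])
  show "c *s (x + y) = c *s x + c *s y" for x y :: "complex^'d" by (rule vector_add_ldistrib)
  show "c *s (r *\<^sub>R x) = r *\<^sub>R (c *s x)" for r and x :: "complex^'d" by (simp add: vec_eq_iff)
  show "norm (c *s x) \<le> norm x * cmod c" for x :: "complex^'d" by (simp add: norm_vector_cscale mult.commute)
qed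

lemma fourier_integral_cscale:
  assumes "integrable lborel u" shows "fourier_integral (\<lambda>x. c *s u x) = (\<lambda>\<xi>. c *s fourier_integral u \<xi>)"
proof
  fix \<xi>
  have "fourier_integral (\<lambda>x. c *s u x) \<xi> = (LINT x|lborel. c *s (exp (- (\<i> * complex_of_real (x * \<xi>))) *s u x))"
    unfolding fourier_integral_def by (simp add: vector_smult_assoc mult.commute)
  also have "\<dots> = c *s fourier_integral u \<xi>"
    unfolding fourier_integral_def by (rule integral_bounded_linear[OF bounded_linear_cscale integrable_exp_vec[OF assms]])
  finally show "fourier_integral (\<lambda>x. c *s u x) \<xi> = c *s fourier_integral u \<xi>" .
qed

lemma fourier_integral_cong: "AE x in lborel. u x = v x \<Longrightarrow> u \<in> borel_measurable borel \<Longrightarrow> v \<in> borel_measurable borel \<Longrightarrow> fourier_integral u = fourier_integral v"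
  unfolding fourier_integral_def by (intro ext integral_cong_AE) (simp, simp, erule eventually_mono, simp)

lemma fourier_integral_L2:
  assumes u: "u \<in> L1_L2" shows "fourier_integral u \<in> L2" "norm (cls (fourier_integral u)) \<le> sqrt (2 * pi) * norm (cls u)"
proof -
  note i = L1_L2D(2)[OF u] and l = L1_L2D(1)[OF u]
  have nth: "(\<lambda>\<xi>. fourier_integral u \<xi> $ i) = ft (\<lambda>x. u x $ i)" for i using fourier_integral_nth[OF i] by auto
  show fL: "fourier_integral u \<in> L2"
    by (rule L2_vecI, subst nth, rule L2_scalar_ft[OF integrable_nth[OF i] L2_scalar_nth[OF l]])
  have [measurable]: "fourier_integral u \<in> borel_measurable borel" "u \<in> borel_measurable borel"
    using L2_measurable_borel fL l by auto
  have nn: "(\<integral>\<^sup>+x. ennreal ((norm (v x))\<^sup>2) \<partial>lborel) = (\<Sum>i\<in>UNIV. \<integral>\<^sup>+x. ennreal ((cmod (v x $ i))\<^sup>2) \<partial>lborel)"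
    if [measurable]: "v \<in> borel_measurable borel" for v :: "'a vfun"
    unfolding norm_sq_vec by (subst sum_ennreal[symmetric], simp, subst nn_integral_sum) auto
  have "ennreal ((norm (cls (fourier_integral u)))\<^sup>2) = (\<Sum>i\<in>UNIV. \<integral>\<^sup>+x. ennreal ((cmod (fourier_integral u x $ i))\<^sup>2) \<partial>lborel)"
    unfolding nn_integral_L2[OF fL, symmetric] by (rule nn) measurable
  also have "\<dots> \<le> (\<Sum>i\<in>UNIV. ennreal (2 * pi) * (\<integral>\<^sup>+x. ennreal ((cmod (u x $ i))\<^sup>2) \<partial>lborel))"
    unfolding fourier_integral_nth[OF i] by (intro sum_mono nn_integral_ft_le integrable_nth i)
  also have "\<dots> = ennreal (2 * pi) * (\<Sum>i\<in>UNIV. \<integral>\<^sup>+x. ennreal ((cmod (u x $ i))\<^sup>2) \<partial>lborel)"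
    by (rule sum_distrib_left[symmetric])
  also have "\<dots> = ennreal (2 * pi) * ennreal ((norm (cls u))\<^sup>2)"
    unfolding nn_integral_L2[OF l, symmetric] by (subst nn) simp_all
  also have "\<dots> = ennreal (2 * pi * (norm (cls u))\<^sup>2)" by (simp add: ennreal_mult)
  finally have "(norm (cls (fourier_integral u)))\<^sup>2 \<le> 2 * pi * (norm (cls u))\<^sup>2" by (subst (asm) ennreal_le_iff) simp_all
  then have "norm (cls (fourier_integral u)) \<le> sqrt (2 * pi * (norm (cls u))\<^sup>2)" by (rule real_le_rsqrt)
  then show "norm (cls (fourier_integral u)) \<le> sqrt (2 * pi) * norm (cls u)" by (simp add: real_sqrt_mult)
qed

lemma trunc_measurable [measurable]: "u \<in> borel_measurable borel \<Longrightarrow> trunc n u \<in> borel_measurable borel"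
  unfolding trunc_def by measurable

lemma trunc_L1_L2: assumes u: "u \<in> L2" shows "trunc n u \<in> L1_L2"
proof -
  have [measurable]: "u \<in> borel_measurable borel" using L2_measurable_borel[OF u] .
  have "trunc n u \<in> L2"
    by (rule L2_dominated[OF _ u, where C = 1]) (auto simp: trunc_def indicator_def)
  moreover have "integrable lborel (trunc n u)"
  proof (rule Bochner_Integration.integrable_bound)
    show "integrable lborel (\<lambda>x. indicator {-real n..real n} x + (norm (u x))\<^sup>2)"
      by (intro Bochner_Integration.integrable_add L2_integrable u integrable_real_indicator) simp_all
    have "t \<le> 1 + t\<^sup>2" if "0 \<le> t" for t :: real
      using zero_le_power2[of "t - 1"] that zero_le_power2[of t] by (simp add: power2_eq_square algebra_simps)
    then show "AE x in lborel. norm (trunc n u x) \<le> norm (indicator {-real n..real n} x + (norm (u x))\<^sup>2)"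
      by (intro AE_I2) (simp add: trunc_def indicator_def)
  qed measurable
  ultimately show ?thesis by (simp add: L1_L2_def)
qed

lemma L1_L2_diff: "u \<in> L1_L2 \<Longrightarrow> v \<in> L1_L2 \<Longrightarrow> (\<lambda>x. u x - v x) \<in> L1_L2"
  by (simp add: L1_L2_def L2_diff)

lemma trunc_tendsto: assumes u: "u \<in> L2" shows "(\<lambda>n. cls (trunc n u)) \<longlonglongrightarrow> cls u"
proof -
  have [measurable]: "u \<in> borel_measurable borel" using L2_measurable_borel[OF u] .
  have tr: "trunc n u \<in> L2" for n using trunc_L1_L2[OF u] L1_L2D by blast
  have "(\<lambda>n. LINT x|lborel. (norm (trunc n u x - u x))\<^sup>2) \<longlonglongrightarrow> (LINT x::real|lborel. 0)"
  proof (rule integral_dominated_convergence)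
    show "integrable lborel (\<lambda>x. (norm (u x))\<^sup>2)" by (rule L2_integrable[OF u])
    show "AE x in lborel. (\<lambda>n. (norm (trunc n u x - u x))\<^sup>2) \<longlonglongrightarrow> 0"
    proof (rule AE_I2)
      fix x
      obtain N where N: "\<bar>x\<bar> \<le> real N" using real_arch_simple by blast
      have "(norm (trunc n u x - u x))\<^sup>2 = 0" if "n \<ge> N" for n
        using N that by (simp add: trunc_def indicator_def abs_le_iff)
      then show "(\<lambda>n. (norm (trunc n u x - u x))\<^sup>2) \<longlonglongrightarrow> 0"
        by (intro tendsto_eventually eventually_sequentiallyI)
    qed
    show "AE x in lborel. norm ((norm (trunc n u x - u x))\<^sup>2) \<le> (norm (u x))\<^sup>2" for n
      by (intro AE_I2) (simp add: trunc_def indicator_def)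
  qed measurable
  then have "(\<lambda>n. sqrt (LINT x|lborel. (norm (trunc n u x - u x))\<^sup>2)) \<longlonglongrightarrow> sqrt 0"
    by (intro tendsto_real_sqrt) simp
  moreover have "norm (cls (trunc n u) - cls u) = sqrt (LINT x|lborel. (norm (trunc n u x - u x))\<^sup>2)" for n
    by (simp add: cls_diff tr u cls_norm L2_diff l2_norm_def)
  ultimately have "(\<lambda>n. norm (cls (trunc n u) - cls u)) \<longlonglongrightarrow> 0" by simp
  then show ?thesis by (rule LIM_zero_cancel[OF tendsto_norm_zero_cancel])
qed

lemma cls_fourier_integral_diff_le:
  assumes "u \<in> L1_L2" "v \<in> L1_L2"
  shows "norm (cls (fourier_integral u) - cls (fourier_integral v)) \<le> sqrt (2 * pi) * norm (cls u - cls v)"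
  using fourier_integral_L2(2)[OF L1_L2_diff[OF assms]]
  by (simp add: cls_diff fourier_integral_L2 assms L1_L2D fourier_integral_diff)

text \<open>Plancherel's extension, as a map of classes.\<close>

definition FT :: "'d::finite lsq \<Rightarrow> 'd lsq" where
  "FT f = lim (\<lambda>n. cls (fourier_integral (trunc n (rep f))))"

lemma trunc_cong: "u \<doteq> v \<Longrightarrow> trunc n u \<doteq> trunc n v"
  unfolding ae_eq_def trunc_def by (erule eventually_mono) simp

lemma fourier_integral_trunc_rep_cls: assumes "u \<in> L2" shows "fourier_integral (trunc n (rep (cls u))) = fourier_integral (trunc n u)"
  using trunc_cong[OF rep_cls[OF assms], of n]
  by (intro fourier_integral_cong trunc_measurable L2_measurable_borel assms rep_L2) (simp add: ae_eq_def)

text \<open>The truncations form a Cauchy sequence, and by \<open>fourier_integral_L2\<close> so do their transforms.\<close>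

lemma FT_tendsto: assumes u: "u \<in> L2" shows "(\<lambda>n. cls (fourier_integral (trunc n u))) \<longlonglongrightarrow> FT (cls u)"
proof -
  have "Cauchy (\<lambda>n. cls (trunc n u))" using trunc_tendsto[OF u] by (rule LIMSEQ_imp_Cauchy)
  have "Cauchy (\<lambda>n. cls (fourier_integral (trunc n u)))"
  proof (rule metric_CauchyI)
    fix e :: real assume e: "0 < e"
    have "0 < e / sqrt (2 * pi)" using e by simp
    from metric_CauchyD[OF \<open>Cauchy (\<lambda>n. cls (trunc n u))\<close> this] obtain M where
      M: "\<And>m n. m \<ge> M \<Longrightarrow> n \<ge> M \<Longrightarrow> norm (cls (trunc m u) - cls (trunc n u)) < e / sqrt (2 * pi)"
      unfolding dist_norm by blast
    have "dist (cls (fourier_integral (trunc m u))) (cls (fourier_integral (trunc n u))) < e" if "m \<ge> M" "n \<ge> M" for m n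
    proof -
      have "dist (cls (fourier_integral (trunc m u))) (cls (fourier_integral (trunc n u))) \<le> sqrt (2 * pi) * norm (cls (trunc m u) - cls (trunc n u))"
        unfolding dist_norm by (intro cls_fourier_integral_diff_le trunc_L1_L2 u)
      also have "\<dots> < sqrt (2 * pi) * (e / sqrt (2 * pi))"
        using M[OF that] by (intro mult_strict_left_mono) simp_all
      finally show ?thesis by simp
    qed
    then show "\<exists>M. \<forall>m\<ge>M. \<forall>n\<ge>M. dist (cls (fourier_integral (trunc m u))) (cls (fourier_integral (trunc n u))) < e" by blast
  qed
  then have "convergent (\<lambda>n. cls (fourier_integral (trunc n u)))" by (rule Cauchy_convergent)
  then show ?thesis unfolding FT_def fourier_integral_trunc_rep_cls[OF u] by (rule convergent_LIMSEQ_iff[THEN iffD1])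
qed

lemma is_fourier_iff:
  assumes u: "u \<in> L2" and v: "v \<in> L2" shows "is_fourier u v \<longleftrightarrow> FT (cls u) = cls v"
proof -
  have set: "(LINT x:{-real n..real n}|lborel. exp (- (\<i> * complex_of_real (x * \<xi>))) *s u x) = fourier_integral (trunc n u) \<xi>" for n \<xi>
    unfolding set_lebesgue_integral_def fourier_integral_def trunc_def
    by (intro Bochner_Integration.integral_cong) (simp_all add: vec_eq_iff)
  have fL: "fourier_integral (trunc n u) \<in> L2" for n by (intro fourier_integral_L2 trunc_L1_L2 u)
  have nn: "(\<integral>\<^sup>+\<xi>. ennreal ((norm (fourier_integral (trunc n u) \<xi> - v \<xi>))\<^sup>2) \<partial>lborel)
      = ennreal ((norm (cls (fourier_integral (trunc n u)) - cls v))\<^sup>2)" for n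
    by (simp only: cls_diff[OF fL v] nn_integral_L2[OF L2_diff[OF fL v]])
  have "is_fourier u v \<longleftrightarrow> (\<lambda>n. ennreal ((norm (cls (fourier_integral (trunc n u)) - cls v))\<^sup>2)) \<longlonglongrightarrow> 0"
    unfolding is_fourier_def set nn using u v by simp
  also have "\<dots> \<longleftrightarrow> (\<lambda>n. (norm (cls (fourier_integral (trunc n u)) - cls v))\<^sup>2) \<longlonglongrightarrow> 0"
    using tendsto_ennreal_iff[of "\<lambda>n. (norm (cls (fourier_integral (trunc n u)) - cls v))\<^sup>2" sequentially 0] by simp
  also have "\<dots> \<longleftrightarrow> (\<lambda>n. norm (cls (fourier_integral (trunc n u)) - cls v)) \<longlonglongrightarrow> 0"
  proof
    assume "(\<lambda>n. (norm (cls (fourier_integral (trunc n u)) - cls v))\<^sup>2) \<longlonglongrightarrow> 0"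
    from tendsto_real_sqrt[OF this] show "(\<lambda>n. norm (cls (fourier_integral (trunc n u)) - cls v)) \<longlonglongrightarrow> 0" by simp
  next
    assume "(\<lambda>n. norm (cls (fourier_integral (trunc n u)) - cls v)) \<longlonglongrightarrow> 0"
    from tendsto_power[OF this, of 2] show "(\<lambda>n. (norm (cls (fourier_integral (trunc n u)) - cls v))\<^sup>2) \<longlonglongrightarrow> 0" by simp
  qed
  also have "\<dots> \<longleftrightarrow> (\<lambda>n. cls (fourier_integral (trunc n u))) \<longlonglongrightarrow> cls v"
    by (simp only: tendsto_norm_zero_iff LIM_zero_iff)
  also have "\<dots> \<longleftrightarrow> FT (cls u) = cls v"
  proof
    show "FT (cls u) = cls v" if "(\<lambda>n. cls (fourier_integral (trunc n u))) \<longlonglongrightarrow> cls v"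
      by (rule LIMSEQ_unique[OF FT_tendsto[OF u] that])
    show "(\<lambda>n. cls (fourier_integral (trunc n u))) \<longlonglongrightarrow> cls v" if "FT (cls u) = cls v"
      using FT_tendsto[OF u] unfolding that .
  qed
  finally show ?thesis .
qed

lemma FT_L1_L2: assumes u: "u \<in> L1_L2" shows "FT (cls u) = cls (fourier_integral u)"
proof (rule LIMSEQ_unique[OF FT_tendsto[OF L1_L2D(1)[OF u]]])
  have "(\<lambda>n. cls (fourier_integral (trunc n u)) - cls (fourier_integral u)) \<longlonglongrightarrow> 0"
  proof (rule Lim_null_comparison)
    show "eventually (\<lambda>n. norm (cls (fourier_integral (trunc n u)) - cls (fourier_integral u)) \<le> sqrt (2 * pi) * norm (cls (trunc n u) - cls u)) sequentially"
      by (intro always_eventually allI cls_fourier_integral_diff_le trunc_L1_L2 L1_L2D u)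
    have "(\<lambda>n. sqrt (2 * pi) * norm (cls (trunc n u) - cls u)) \<longlonglongrightarrow> sqrt (2 * pi) * norm (cls u - cls u)"
      by (intro tendsto_intros trunc_tendsto L1_L2D u)
    then show "(\<lambda>n. sqrt (2 * pi) * norm (cls (trunc n u) - cls u)) \<longlonglongrightarrow> 0" by simp
  qed
  then show "(\<lambda>n. cls (fourier_integral (trunc n u))) \<longlonglongrightarrow> cls (fourier_integral u)" by (simp only: LIM_zero_iff)
qed

section \<open>Plancherel's theorem\<close>

definition cnjv :: "complex^'d::finite \<Rightarrow> complex^'d" where
  "cnjv z = (\<chi> i. cnj (z $ i))"

lemma cnjv_nth [simp]: "cnjv z $ i = cnj (z $ i)" by (simp add: cnjv_def)
lemma cnjv_cnjv [simp]: "cnjv (cnjv z) = z" by (simp add: vec_eq_iff)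
lemma norm_cnjv [simp]: "norm (cnjv z) = norm z" by (simp add: norm_vec_def L2_set_def)
lemma cnjv_add: "cnjv (x + y) = cnjv x + cnjv y" by (simp add: vec_eq_iff)
lemma cnjv_diff: "cnjv (x - y) = cnjv x - cnjv y" by (simp add: vec_eq_iff)
lemma cnjv_cscale: "cnjv (c *s x) = cnj c *s cnjv x" by (simp add: vec_eq_iff)

lemma cnjv_scaleR: "cnjv (r *\<^sub>R x) = r *\<^sub>R cnjv x" by (simp add: vec_eq_iff)

lemma cnjv_measurable [measurable]: "u \<in> borel_measurable M \<Longrightarrow> (\<lambda>x. cnjv (u x)) \<in> borel_measurable M"
  unfolding cnjv_def by measurable

lemma inner_cvec: "(x :: complex^'d::finite) \<bullet> y = (\<Sum>i\<in>UNIV. Re (x $ i * cnj (y $ i)))"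
  by (simp add: inner_vec_def inner_complex_def)

lemma inner_cnjv: "x \<bullet> cnjv y = cnjv x \<bullet> (y :: complex^'d::finite)"
  by (simp add: inner_cvec)

lemma L2_cnjv: "u \<in> L2 \<Longrightarrow> (\<lambda>x. cnjv (u x)) \<in> L2"
  by (rule L2_dominated[of _ u 1]) simp_all

lift_definition Conj :: "'d::finite lsq \<Rightarrow> 'd lsq" is "\<lambda>u x. cnjv (u x)"
  by (auto simp: l2_rel_def intro: L2_cnjv ae_eq_fun[where f = "\<lambda>x. cnjv"])

lift_definition cscale :: "complex \<Rightarrow> 'd::finite lsq \<Rightarrow> 'd lsq" is "\<lambda>c u x. c *s u x"
  by (auto simp: l2_rel_def intro: L2_cscale ae_eq_fun[where f = "\<lambda>x z. c *s z" for c])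

lemma Conj_cls: "u \<in> L2 \<Longrightarrow> Conj (cls u) = cls (\<lambda>x. cnjv (u x))"
  by (simp add: Conj.abs_eq l2_rel_self)

lemma cscale_cls: "u \<in> L2 \<Longrightarrow> cscale c (cls u) = cls (\<lambda>x. c *s u x)"
  by (simp add: cscale.abs_eq l2_rel_self)

lemma lsq_cases: obtains u where "u \<in> L2" "f = cls u"
  using cls_rep[of f] rep_L2[of f] by metis

lemma Conj_Conj [simp]: "Conj (Conj f) = f"
  by (cases f rule: lsq_cases) (simp add: Conj_cls L2_cnjv)

lemma Conj_diff: "Conj (f - g) = Conj f - Conj g"
  by (cases f rule: lsq_cases, cases g rule: lsq_cases) (simp add: Conj_cls L2_cnjv cls_diff cnjv_diff L2_diff)

lemma norm_Conj [simp]: "norm (Conj f) = norm f"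
  by (cases f rule: lsq_cases) (simp add: Conj_cls L2_cnjv cls_norm l2_norm_def)

lemma Conj_adjoint: "f \<bullet> Conj g = Conj f \<bullet> g"
  by (cases f rule: lsq_cases, cases g rule: lsq_cases) (simp add: Conj_cls L2_cnjv cls_inner inner_cnjv)

lemma Conj_cont: "X \<longlonglongrightarrow> f \<Longrightarrow> (\<lambda>n. Conj (X n)) \<longlonglongrightarrow> Conj f"
  unfolding tendsto_iff dist_norm Conj_diff[symmetric] norm_Conj .

lemma L1_L2_nth: "u \<in> L1_L2 \<Longrightarrow> integrable lborel (\<lambda>x. u x $ i)" "u \<in> L1_L2 \<Longrightarrow> L2_scalar (\<lambda>x. u x $ i)"
  by (auto intro: integrable_nth L2_scalar_nth L1_L2D)

lemma fourier_integral_multiplication: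
  assumes u: "u \<in> L1_L2" and w: "w \<in> L1_L2"
  shows "cls (fourier_integral u) \<bullet> Conj (cls w) = cls u \<bullet> Conj (cls (fourier_integral w))"
proof -
  note nth = fourier_integral_nth[OF L1_L2D(2)[OF u]] fourier_integral_nth[OF L1_L2D(2)[OF w]]
  have fL: "fourier_integral u \<in> L2" "fourier_integral w \<in> L2" using fourier_integral_L2 u w by auto
  have 1: "integrable lborel (\<lambda>x. ft (\<lambda>x. u x $ i) x * (w x $ i))" for i
    by (intro integrable_mult_L2_scalar L2_scalar_ft L1_L2_nth u w)
  have 2: "integrable lborel (\<lambda>x. u x $ i * ft (\<lambda>x. w x $ i) x)" for i
    by (intro integrable_mult_L2_scalar L2_scalar_ft L1_L2_nth u w)
  have "cls (fourier_integral u) \<bullet> Conj (cls w) = (LINT x|lborel. (\<Sum>i\<in>UNIV. Re (ft (\<lambda>x. u x $ i) x * (w x $ i))))"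
    using fL L1_L2D(1)[OF u] L1_L2D(1)[OF w] by (simp add: Conj_cls cls_inner L2_cnjv inner_cvec nth)
  also have "\<dots> = (\<Sum>i\<in>UNIV. LINT x|lborel. Re (ft (\<lambda>x. u x $ i) x * (w x $ i)))"
    by (rule Bochner_Integration.integral_sum) (rule integrable_Re[OF 1])
  also have "\<dots> = (\<Sum>i\<in>UNIV. Re (LINT x|lborel. ft (\<lambda>x. u x $ i) x * (w x $ i)))"
    by (simp only: integral_Re[OF 1])
  also have "\<dots> = (\<Sum>i\<in>UNIV. Re (LINT x|lborel. u x $ i * ft (\<lambda>x. w x $ i) x))"
    by (simp only: ft_multiplication[OF L1_L2_nth(1)[OF u] L1_L2_nth(1)[OF w]])
  also have "\<dots> = (\<Sum>i\<in>UNIV. LINT x|lborel. Re (u x $ i * ft (\<lambda>x. w x $ i) x))"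
    by (simp only: integral_Re[OF 2])
  also have "\<dots> = (LINT x|lborel. (\<Sum>i\<in>UNIV. Re (u x $ i * ft (\<lambda>x. w x $ i) x)))"
    by (rule Bochner_Integration.integral_sum[symmetric]) (rule integrable_Re[OF 2])
  also have "\<dots> = cls u \<bullet> Conj (cls (fourier_integral w))"
    using fL L1_L2D(1)[OF u] L1_L2D(1)[OF w] by (simp add: Conj_cls cls_inner L2_cnjv inner_cvec nth)
  finally show ?thesis .
qed

text \<open>The multiplication formula is bilinear and the inner product is sesquilinear; with the conjugations that
  make up for this, it says that \<open>Conj FT Conj\<close> is the adjoint of \<open>FT\<close>.\<close>

lemma FT_multiplication: "FT f \<bullet> Conj g = f \<bullet> Conj (FT g)"
proof (cases f rule: lsq_cases)
  fix u assume u: "u \<in> L2" "f = cls u"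
  show ?thesis
  proof (cases g rule: lsq_cases)
    fix w assume w: "w \<in> L2" "g = cls w"
    have "(\<lambda>n. cls (fourier_integral (trunc n u)) \<bullet> Conj (cls (trunc n w))) \<longlonglongrightarrow> FT f \<bullet> Conj g"
      unfolding u(2) w(2) by (intro tendsto_inner FT_tendsto Conj_cont trunc_tendsto u w)
    moreover have "(\<lambda>n. cls (trunc n u) \<bullet> Conj (cls (fourier_integral (trunc n w)))) \<longlonglongrightarrow> f \<bullet> Conj (FT g)"
      unfolding u(2) w(2) by (intro tendsto_inner FT_tendsto Conj_cont trunc_tendsto u w)
    moreover have "cls (fourier_integral (trunc n u)) \<bullet> Conj (cls (trunc n w)) = cls (trunc n u) \<bullet> Conj (cls (fourier_integral (trunc n w)))" for n
      by (intro fourier_integral_multiplication trunc_L1_L2 u w)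
    ultimately show ?thesis by (simp only: LIMSEQ_unique)
  qed
qed

abbreviation step_fun :: "real \<Rightarrow> real \<Rightarrow> complex^'d::finite \<Rightarrow> 'd vfun" where
  "step_fun a b c \<equiv> (\<lambda>x. indicator {a<..<b} x *\<^sub>R c)"

lemma integrable_Ioo: fixes a b :: real shows "integrable lborel (\<lambda>x. indicator {a<..<b} x :: real)"
  by (rule integrable_real_indicator) (simp, cases "a \<le> b", simp_all)

lemma step_fun_L1_L2: "step_fun a b c \<in> L1_L2"
proof -
  have "(\<lambda>x. (norm (step_fun a b c x))\<^sup>2) = (\<lambda>x. indicator {a<..<b} x * (norm c)\<^sup>2)"
    by (auto simp: indicator_def)
  then have "step_fun a b c \<in> L2" using integrable_Ioo[of a b] by (simp add: L2_def)
  moreover have "integrable lborel (step_fun a b c)" using integrable_Ioo[of a b] by simp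
  ultimately show ?thesis by (simp add: L1_L2_def)
qed

lemma fourier_integral_step_pairing:
  assumes u: "u \<in> L1_L2"
  shows "cls (fourier_integral u) \<bullet> cls (fourier_integral (step_fun a b c)) = 2 * pi * (cls u \<bullet> cls (step_fun a b c))"
proof -
  let ?w = "\<lambda>x. complex_of_real (indicator {a<..<b} x)"
  note w = step_fun_L1_L2[of a b c]
  have fL: "fourier_integral u \<in> L2" "fourier_integral (step_fun a b c) \<in> L2" using fourier_integral_L2 u w by auto
  have iw: "integrable lborel ?w" using integrable_Ioo[of a b] by simp
  have "(\<lambda>x. (cmod (?w x))\<^sup>2) = (\<lambda>x. indicator {a<..<b} x :: real)" by (auto simp: indicator_def)
  then have w2: "L2_scalar ?w" using integrable_Ioo[of a b] by (simp add: L2_scalar_def)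
  have ftw: "fourier_integral (step_fun a b c) \<xi> $ i = c $ i * ft ?w \<xi>" for \<xi> i
  proof -
    have "fourier_integral (step_fun a b c) \<xi> $ i = (LINT x|lborel. c $ i * (exp (- (\<i> * complex_of_real (x * \<xi>))) * ?w x))"
      unfolding fourier_integral_nth[OF L1_L2D(2)[OF w]] ft_def
      by (intro Bochner_Integration.integral_cong)
        (simp_all add: scaleR_conv_of_real[where 'a = complex] mult_ac)
    then show ?thesis unfolding ft_def by simp
  qed
  have 1: "integrable lborel (\<lambda>x. ft (\<lambda>x. u x $ i) x * cnj (ft ?w x))" for i
    by (intro integrable_mult_L2_scalar L2_scalar_cnj L2_scalar_ft L1_L2_nth u iw w2)
  have 2: "integrable lborel (\<lambda>x. u x $ i * ?w x)" for i
    by (intro integrable_mult_L2_scalar L1_L2_nth u w2)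
  have int1: "integrable lborel (\<lambda>x. cnj (c $ i) * (ft (\<lambda>x. u x $ i) x * cnj (ft ?w x)))"
    and int2: "integrable lborel (\<lambda>x. cnj (c $ i) * (u x $ i * ?w x))" for i
    using 1 2 by (auto intro: integrable_mult_right)
  have "cls (fourier_integral u) \<bullet> cls (fourier_integral (step_fun a b c))
      = (LINT x|lborel. (\<Sum>i\<in>UNIV. Re (cnj (c $ i) * (ft (\<lambda>x. u x $ i) x * cnj (ft ?w x)))))"
    unfolding cls_inner[OF fL] inner_cvec ftw fourier_integral_nth[OF L1_L2D(2)[OF u]] by (simp only: complex_cnj_mult mult_ac)
  also have "\<dots> = (\<Sum>i\<in>UNIV. LINT x|lborel. Re (cnj (c $ i) * (ft (\<lambda>x. u x $ i) x * cnj (ft ?w x))))"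
    by (rule Bochner_Integration.integral_sum) (rule integrable_Re[OF int1])
  also have "\<dots> = (\<Sum>i\<in>UNIV. Re (cnj (c $ i) * (LINT x|lborel. ft (\<lambda>x. u x $ i) x * cnj (ft ?w x))))"
    by (simp only: integral_Re[OF int1] integral_mult_right_zero)
  also have "\<dots> = (\<Sum>i\<in>UNIV. Re (cnj (c $ i) * (2 * complex_of_real pi * (LINT x|lborel. u x $ i * ?w x))))"
    by (simp only: ft_interval_pairing[OF L1_L2_nth[OF u]])
  also have "\<dots> = (\<Sum>i\<in>UNIV. 2 * pi * Re (LINT x|lborel. cnj (c $ i) * (u x $ i * ?w x)))"
    unfolding integral_mult_right_zero by (intro sum.cong) (simp_all add: algebra_simps)
  also have "\<dots> = 2 * pi * (\<Sum>i\<in>UNIV. LINT x|lborel. Re (cnj (c $ i) * (u x $ i * ?w x)))"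
    by (simp only: integral_Re[OF int2] sum_distrib_left)
  also have "(\<Sum>i\<in>UNIV. LINT x|lborel. Re (cnj (c $ i) * (u x $ i * ?w x)))
      = (LINT x|lborel. (\<Sum>i\<in>UNIV. Re (cnj (c $ i) * (u x $ i * ?w x))))"
    by (rule Bochner_Integration.integral_sum[symmetric]) (rule integrable_Re[OF int2])
  also have "\<dots> = cls u \<bullet> cls (step_fun a b c)"
    unfolding cls_inner[OF L1_L2D(1)[OF u] L1_L2D(1)[OF w]] inner_cvec
    by (intro Bochner_Integration.integral_cong sum.cong) (simp_all add: scaleR_conv_of_real[where 'a = complex] mult_ac)
  finally show ?thesis .
qed

lemma FT_step_pairing: "FT f \<bullet> FT (cls (step_fun a b c)) = 2 * pi * (f \<bullet> cls (step_fun a b c))"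
proof (cases f rule: lsq_cases)
  fix u assume u: "u \<in> L2" "f = cls u"
  have "(\<lambda>n. cls (fourier_integral (trunc n u)) \<bullet> FT (cls (step_fun a b c))) \<longlonglongrightarrow> FT f \<bullet> FT (cls (step_fun a b c))"
    unfolding u(2) by (intro tendsto_inner FT_tendsto u tendsto_const)
  moreover have "(\<lambda>n. 2 * pi * (cls (trunc n u) \<bullet> cls (step_fun a b c))) \<longlonglongrightarrow> 2 * pi * (f \<bullet> cls (step_fun a b c))"
    unfolding u(2) by (intro tendsto_inner tendsto_mult trunc_tendsto u tendsto_const)
  moreover have "cls (fourier_integral (trunc n u)) \<bullet> FT (cls (step_fun a b c)) = 2 * pi * (cls (trunc n u) \<bullet> cls (step_fun a b c))" for n
    unfolding FT_L1_L2[OF step_fun_L1_L2] by (intro fourier_integral_step_pairing trunc_L1_L2 u)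
  ultimately show ?thesis by (simp only: LIMSEQ_unique)
qed

lemma step_fun_separating:
  assumes orth: "\<And>a b c. f \<bullet> cls (step_fun a b c) = 0" shows "f = 0"
proof (cases f rule: lsq_cases)
  fix u assume u: "u \<in> L2" "f = cls u"
  have [measurable]: "u \<in> borel_measurable borel" using L2_measurable_borel[OF u(1)] .
  have "AE x in lborel. u x \<bullet> c = 0" for c
  proof (rule zero_if_interval_integrals_zero)
    have *: "indicator {a<..<b} x * (u x \<bullet> c) = u x \<bullet> step_fun a b c x" for a b x by simp
    show "integrable lborel (\<lambda>x. indicator {-real n<..<real n} x * (u x \<bullet> c))" for n
      unfolding * by (rule integrable_inner_L2[OF u(1) L1_L2D(1)[OF step_fun_L1_L2]])
    show "(LINT x|lborel. indicator {a<..<b} x * (u x \<bullet> c)) = 0" for a b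
      unfolding * using orth[of a b c] unfolding u(2) cls_inner[OF u(1) L1_L2D(1)[OF step_fun_L1_L2]] .
  qed
  then have "AE x in lborel. \<forall>b\<in>Basis. u x \<bullet> b = 0" by (intro AE_finite_allI) simp_all
  then have "AE x in lborel. u x = 0"
    by (rule eventually_mono) (simp add: euclidean_all_zero_iff)
  then have "cls u = cls (\<lambda>x. 0)" using u(1) by (simp add: cls_eq_iff ae_eq_def)
  then show ?thesis using u(2) by (simp add: cls_zero)
qed

text \<open>As \<open>Conj FT Conj\<close> is the adjoint of \<open>FT\<close>, the pairing with step functions, which separate points,
  becomes an inversion formula.\<close>

lemma FT_inversion: "Conj (FT (Conj (FT f))) = (2 * pi) *\<^sub>R f"
proof -
  have "(Conj (FT (Conj (FT f))) - (2 * pi) *\<^sub>R f) \<bullet> cls (step_fun a b c) = 0" for a b c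
  proof -
    let ?w = "cls (step_fun a b c)"
    have "Conj (FT (Conj (FT f))) \<bullet> ?w = ?w \<bullet> Conj (FT (Conj (FT f)))" by (rule inner_commute)
    also have "\<dots> = FT ?w \<bullet> Conj (Conj (FT f))" by (rule FT_multiplication[symmetric])
    also have "\<dots> = FT f \<bullet> FT ?w" by (simp add: inner_commute)
    also have "\<dots> = 2 * pi * (f \<bullet> ?w)" by (rule FT_step_pairing)
    finally show ?thesis by (simp add: inner_diff_left)
  qed
  then have "Conj (FT (Conj (FT f))) - (2 * pi) *\<^sub>R f = 0" by (rule step_fun_separating)
  then show ?thesis by simp
qed

lemma Parseval: "FT f \<bullet> FT g = 2 * pi * (f \<bullet> g)"
proof -
  have "FT f \<bullet> FT g = FT f \<bullet> Conj (Conj (FT g))" by simp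
  also have "\<dots> = f \<bullet> Conj (FT (Conj (FT g)))" by (rule FT_multiplication)
  also have "\<dots> = 2 * pi * (f \<bullet> g)" by (simp add: FT_inversion)
  finally show ?thesis .
qed

text \<open>A map that preserves inner products up to a factor is linear.\<close>

lemma FT_lin: "FT (f + g) = FT f + FT g" "FT (r *\<^sub>R f) = r *\<^sub>R FT f" "FT (f - g) = FT f - FT g"
proof -
  have "(FT (f + g) - (FT f + FT g)) \<bullet> (FT (f + g) - (FT f + FT g)) = 0"
    by (simp add: inner_diff_left inner_diff_right inner_add_left inner_add_right Parseval algebra_simps)
  then show "FT (f + g) = FT f + FT g" by simp
  have "(FT (r *\<^sub>R f) - r *\<^sub>R FT f) \<bullet> (FT (r *\<^sub>R f) - r *\<^sub>R FT f) = 0"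
    by (simp add: inner_diff_left inner_diff_right Parseval)
  then show "FT (r *\<^sub>R f) = r *\<^sub>R FT f" by simp
  have "(FT (f - g) - (FT f - FT g)) \<bullet> (FT (f - g) - (FT f - FT g)) = 0"
    by (simp add: inner_diff_left inner_diff_right Parseval algebra_simps)
  then show "FT (f - g) = FT f - FT g" by simp
qed

text \<open>The inversion formula for \<open>Conj g\<close> exhibits a preimage of \<open>g\<close>.\<close>

lemma FT_surj: "\<exists>f. FT f = g"
proof -
  have "Conj (FT (Conj (FT (Conj g)))) = (2 * pi) *\<^sub>R Conj g" by (rule FT_inversion)
  then have "FT (Conj (FT (Conj g))) = Conj ((2 * pi) *\<^sub>R Conj g)" by (metis Conj_Conj)
  also have "\<dots> = (2 * pi) *\<^sub>R g"
    by (cases g rule: lsq_cases) (simp add: Conj_cls L2_cnjv cls_scaleR L2_scaleR cnjv_scaleR)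
  finally have "FT ((1 / (2 * pi)) *\<^sub>R Conj (FT (Conj g))) = g" by (simp add: FT_lin(2))
  then show ?thesis ..
qed

lemma FT_inj: "FT f = FT g \<Longrightarrow> f = g"
proof -
  assume "FT f = FT g"
  then have "FT (f - g) \<bullet> FT (f - g) = 0" by (simp add: FT_lin)
  then show ?thesis by (simp add: Parseval)
qed

section \<open>Complex structure and reflection\<close>

lemma cscale_diff: "cscale c (f - g) = cscale c f - cscale c g"
  by (cases f rule: lsq_cases, cases g rule: lsq_cases)
    (simp add: cscale_cls L2_cscale cls_diff vector_ssub_ldistrib L2_diff)

lemma norm_cscale: "norm (cscale c f) = cmod c * norm f"
  by (cases f rule: lsq_cases)
    (simp add: cscale_cls L2_cscale cls_norm l2_norm_def norm_vector_cscale power_mult_distrib real_sqrt_mult)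

lemma trunc_cscale: "trunc n (\<lambda>x. c *s u x) = (\<lambda>x. c *s trunc n u x)"
  by (auto simp: trunc_def vec_eq_iff)

lemma FT_cscale: "FT (cscale c f) = cscale c (FT f)"
proof (cases f rule: lsq_cases)
  fix u assume u: "u \<in> L2" "f = cls u"
  have "(\<lambda>n. cls (fourier_integral (trunc n (\<lambda>x. c *s u x)))) \<longlonglongrightarrow> FT (cscale c f)"
    unfolding u(2) cscale_cls[OF u(1)] by (rule FT_tendsto[OF L2_cscale[OF u(1)]])
  moreover have "cls (fourier_integral (trunc n (\<lambda>x. c *s u x))) = cscale c (cls (fourier_integral (trunc n u)))" for n
    unfolding trunc_cscale fourier_integral_cscale[OF L1_L2D(2)[OF trunc_L1_L2[OF u(1)]]]
    by (rule cscale_cls[symmetric]) (intro fourier_integral_L2 trunc_L1_L2 u)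
  moreover have "(\<lambda>n. cscale c (cls (fourier_integral (trunc n u)))) \<longlonglongrightarrow> cscale c (FT f)"
  proof (rule LIM_zero_cancel, rule Lim_null_comparison)
    show "eventually (\<lambda>n. norm (cscale c (cls (fourier_integral (trunc n u))) - cscale c (FT f)) \<le> cmod c * norm (cls (fourier_integral (trunc n u)) - FT f)) sequentially"
      by (simp add: cscale_diff[symmetric] norm_cscale)
    have "(\<lambda>n. cmod c * norm (cls (fourier_integral (trunc n u)) - FT f)) \<longlonglongrightarrow> cmod c * norm (FT f - FT f)"
      unfolding u(2) by (intro tendsto_intros FT_tendsto u)
    then show "(\<lambda>n. cmod c * norm (cls (fourier_integral (trunc n u)) - FT f)) \<longlonglongrightarrow> 0" by simp
  qed
  ultimately show ?thesis by (simp only: LIMSEQ_unique)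
qed

lemma L2_refl: assumes "w \<in> L2" shows "(\<lambda>x. w (- x)) \<in> L2"
proof -
  have [measurable]: "w \<in> borel_measurable borel" using L2_measurable_borel[OF assms] .
  have "integrable lborel (\<lambda>x. (norm (w (0 + (-1) * x)))\<^sup>2)"
    using L2_integrable[OF assms] by (subst lborel_integrable_real_affine_iff[where f = "\<lambda>x. (norm (w x))\<^sup>2"]) simp_all
  then show ?thesis by (simp add: L2_def)
qed

lemma AE_refl:
  assumes [measurable]: "Measurable.pred borel P" and "AE x in lborel. P (x :: real)"
  shows "AE x in lborel. P (- x)"
  using AE_borel_affine[of "-1" P 0] assms by simp

lemma ae_eq_refl_fun:
  assumes "u \<in> L2" "v \<in> L2" "u \<doteq> v" shows "(\<lambda>x. u (- x)) \<doteq> (\<lambda>x. v (- x))"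
proof -
  have [measurable]: "u \<in> borel_measurable borel" "v \<in> borel_measurable borel" using assms L2_measurable_borel by auto
  have "AE x in lborel. norm (u x - v x) = 0" using assms(3) unfolding ae_eq_def by (rule eventually_mono) simp
  then have "AE x in lborel. norm (u (- x) - v (- x)) = 0" by (intro AE_refl[where P = "\<lambda>x. norm (u x - v x) = 0"]) measurable
  then show ?thesis unfolding ae_eq_def by (rule eventually_mono) simp
qed

lift_definition refl_lsq :: "'d::finite lsq \<Rightarrow> 'd lsq" is "\<lambda>u x. u (- x)"
  by (auto simp: l2_rel_def intro: L2_refl ae_eq_refl_fun)

lemma refl_cls: "u \<in> L2 \<Longrightarrow> refl_lsq (cls u) = cls (\<lambda>x. u (- x))"
  by (simp add: refl_lsq.abs_eq l2_rel_self)

lemma refl_diff: "refl_lsq (f - g) = refl_lsq f - refl_lsq g"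
  by (cases f rule: lsq_cases, cases g rule: lsq_cases) (simp add: refl_cls L2_refl cls_diff L2_diff)

lemma norm_refl [simp]: "norm (refl_lsq f) = norm f"
proof (cases f rule: lsq_cases)
  fix u assume u: "u \<in> L2" "f = cls u"
  have "(LINT x|lborel. (norm (u x))\<^sup>2) = (LINT x|lborel. (norm (u (- x)))\<^sup>2)"
    using lborel_integral_real_affine[of "-1" "\<lambda>x. (norm (u x))\<^sup>2" 0] by simp
  then show ?thesis using u by (simp add: refl_cls L2_refl cls_norm l2_norm_def)
qed

lemma FT_Conj: "FT (Conj f) = Conj (refl_lsq (FT f))"
proof (cases f rule: lsq_cases)
  fix u assume u: "u \<in> L2" "f = cls u"
  let ?v = "\<lambda>x. cnjv (u x)"
  have tr: "trunc n ?v = (\<lambda>x. cnjv (trunc n u x))" for n by (auto simp: trunc_def cnjv_scaleR)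
  note i = L1_L2D(2)[OF trunc_L1_L2[OF u(1)]]
  have bl: "bounded_linear (cnjv :: complex^'a \<Rightarrow> complex^'a)"
    by (rule bounded_linear_intro[where K = 1]) (simp_all add: cnjv_add cnjv_scaleR)
  have f: "fourier_integral (trunc n ?v) = (\<lambda>\<xi>. cnjv (fourier_integral (trunc n u) (- \<xi>)))" for n
  proof
    fix \<xi>
    have "fourier_integral (trunc n ?v) \<xi> = (LINT x|lborel. cnjv (exp (- (\<i> * complex_of_real (x * - \<xi>))) *s trunc n u x))"
      unfolding fourier_integral_def tr by (intro Bochner_Integration.integral_cong) (simp_all add: cnjv_cscale exp_cnj)
    also have "\<dots> = cnjv (fourier_integral (trunc n u) (- \<xi>))"
      unfolding fourier_integral_def by (rule integral_bounded_linear[OF bl integrable_exp_vec[OF i]])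
    finally show "fourier_integral (trunc n ?v) \<xi> = cnjv (fourier_integral (trunc n u) (- \<xi>))" .
  qed
  have fL: "fourier_integral (trunc n u) \<in> L2" for n by (intro fourier_integral_L2 trunc_L1_L2 u)
  have "cls (fourier_integral (trunc n ?v)) = Conj (refl_lsq (cls (fourier_integral (trunc n u))))" for n
    unfolding f by (simp add: refl_cls Conj_cls L2_refl fL)
  moreover have "(\<lambda>n. cls (fourier_integral (trunc n ?v))) \<longlonglongrightarrow> FT (Conj f)"
    unfolding u(2) Conj_cls[OF u(1)] by (rule FT_tendsto[OF L2_cnjv[OF u(1)]])
  moreover have "(\<lambda>n. Conj (refl_lsq (cls (fourier_integral (trunc n u))))) \<longlonglongrightarrow> Conj (refl_lsq (FT f))"
  proof (rule Conj_cont)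
    show "(\<lambda>n. refl_lsq (cls (fourier_integral (trunc n u)))) \<longlonglongrightarrow> refl_lsq (FT f)"
      using FT_tendsto[OF u(1)] unfolding tendsto_iff dist_norm refl_diff[symmetric] norm_refl u(2) .
  qed
  ultimately show ?thesis by (simp only: LIMSEQ_unique)
qed

text \<open>The one-dimensional Sobolev embedding at the level of the Fourier transform: the inversion formula
  represents the function by an absolutely convergent integral.\<close>

lemma bounded_if_transform_integrable:
  assumes u: "u \<in> L2" and v: "v \<in> L1_L2" and uv: "FT (cls u) = cls v"
  shows "AE x in lborel. norm (u x) \<le> (LINT \<xi>|lborel. norm (v \<xi>)) / (2 * pi)"
proof -
  let ?w = "\<lambda>\<xi>. cnjv (v \<xi>)"
  note vL = L1_L2D(1)[OF v]
  have [measurable]: "v \<in> borel_measurable borel" using L2_measurable_borel[OF vL] .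
  have wint: "integrable lborel ?w"
    by (rule Bochner_Integration.integrable_bound[OF L1_L2D(2)[OF v]]) simp_all
  then have w: "?w \<in> L1_L2" using L2_cnjv[OF vL] by (simp add: L1_L2_def)
  have "(2 * pi) *\<^sub>R cls u = Conj (FT (Conj (cls v)))" using FT_inversion[of "cls u"] uv by simp
  also have "\<dots> = cls (\<lambda>x. cnjv (fourier_integral ?w x))"
    unfolding Conj_cls[OF vL] FT_L1_L2[OF w] by (rule Conj_cls[OF fourier_integral_L2(1)[OF w]])
  finally have "cls (\<lambda>x. (2 * pi) *\<^sub>R u x) = cls (\<lambda>x. cnjv (fourier_integral ?w x))" by (simp only: cls_scaleR[OF u])
  then have "(\<lambda>x. (2 * pi) *\<^sub>R u x) \<doteq> (\<lambda>x. cnjv (fourier_integral ?w x))"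
    by (subst (asm) cls_eq_iff) (simp_all add: L2_scaleR u L2_cnjv fourier_integral_L2(1)[OF w])
  then show ?thesis unfolding ae_eq_def
  proof (rule eventually_mono)
    fix x assume "(2 * pi) *\<^sub>R u x = cnjv (fourier_integral ?w x)"
    then have "norm ((2 * pi) *\<^sub>R u x) = norm (fourier_integral ?w x)" by simp
    also have "\<dots> \<le> (LINT \<xi>|lborel. norm (exp (- (\<i> * complex_of_real (\<xi> * x))) *s ?w \<xi>))"
      unfolding fourier_integral_def by (rule integral_norm_bound)
    also have "\<dots> = (LINT \<xi>|lborel. norm (v \<xi>))" by (simp add: norm_vector_cscale)
    finally show "norm (u x) \<le> (LINT \<xi>|lborel. norm (v \<xi>)) / (2 * pi)" by (simp add: field_simps)
  qed
qed

section \<open>Fourier multipliers and their symbols\<close>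

text \<open>Measurability of a matrix-valued symbol, in the form in which it is used.\<close>

definition measurable_symbol :: "'d::finite symbol \<Rightarrow> bool" where
  "measurable_symbol m \<longleftrightarrow> (\<forall>w\<in>borel_measurable borel. (\<lambda>\<xi>. m \<xi> *v w \<xi>) \<in> borel_measurable borel)"

lemma measurable_symbolD: "measurable_symbol m \<Longrightarrow> w \<in> borel_measurable borel \<Longrightarrow> (\<lambda>\<xi>. m \<xi> *v w \<xi>) \<in> borel_measurable borel"
  by (simp add: measurable_symbol_def)

lemma measurable_symbolI:
  fixes m :: "'d::finite symbol"
  assumes "m \<in> borel_measurable lborel" shows "measurable_symbol m"
  unfolding measurable_symbol_def
proof
  fix w :: "'d vfun" assume [measurable]: "w \<in> borel_measurable borel"
  have [measurable]: "(\<lambda>\<xi>. m \<xi> $ i $ k) \<in> borel_measurable borel" for i k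
    by (rule borel_measurable_continuous_on[where f = "\<lambda>A. A $ i $ k"])
      (use assms linear_continuous_on[OF bounded_linear_compose[OF bounded_linear_vec_nth bounded_linear_vec_nth]] in auto)
  show "(\<lambda>\<xi>. m \<xi> *v w \<xi>) \<in> borel_measurable borel"
    by (rule measurable_vecI) (simp add: matrix_vector_mult_def)
qed

lemma sym_prod_mult: "(m \<odot> n) \<xi> *v x = m \<xi> *v (n \<xi> *v x)"
  by (simp add: sym_prod_def matrix_vector_mul_assoc)

lemma measurable_symbol_prod: "measurable_symbol m \<Longrightarrow> measurable_symbol n \<Longrightarrow> measurable_symbol (m \<odot> n)"
  unfolding measurable_symbol_def[of "m \<odot> n"] sym_prod_mult by (intro ballI measurable_symbolD)

lemma mat_cscale: "A *v (c *s x) = c *s (A *v (x :: complex^'d::finite))"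
  by (simp add: vec_eq_iff matrix_vector_mult_def sum_distrib_left mult_ac)

lemma mat_scaleR: "A *v (r *\<^sub>R x) = r *\<^sub>R (A *v (x :: complex^'d::finite))"
  by (simp add: vec_eq_iff matrix_vector_mult_def scaleR_right.sum)

lemma fourier_spec:
  assumes u: "u \<in> L2" shows "fourier u \<in> L2" "cls (fourier u) = FT (cls u)"
proof -
  have "is_fourier u (rep (FT (cls u)))" using is_fourier_iff[OF u rep_L2] by simp
  then have "is_fourier u (fourier u)" unfolding fourier_def by (rule someI[of "is_fourier u"])
  then show "fourier u \<in> L2" "cls (fourier u) = FT (cls u)"
    using is_fourier_iff[OF u] by (auto simp: is_fourier_def)
qed

lemma inv_fourier_spec:
  assumes v: "v \<in> L2" shows "inv_fourier v \<in> L2" "FT (cls (inv_fourier v)) = cls v"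
proof -
  obtain f where "FT f = cls v" using FT_surj by blast
  then have "is_fourier (rep f) v" using is_fourier_iff[OF rep_L2 v, of f] by simp
  then have "is_fourier (inv_fourier v) v" unfolding inv_fourier_def by (rule someI[of "\<lambda>u. is_fourier u v"])
  then show "inv_fourier v \<in> L2" "FT (cls (inv_fourier v)) = cls v"
    using is_fourier_iff[OF _ v] by (auto simp: is_fourier_def)
qed

lemma fourier_cong:
  assumes "u \<in> L2" "v \<in> L2" "u \<doteq> v" shows "fourier u = fourier v"
proof -
  have "cls u = cls v" using assms by (simp add: cls_eq_iff)
  then have "is_fourier u w \<longleftrightarrow> is_fourier v w" for w
    using is_fourier_iff[OF assms(1), of w] is_fourier_iff[OF assms(2), of w]
    by (cases "w \<in> L2") (auto simp: is_fourier_def)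
  then show ?thesis by (simp add: fourier_def)
qed

lemma fm_cong: "u \<in> L2 \<Longrightarrow> v \<in> L2 \<Longrightarrow> u \<doteq> v \<Longrightarrow> fm m u = fm m v"
  unfolding fm_def using fourier_cong[of u v] by simp

lemma fm_dom_cong: "u \<in> L2 \<Longrightarrow> v \<in> L2 \<Longrightarrow> u \<doteq> v \<Longrightarrow> u \<in> fm_dom m \<longleftrightarrow> v \<in> fm_dom m"
  unfolding fm_dom_def using fourier_cong[of u v] by simp

lemma fm_dom_L2: "u \<in> fm_dom m \<Longrightarrow> u \<in> L2" by (simp add: fm_dom_def)

lemma mult_ae_cong: "v \<doteq> w \<Longrightarrow> (\<lambda>\<xi>. m \<xi> *v v \<xi>) \<doteq> (\<lambda>\<xi>. m \<xi> *v w \<xi>)"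
  by (rule ae_eq_fun)

lemma L2_ae_cong:
  assumes "v \<in> L2" "w \<in> borel_measurable borel" "v \<doteq> w" shows "w \<in> L2"
proof (rule L2_dominated[OF assms(2,1), where C = 1])
  show "AE x in lborel. norm (w x) \<le> 1 * norm (v x)"
    using assms(3) unfolding ae_eq_def by (rule eventually_mono) simp
qed

lemma fm_dom_iff:
  assumes m: "measurable_symbol m" and u: "u \<in> L2" and v: "v \<in> L2" and uv: "FT (cls u) = cls v"
  shows "u \<in> fm_dom m \<longleftrightarrow> (\<lambda>\<xi>. m \<xi> *v v \<xi>) \<in> L2"
proof -
  have eq: "fourier u \<doteq> v"
    using cls_eq_iff[OF fourier_spec(1)[OF u] v] fourier_spec(2)[OF u] uv by simp
  have meas: "(\<lambda>\<xi>. m \<xi> *v fourier u \<xi>) \<in> borel_measurable borel" "(\<lambda>\<xi>. m \<xi> *v v \<xi>) \<in> borel_measurable borel"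
    using measurable_symbolD[OF m] L2_measurable_borel fourier_spec(1)[OF u] v by auto
  have "(\<lambda>\<xi>. m \<xi> *v fourier u \<xi>) \<in> L2 \<longleftrightarrow> (\<lambda>\<xi>. m \<xi> *v v \<xi>) \<in> L2"
    using L2_ae_cong[OF _ meas(2) mult_ae_cong[OF eq]] L2_ae_cong[OF _ meas(1) ae_eq_sym[OF mult_ae_cong[OF eq]]]
    by (intro iffI)
  then show ?thesis using u by (simp add: fm_dom_def)
qed

lemma fm_spec:
  assumes m: "measurable_symbol m" and u: "u \<in> fm_dom m" and v: "v \<in> L2" and uv: "FT (cls u) = cls v"
  shows "fm m u \<in> L2" "FT (cls (fm m u)) = cls (\<lambda>\<xi>. m \<xi> *v v \<xi>)"
proof -
  note uL = fm_dom_L2[OF u]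
  have mu: "(\<lambda>\<xi>. m \<xi> *v fourier u \<xi>) \<in> L2" using u by (simp add: fm_dom_def)
  show "fm m u \<in> L2" unfolding fm_def by (rule inv_fourier_spec(1)[OF mu])
  have eq: "fourier u \<doteq> v"
    using cls_eq_iff[OF fourier_spec(1)[OF uL] v] fourier_spec(2)[OF uL] uv by simp
  have "FT (cls (fm m u)) = cls (\<lambda>\<xi>. m \<xi> *v fourier u \<xi>)" unfolding fm_def by (rule inv_fourier_spec(2)[OF mu])
  also have "\<dots> = cls (\<lambda>\<xi>. m \<xi> *v v \<xi>)"
  proof -
    have mv: "(\<lambda>\<xi>. m \<xi> *v v \<xi>) \<in> L2" using fm_dom_iff[OF m uL v uv] u by simp
    show ?thesis unfolding cls_eq_iff[OF mu mv] by (rule mult_ae_cong[OF eq])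
  qed
  finally show "FT (cls (fm m u)) = cls (\<lambda>\<xi>. m \<xi> *v v \<xi>)" .
qed

lemma inner_ii: "x \<bullet> (\<i> *s y) = Im (\<Sum>i\<in>UNIV. x $ i * cnj (y $ i))" for x y :: "complex^'d::finite"
  unfolding inner_cvec Im_sum by (rule sum.cong) (simp_all add: algebra_simps)

text \<open>The complex inner product is recovered from the real one and the multiplication by \<open>\<i>\<close>.\<close>

lemma l2_inner_cls:
  assumes "u \<in> L2" "v \<in> L2" shows "l2_inner u v = Complex (cls u \<bullet> cls v) (cls u \<bullet> cscale \<i> (cls v))"
proof -
  have i: "integrable lborel (\<lambda>x. \<Sum>i\<in>UNIV. u x $ i * cnj (v x $ i))"
    by (intro Bochner_Integration.integrable_sum integrable_mult_L2_scalar L2_scalar_cnj L2_scalar_nth assms)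
  have "Re (l2_inner u v) = cls u \<bullet> cls v"
    unfolding l2_inner_def integral_Re[OF i, symmetric] cls_inner[OF assms] inner_cvec by (simp only: Re_sum)
  moreover have "Im (l2_inner u v) = cls u \<bullet> cscale \<i> (cls v)"
    unfolding l2_inner_def integral_Im[OF i, symmetric] cscale_cls[OF assms(2)] cls_inner[OF assms(1) L2_cscale[OF assms(2)]]
      inner_ii ..
  ultimately show ?thesis by (simp add: complex_eq_iff)
qed

lemma Parseval_fun:
  assumes "u \<in> L2" "u' \<in> L2" "v \<in> L2" "v' \<in> L2" "FT (cls u) = cls v" "FT (cls u') = cls v'"
  shows "2 * pi * (cls u \<bullet> cls u') = (LINT \<xi>|lborel. v \<xi> \<bullet> v' \<xi>)"
  using Parseval[of "cls u" "cls u'"] unfolding assms(5,6) cls_inner[OF assms(3,4)] by simp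

text \<open>Every multiplier contains in its domain the functions whose transform is cut down by a positive weight
  that tames the symbol; testing with those makes operator identities pointwise.  This weight makes them
  square-integrable in addition.\<close>

definition gauss_weight :: "real \<Rightarrow> real" where "gauss_weight \<xi> = exp (- \<xi>\<^sup>2 / 2)"

lemma gauss_weight: "0 < gauss_weight \<xi>" "gauss_weight \<xi> \<le> 1" "gauss_weight \<in> borel_measurable borel" "integrable lborel (\<lambda>\<xi>. (gauss_weight \<xi>)\<^sup>2)"
proof -
  show "0 < gauss_weight \<xi>" "gauss_weight \<xi> \<le> 1" by (simp_all add: gauss_weight_def)
  show m: "gauss_weight \<in> borel_measurable borel" unfolding gauss_weight_def by measurable
  have "gauss 1 = gauss_weight" by (simp add: fun_eq_iff gauss_def gauss_weight_def)
  then have "integrable lborel gauss_weight" using integrable_gauss[of 1] by simp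
  then show "integrable lborel (\<lambda>\<xi>. (gauss_weight \<xi>)\<^sup>2)"
  proof (rule Bochner_Integration.integrable_bound)
    show "AE \<xi> in lborel. norm ((gauss_weight \<xi>)\<^sup>2) \<le> norm (gauss_weight \<xi>)"
      by (intro AE_I2) (simp add: gauss_weight_def power2_eq_square mult_le_one)
  qed (use m in simp)
qed

lemma L2_gauss_weight:
  assumes "w \<in> borel_measurable borel" "\<And>\<xi>. norm (w \<xi>) \<le> C * gauss_weight \<xi>" shows "w \<in> L2"
proof (rule L2_bound[OF assms(1)])
  show "integrable lborel (\<lambda>\<xi>. C\<^sup>2 * (gauss_weight \<xi>)\<^sup>2)" using gauss_weight(4) by simp
  show "AE \<xi> in lborel. (norm (w \<xi>))\<^sup>2 \<le> C\<^sup>2 * (gauss_weight \<xi>)\<^sup>2"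
    using assms(2) by (intro AE_I2) (simp add: power_mult_distrib[symmetric] power_mono)
qed

text \<open>For constant vectors \<open>x\<close> and \<open>y\<close> the defect \<open>h \<xi>\<close> of the identity is itself used as a test function: the
  hypothesis for \<open>w = \<rho> h x\<close> and \<open>w' = \<rho> y\<close> says that the integral of \<open>(\<rho> h)\<^sup>2\<close> vanishes.  A basis provides one
  null set for all vectors.\<close>

lemma pointwise_adjoint:
  fixes m :: "'d::finite symbol"
  assumes m: "measurable_symbol m"
    and H: "\<And>w w'. w \<in> L2 \<Longrightarrow> w' \<in> L2 \<Longrightarrow> (\<lambda>\<xi>. m \<xi> *v w \<xi>) \<in> L2 \<Longrightarrow> (\<lambda>\<xi>. m \<xi> *v w' \<xi>) \<in> L2 \<Longrightarrow>
      (LINT \<xi>|lborel. (m \<xi> *v w \<xi>) \<bullet> w' \<xi>) = s * (LINT \<xi>|lborel. w \<xi> \<bullet> (m \<xi> *v w' \<xi>))"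
  shows "AE \<xi> in lborel. \<forall>x y. (m \<xi> *v x) \<bullet> y = s * (x \<bullet> (m \<xi> *v y))"
proof -
  have fixed: "AE \<xi> in lborel. (m \<xi> *v x) \<bullet> y = s * (x \<bullet> (m \<xi> *v y))" for x y :: "complex^'d"
  proof -
    have [measurable]: "(\<lambda>\<xi>. m \<xi> *v x) \<in> borel_measurable borel" "(\<lambda>\<xi>. m \<xi> *v y) \<in> borel_measurable borel"
      using measurable_symbolD[OF m] by simp_all
    note [measurable] = gauss_weight(3)
    define h where "h \<xi> = (m \<xi> *v x) \<bullet> y - s * (x \<bullet> (m \<xi> *v y))" for \<xi>
    define W where "W \<xi> = 1 + norm (m \<xi> *v x) + norm (m \<xi> *v y)" for \<xi>
    \<comment> \<open>\<open>h\<close> and the two vectors \<open>m \<xi> *v x\<close>, \<open>m \<xi> *v y\<close> grow at most like \<open>W\<close>; two factors of \<open>W\<close> have to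
      be absorbed, since both \<open>h\<close> and the symbol occur in \<open>m \<xi> *v w \<xi>\<close>.\<close>
    define \<rho> where "\<rho> \<xi> = gauss_weight \<xi> / (W \<xi>)\<^sup>2" for \<xi>
    have [measurable]: "h \<in> borel_measurable borel" "W \<in> borel_measurable borel" "\<rho> \<in> borel_measurable borel"
      unfolding h_def W_def \<rho>_def by measurable
    have W1: "W \<xi> \<ge> 1" for \<xi> by (simp add: W_def)
    have W0: "W \<xi> > 0" for \<xi> using W1[of \<xi>] by linarith
    have \<rho>0: "\<rho> \<xi> > 0" for \<xi> using gauss_weight(1) W0[of \<xi>] by (simp add: \<rho>_def)
    have \<rho>W: "\<rho> \<xi> * t \<le> c * gauss_weight \<xi>" if "t \<le> c * (W \<xi>)\<^sup>2" for t c \<xi>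
    proof -
      have "\<rho> \<xi> * t \<le> \<rho> \<xi> * (c * (W \<xi>)\<^sup>2)" using that \<rho>0[of \<xi>] by (intro mult_left_mono) simp_all
      then show ?thesis using W0[of \<xi>] by (simp add: \<rho>_def mult.commute)
    qed
    define c where "c = norm y + \<bar>s\<bar> * norm x"
    have c0: "c \<ge> 0" by (simp add: c_def)
    have hW: "\<bar>h \<xi>\<bar> \<le> c * W \<xi>" for \<xi>
    proof -
      have "\<bar>(m \<xi> *v x) \<bullet> y\<bar> \<le> norm (m \<xi> *v x) * norm y" "\<bar>x \<bullet> (m \<xi> *v y)\<bar> \<le> norm x * norm (m \<xi> *v y)"
        by (rule Cauchy_Schwarz_ineq2)+
      then have "\<bar>h \<xi>\<bar> \<le> norm (m \<xi> *v x) * norm y + \<bar>s\<bar> * (norm x * norm (m \<xi> *v y))"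
      proof -
      assume 1: "\<bar>(m \<xi> *v x) \<bullet> y\<bar> \<le> norm (m \<xi> *v x) * norm y" and 2: "\<bar>x \<bullet> (m \<xi> *v y)\<bar> \<le> norm x * norm (m \<xi> *v y)"
      have "\<bar>h \<xi>\<bar> \<le> \<bar>(m \<xi> *v x) \<bullet> y\<bar> + \<bar>s * (x \<bullet> (m \<xi> *v y))\<bar>" unfolding h_def by (rule abs_triangle_ineq4)
      then show ?thesis using 1 mult_left_mono[OF 2, of "\<bar>s\<bar>"] by (simp only: abs_mult) linarith
    qed
      also have "\<dots> \<le> W \<xi> * norm y + \<bar>s\<bar> * (norm x * W \<xi>)"
        by (intro add_mono mult_left_mono mult_right_mono) (simp_all add: W_def)
      finally show ?thesis by (simp add: c_def algebra_simps)
    qed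
    have W2: "W \<xi> \<le> (W \<xi>)\<^sup>2" for \<xi> using W1[of \<xi>] by (simp add: power2_eq_square)
    let ?w = "\<lambda>\<xi>. (\<rho> \<xi> * h \<xi>) *\<^sub>R x" and ?w' = "\<lambda>\<xi>. \<rho> \<xi> *\<^sub>R y"
    have mw: "(\<lambda>\<xi>. m \<xi> *v ?w \<xi>) = (\<lambda>\<xi>. (\<rho> \<xi> * h \<xi>) *\<^sub>R (m \<xi> *v x))" "(\<lambda>\<xi>. m \<xi> *v ?w' \<xi>) = (\<lambda>\<xi>. \<rho> \<xi> *\<^sub>R (m \<xi> *v y))"
      by (auto simp: mat_scaleR)
    have "?w \<in> L2"
    proof (rule L2_gauss_weight[where C = "c * norm x"])
      fix \<xi>
      have "\<bar>h \<xi>\<bar> * norm x \<le> (c * norm x) * (W \<xi>)\<^sup>2"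
        using mult_right_mono[OF order_trans[OF hW mult_left_mono[OF W2 c0]], of "norm x" \<xi>] by (simp add: mult_ac)
      from \<rho>W[OF this] show "norm (?w \<xi>) \<le> c * norm x * gauss_weight \<xi>" using \<rho>0[of \<xi>] by (simp add: abs_mult mult.assoc)
    qed measurable
    moreover have "?w' \<in> L2"
    proof (rule L2_gauss_weight[where C = "norm y"])
      fix \<xi>
      have "norm y \<le> norm y * (W \<xi>)\<^sup>2" using W1[of \<xi>] by (simp add: mult_le_cancel_left1 one_le_power)
      from \<rho>W[OF this] show "norm (?w' \<xi>) \<le> norm y * gauss_weight \<xi>" using \<rho>0[of \<xi>] by simp
    qed measurable
    moreover have "(\<lambda>\<xi>. m \<xi> *v ?w \<xi>) \<in> L2" unfolding mw
    proof (rule L2_gauss_weight[where C = c])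
      fix \<xi>
      have "\<bar>h \<xi>\<bar> * norm (m \<xi> *v x) \<le> (c * W \<xi>) * W \<xi>"
        by (rule mult_mono[OF hW]) (use c0 W0[of \<xi>] in \<open>simp_all add: W_def\<close>)
      then have "\<bar>h \<xi>\<bar> * norm (m \<xi> *v x) \<le> c * (W \<xi>)\<^sup>2" by (simp add: power2_eq_square mult.assoc)
      from \<rho>W[OF this] show "norm ((\<rho> \<xi> * h \<xi>) *\<^sub>R (m \<xi> *v x)) \<le> c * gauss_weight \<xi>" using \<rho>0[of \<xi>] by (simp add: abs_mult mult.assoc)
    qed measurable
    moreover have "(\<lambda>\<xi>. m \<xi> *v ?w' \<xi>) \<in> L2" unfolding mw
    proof (rule L2_gauss_weight[where C = 1])
      fix \<xi>
      have "norm (m \<xi> *v y) \<le> 1 * (W \<xi>)\<^sup>2" using W2[of \<xi>] norm_ge_zero[of "m \<xi> *v x"] unfolding W_def by linarith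
      from \<rho>W[OF this] show "norm (\<rho> \<xi> *\<^sub>R (m \<xi> *v y)) \<le> 1 * gauss_weight \<xi>" using \<rho>0[of \<xi>] by simp
    qed measurable
    ultimately have L: "?w \<in> L2" "?w' \<in> L2" "(\<lambda>\<xi>. m \<xi> *v ?w \<xi>) \<in> L2" "(\<lambda>\<xi>. m \<xi> *v ?w' \<xi>) \<in> L2" by blast+
    note i1 = integrable_inner_L2[OF L(3,2)] and i2 = integrable_inner_L2[OF L(1,4)]
    have pt: "(m \<xi> *v ?w \<xi>) \<bullet> ?w' \<xi> - s * (?w \<xi> \<bullet> (m \<xi> *v ?w' \<xi>)) = (\<rho> \<xi> * h \<xi>)\<^sup>2" for \<xi>
      by (simp add: mat_scaleR h_def power2_eq_square algebra_simps)
    have int: "integrable lborel (\<lambda>\<xi>. (\<rho> \<xi> * h \<xi>)\<^sup>2)"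
      unfolding pt[symmetric] by (intro Bochner_Integration.integrable_diff i1 integrable_mult_right i2)
    have "(LINT \<xi>|lborel. (\<rho> \<xi> * h \<xi>)\<^sup>2) = (LINT \<xi>|lborel. (m \<xi> *v ?w \<xi>) \<bullet> ?w' \<xi>) - (LINT \<xi>|lborel. s * (?w \<xi> \<bullet> (m \<xi> *v ?w' \<xi>)))"
      unfolding pt[symmetric] by (intro Bochner_Integration.integral_diff i1 integrable_mult_right i2)
    also have "\<dots> = 0" unfolding H[OF L] by simp
    finally have "AE \<xi> in lborel. (\<rho> \<xi> * h \<xi>)\<^sup>2 = 0"
      by (subst (asm) integral_nonneg_eq_0_iff_AE[OF int]) simp_all
    then show ?thesis
    proof (rule eventually_mono)
      fix \<xi> assume "(\<rho> \<xi> * h \<xi>)\<^sup>2 = 0"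
      then have "h \<xi> = 0" using \<rho>0[of \<xi>] by simp
      then show "(m \<xi> *v x) \<bullet> y = s * (x \<bullet> (m \<xi> *v y))" by (simp add: h_def)
    qed
  qed
  have "AE \<xi> in lborel. \<forall>x\<in>Basis. \<forall>y\<in>Basis. (m \<xi> *v x) \<bullet> y = s * (x \<bullet> (m \<xi> *v y))"
    by (intro AE_finite_allI fixed) simp_all
  then show ?thesis
  proof (rule eventually_mono)
    fix \<xi> assume B: "\<forall>x\<in>Basis. \<forall>y\<in>Basis. (m \<xi> *v x) \<bullet> y = s * (x \<bullet> (m \<xi> *v y))"
    have lin1: "linear (\<lambda>x. (m \<xi> *v x) \<bullet> y)" for y
      by (rule linearI) (simp_all only: matrix_vector_right_distrib inner_add_left mat_scaleR inner_scaleR_left real_scaleR_def)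
    have lin2: "linear (\<lambda>x. s * (x \<bullet> (m \<xi> *v y)))" for y
      by (rule linearI) (simp_all add: inner_add_left distrib_left)
    have lin3: "linear (\<lambda>y. (m \<xi> *v x) \<bullet> y)" for x
      by (rule linearI) (simp_all add: inner_add_right)
    have lin4: "linear (\<lambda>y. s * (x \<bullet> (m \<xi> *v y)))" for x
      by (rule linearI) (simp_all add: matrix_vector_right_distrib mat_scaleR inner_add_right distrib_left)
    have 1: "(m \<xi> *v x) \<bullet> y = s * (x \<bullet> (m \<xi> *v y))" if y: "y \<in> Basis" for x y
    proof -
      have "(\<lambda>x. (m \<xi> *v x) \<bullet> y) = (\<lambda>x. s * (x \<bullet> (m \<xi> *v y)))"
        by (rule linear_eq_stdbasis[OF lin1 lin2]) (rule B[rule_format, OF _ y])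
      then show ?thesis by (rule fun_cong)
    qed
    show "\<forall>x y. (m \<xi> *v x) \<bullet> y = s * (x \<bullet> (m \<xi> *v y))"
    proof (intro allI)
      fix x y
      have "(\<lambda>y. (m \<xi> *v x) \<bullet> y) = (\<lambda>y. s * (x \<bullet> (m \<xi> *v y)))"
        by (rule linear_eq_stdbasis[OF lin3 lin4]) (rule 1)
      then show "(m \<xi> *v x) \<bullet> y = s * (x \<bullet> (m \<xi> *v y))" by (rule fun_cong)
    qed
  qed
qed

text \<open>To be applied with \<open>q\<close> the density of a form: the weight and the indicator come from inserting the
  function \<open>\<rho>\<close> times the indicator of \<open>q < 0\<close> into the form.\<close>

lemma AE_nonneg_by_testing:
  fixes q :: "real \<Rightarrow> real"
  assumes pos: "\<And>\<xi>. \<rho> \<xi> > 0"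
    and int: "integrable lborel (\<lambda>\<xi>. indicator {\<xi>. q \<xi> < 0} \<xi> * (\<rho> \<xi>)\<^sup>2 * q \<xi>)"
    and ge: "0 \<le> (LINT \<xi>|lborel. indicator {\<xi>. q \<xi> < 0} \<xi> * (\<rho> \<xi>)\<^sup>2 * q \<xi>)"
  shows "AE \<xi> in lborel. 0 \<le> q \<xi>"
proof -
  let ?f = "\<lambda>\<xi>. - (indicator {\<xi>. q \<xi> < 0} \<xi> * (\<rho> \<xi>)\<^sup>2 * q \<xi>)"
  have nn: "0 \<le> ?f \<xi>" for \<xi> by (auto simp: indicator_def mult_le_0_iff)
  have i: "integrable lborel ?f" using int by simp
  have "0 \<le> (LINT \<xi>|lborel. ?f \<xi>)" by (rule integral_nonneg_AE) (use nn in simp)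
  then have "(LINT \<xi>|lborel. ?f \<xi>) = 0" using ge by simp
  then have "AE \<xi> in lborel. ?f \<xi> = 0"
    by (subst (asm) integral_nonneg_eq_0_iff_AE[OF i]) (use nn in simp_all)
  then show ?thesis
  proof (rule eventually_mono)
    fix \<xi> assume "?f \<xi> = 0"
    then show "0 \<le> q \<xi>" using pos[of \<xi>] by (cases "q \<xi> < 0") (auto simp: indicator_def)
  qed
qed

lemma pointwise_adjoint_op:
  fixes m :: "'d::finite symbol"
  assumes m: "measurable_symbol m"
    and H: "\<And>u v. u \<in> fm_dom m \<Longrightarrow> v \<in> fm_dom m \<Longrightarrow> l2_inner (fm m u) v = complex_of_real s * l2_inner u (fm m v)"
  shows "AE \<xi> in lborel. \<forall>x y. (m \<xi> *v x) \<bullet> y = s * (x \<bullet> (m \<xi> *v y))"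
proof (rule pointwise_adjoint[OF m])
  fix w w' :: "'d vfun"
  assume w: "w \<in> L2" "w' \<in> L2" "(\<lambda>\<xi>. m \<xi> *v w \<xi>) \<in> L2" "(\<lambda>\<xi>. m \<xi> *v w' \<xi>) \<in> L2"
  let ?u = "inv_fourier w" and ?v = "inv_fourier w'"
  note u = inv_fourier_spec[OF w(1)] and v = inv_fourier_spec[OF w(2)]
  have ud: "?u \<in> fm_dom m" "?v \<in> fm_dom m"
    using fm_dom_iff[OF m u(1) w(1) u(2)] fm_dom_iff[OF m v(1) w(2) v(2)] w by auto
  note fu = fm_spec[OF m ud(1) w(1) u(2)] and fv = fm_spec[OF m ud(2) w(2) v(2)]
  have "Re (l2_inner (fm m ?u) ?v) = s * Re (l2_inner ?u (fm m ?v))"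
    unfolding H[OF ud] by simp
  then have "cls (fm m ?u) \<bullet> cls ?v = s * (cls ?u \<bullet> cls (fm m ?v))"
    unfolding l2_inner_cls[OF fu(1) v(1)] l2_inner_cls[OF u(1) fv(1)] complex.sel .
  then show "(LINT \<xi>|lborel. (m \<xi> *v w \<xi>) \<bullet> w' \<xi>) = s * (LINT \<xi>|lborel. w \<xi> \<bullet> (m \<xi> *v w' \<xi>))"
    unfolding Parseval_fun[OF fu(1) v(1) w(3) w(2) fu(2) v(2), symmetric]
      Parseval_fun[OF u(1) fv(1) w(1) w(4) u(2) fv(2), symmetric] by simp
qed

lemma L2_cut:
  assumes v: "v \<in> L2" and [measurable]: "E \<in> sets borel" "\<rho> \<in> borel_measurable borel" and b: "\<And>\<xi>. \<bar>\<rho> \<xi>\<bar> \<le> C"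
  shows "(\<lambda>\<xi>. (indicator E \<xi> * \<rho> \<xi>) *\<^sub>R v \<xi>) \<in> L2"
proof (rule L2_dominated[OF _ v, where C = C])
  have [measurable]: "v \<in> borel_measurable borel" using L2_measurable_borel[OF v] .
  show "(\<lambda>\<xi>. (indicator E \<xi> * \<rho> \<xi>) *\<^sub>R v \<xi>) \<in> borel_measurable borel" by measurable
  have "C \<ge> 0" using b[of 0] abs_ge_zero order_trans by blast
  then have "\<bar>indicator E \<xi> * \<rho> \<xi>\<bar> \<le> C" for \<xi> using b[of \<xi>] by (simp add: indicator_def)
  then show "AE \<xi> in lborel. norm ((indicator E \<xi> * \<rho> \<xi>) *\<^sub>R v \<xi>) \<le> C * norm (v \<xi>)"
    by (intro AE_I2) (simp only: norm_scaleR mult_right_mono norm_ge_zero)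
qed

lemma form_nonneg_pointwise:
  assumes m: "measurable_symbol m" and pos: "\<And>u. u \<in> fm_dom m \<Longrightarrow> 0 \<le> Re (l2_inner u (fm m u))" and w: "w \<in> L2"
  shows "AE \<xi> in lborel. 0 \<le> (m \<xi> *v w \<xi>) \<bullet> w \<xi>"
proof -
  have [measurable]: "w \<in> borel_measurable borel" using L2_measurable_borel[OF w] .
  have [measurable]: "(\<lambda>\<xi>. m \<xi> *v w \<xi>) \<in> borel_measurable borel" by (rule measurable_symbolD[OF m]) measurable
  note [measurable] = gauss_weight(3)
  define q where "q \<xi> = (m \<xi> *v w \<xi>) \<bullet> w \<xi>" for \<xi>
  define \<rho> where "\<rho> \<xi> = gauss_weight \<xi> / (1 + norm (m \<xi> *v w \<xi>))" for \<xi>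
  have [measurable]: "q \<in> borel_measurable borel" "\<rho> \<in> borel_measurable borel" unfolding q_def \<rho>_def by measurable
  define E where "E = {\<xi>. q \<xi> < 0}"
  have [measurable]: "E \<in> sets borel" unfolding E_def by measurable
  have \<rho>0: "\<rho> \<xi> > 0" for \<xi> using gauss_weight(1) by (simp add: \<rho>_def add_pos_nonneg)
  have \<rho>1: "\<bar>\<rho> \<xi>\<bar> \<le> 1" for \<xi>
    using gauss_weight(1,2)[of \<xi>] by (simp add: \<rho>_def divide_le_eq add_pos_nonneg) (meson le_add_same_cancel1 norm_ge_zero order_trans)
  let ?v = "\<lambda>\<xi>. (indicator E \<xi> * \<rho> \<xi>) *\<^sub>R w \<xi>"
  have v: "?v \<in> L2" by (rule L2_cut[OF w _ _ \<rho>1]) measurable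
  have mv: "(\<lambda>\<xi>. m \<xi> *v ?v \<xi>) = (\<lambda>\<xi>. (indicator E \<xi> * \<rho> \<xi>) *\<^sub>R (m \<xi> *v w \<xi>))" by (simp only: mat_scaleR)
  have mvL: "(\<lambda>\<xi>. m \<xi> *v ?v \<xi>) \<in> L2" unfolding mv
  proof (rule L2_gauss_weight[where C = 1])
    fix \<xi>
    have n: "norm (m \<xi> *v w \<xi>) \<le> 1 + norm (m \<xi> *v w \<xi>)" by simp
    have "\<rho> \<xi> * norm (m \<xi> *v w \<xi>) \<le> \<rho> \<xi> * (1 + norm (m \<xi> *v w \<xi>))" using \<rho>0[of \<xi>] n by (intro mult_left_mono) simp_all
    also have "\<dots> = gauss_weight \<xi>"
    proof -
      have "1 + norm (m \<xi> *v w \<xi>) \<noteq> 0" using norm_ge_zero[of "m \<xi> *v w \<xi>"] by linarith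
      then show ?thesis by (simp add: \<rho>_def)
    qed
    finally have "\<rho> \<xi> * norm (m \<xi> *v w \<xi>) \<le> gauss_weight \<xi>" .
    then show "norm ((indicator E \<xi> * \<rho> \<xi>) *\<^sub>R (m \<xi> *v w \<xi>)) \<le> 1 * gauss_weight \<xi>"
      using \<rho>0[of \<xi>] gauss_weight(1)[of \<xi>] by (auto simp: indicator_def)
  qed measurable
  note u = inv_fourier_spec[OF v]
  have ud: "inv_fourier ?v \<in> fm_dom m" using fm_dom_iff[OF m u(1) v u(2)] mvL by simp
  note fu = fm_spec[OF m ud v u(2)]
  have pt: "(m \<xi> *v ?v \<xi>) \<bullet> ?v \<xi> = indicator {\<xi>. q \<xi> < 0} \<xi> * (\<rho> \<xi>)\<^sup>2 * q \<xi>" for \<xi>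
    by (simp add: mat_scaleR q_def E_def indicator_def power2_eq_square)
  have "AE \<xi> in lborel. 0 \<le> q \<xi>"
  proof (rule AE_nonneg_by_testing[OF \<rho>0])
    show "integrable lborel (\<lambda>\<xi>. indicator {\<xi>. q \<xi> < 0} \<xi> * (\<rho> \<xi>)\<^sup>2 * q \<xi>)"
      unfolding pt[symmetric] by (rule integrable_inner_L2[OF mvL v])
    have "0 \<le> cls (inv_fourier ?v) \<bullet> cls (fm m (inv_fourier ?v))"
      using pos[OF ud] unfolding l2_inner_cls[OF u(1) fu(1)] complex.sel .
    then have "0 \<le> 2 * pi * (cls (fm m (inv_fourier ?v)) \<bullet> cls (inv_fourier ?v))" by (simp add: inner_commute)
    then show "0 \<le> (LINT \<xi>|lborel. indicator {\<xi>. q \<xi> < 0} \<xi> * (\<rho> \<xi>)\<^sup>2 * q \<xi>)"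
      unfolding pt[symmetric] Parseval_fun[OF fu(1) u(1) mvL v fu(2) u(2)] .
  qed
  then show ?thesis by (simp add: q_def)
qed

lemma bessel_cls:
  assumes u: "u \<in> L2" and v: "v \<in> L2" and uv: "FT (cls u) = cls v"
  shows "bessel s u \<in> L2 \<longleftrightarrow> (\<lambda>\<xi>. ((1 + \<xi>\<^sup>2) powr (s / 2)) *\<^sub>R v \<xi>) \<in> L2"
    "bessel s u \<doteq> (\<lambda>\<xi>. ((1 + \<xi>\<^sup>2) powr (s / 2)) *\<^sub>R v \<xi>)"
proof -
  have eq: "fourier u \<doteq> v"
    using cls_eq_iff[OF fourier_spec(1)[OF u] v] fourier_spec(2)[OF u] uv by simp
  show eq2: "bessel s u \<doteq> (\<lambda>\<xi>. ((1 + \<xi>\<^sup>2) powr (s / 2)) *\<^sub>R v \<xi>)"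
    unfolding bessel_def by (rule ae_eq_fun[OF eq])
  have [measurable]: "fourier u \<in> borel_measurable borel" "v \<in> borel_measurable borel"
    using L2_measurable_borel fourier_spec(1)[OF u] v by auto
  have m1: "bessel s u \<in> borel_measurable borel" unfolding bessel_def by measurable
  have m2: "(\<lambda>\<xi>. ((1 + \<xi>\<^sup>2) powr (s / 2)) *\<^sub>R v \<xi>) \<in> borel_measurable borel" by measurable
  show "bessel s u \<in> L2 \<longleftrightarrow> (\<lambda>\<xi>. ((1 + \<xi>\<^sup>2) powr (s / 2)) *\<^sub>R v \<xi>) \<in> L2"
    using L2_ae_cong[OF _ m2 eq2] L2_ae_cong[OF _ m1 ae_eq_sym[OF eq2]] by (intro iffI)
qed

lemma sobolev_norm1_sq:
  assumes u: "u \<in> L2" and v: "v \<in> L2" and uv: "FT (cls u) = cls v"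
  shows "2 * pi * (sobolev_norm 1 u)\<^sup>2 = (LINT \<xi>|lborel. (1 + \<xi>\<^sup>2) * (norm (v \<xi>))\<^sup>2)"
proof -
  have eq: "fourier u \<doteq> v"
    using cls_eq_iff[OF fourier_spec(1)[OF u] v] fourier_spec(2)[OF u] uv by simp
  have [measurable]: "fourier u \<in> borel_measurable borel" "v \<in> borel_measurable borel"
    using L2_measurable_borel fourier_spec(1)[OF u] v by auto
  have sq: "((1 + \<xi>\<^sup>2) powr (1 / 2))\<^sup>2 = 1 + \<xi>\<^sup>2" for \<xi> :: real
  proof -
    have "0 < 1 + \<xi>\<^sup>2" by (simp add: add_pos_nonneg)
    then show ?thesis by (simp add: powr_half_sqrt)
  qed
  have "(LINT \<xi>|lborel. (norm (bessel 1 u \<xi>))\<^sup>2) = (LINT \<xi>|lborel. (1 + \<xi>\<^sup>2) * (norm (v \<xi>))\<^sup>2)"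
  proof (rule integral_cong_AE)
    show "AE \<xi> in lborel. (norm (bessel 1 u \<xi>))\<^sup>2 = (1 + \<xi>\<^sup>2) * (norm (v \<xi>))\<^sup>2"
      using eq unfolding ae_eq_def by (rule eventually_mono) (simp add: bessel_def power_mult_distrib sq)
    show "(\<lambda>\<xi>. (norm (bessel 1 u \<xi>))\<^sup>2) \<in> borel_measurable lborel" unfolding bessel_def by measurable
    show "(\<lambda>\<xi>. (1 + \<xi>\<^sup>2) * (norm (v \<xi>))\<^sup>2) \<in> borel_measurable lborel" by measurable
  qed
  moreover have "0 \<le> (LINT \<xi>|lborel. (norm (bessel 1 u \<xi>))\<^sup>2)" by (rule integral_nonneg_AE) simp
  ultimately show ?thesis
    unfolding sobolev_norm_def l2_norm_def by (simp add: power_divide)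
qed

lemma gauss_weight_bounds: "(1 + \<xi>\<^sup>2) * gauss_weight \<xi> \<le> 2" "((1 + \<xi>\<^sup>2) powr (1/2)) * gauss_weight \<xi> \<le> 2"
proof -
  have "1 + \<xi>\<^sup>2 / 2 \<le> exp (\<xi>\<^sup>2 / 2)" by (rule exp_ge_add_one_self)
  then have "1 + \<xi>\<^sup>2 \<le> 2 * exp (\<xi>\<^sup>2 / 2)" using zero_le_power2[of \<xi>] by linarith
  then have "(1 + \<xi>\<^sup>2) * gauss_weight \<xi> \<le> 2 * exp (\<xi>\<^sup>2 / 2) * gauss_weight \<xi>" using gauss_weight(1)[of \<xi>] by (intro mult_right_mono) simp_all
  also have "\<dots> = 2" by (simp add: gauss_weight_def exp_minus)
  finally show 1: "(1 + \<xi>\<^sup>2) * gauss_weight \<xi> \<le> 2" .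
  have "(1 + \<xi>\<^sup>2) powr (1/2) \<le> (1 + \<xi>\<^sup>2) powr 1" by (rule powr_mono) simp_all
  also have "\<dots> = 1 + \<xi>\<^sup>2" by (simp add: add_pos_nonneg)
  finally have "((1 + \<xi>\<^sup>2) powr (1/2)) * gauss_weight \<xi> \<le> (1 + \<xi>\<^sup>2) * gauss_weight \<xi>" using gauss_weight(1)[of \<xi>] by (intro mult_right_mono) simp_all
  then show "((1 + \<xi>\<^sup>2) powr (1/2)) * gauss_weight \<xi> \<le> 2" using 1 by linarith
qed

text \<open>A localized transform with Gaussian weight is the transform of a function that is as smooth as
  the Sobolev bounds of the model require.\<close>

lemma gauss_cut_sobolev:
  assumes v: "v \<in> L2" and [measurable]: "E \<in> sets borel"
  shows "(\<lambda>\<xi>. (indicator E \<xi> * gauss_weight \<xi>) *\<^sub>R v \<xi>) \<in> L2" (is "?w \<in> L2")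
    "inv_fourier (\<lambda>\<xi>. (indicator E \<xi> * gauss_weight \<xi>) *\<^sub>R v \<xi>) \<in> sobolev 1"
    "inv_fourier (\<lambda>\<xi>. (indicator E \<xi> * gauss_weight \<xi>) *\<^sub>R v \<xi>) \<in> sobolev 2"
    "integrable lborel (\<lambda>\<xi>. (1 + \<xi>\<^sup>2) * (norm ((indicator E \<xi> * gauss_weight \<xi>) *\<^sub>R v \<xi>))\<^sup>2)"
proof -
  note [measurable] = gauss_weight(3)
  show w: "?w \<in> L2"
    by (rule L2_cut[OF v, where C = 1]) (use gauss_weight(1,2) in \<open>simp_all add: abs_le_iff less_imp_le order_trans[of _ 0]\<close>)
  note u = inv_fourier_spec[OF w]
  have m1: "(\<lambda>\<xi>. (indicator E \<xi> * (((1 + \<xi>\<^sup>2) powr (1/2)) * gauss_weight \<xi>)) *\<^sub>R v \<xi>) \<in> L2"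
    by (rule L2_cut[OF v, where C = 2]) (use gauss_weight_bounds(2) gauss_weight(1) in \<open>simp_all add: abs_mult less_imp_le\<close>)
  have "(\<lambda>\<xi>. (indicator E \<xi> * ((1 + \<xi>\<^sup>2) * gauss_weight \<xi>)) *\<^sub>R v \<xi>) \<in> L2"
    by (rule L2_cut[OF v, where C = 2]) (use gauss_weight_bounds(1) gauss_weight(1) in \<open>simp_all add: abs_mult less_imp_le\<close>)
  moreover have "(1 + \<xi>\<^sup>2) powr (2/2) = 1 + \<xi>\<^sup>2" for \<xi> :: real by (simp add: add_pos_nonneg)
  ultimately have m2: "(\<lambda>\<xi>. ((1 + \<xi>\<^sup>2) powr (2/2)) *\<^sub>R ?w \<xi>) \<in> L2" by (simp add: mult_ac)
  have m1': "(\<lambda>\<xi>. ((1 + \<xi>\<^sup>2) powr (1/2)) *\<^sub>R ?w \<xi>) \<in> L2" using m1 by (simp add: mult_ac)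
  show "inv_fourier ?w \<in> sobolev 1" "inv_fourier ?w \<in> sobolev 2"
    unfolding sobolev_def using bessel_cls(1)[OF u(1) w u(2)] u(1) m1' m2 by auto
  have "(norm (((1 + \<xi>\<^sup>2) powr (1/2)) *\<^sub>R ?w \<xi>))\<^sup>2 = (1 + \<xi>\<^sup>2) * (norm (?w \<xi>))\<^sup>2" for \<xi>
  proof -
    have "((1 + \<xi>\<^sup>2) powr (1/2))\<^sup>2 = 1 + \<xi>\<^sup>2" using add_pos_nonneg[of 1 "\<xi>\<^sup>2"] by (simp add: powr_half_sqrt)
    then show ?thesis by (simp only: norm_scaleR power_mult_distrib power2_abs)
  qed
  with L2_integrable[OF m1'] show "integrable lborel (\<lambda>\<xi>. (1 + \<xi>\<^sup>2) * (norm (?w \<xi>))\<^sup>2)" by (simp only:)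
qed

text \<open>A lower bound of the form by the \<open>H\<^sup>1\<close> norm descends to the symbol, by testing where it fails.\<close>

lemma coercive_pointwise:
  assumes m: "measurable_symbol m" and dom: "sobolev 2 \<subseteq> fm_dom m"
    and low: "\<And>u. u \<in> sobolev 2 \<Longrightarrow> c * (sobolev_norm 1 u)\<^sup>2 \<le> Re (l2_inner (fm m u) u)" and v: "v \<in> L2"
  shows "AE \<xi> in lborel. c * ((1 + \<xi>\<^sup>2) * (norm (v \<xi>))\<^sup>2) \<le> (m \<xi> *v v \<xi>) \<bullet> v \<xi>"
proof -
  have [measurable]: "v \<in> borel_measurable borel" using L2_measurable_borel[OF v] .
  have [measurable]: "(\<lambda>\<xi>. m \<xi> *v v \<xi>) \<in> borel_measurable borel" by (rule measurable_symbolD[OF m]) measurable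
  define q where "q \<xi> = (m \<xi> *v v \<xi>) \<bullet> v \<xi> - c * ((1 + \<xi>\<^sup>2) * (norm (v \<xi>))\<^sup>2)" for \<xi>
  have [measurable]: "q \<in> borel_measurable borel" unfolding q_def by measurable
  define E where "E = {\<xi>. q \<xi> < 0}"
  have E: "E \<in> sets borel" unfolding E_def by measurable
  let ?w = "\<lambda>\<xi>. (indicator E \<xi> * gauss_weight \<xi>) *\<^sub>R v \<xi>"
  note w = gauss_cut_sobolev[OF v E]
  note u = inv_fourier_spec[OF w(1)]
  have ud: "inv_fourier ?w \<in> fm_dom m" using dom w(3) by blast
  note fu = fm_spec[OF m ud w(1) u(2)]
  have mwL: "(\<lambda>\<xi>. m \<xi> *v ?w \<xi>) \<in> L2" using fm_dom_iff[OF m u(1) w(1) u(2)] ud by simp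
  have pt: "(m \<xi> *v ?w \<xi>) \<bullet> ?w \<xi> - c * ((1 + \<xi>\<^sup>2) * (norm (?w \<xi>))\<^sup>2) = indicator {\<xi>. q \<xi> < 0} \<xi> * (gauss_weight \<xi>)\<^sup>2 * q \<xi>" for \<xi>
    by (cases "\<xi> \<in> E") (simp_all add: mat_scaleR q_def E_def power_mult_distrib power2_eq_square algebra_simps)
  note i1 = integrable_inner_L2[OF mwL w(1)]
  have "AE \<xi> in lborel. 0 \<le> q \<xi>"
  proof (rule AE_nonneg_by_testing[OF gauss_weight(1)])
    show "integrable lborel (\<lambda>\<xi>. indicator {\<xi>. q \<xi> < 0} \<xi> * (gauss_weight \<xi>)\<^sup>2 * q \<xi>)"
      unfolding pt[symmetric] by (intro Bochner_Integration.integrable_diff integrable_mult_right i1 w(4))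
    have "2 * pi * (c * (sobolev_norm 1 (inv_fourier ?w))\<^sup>2) \<le> 2 * pi * (cls (fm m (inv_fourier ?w)) \<bullet> cls (inv_fourier ?w))"
      using low[OF w(3)] unfolding l2_inner_cls[OF fu(1) u(1)] complex.sel by (intro mult_left_mono) simp_all
    then have "c * (LINT \<xi>|lborel. (1 + \<xi>\<^sup>2) * (norm (?w \<xi>))\<^sup>2) \<le> (LINT \<xi>|lborel. (m \<xi> *v ?w \<xi>) \<bullet> ?w \<xi>)"
      unfolding Parseval_fun[OF fu(1) u(1) mwL w(1) fu(2) u(2)] sobolev_norm1_sq[OF u(1) w(1) u(2), symmetric]
      by (simp only: mult.left_commute)
    moreover have "(LINT \<xi>|lborel. indicator {\<xi>. q \<xi> < 0} \<xi> * (gauss_weight \<xi>)\<^sup>2 * q \<xi>)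
      = (LINT \<xi>|lborel. (m \<xi> *v ?w \<xi>) \<bullet> ?w \<xi>) - c * (LINT \<xi>|lborel. (1 + \<xi>\<^sup>2) * (norm (?w \<xi>))\<^sup>2)"
      unfolding pt[symmetric] by (simp only: Bochner_Integration.integral_diff[OF i1 integrable_mult_right[OF w(4)]] integral_mult_right_zero)
    ultimately show "0 \<le> (LINT \<xi>|lborel. indicator {\<xi>. q \<xi> < 0} \<xi> * (gauss_weight \<xi>)\<^sup>2 * q \<xi>)" by linarith
  qed
  then show ?thesis by (rule eventually_mono) (simp add: q_def)
qed

text \<open>An operator bound on \<open>H\<^sup>1\<close> descends to the symbol, by testing where it fails.\<close>

lemma order_one_pointwise:
  assumes m: "measurable_symbol m" and dom: "sobolev 1 \<subseteq> fm_dom m"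
    and bd: "\<And>u. u \<in> sobolev 1 \<Longrightarrow> l2_norm (fm m u) \<le> C * sobolev_norm 1 u" and v: "v \<in> L2"
  shows "AE \<xi> in lborel. (norm (m \<xi> *v v \<xi>))\<^sup>2 \<le> C\<^sup>2 * ((1 + \<xi>\<^sup>2) * (norm (v \<xi>))\<^sup>2)"
proof -
  have [measurable]: "v \<in> borel_measurable borel" using L2_measurable_borel[OF v] .
  have [measurable]: "(\<lambda>\<xi>. m \<xi> *v v \<xi>) \<in> borel_measurable borel" by (rule measurable_symbolD[OF m]) measurable
  define q where "q \<xi> = C\<^sup>2 * ((1 + \<xi>\<^sup>2) * (norm (v \<xi>))\<^sup>2) - (norm (m \<xi> *v v \<xi>))\<^sup>2" for \<xi>
  have [measurable]: "q \<in> borel_measurable borel" unfolding q_def by measurable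
  define E where "E = {\<xi>. q \<xi> < 0}"
  have E: "E \<in> sets borel" unfolding E_def by measurable
  let ?w = "\<lambda>\<xi>. (indicator E \<xi> * gauss_weight \<xi>) *\<^sub>R v \<xi>"
  note w = gauss_cut_sobolev[OF v E]
  note u = inv_fourier_spec[OF w(1)]
  have ud: "inv_fourier ?w \<in> fm_dom m" using dom w(2) by blast
  note fu = fm_spec[OF m ud w(1) u(2)]
  have mwL: "(\<lambda>\<xi>. m \<xi> *v ?w \<xi>) \<in> L2" using fm_dom_iff[OF m u(1) w(1) u(2)] ud by simp
  have pt: "C\<^sup>2 * ((1 + \<xi>\<^sup>2) * (norm (?w \<xi>))\<^sup>2) - (m \<xi> *v ?w \<xi>) \<bullet> (m \<xi> *v ?w \<xi>) = indicator {\<xi>. q \<xi> < 0} \<xi> * (gauss_weight \<xi>)\<^sup>2 * q \<xi>" for \<xi>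
    by (cases "\<xi> \<in> E") (simp_all add: mat_scaleR q_def E_def power_mult_distrib power2_eq_square dot_square_norm algebra_simps)
  note i1 = integrable_inner_L2[OF mwL mwL]
  have "AE \<xi> in lborel. 0 \<le> q \<xi>"
  proof (rule AE_nonneg_by_testing[OF gauss_weight(1)])
    show "integrable lborel (\<lambda>\<xi>. indicator {\<xi>. q \<xi> < 0} \<xi> * (gauss_weight \<xi>)\<^sup>2 * q \<xi>)"
      unfolding pt[symmetric] by (intro Bochner_Integration.integrable_diff integrable_mult_right i1 w(4))
    have "norm (cls (fm m (inv_fourier ?w))) \<le> C * sobolev_norm 1 (inv_fourier ?w)"
      using bd[OF w(2)] unfolding cls_norm[OF fu(1)] .
    then have "(norm (cls (fm m (inv_fourier ?w))))\<^sup>2 \<le> (C * sobolev_norm 1 (inv_fourier ?w))\<^sup>2" by (intro power_mono) simp_all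
    then have "2 * pi * (cls (fm m (inv_fourier ?w)) \<bullet> cls (fm m (inv_fourier ?w))) \<le> 2 * pi * (C\<^sup>2 * (sobolev_norm 1 (inv_fourier ?w))\<^sup>2)"
      unfolding power_mult_distrib power2_norm_eq_inner by (intro mult_left_mono) simp_all
    then have "(LINT \<xi>|lborel. (m \<xi> *v ?w \<xi>) \<bullet> (m \<xi> *v ?w \<xi>)) \<le> C\<^sup>2 * (LINT \<xi>|lborel. (1 + \<xi>\<^sup>2) * (norm (?w \<xi>))\<^sup>2)"
      unfolding Parseval_fun[OF fu(1) fu(1) mwL mwL fu(2) fu(2)] sobolev_norm1_sq[OF u(1) w(1) u(2), symmetric]
      by (simp only: mult.left_commute)
    moreover have "(LINT \<xi>|lborel. indicator {\<xi>. q \<xi> < 0} \<xi> * (gauss_weight \<xi>)\<^sup>2 * q \<xi>)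
      = C\<^sup>2 * (LINT \<xi>|lborel. (1 + \<xi>\<^sup>2) * (norm (?w \<xi>))\<^sup>2) - (LINT \<xi>|lborel. (m \<xi> *v ?w \<xi>) \<bullet> (m \<xi> *v ?w \<xi>))"
      unfolding pt[symmetric] by (simp only: Bochner_Integration.integral_diff[OF integrable_mult_right[OF w(4)] i1] integral_mult_right_zero)
    ultimately show "0 \<le> (LINT \<xi>|lborel. indicator {\<xi>. q \<xi> < 0} \<xi> * (gauss_weight \<xi>)\<^sup>2 * q \<xi>)" by linarith
  qed
  then show ?thesis by (rule eventually_mono) (simp add: q_def)
qed

lemma real_valued_iff: assumes u: "u \<in> L2" shows "real_valued u \<longleftrightarrow> Conj (cls u) = cls u"
proof -
  have "Conj (cls u) = cls u \<longleftrightarrow> (AE x in lborel. cnjv (u x) = u x)"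
    unfolding Conj_cls[OF u] cls_eq_iff[OF L2_cnjv[OF u] u] ae_eq_def ..
  also have "\<dots> \<longleftrightarrow> (AE x in lborel. \<forall>i. u x $ i \<in> \<real>)"
    by (simp add: vec_eq_iff Reals_cnj_iff)
  finally show ?thesis by (simp add: real_valued_def)
qed

text \<open>The symbols of real operators, that is, \<open>m(-\<xi>)\<close> is the complex conjugate of \<open>m(\<xi>)\<close>.\<close>

definition conj_sym :: "'d::finite symbol \<Rightarrow> bool" where
  "conj_sym m \<longleftrightarrow> (AE \<xi> in lborel. \<forall>x. m \<xi> *v cnjv x = cnjv (m (- \<xi>) *v x))"

text \<open>Test functions with even transforms proportional to a standard basis vector are real-valued, and so
  are their images; the latter determine the columns of the symbol.\<close>

lemma conj_symI:
  fixes m :: "'d::finite symbol"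
  assumes m: "measurable_symbol m"
    and real: "\<And>u. u \<in> fm_dom m \<Longrightarrow> real_valued u \<Longrightarrow> real_valued (fm m u)"
  shows "conj_sym m"
proof -
  have col: "AE \<xi> in lborel. cnjv (m (- \<xi>) *v axis k 1) = m \<xi> *v axis k 1" for k :: 'd
  proof -
    let ?e = "axis k 1 :: complex^'d"
    have me: "(\<lambda>\<xi>. m \<xi> *v ?e) \<in> borel_measurable borel" by (rule measurable_symbolD[OF m]) simp
    note [measurable] = gauss_weight(3) me
    have [measurable]: "(\<lambda>\<xi>. m (- \<xi>) *v ?e) \<in> borel_measurable borel"
      by (rule measurable_compose[OF _ me]) measurable
    define W where "W \<xi> = 1 + norm (m \<xi> *v ?e) + norm (m (- \<xi>) *v ?e)" for \<xi>
    define \<rho> where "\<rho> \<xi> = gauss_weight \<xi> / W \<xi>" for \<xi>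
    have [measurable]: "W \<in> borel_measurable borel" "\<rho> \<in> borel_measurable borel" unfolding W_def \<rho>_def by measurable
    have W1: "W \<xi> \<ge> 1" for \<xi> by (simp add: W_def)
    have \<rho>0: "\<rho> \<xi> > 0" for \<xi> using gauss_weight(1)[of \<xi>] W1[of \<xi>] by (simp add: \<rho>_def)
    have even: "\<rho> (- \<xi>) = \<rho> \<xi>" for \<xi> by (simp add: \<rho>_def W_def gauss_weight_def add.commute add.left_commute)
    have \<rho>W: "\<rho> \<xi> * t \<le> gauss_weight \<xi>" if "t \<le> W \<xi>" for t \<xi>
    proof -
      have "\<rho> \<xi> * t \<le> \<rho> \<xi> * W \<xi>" using that \<rho>0[of \<xi>] by (intro mult_left_mono) simp_all
      then show ?thesis using W1[of \<xi>] by (simp add: \<rho>_def)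
    qed
    let ?w = "\<lambda>\<xi>. \<rho> \<xi> *\<^sub>R ?e"
    have w: "?w \<in> L2"
    proof (rule L2_gauss_weight[where C = "norm ?e"])
      show "norm (?w \<xi>) \<le> norm ?e * gauss_weight \<xi>" for \<xi>
        using mult_right_mono[OF \<rho>W[OF W1[of \<xi>]], of "norm ?e"] \<rho>0[of \<xi>] by (simp add: mult.commute)
    qed measurable
    have mw: "(\<lambda>\<xi>. m \<xi> *v ?w \<xi>) = (\<lambda>\<xi>. \<rho> \<xi> *\<^sub>R (m \<xi> *v ?e))" by (simp only: mat_scaleR)
    have mwL: "(\<lambda>\<xi>. m \<xi> *v ?w \<xi>) \<in> L2" unfolding mw
    proof (rule L2_gauss_weight[where C = 1])
      fix \<xi>
      have "norm (m \<xi> *v ?e) \<le> W \<xi>" using norm_ge_zero[of "m (- \<xi>) *v ?e"] unfolding W_def by linarith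
      from \<rho>W[OF this] show "norm (\<rho> \<xi> *\<^sub>R (m \<xi> *v ?e)) \<le> 1 * gauss_weight \<xi>" using \<rho>0[of \<xi>] by simp
    qed measurable
    note u = inv_fourier_spec[OF w]
    have ce: "cnjv ?e = ?e" by (simp add: vec_eq_iff axis_def)
    have "Conj (refl_lsq (cls ?w)) = cls ?w"
      by (simp add: refl_cls w Conj_cls L2_refl even cnjv_scaleR ce)
    then have "FT (Conj (cls (inv_fourier ?w))) = FT (cls (inv_fourier ?w))" by (simp add: FT_Conj u(2))
    then have "real_valued (inv_fourier ?w)" using real_valued_iff[OF u(1)] FT_inj by blast
    moreover have ud: "inv_fourier ?w \<in> fm_dom m" using fm_dom_iff[OF m u(1) w u(2)] mwL by simp
    ultimately have r: "real_valued (fm m (inv_fourier ?w))" using real by blast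
    note fu = fm_spec[OF m ud w u(2)]
    have "Conj (refl_lsq (cls (\<lambda>\<xi>. m \<xi> *v ?w \<xi>))) = cls (\<lambda>\<xi>. m \<xi> *v ?w \<xi>)"
      using r real_valued_iff[OF fu(1)] FT_Conj[of "cls (fm m (inv_fourier ?w))"] fu(2) by simp
    then have "cls (\<lambda>\<xi>. cnjv (m (- \<xi>) *v ?w (- \<xi>))) = cls (\<lambda>\<xi>. m \<xi> *v ?w \<xi>)"
      by (simp add: refl_cls[OF mwL] Conj_cls[OF L2_refl[OF mwL]])
    then have "(\<lambda>\<xi>. cnjv (m (- \<xi>) *v ?w (- \<xi>))) \<doteq> (\<lambda>\<xi>. m \<xi> *v ?w \<xi>)"
      by (subst (asm) cls_eq_iff[OF L2_cnjv[OF L2_refl[OF mwL]] mwL])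
    then show ?thesis unfolding ae_eq_def
    proof (rule eventually_mono)
      fix \<xi> assume "cnjv (m (- \<xi>) *v ?w (- \<xi>)) = m \<xi> *v ?w \<xi>"
      then have "\<rho> \<xi> *\<^sub>R cnjv (m (- \<xi>) *v ?e) = \<rho> \<xi> *\<^sub>R (m \<xi> *v ?e)" by (simp only: mat_scaleR cnjv_scaleR even)
      then show "cnjv (m (- \<xi>) *v ?e) = m \<xi> *v ?e" using \<rho>0[of \<xi>] by simp
    qed
  qed
  have "AE \<xi> in lborel. \<forall>k. cnjv (m (- \<xi>) *v axis k 1) = m \<xi> *v axis k 1"
    using AE_finite_allI[where S = UNIV, OF finite col] by simp
  then show ?thesis unfolding conj_sym_def
  proof (rule eventually_mono)
    fix \<xi> assume *: "\<forall>k. cnjv (m (- \<xi>) *v axis k 1) = m \<xi> *v axis k 1"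
    have ent: "cnj (m (- \<xi>) $ i $ k) = m \<xi> $ i $ k" for i k
      using arg_cong[OF *[rule_format, of k], of "\<lambda>z. z $ i"] by (simp add: matrix_vector_mult_def axis_def if_distrib cong: if_cong)
    show "\<forall>x. m \<xi> *v cnjv x = cnjv (m (- \<xi>) *v x)"
      by (simp add: vec_eq_iff matrix_vector_mult_def ent[symmetric])
  qed
qed

lemma conj_sym_prod:
  assumes m: "conj_sym m" and n: "conj_sym n" shows "conj_sym (m \<odot> n)"
  using m n unfolding conj_sym_def by eventually_elim (simp add: sym_prod_mult)

section \<open>The multiplication operator\<close>

lemma has_derivative_along_line:
  fixes F :: "real ^ 'd::finite \<Rightarrow> real"
  assumes "\<And>a. F differentiable (at a)"
  shows "((\<lambda>s. F (p + s *\<^sub>R axis i 1)) has_real_derivative partial_deriv i F (p + s *\<^sub>R axis i 1)) (at s)"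
proof -
  let ?D = "frechet_derivative F (at (p + s *\<^sub>R axis i 1))"
  have D: "(F has_derivative ?D) (at (p + s *\<^sub>R axis i 1))"
    using assms frechet_derivative_works by blast
  have l: "((\<lambda>s. p + s *\<^sub>R axis i (1::real)) has_derivative (\<lambda>h. h *\<^sub>R axis i 1)) (at s)"
    by (auto intro!: derivative_eq_intros)
  have "((\<lambda>s. F (p + s *\<^sub>R axis i 1)) has_derivative (\<lambda>h. ?D (h *\<^sub>R axis i 1))) (at s)"
    by (rule has_derivative_compose[OF l D])
  moreover have "(\<lambda>h. ?D (h *\<^sub>R axis i 1)) = (*) (?D (axis i 1))"
    using linear_scale[OF has_derivative_linear[OF D]] by (auto simp: mult.commute)
  ultimately show ?thesis by (simp add: has_field_derivative_def partial_deriv_def)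
qed

text \<open>The second difference quotient in the directions \<open>i\<close> and \<open>j\<close> is symmetric in them; the mean value theorem
  in each direction expresses it as a mixed second derivative.\<close>

lemma second_difference:
  fixes F :: "real ^ 'd::finite \<Rightarrow> real"
  assumes F: "\<And>a. F differentiable (at a)" and Fi: "\<And>a. partial_deriv i F differentiable (at a)" and h: "0 < h"
  shows "\<exists>s t. 0 < s \<and> s < h \<and> 0 < t \<and> t < h \<and>
    F (a + h *\<^sub>R axis j 1 + h *\<^sub>R axis i 1) - F (a + h *\<^sub>R axis i 1) - F (a + h *\<^sub>R axis j 1) + F a
      = h * (h * partial_deriv j (partial_deriv i F) (a + s *\<^sub>R axis i 1 + t *\<^sub>R axis j 1))"
proof -
  let ?ei = "axis i (1::real)" and ?ej = "axis j (1::real)"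
  let ?\<phi> = "\<lambda>s. F (a + h *\<^sub>R ?ej + s *\<^sub>R ?ei) - F (a + s *\<^sub>R ?ei)"
  have "\<exists>s. 0 < s \<and> s < h \<and> ?\<phi> h - ?\<phi> 0 = (h - 0) *
      (partial_deriv i F (a + h *\<^sub>R ?ej + s *\<^sub>R ?ei) - partial_deriv i F (a + s *\<^sub>R ?ei))"
    by (rule MVT2[OF h]) (intro DERIV_diff has_derivative_along_line F)
  then obtain s where s: "0 < s" "s < h" "?\<phi> h - ?\<phi> 0 = h *
      (partial_deriv i F (a + h *\<^sub>R ?ej + s *\<^sub>R ?ei) - partial_deriv i F (a + s *\<^sub>R ?ei))" by auto
  let ?\<psi> = "\<lambda>t. partial_deriv i F (a + s *\<^sub>R ?ei + t *\<^sub>R ?ej)"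
  have "\<exists>t. 0 < t \<and> t < h \<and> ?\<psi> h - ?\<psi> 0 = (h - 0) * partial_deriv j (partial_deriv i F) (a + s *\<^sub>R ?ei + t *\<^sub>R ?ej)"
    by (rule MVT2[OF h]) (intro has_derivative_along_line Fi)
  then obtain t where t: "0 < t" "t < h"
    "?\<psi> h - ?\<psi> 0 = h * partial_deriv j (partial_deriv i F) (a + s *\<^sub>R ?ei + t *\<^sub>R ?ej)" by auto
  have c: "a + h *\<^sub>R ?ej + s *\<^sub>R ?ei = a + s *\<^sub>R ?ei + h *\<^sub>R ?ej" by simp
  have "?\<phi> h - ?\<phi> 0 = h * (h * partial_deriv j (partial_deriv i F) (a + s *\<^sub>R ?ei + t *\<^sub>R ?ej))"
    unfolding s(3) c using t(3) by simp
  then show ?thesis using s(1,2) t(1,2) by (intro exI[of _ s] exI[of _ t]) simp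
qed

lemma partial_derivs_commute:
  fixes F :: "real ^ 'd::finite \<Rightarrow> real"
  assumes F: "Ck 2 F" shows "partial_deriv i (partial_deriv j F) a = partial_deriv j (partial_deriv i F) a"
proof (rule ccontr)
  have C: "\<And>a. F differentiable (at a)" "\<And>i a. partial_deriv i F differentiable (at a)"
    "\<And>i k. continuous_on UNIV (partial_deriv k (partial_deriv i F))"
    using F by (auto simp: numeral_2_eq_2)
  let ?f = "partial_deriv i (partial_deriv j F)" and ?g = "partial_deriv j (partial_deriv i F)"
  assume ne: "?f a \<noteq> ?g a"
  define e where "e = \<bar>?f a - ?g a\<bar> / 2"
  have e: "e > 0" using ne by (simp add: e_def)
  obtain d1 where d1: "d1 > 0" "\<And>x. dist x a < d1 \<Longrightarrow> dist (?f x) (?f a) < e"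
    using C(3)[of i j] e unfolding continuous_on_iff by (metis UNIV_I)
  obtain d2 where d2: "d2 > 0" "\<And>x. dist x a < d2 \<Longrightarrow> dist (?g x) (?g a) < e"
    using C(3)[of j i] e unfolding continuous_on_iff by (metis UNIV_I)
  define h where "h = min d1 d2 / 3"
  have h: "h > 0" using d1 d2 by (simp add: h_def)
  have near: "dist (a + s *\<^sub>R axis k 1 + t *\<^sub>R axis l 1) a < min d1 d2" if "0 < s" "s < h" "0 < t" "t < h" for s t and k l :: 'd
  proof -
    have "norm (s *\<^sub>R axis k (1::real) + t *\<^sub>R axis l 1) \<le> \<bar>s\<bar> + \<bar>t\<bar>"
      by (rule order_trans[OF norm_triangle_ineq]) (simp add: norm_axis_1)
    also have "\<dots> < 3 * h" using that by simp
    finally show ?thesis by (simp add: dist_norm add.assoc h_def)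
  qed
  obtain s t where st: "0 < s" "s < h" "0 < t" "t < h"
    "F (a + h *\<^sub>R axis j 1 + h *\<^sub>R axis i 1) - F (a + h *\<^sub>R axis i 1) - F (a + h *\<^sub>R axis j 1) + F a
      = h * (h * ?g (a + s *\<^sub>R axis i 1 + t *\<^sub>R axis j 1))"
    using second_difference[OF C(1,2) h] by blast
  obtain s' t' where st': "0 < s'" "s' < h" "0 < t'" "t' < h"
    "F (a + h *\<^sub>R axis i 1 + h *\<^sub>R axis j 1) - F (a + h *\<^sub>R axis j 1) - F (a + h *\<^sub>R axis i 1) + F a
      = h * (h * ?f (a + s' *\<^sub>R axis j 1 + t' *\<^sub>R axis i 1))"
    using second_difference[OF C(1,2) h] by blast
  have comm: "a + h *\<^sub>R axis i 1 + h *\<^sub>R axis j 1 = a + h *\<^sub>R axis j 1 + h *\<^sub>R axis i 1" by simp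
  have "h * (h * ?g (a + s *\<^sub>R axis i 1 + t *\<^sub>R axis j 1)) = h * (h * ?f (a + s' *\<^sub>R axis j 1 + t' *\<^sub>R axis i 1))"
    using st(5) st'(5) unfolding comm by linarith
  then have eq: "?g (a + s *\<^sub>R axis i 1 + t *\<^sub>R axis j 1) = ?f (a + s' *\<^sub>R axis j 1 + t' *\<^sub>R axis i 1)" using h by simp
  have 1: "dist (?g (a + s *\<^sub>R axis i 1 + t *\<^sub>R axis j 1)) (?g a) < e" using d2(2) near[OF st(1-4)] by simp
  have 2: "dist (?f (a + s' *\<^sub>R axis j 1 + t' *\<^sub>R axis i 1)) (?f a) < e" using d1(2) near[OF st'(1-4)] by simp
  have "\<bar>?f a - ?g a\<bar> < e + e"
    using dist_triangle2[of "?f a" "?g a" "?g (a + s *\<^sub>R axis i 1 + t *\<^sub>R axis j 1)"] 1 2 eq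
    by (simp add: dist_commute dist_real_def)
  then show False by (simp add: e_def)
qed

lemma hessian_symmetric: "smooth_fun F \<Longrightarrow> hessian F a $ i $ k = hessian F a $ k $ i"
  using partial_derivs_commute[of F i k a] by (simp add: hessian_def smooth_fun_def)

lemma hessian_continuous: "smooth_fun F \<Longrightarrow> continuous_on UNIV (\<lambda>a. hessian F a $ i $ k)"
proof -
  assume "smooth_fun F"
  then have "Ck 2 F" by (simp add: smooth_fun_def)
  then show ?thesis by (simp add: numeral_2_eq_2 hessian_def)
qed

lemma norm_mat_vec_le:
  fixes A :: "complex^'d::finite^'d"
  assumes B: "\<And>i k. cmod (A $ i $ k) \<le> B"
  shows "norm (A *v x) \<le> (real CARD('d) * (real CARD('d) * B)) * norm x"
proof -
  have c: "cmod ((A *v x) $ i) \<le> real CARD('d) * B * norm x" for i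
  proof -
    have "cmod ((A *v x) $ i) \<le> (\<Sum>k\<in>UNIV. cmod (A $ i $ k * x $ k))"
      unfolding matrix_vector_mult_def by (simp add: norm_sum)
    also have "\<dots> \<le> (\<Sum>k\<in>(UNIV::'d set). B * norm x)"
    proof (rule sum_mono)
      fix k
      have "cmod (A $ i $ k) * cmod (x $ k) \<le> B * norm x"
        by (rule mult_mono[OF B Finite_Cartesian_Product.norm_nth_le]) (use order_trans[OF norm_ge_zero B] in auto)
      then show "cmod (A $ i $ k * x $ k) \<le> B * norm x" by (simp add: norm_mult)
    qed
    finally show ?thesis by simp
  qed
  have "norm (A *v x) \<le> (\<Sum>i\<in>UNIV. cmod ((A *v x) $ i))" by (simp add: norm_vec_def L2_set_le_sum)
  also have "\<dots> \<le> (\<Sum>i\<in>(UNIV::'d set). real CARD('d) * B * norm x)" by (rule sum_mono) (rule c)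
  finally show ?thesis by simp
qed

lemma integrable_inverse_square: "integrable lborel (\<lambda>\<xi>::real. 1 / (1 + \<xi>\<^sup>2))"
  using integrable_inverse_1_plus_square by (simp add: set_integrable_def einterval_eq inverse_eq_divide)

text \<open>The transform of an \<open>H\<^sup>1\<close> function is integrable: by \<open>2ab \<le> a\<^sup>2 + b\<^sup>2\<close> it is dominated by
  \<open>1/(1 + \<xi>\<^sup>2)\<close> plus the square of its product with the Bessel weight.\<close>

lemma sobolev_embedding:
  assumes "u \<in> sobolev 1" shows "\<exists>B. AE x in lborel. norm (u x) \<le> B"
proof -
  have u: "u \<in> L2" and b: "bessel 1 u \<in> L2" using assms by (auto simp: sobolev_def)
  note v = fourier_spec[OF u]
  have [measurable]: "fourier u \<in> borel_measurable borel" using L2_measurable_borel[OF v(1)] .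
  have "integrable lborel (fourier u)"
  proof (rule Bochner_Integration.integrable_bound)
    show "integrable lborel (\<lambda>\<xi>. 1 / (1 + \<xi>\<^sup>2) + (norm (bessel 1 u \<xi>))\<^sup>2)"
      by (intro Bochner_Integration.integrable_add integrable_inverse_square L2_integrable b)
    show "AE \<xi> in lborel. norm (fourier u \<xi>) \<le> norm (1 / (1 + \<xi>\<^sup>2) + (norm (bessel 1 u \<xi>))\<^sup>2)"
    proof (rule AE_I2)
      fix \<xi> :: real
      define t where "t = (1 + \<xi>\<^sup>2) powr (1/2)"
      have t0: "t > 0" using add_pos_nonneg[of 1 "\<xi>\<^sup>2"] by (simp add: t_def)
      have t2: "t\<^sup>2 = 1 + \<xi>\<^sup>2" using add_pos_nonneg[of 1 "\<xi>\<^sup>2"] by (simp add: t_def powr_half_sqrt)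
      have nb: "norm (bessel 1 u \<xi>) = t * norm (fourier u \<xi>)" using t0 by (simp add: bessel_def t_def)
      let ?n = "norm (fourier u \<xi>)"
      have "2 * ((1 / t) * (t * ?n)) \<le> (1 / t)\<^sup>2 + (t * ?n)\<^sup>2"
        using zero_le_power2[of "1 / t - t * ?n"] by (simp add: power2_eq_square algebra_simps)
      moreover have "(1 / t) * (t * ?n) = ?n" using t0 by simp
      moreover have "(1 / t)\<^sup>2 = 1 / (1 + \<xi>\<^sup>2)" by (simp add: power_divide t2)
      ultimately have "2 * ?n \<le> 1 / (1 + \<xi>\<^sup>2) + (norm (bessel 1 u \<xi>))\<^sup>2" by (simp only: nb)
      then have "?n \<le> 1 / (1 + \<xi>\<^sup>2) + (norm (bessel 1 u \<xi>))\<^sup>2" using norm_ge_zero[of "fourier u \<xi>"] by linarith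
      then show "?n \<le> norm (1 / (1 + \<xi>\<^sup>2) + (norm (bessel 1 u \<xi>))\<^sup>2)" by (simp add: order_trans[OF _ abs_ge_self])
    qed
  qed measurable
  then have "fourier u \<in> L1_L2" using v(1) by (simp add: L1_L2_def)
  from bounded_if_transform_integrable[OF u this v(2)[symmetric]] show ?thesis by blast
qed

context one_dim_model
begin

lemma Q_measurable: "Q \<in> borel_measurable borel"
proof -
  have "(\<lambda>x. cvec (Q x)) \<in> L2" using Q_smooth by (auto simp: sobolev_inf_def sobolev_def)
  then have [measurable]: "(\<lambda>x. cvec (Q x)) \<in> borel_measurable borel" by (rule L2_measurable_borel)
  have "(\<lambda>x. Re (cvec (Q x) $ i)) \<in> borel_measurable borel" for i by measurable
  then have c: "(\<lambda>x. Q x $ i) \<in> borel_measurable borel" for i by (simp add: cvec_def)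
  show ?thesis
  proof (subst borel_measurable_euclidean_space, intro ballI)
    fix b :: "real ^ 'd" assume "b \<in> Basis"
    then obtain i where "b = axis i 1" by (auto simp: Basis_vec_def)
    then show "(\<lambda>x. Q x \<bullet> b) \<in> borel_measurable borel" using c[of i] by (simp add: inner_axis)
  qed
qed

text \<open>The values of \<open>Q\<close> stay in a ball, up to a null set, and the Hessian is bounded on it.\<close>

lemma hessian_Q_bounded: "\<exists>B. AE x in lborel. \<forall>i k. \<bar>hessian F (Q x) $ i $ k\<bar> \<le> B"
proof -
  have "(\<lambda>x. cvec (Q x)) \<in> sobolev 1" using Q_smooth by (auto simp: sobolev_inf_def)
  from sobolev_embedding[OF this] obtain B0 where B0: "AE x in lborel. norm (cvec (Q x)) \<le> B0" by blast
  have nc: "norm (cvec a) = norm a" for a :: "real ^ 'd" by (simp add: cvec_def norm_vec_def)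
  have "\<exists>B. \<forall>a\<in>cball 0 B0. \<bar>hessian F a $ i $ k\<bar> \<le> B" for i k
  proof -
    have "compact ((\<lambda>a. hessian F a $ i $ k) ` cball 0 B0)"
      by (rule compact_continuous_image[OF continuous_on_subset[OF hessian_continuous[OF F_smooth]] compact_cball]) simp
    then have "bounded ((\<lambda>a. hessian F a $ i $ k) ` cball 0 B0)" by (rule compact_imp_bounded)
    then show ?thesis unfolding bounded_iff by auto
  qed
  then obtain B where B: "\<And>i k a. a \<in> cball 0 B0 \<Longrightarrow> \<bar>hessian F a $ i $ k\<bar> \<le> B i k" by metis
  define B' where "B' = (\<Sum>i\<in>UNIV. \<Sum>k\<in>UNIV. \<bar>B i k\<bar>)"
  have "B i k \<le> B'" for i k
  proof -
    have "B i k \<le> \<bar>B i k\<bar>" by simp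
    also have "\<dots> \<le> (\<Sum>k\<in>UNIV. \<bar>B i k\<bar>)" by (rule member_le_sum) simp_all
    also have "\<dots> \<le> B'" unfolding B'_def by (rule member_le_sum[where f = "\<lambda>i. \<Sum>k\<in>UNIV. \<bar>B i k\<bar>"]) (simp_all add: sum_nonneg)
    finally show ?thesis .
  qed
  then have "\<bar>hessian F a $ i $ k\<bar> \<le> B'" if "norm a \<le> B0" for a i k
    using B[of a i k] that by (meson mem_cball_0 order_trans)
  then have "AE x in lborel. \<forall>i k. \<bar>hessian F (Q x) $ i $ k\<bar> \<le> B'"
    using B0 by (rule_tac eventually_mono[OF B0]) (simp add: nc)
  then show ?thesis by blast
qed

text \<open>\<open>Q\<close> is essentially bounded by the Sobolev embedding, hence so is the continuous function
  \<open>\<nabla>\<^sup>2F\<close> of \<open>Q\<close>.\<close>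

lemma R_op_L2:
  "\<exists>K\<ge>0. \<forall>u\<in>L2. R_op F Q u \<in> L2 \<and> norm (cls (R_op F Q u)) \<le> K * norm (cls u)"
proof -
  obtain B where B: "AE x in lborel. \<forall>i k. \<bar>hessian F (Q x) $ i $ k\<bar> \<le> B" using hessian_Q_bounded by blast
  define K where "K = \<bar>real CARD('d) * (real CARD('d) * B)\<bar>"
  have "R_op F Q u \<in> L2 \<and> norm (cls (R_op F Q u)) \<le> K * norm (cls u)" if u: "u \<in> L2" for u
  proof -
    have [measurable]: "u \<in> borel_measurable borel" using L2_measurable_borel[OF u] .
    have [measurable]: "(\<lambda>x. hessian F (Q x) $ i $ k) \<in> borel_measurable borel" for i k
      by (rule borel_measurable_continuous_on[OF hessian_continuous[OF F_smooth] Q_measurable])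
    have [measurable]: "R_op F Q u \<in> borel_measurable borel"
      unfolding R_op_def by (rule measurable_vecI) (simp add: matrix_vector_mult_def cmat_def)
    have le: "AE x in lborel. norm (R_op F Q u x) \<le> K * norm (u x)"
      using B
    proof (rule eventually_mono)
      fix x assume "\<forall>i k. \<bar>hessian F (Q x) $ i $ k\<bar> \<le> B"
      then have "norm (cmat (hessian F (Q x)) *v u x) \<le> (real CARD('d) * (real CARD('d) * B)) * norm (u x)"
        by (intro norm_mat_vec_le) (simp add: cmat_def)
      also have "\<dots> \<le> K * norm (u x)" unfolding K_def by (intro mult_right_mono) simp_all
      finally show "norm (R_op F Q u x) \<le> K * norm (u x)" by (simp add: R_op_def)
    qed
    have RL: "R_op F Q u \<in> L2" by (rule L2_dominated[OF _ u le]) measurable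
    have "(norm (cls (R_op F Q u)))\<^sup>2 \<le> K\<^sup>2 * (norm (cls u))\<^sup>2"
    proof -
      have "(LINT x|lborel. (norm (R_op F Q u x))\<^sup>2) \<le> (LINT x|lborel. K\<^sup>2 * (norm (u x))\<^sup>2)"
      proof (rule integral_mono_AE)
        show "AE x in lborel. (norm (R_op F Q u x))\<^sup>2 \<le> K\<^sup>2 * (norm (u x))\<^sup>2"
          using le by (rule eventually_mono) (simp add: power_mult_distrib[symmetric] power_mono)
      qed (use L2_integrable[OF RL] L2_integrable[OF u] in simp_all)
      then show ?thesis by (simp add: cls_norm RL u l2_norm_def)
    qed
    then have "(norm (cls (R_op F Q u)))\<^sup>2 \<le> (K * norm (cls u))\<^sup>2" by (simp add: power_mult_distrib)
    then have "norm (cls (R_op F Q u)) \<le> K * norm (cls u)" by (rule power2_le_imp_le) (simp add: K_def)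
    with RL show ?thesis by blast
  qed
  then show ?thesis by (intro exI[of _ K]) (simp add: K_def)
qed

lemma R_op_pointwise:
  "(cmat (hessian F a) *v x) \<bullet> y = x \<bullet> (cmat (hessian F a) *v y)"
  "cnjv (cmat (hessian F a) *v x) = cmat (hessian F a) *v cnjv x"
proof -
  have "(cmat (hessian F a) *v x) \<bullet> y = (\<Sum>i\<in>UNIV. \<Sum>k\<in>UNIV. hessian F a $ i $ k * Re (x $ k * cnj (y $ i)))"
    by (simp add: inner_cvec matrix_vector_mult_def cmat_def sum_distrib_right sum_distrib_left algebra_simps)
  also have "\<dots> = (\<Sum>k\<in>UNIV. \<Sum>i\<in>UNIV. hessian F a $ k $ i * Re (x $ k * cnj (y $ i)))"
    by (subst sum.swap) (simp only: hessian_symmetric[OF F_smooth])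
  also have "\<dots> = x \<bullet> (cmat (hessian F a) *v y)"
    by (simp add: inner_cvec matrix_vector_mult_def cmat_def sum_distrib_right sum_distrib_left algebra_simps)
  finally show "(cmat (hessian F a) *v x) \<bullet> y = x \<bullet> (cmat (hessian F a) *v y)" .
  show "cnjv (cmat (hessian F a) *v x) = cmat (hessian F a) *v cnjv x"
    by (simp add: vec_eq_iff matrix_vector_mult_def cmat_def)
qed

end

section \<open>Operators on classes\<close>

text \<open>Operators and domains are transported to classes by means of arbitrary representatives; for the
  operators of the model the choice is immaterial.\<close>

definition lift_op :: "('d::finite vfun \<Rightarrow> 'd vfun) \<Rightarrow> 'd lsq \<Rightarrow> 'd lsq" where
  "lift_op T f = cls (T (rep f))"

definition lift_dom :: "'d::finite vfun set \<Rightarrow> 'd lsq set" where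
  "lift_dom D = {f. rep f \<in> D}"

lemma lift_dom_fm_iff:
  assumes "measurable_symbol m" "v \<in> L2" "FT f = cls v"
  shows "f \<in> lift_dom (fm_dom m) \<longleftrightarrow> (\<lambda>\<xi>. m \<xi> *v v \<xi>) \<in> L2"
  using fm_dom_iff[OF assms(1) rep_L2 assms(2), of f] assms(3) by (simp add: lift_dom_def)

lemma FT_lift_op_fm:
  assumes "measurable_symbol m" "f \<in> lift_dom (fm_dom m)" "v \<in> L2" "FT f = cls v"
  shows "FT (lift_op (fm m) f) = cls (\<lambda>\<xi>. m \<xi> *v v \<xi>)"
  using fm_spec(2)[OF assms(1) _ assms(3), of "rep f"] assms by (simp add: lift_op_def lift_dom_def)

lemma lift_dom_fm_cls: "u \<in> L2 \<Longrightarrow> cls u \<in> lift_dom (fm_dom m) \<longleftrightarrow> u \<in> fm_dom m"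
  using fm_dom_cong[of "rep (cls u)" u m] rep_cls[of u] by (simp add: lift_dom_def)

lemma lift_op_fm_cls: "u \<in> L2 \<Longrightarrow> lift_op (fm m) (cls u) = cls (fm m u)"
  using fm_cong[of "rep (cls u)" u m] rep_cls[of u] by (simp add: lift_op_def)

lemma FT_rep: obtains v where "v \<in> L2" "FT f = cls v"
  using rep_L2 cls_rep by metis

lemma FT_0: "FT 0 = 0" using FT_lin(2)[of 0 0] by simp

lemma L2_mult_L2_add: "(\<lambda>\<xi>. m \<xi> *v v \<xi>) \<in> L2 \<Longrightarrow> (\<lambda>\<xi>. m \<xi> *v w \<xi>) \<in> L2 \<Longrightarrow> (\<lambda>\<xi>. m \<xi> *v (v \<xi> + w \<xi>)) \<in> L2"
  unfolding matrix_vector_right_distrib by (rule L2_add)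

lemma lin_on_fm:
  assumes m: "measurable_symbol m" shows "lin_on (lift_dom (fm_dom m)) (lift_op (fm m))"
proof -
  have add: "f + g \<in> lift_dom (fm_dom m) \<and> lift_op (fm m) (f + g) = lift_op (fm m) f + lift_op (fm m) g"
    if f: "f \<in> lift_dom (fm_dom m)" and g: "g \<in> lift_dom (fm_dom m)" for f g
  proof -
    obtain v where v: "v \<in> L2" "FT f = cls v" by (rule FT_rep)
    obtain w where w: "w \<in> L2" "FT g = cls w" by (rule FT_rep)
    have fg: "FT (f + g) = cls (\<lambda>x. v x + w x)" unfolding FT_lin v(2) w(2) by (rule cls_add[OF v(1) w(1)])
    have mv: "(\<lambda>\<xi>. m \<xi> *v v \<xi>) \<in> L2" "(\<lambda>\<xi>. m \<xi> *v w \<xi>) \<in> L2"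
      using lift_dom_fm_iff[OF m v] lift_dom_fm_iff[OF m w] f g by auto
    have d: "f + g \<in> lift_dom (fm_dom m)"
      using lift_dom_fm_iff[OF m L2_add[OF v(1) w(1)] fg] L2_mult_L2_add[OF mv] by simp
    have "FT (lift_op (fm m) (f + g)) = cls (\<lambda>\<xi>. m \<xi> *v v \<xi> + m \<xi> *v w \<xi>)"
      using FT_lift_op_fm[OF m d L2_add[OF v(1) w(1)] fg] by (simp only: matrix_vector_right_distrib)
    also have "\<dots> = FT (lift_op (fm m) f + lift_op (fm m) g)"
      unfolding FT_lin FT_lift_op_fm[OF m f v] FT_lift_op_fm[OF m g w] by (rule cls_add[OF mv, symmetric])
    finally show ?thesis using d FT_inj by blast
  qed
  have sc: "c *\<^sub>R f \<in> lift_dom (fm_dom m) \<and> lift_op (fm m) (c *\<^sub>R f) = c *\<^sub>R lift_op (fm m) f"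
    if f: "f \<in> lift_dom (fm_dom m)" for c f
  proof -
    obtain v where v: "v \<in> L2" "FT f = cls v" by (rule FT_rep)
    have fg: "FT (c *\<^sub>R f) = cls (\<lambda>x. c *\<^sub>R v x)" unfolding FT_lin v(2) by (rule cls_scaleR[OF v(1)])
    have mv: "(\<lambda>\<xi>. m \<xi> *v v \<xi>) \<in> L2" using lift_dom_fm_iff[OF m v] f by auto
    have d: "c *\<^sub>R f \<in> lift_dom (fm_dom m)"
      using lift_dom_fm_iff[OF m L2_scaleR[OF v(1)] fg] L2_scaleR[OF mv] by (simp only: mat_scaleR)
    have "FT (lift_op (fm m) (c *\<^sub>R f)) = cls (\<lambda>\<xi>. c *\<^sub>R (m \<xi> *v v \<xi>))"
      using FT_lift_op_fm[OF m d L2_scaleR[OF v(1)] fg] by (simp only: mat_scaleR)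
    also have "\<dots> = FT (c *\<^sub>R lift_op (fm m) f)"
      unfolding FT_lin FT_lift_op_fm[OF m f v] by (rule cls_scaleR[OF mv, symmetric])
    finally show ?thesis using d FT_inj by blast
  qed
  have z: "0 \<in> lift_dom (fm_dom m)"
    using lift_dom_fm_iff[OF m, of "\<lambda>x. 0" 0] by (simp add: FT_0 cls_zero)
  show ?thesis unfolding lin_on_def subspace_def using add sc z by blast
qed

lemma cscale_fm:
  assumes m: "measurable_symbol m" and f: "f \<in> lift_dom (fm_dom m)"
  shows "cscale c f \<in> lift_dom (fm_dom m)" "lift_op (fm m) (cscale c f) = cscale c (lift_op (fm m) f)"
proof -
  obtain v where v: "v \<in> L2" "FT f = cls v" by (rule FT_rep)
  have fg: "FT (cscale c f) = cls (\<lambda>x. c *s v x)" unfolding FT_cscale v(2) by (rule cscale_cls[OF v(1)])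
  have mv: "(\<lambda>\<xi>. m \<xi> *v v \<xi>) \<in> L2" using lift_dom_fm_iff[OF m v] f by auto
  show d: "cscale c f \<in> lift_dom (fm_dom m)"
    using lift_dom_fm_iff[OF m L2_cscale[OF v(1)] fg] L2_cscale[OF mv] by (simp only: mat_cscale)
  have "FT (lift_op (fm m) (cscale c f)) = cls (\<lambda>\<xi>. c *s (m \<xi> *v v \<xi>))"
    using FT_lift_op_fm[OF m d L2_cscale[OF v(1)] fg] by (simp only: mat_cscale)
  also have "\<dots> = FT (cscale c (lift_op (fm m) f))"
    unfolding FT_cscale FT_lift_op_fm[OF m f v] by (rule cscale_cls[OF mv, symmetric])
  finally show "lift_op (fm m) (cscale c f) = cscale c (lift_op (fm m) f)" by (rule FT_inj)
qed

lemma Conj_fm: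
  assumes m: "measurable_symbol m" and cs: "conj_sym m" and f: "f \<in> lift_dom (fm_dom m)"
  shows "Conj f \<in> lift_dom (fm_dom m)" "lift_op (fm m) (Conj f) = Conj (lift_op (fm m) f)"
proof -
  obtain v where v: "v \<in> L2" "FT f = cls v" by (rule FT_rep)
  let ?v = "\<lambda>\<xi>. cnjv (v (- \<xi>))"
  have vL: "?v \<in> L2" by (rule L2_cnjv[OF L2_refl[OF v(1)]])
  have fg: "FT (Conj f) = cls ?v" unfolding FT_Conj v(2) refl_cls[OF v(1)] by (rule Conj_cls[OF L2_refl[OF v(1)]])
  have mv: "(\<lambda>\<xi>. m \<xi> *v v \<xi>) \<in> L2" using lift_dom_fm_iff[OF m v] f by auto
  have rmv: "(\<lambda>\<xi>. cnjv (m (- \<xi>) *v v (- \<xi>))) \<in> L2" by (rule L2_cnjv[OF L2_refl[OF mv]])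
  have eq: "(\<lambda>\<xi>. cnjv (m (- \<xi>) *v v (- \<xi>))) \<doteq> (\<lambda>\<xi>. m \<xi> *v ?v \<xi>)"
    using cs unfolding conj_sym_def ae_eq_def by (rule eventually_mono) simp
  have mvL: "(\<lambda>\<xi>. m \<xi> *v ?v \<xi>) \<in> L2"
    by (rule L2_ae_cong[OF rmv measurable_symbolD[OF m L2_measurable_borel[OF vL]] eq])
  show d: "Conj f \<in> lift_dom (fm_dom m)" using lift_dom_fm_iff[OF m vL fg] mvL by simp
  have "FT (lift_op (fm m) (Conj f)) = cls (\<lambda>\<xi>. m \<xi> *v ?v \<xi>)" by (rule FT_lift_op_fm[OF m d vL fg])
  also have "\<dots> = cls (\<lambda>\<xi>. cnjv (m (- \<xi>) *v v (- \<xi>)))"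
    using eq by (subst cls_eq_iff[OF mvL rmv]) (rule ae_eq_sym)
  also have "\<dots> = FT (Conj (lift_op (fm m) f))"
    unfolding FT_Conj FT_lift_op_fm[OF m f v] refl_cls[OF mv] by (rule Conj_cls[OF L2_refl[OF mv], symmetric])
  finally show "lift_op (fm m) (Conj f) = Conj (lift_op (fm m) f)" by (rule FT_inj)
qed

lemma Parseval_lsq:
  assumes "v \<in> L2" "w \<in> L2" "FT f = cls v" "FT g = cls w"
  shows "2 * pi * (f \<bullet> g) = (LINT \<xi>|lborel. v \<xi> \<bullet> w \<xi>)"
  using Parseval[of f g] unfolding assms(3,4) cls_inner[OF assms(1,2)] by simp

lemma adj_fm:
  assumes m: "measurable_symbol m" and adj: "AE \<xi> in lborel. \<forall>x y. (m \<xi> *v x) \<bullet> y = s * (x \<bullet> (m \<xi> *v y))"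
    and f: "f \<in> lift_dom (fm_dom m)" and g: "g \<in> lift_dom (fm_dom m)"
  shows "lift_op (fm m) f \<bullet> g = s * (f \<bullet> lift_op (fm m) g)"
proof -
  obtain v where v: "v \<in> L2" "FT f = cls v" by (rule FT_rep)
  obtain w where w: "w \<in> L2" "FT g = cls w" by (rule FT_rep)
  have mv: "(\<lambda>\<xi>. m \<xi> *v v \<xi>) \<in> L2" "(\<lambda>\<xi>. m \<xi> *v w \<xi>) \<in> L2"
    using lift_dom_fm_iff[OF m v] lift_dom_fm_iff[OF m w] f g by auto
  have "2 * pi * (lift_op (fm m) f \<bullet> g) = (LINT \<xi>|lborel. (m \<xi> *v v \<xi>) \<bullet> w \<xi>)"
    by (rule Parseval_lsq[OF mv(1) w(1) FT_lift_op_fm[OF m f v] w(2)])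
  also have "\<dots> = (LINT \<xi>|lborel. s * (v \<xi> \<bullet> (m \<xi> *v w \<xi>)))"
  proof (rule integral_cong_AE)
    show "AE \<xi> in lborel. (m \<xi> *v v \<xi>) \<bullet> w \<xi> = s * (v \<xi> \<bullet> (m \<xi> *v w \<xi>))"
      using adj by (rule eventually_mono) simp
  qed (use integrable_inner_L2[OF mv(1) w(1)] integrable_inner_L2[OF v(1) mv(2)] in auto)
  also have "\<dots> = s * (2 * pi * (f \<bullet> lift_op (fm m) g))"
    unfolding Parseval_lsq[OF v(1) mv(2) v(2) FT_lift_op_fm[OF m g w]] by (rule integral_mult_right_zero)
  finally show ?thesis by simp
qed

lemma cscale_decomp: "cscale c f = Re c *\<^sub>R f + Im c *\<^sub>R cscale \<i> f"
proof (cases f rule: lsq_cases)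
  fix u assume u: "u \<in> L2" "f = cls u"
  have "(\<lambda>x. c *s u x) = (\<lambda>x. Re c *\<^sub>R u x + Im c *\<^sub>R (\<i> *s u x))"
    by (auto simp: vec_eq_iff complex_eq_iff)
  then show ?thesis using u by (simp add: cscale_cls cls_scaleR L2_cscale cls_add L2_scaleR)
qed

lemma cscale_add: "cscale c (f + g) = cscale c f + cscale c g"
  by (cases f rule: lsq_cases, cases g rule: lsq_cases)
    (simp add: cscale_cls L2_cscale cls_add vector_add_ldistrib L2_add)

lemma cscale_cscale: "cscale c (cscale d f) = cscale (c * d) f"
  by (cases f rule: lsq_cases) (simp add: cscale_cls L2_cscale vector_smult_assoc)

lemma Conj_cscale: "Conj (cscale c f) = cscale (cnj c) (Conj f)"
  by (cases f rule: lsq_cases) (simp add: cscale_cls L2_cscale Conj_cls L2_cnjv cnjv_cscale)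

lemma Conj_add: "Conj (f + g) = Conj f + Conj g"
  by (cases f rule: lsq_cases, cases g rule: lsq_cases) (simp add: Conj_cls L2_cnjv cls_add cnjv_add L2_add)

lemma Conj_scaleR: "Conj (r *\<^sub>R f) = r *\<^sub>R Conj f"
  by (cases f rule: lsq_cases) (simp add: Conj_cls L2_cnjv cls_scaleR cnjv_scaleR L2_scaleR)

lemma cscale_i_isometry: "cscale \<i> f \<bullet> cscale \<i> g = f \<bullet> g"
  by (cases f rule: lsq_cases, cases g rule: lsq_cases)
    (simp add: cscale_cls L2_cscale cls_inner inner_cvec)

lemma cscale_i_skew: "cscale \<i> f \<bullet> g = - (f \<bullet> cscale \<i> g)"
proof -
  obtain u where u: "u \<in> L2" "f = cls u" by (rule lsq_cases)
  obtain v where v: "v \<in> L2" "g = cls v" by (rule lsq_cases)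
  have "cscale \<i> f \<bullet> g = (LINT x|lborel. (\<i> *s u x) \<bullet> v x)"
    unfolding u(2) v(2) cscale_cls[OF u(1)] by (rule cls_inner[OF L2_cscale[OF u(1)] v(1)])
  also have "\<dots> = (LINT x|lborel. - (u x \<bullet> (\<i> *s v x)))"
    by (rule Bochner_Integration.integral_cong[OF refl]) (simp add: inner_cvec sum_negf[symmetric] algebra_simps)
  also have "\<dots> = - (f \<bullet> cscale \<i> g)"
    unfolding u(2) v(2) cscale_cls[OF v(1)] cls_inner[OF u(1) L2_cscale[OF v(1)]] by (rule Bochner_Integration.integral_minus)
  finally show ?thesis .
qed

lemma real_orth_i: assumes f: "Conj f = f" and g: "Conj g = g" shows "f \<bullet> cscale \<i> g = 0"
proof -
  have "Conj (cscale \<i> g) = - cscale \<i> g" unfolding Conj_cscale g by (subst cscale_decomp) simp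
  then have "f \<bullet> cscale \<i> g = - (f \<bullet> cscale \<i> g)" using Conj_adjoint[of f "cscale \<i> g"] unfolding f by simp
  then show ?thesis by simp
qed

text \<open>For real-valued functions the complex multiples interact only through their coefficients.\<close>

lemma cscale_inner_real:
  assumes f: "Conj f = f" and g: "Conj g = g" shows "cscale c f \<bullet> cscale d g = Re (c * cnj d) * (f \<bullet> g)"
proof -
  have "cscale \<i> f \<bullet> g = 0" using cscale_i_skew[of f g] real_orth_i[OF f g] by simp
  then show ?thesis
    unfolding cscale_decomp[of c f] cscale_decomp[of d g] inner_add_left inner_add_right inner_scaleR_left inner_scaleR_right
      cscale_i_isometry real_orth_i[OF f g]
    by (simp add: algebra_simps)
qed

text \<open>The real Hilbert space in which the kernel is a line and the bifurcation takes place.\<close>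

definition real_lsq :: "'d::finite lsq set" where "real_lsq = {f. Conj f = f}"

lemma real_lsq_closed_subspace: "subspace (real_lsq :: 'a::finite lsq set)" "closed (real_lsq :: 'a lsq set)"
proof -
  have "Conj (0 :: 'a lsq) = 0" using Conj_scaleR[of 0 0] by simp
  then show "subspace (real_lsq :: 'a lsq set)" unfolding subspace_def real_lsq_def mem_Collect_eq Conj_add Conj_scaleR by simp
  show "closed (real_lsq :: 'a lsq set)"
  proof (subst closed_sequential_limits, intro allI impI, elim conjE)
    fix X and f :: "'a lsq" assume X: "\<forall>n. X n \<in> real_lsq" "X \<longlonglongrightarrow> f"
    then have "(\<lambda>n. Conj (X n)) \<longlonglongrightarrow> f" by (simp add: real_lsq_def)
    from LIMSEQ_unique[OF Conj_cont[OF X(2)] this] show "f \<in> real_lsq" by (simp add: real_lsq_def)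
  qed
qed

lemma real_part_in_real_lsq: "(1/2) *\<^sub>R (f + Conj f) \<in> real_lsq"
  by (simp add: real_lsq_def Conj_scaleR Conj_add add.commute)

section \<open>The form of the linearised operator\<close>

lemma fm_L2: assumes "measurable_symbol m" "u \<in> fm_dom m" shows "fm m u \<in> L2"
proof -
  obtain v where v: "v \<in> L2" "FT (cls u) = cls v" by (rule FT_rep)
  show ?thesis by (rule fm_spec(1)[OF assms v])
qed

context one_dim_model
begin

definition Rop :: "'d lsq \<Rightarrow> 'd lsq" where "Rop = lift_op (R_op F Q)"

definition Ldom :: "'d lsq set" where "Ldom = lift_dom (fm_dom l0)"

definition Lop :: "'d lsq \<Rightarrow> 'd lsq" where "Lop f = lift_op (fm l0) f + Rop f"

lemma measurable_symbol_l0: "measurable_symbol l0" by (rule measurable_symbolI[OF L0_measurable])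

lemma R_L2: "u \<in> L2 \<Longrightarrow> R_op F Q u \<in> L2" using R_op_L2 by blast

lemma Rop_cls: assumes "u \<in> L2" shows "Rop (cls u) = cls (R_op F Q u)"
proof -
  have "R_op F Q (rep (cls u)) \<doteq> R_op F Q u"
    unfolding R_op_def by (rule ae_eq_fun[OF rep_cls[OF assms]])
  then show ?thesis by (simp add: Rop_def lift_op_def cls_eq_iff R_L2 assms)
qed

lemma Rop_bounded: obtains K where "K \<ge> 0" "\<And>f. norm (Rop f) \<le> K * norm f"
proof -
  obtain K where "K \<ge> 0" "\<forall>u\<in>L2. R_op F Q u \<in> L2 \<and> norm (cls (R_op F Q u)) \<le> K * norm (cls u)"
    using R_op_L2 by blast
  moreover from this have "norm (Rop f) \<le> K * norm f" for f
    by (cases f rule: lsq_cases) (simp add: Rop_cls)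
  ultimately show ?thesis using that by blast
qed

lemma Rop_form_bound: obtains K where "K \<ge> 0" "\<And>f. \<bar>Rop f \<bullet> f\<bar> \<le> K * (f \<bullet> f)"
proof -
  obtain K where K: "K \<ge> 0" "\<And>f. norm (Rop f) \<le> K * norm f" using Rop_bounded by blast
  have "\<bar>Rop f \<bullet> f\<bar> \<le> K * (f \<bullet> f)" for f
  proof -
    have "\<bar>Rop f \<bullet> f\<bar> \<le> norm (Rop f) * norm f" by (rule Cauchy_Schwarz_ineq2)
    also have "\<dots> \<le> K * norm f * norm f" by (rule mult_right_mono[OF K(2)]) simp
    finally show ?thesis by (simp add: power2_norm_eq_inner[symmetric] power2_eq_square)
  qed
  with K(1) show ?thesis by (rule that)
qed

lemma Rop_add: "Rop (f + g) = Rop f + Rop g"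
proof (cases f rule: lsq_cases, cases g rule: lsq_cases)
  fix u v assume u: "u \<in> L2" "f = cls u" and v: "v \<in> L2" "g = cls v"
  have "R_op F Q (\<lambda>x. u x + v x) = (\<lambda>x. R_op F Q u x + R_op F Q v x)"
    by (simp add: R_op_def matrix_vector_right_distrib)
  then show ?thesis unfolding u(2) v(2)
    by (simp add: cls_add u v Rop_cls R_L2 L2_add)
qed

lemma Rop_cscale: "Rop (cscale c f) = cscale c (Rop f)"
proof (cases f rule: lsq_cases)
  fix u assume u: "u \<in> L2" "f = cls u"
  have "R_op F Q (\<lambda>x. c *s u x) = (\<lambda>x. c *s R_op F Q u x)" by (simp add: R_op_def mat_cscale)
  then show ?thesis unfolding u(2) by (simp add: cscale_cls u Rop_cls R_L2 L2_cscale)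
qed

lemma cscale_of_real: "cscale (complex_of_real c) f = c *\<^sub>R f"
  using cscale_decomp[of "complex_of_real c" f] by simp

lemma Rop_scaleR: "Rop (c *\<^sub>R f) = c *\<^sub>R Rop f"
  unfolding cscale_of_real[symmetric] by (rule Rop_cscale)

lemma Rop_Conj: "Rop (Conj f) = Conj (Rop f)"
proof (cases f rule: lsq_cases)
  fix u assume u: "u \<in> L2" "f = cls u"
  have "R_op F Q (\<lambda>x. cnjv (u x)) = (\<lambda>x. cnjv (R_op F Q u x))" by (simp add: R_op_def R_op_pointwise(2))
  then show ?thesis unfolding u(2) by (simp add: Conj_cls u Rop_cls R_L2 L2_cnjv)
qed

lemma Rop_sym: "Rop f \<bullet> g = f \<bullet> Rop g"
proof (cases f rule: lsq_cases, cases g rule: lsq_cases)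
  fix u v assume u: "u \<in> L2" "f = cls u" and v: "v \<in> L2" "g = cls v"
  have "R_op F Q u x \<bullet> v x = u x \<bullet> R_op F Q v x" for x by (simp add: R_op_def R_op_pointwise(1))
  then show ?thesis unfolding u(2) v(2) by (simp add: u v Rop_cls R_L2 cls_inner)
qed

lemma L_op_cls:
  assumes u: "u \<in> L_dom l0"
  shows "L_op F Q l0 u \<in> L2" "cls (L_op F Q l0 u) = Lop (cls u)"
proof -
  have uL: "u \<in> L2" using u by (simp add: L_dom_def fm_dom_L2)
  have f: "fm l0 u \<in> L2" using fm_L2[OF measurable_symbol_l0] u by (simp add: L_dom_def)
  show "L_op F Q l0 u \<in> L2" unfolding L_op_def by (rule L2_add[OF f R_L2[OF uL]])
  show "cls (L_op F Q l0 u) = Lop (cls u)"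
    unfolding L_op_def Lop_def lift_op_fm_cls[OF uL] Rop_cls[OF uL] by (rule cls_add[OF f R_L2[OF uL], symmetric])
qed

lemma L_dom_cls: "u \<in> L2 \<Longrightarrow> u \<in> L_dom l0 \<longleftrightarrow> cls u \<in> Ldom"
  by (simp add: L_dom_def Ldom_def lift_dom_fm_cls)

lemma lin_on_Lop: "lin_on Ldom Lop"
  using lin_on_fm[OF measurable_symbol_l0] unfolding lin_on_def Ldom_def Lop_def by (simp add: Rop_add Rop_scaleR scaleR_add_right)

lemma cscale_Lop: assumes "f \<in> Ldom" shows "cscale c f \<in> Ldom" "Lop (cscale c f) = cscale c (Lop f)"
  using cscale_fm[OF measurable_symbol_l0, of f c] assms by (simp_all add: Ldom_def Lop_def Rop_cscale cscale_add)

lemma Conj_Lop: assumes "f \<in> Ldom" shows "Conj f \<in> Ldom" "Lop (Conj f) = Conj (Lop f)"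
  using Conj_fm[OF measurable_symbol_l0 conj_symI[OF measurable_symbol_l0 L0_real], of f] assms
  by (simp_all add: Ldom_def Lop_def Rop_Conj Conj_add)

lemma l0_adj: "AE \<xi> in lborel. \<forall>x y. (l0 \<xi> *v x) \<bullet> y = 1 * (x \<bullet> (l0 \<xi> *v y))"
  using L0_selfadjoint by (intro pointwise_adjoint_op[OF measurable_symbol_l0]) (simp add: selfadjoint_op_def symmetric_op_def)

lemma Lop_sym: assumes "f \<in> Ldom" "g \<in> Ldom" shows "Lop f \<bullet> g = f \<bullet> Lop g"
  using adj_fm[OF measurable_symbol_l0 l0_adj, of f g] assms
  by (simp add: Ldom_def Lop_def inner_add_left inner_add_right Rop_sym)

text \<open>The form of \<open>L\<^sub>0\<close> controls the \<open>H\<^sup>1\<close> norm on the whole domain of \<open>L\<^sub>0\<close>, not just on \<open>H\<^sup>2\<close>, because the bound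
  is a pointwise one for the symbol.\<close>

lemma L0_coercive:
  obtains c where "c > 0"
    "\<And>f v. f \<in> Ldom \<Longrightarrow> v \<in> L2 \<Longrightarrow> FT f = cls v \<Longrightarrow> integrable lborel (\<lambda>\<xi>. (1 + \<xi>\<^sup>2) * (norm (v \<xi>))\<^sup>2) \<and>
       c * (LINT \<xi>|lborel. (1 + \<xi>\<^sup>2) * (norm (v \<xi>))\<^sup>2) \<le> 2 * pi * (lift_op (fm l0) f \<bullet> f)"
proof -
  obtain C where C: "C > 0" "\<forall>u\<in>sobolev 2. (sobolev_norm 1 u)\<^sup>2 / C \<le> Re (l2_inner (fm l0 u) u)"
    using L0_form by blast
  have "integrable lborel (\<lambda>\<xi>. (1 + \<xi>\<^sup>2) * (norm (v \<xi>))\<^sup>2) \<and>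
       (1 / C) * (LINT \<xi>|lborel. (1 + \<xi>\<^sup>2) * (norm (v \<xi>))\<^sup>2) \<le> 2 * pi * (lift_op (fm l0) f \<bullet> f)"
    if f: "f \<in> Ldom" and v: "v \<in> L2" and fv: "FT f = cls v" for f v
  proof -
    have fd: "f \<in> lift_dom (fm_dom l0)" using f by (simp add: Ldom_def)
    have mv: "(\<lambda>\<xi>. l0 \<xi> *v v \<xi>) \<in> L2" using lift_dom_fm_iff[OF measurable_symbol_l0 v fv] fd by simp
    have pt: "AE \<xi> in lborel. (1 / C) * ((1 + \<xi>\<^sup>2) * (norm (v \<xi>))\<^sup>2) \<le> (l0 \<xi> *v v \<xi>) \<bullet> v \<xi>"
      by (rule coercive_pointwise[OF measurable_symbol_l0 L0_dom _ v]) (use C in simp)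
    note i = integrable_inner_L2[OF mv v]
    have [measurable]: "v \<in> borel_measurable borel" using L2_measurable_borel[OF v] .
    have int: "integrable lborel (\<lambda>\<xi>. (1 / C) * ((1 + \<xi>\<^sup>2) * (norm (v \<xi>))\<^sup>2))"
    proof (rule Bochner_Integration.integrable_bound[OF i])
      show "AE \<xi> in lborel. norm ((1 / C) * ((1 + \<xi>\<^sup>2) * (norm (v \<xi>))\<^sup>2)) \<le> norm ((l0 \<xi> *v v \<xi>) \<bullet> v \<xi>)"
        using pt
      proof (rule eventually_mono)
        fix \<xi> assume le: "(1 / C) * ((1 + \<xi>\<^sup>2) * (norm (v \<xi>))\<^sup>2) \<le> (l0 \<xi> *v v \<xi>) \<bullet> v \<xi>"
        have "0 \<le> (1 / C) * ((1 + \<xi>\<^sup>2) * (norm (v \<xi>))\<^sup>2)"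
          using C(1) by (intro mult_nonneg_nonneg) (simp_all add: add_nonneg_nonneg)
        then show "norm ((1 / C) * ((1 + \<xi>\<^sup>2) * (norm (v \<xi>))\<^sup>2)) \<le> norm ((l0 \<xi> *v v \<xi>) \<bullet> v \<xi>)"
          using le unfolding real_norm_def by linarith
      qed
    qed measurable
    have "integrable lborel (\<lambda>\<xi>. C * ((1 / C) * ((1 + \<xi>\<^sup>2) * (norm (v \<xi>))\<^sup>2)))"
      by (rule integrable_mult_right) (rule int)
    then have "integrable lborel (\<lambda>\<xi>. (1 + \<xi>\<^sup>2) * (norm (v \<xi>))\<^sup>2)" using C(1) by simp
    moreover have "(1 / C) * (LINT \<xi>|lborel. (1 + \<xi>\<^sup>2) * (norm (v \<xi>))\<^sup>2) \<le> (LINT \<xi>|lborel. (l0 \<xi> *v v \<xi>) \<bullet> v \<xi>)"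
      unfolding integral_mult_right_zero[symmetric] by (rule integral_mono_AE[OF int i pt])
    moreover have "(LINT \<xi>|lborel. (l0 \<xi> *v v \<xi>) \<bullet> v \<xi>) = 2 * pi * (lift_op (fm l0) f \<bullet> f)"
      using Parseval_lsq[OF mv v FT_lift_op_fm[OF measurable_symbol_l0 fd v fv] fv] by simp
    ultimately show ?thesis by simp
  qed
  then show ?thesis using that[of "1 / C"] C(1) by (simp del: times_divide_eq_left)
qed

lemma Lop_bounded_below: obtains m1 where "\<And>f. f \<in> Ldom \<Longrightarrow> m1 * (f \<bullet> f) \<le> Lop f \<bullet> f"
proof -
  obtain K where K: "K \<ge> 0" "\<And>f. \<bar>Rop f \<bullet> f\<bar> \<le> K * (f \<bullet> f)" by (rule Rop_form_bound) (rule that)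
  have "- K * (f \<bullet> f) \<le> Lop f \<bullet> f" if f: "f \<in> Ldom" for f
  proof -
    obtain c where c: "c > 0" "\<And>f v. f \<in> Ldom \<Longrightarrow> v \<in> L2 \<Longrightarrow> FT f = cls v \<Longrightarrow>
       integrable lborel (\<lambda>\<xi>. (1 + \<xi>\<^sup>2) * (norm (v \<xi>))\<^sup>2) \<and>
       c * (LINT \<xi>|lborel. (1 + \<xi>\<^sup>2) * (norm (v \<xi>))\<^sup>2) \<le> 2 * pi * (lift_op (fm l0) f \<bullet> f)" by (rule L0_coercive) (rule that)
    obtain v where v: "v \<in> L2" "FT f = cls v" by (rule FT_rep)
    have "0 \<le> c * (LINT \<xi>|lborel. (1 + \<xi>\<^sup>2) * (norm (v \<xi>))\<^sup>2)"
      using c(1) by (intro mult_nonneg_nonneg integral_nonneg_AE AE_I2) (simp_all add: add_nonneg_nonneg)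
    then have "0 \<le> 2 * pi * (lift_op (fm l0) f \<bullet> f)" using c(2)[OF f v] by linarith
    then have "0 \<le> lift_op (fm l0) f \<bullet> f" using pi_gt_zero by (simp add: zero_le_mult_iff not_le)
    then show ?thesis using K(2)[of f] by (simp add: Lop_def inner_add_left)
  qed
  then show ?thesis using that by blast
qed

lemma L_resolvent:
  assumes l: "l < 0" "l \<noteq> \<mu>"
  shows "\<exists>K. \<forall>f. \<exists>u\<in>Ldom. Lop u - l *\<^sub>R u = f \<and> norm u \<le> K * norm f"
proof -
  have "complex_of_real l \<notin> complex_of_real ` \<Sigma>" 
  proof
    assume "complex_of_real l \<in> complex_of_real ` \<Sigma>"
    then have "l \<in> \<Sigma>" by (auto simp only: image_iff of_real_eq_iff)
    then show False using l(1) \<Sigma>_bound \<alpha>_pos by auto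
  qed
  then have "complex_of_real l \<notin> op_spectrum (L_dom l0) (L_op F Q l0)"
    unfolding L_spectrum using l by simp
  then have "in_resolvent_set (L_dom l0) (L_op F Q l0) (complex_of_real l)" by (simp add: op_spectrum_def)
  then obtain C where surj: "\<forall>f\<in>L2. \<exists>u\<in>L_dom l0. (\<lambda>x. L_op F Q l0 u x - complex_of_real l *s u x) \<doteq> f"
    and C: "\<forall>u\<in>L_dom l0. l2_norm u \<le> C * l2_norm (\<lambda>x. L_op F Q l0 u x - complex_of_real l *s u x)"
    unfolding in_resolvent_set_def by blast
  have "\<exists>u\<in>Ldom. Lop u - l *\<^sub>R u = f \<and> norm u \<le> C * norm f" for f
  proof -
    obtain u where u: "u \<in> L_dom l0" "(\<lambda>x. L_op F Q l0 u x - complex_of_real l *s u x) \<doteq> rep f"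
      using surj rep_L2 by blast
    have uL: "u \<in> L2" using u(1) by (simp add: L_dom_def fm_dom_L2)
    have d: "(\<lambda>x. L_op F Q l0 u x - complex_of_real l *s u x) \<in> L2"
      by (rule L2_diff[OF L_op_cls(1)[OF u(1)] L2_cscale[OF uL]])
    have "cls (\<lambda>x. L_op F Q l0 u x - complex_of_real l *s u x) = Lop (cls u) - cscale (complex_of_real l) (cls u)"
      unfolding cscale_cls[OF uL] L_op_cls(2)[OF u(1), symmetric]
      by (rule cls_diff[OF L_op_cls(1)[OF u(1)] L2_cscale[OF uL], symmetric])
    then have e: "cls (\<lambda>x. L_op F Q l0 u x - complex_of_real l *s u x) = Lop (cls u) - l *\<^sub>R cls u"
      by (simp only: cscale_of_real)
    have f: "cls (\<lambda>x. L_op F Q l0 u x - complex_of_real l *s u x) = f"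
      using u(2) cls_eq_iff[OF d rep_L2] by simp
    have "norm (cls u) \<le> C * norm f"
      using C[rule_format, OF u(1)] unfolding cls_norm[OF d, symmetric] cls_norm[OF uL, symmetric] f .
    moreover have "cls u \<in> Ldom" using L_dom_cls[OF uL] u(1) by simp
    moreover have "Lop (cls u) - l *\<^sub>R cls u = f" using f unfolding e .
    ultimately show ?thesis by blast
  qed
  then show ?thesis by blast
qed

text \<open>The eigenspace of \<open>\<mu>\<close> is a complex line, so orthogonality to it amounts to two real conditions, one for
  \<open>e\<close> and one for \<open>\<i> e\<close>.\<close>

lemma L_negative_direction:
  obtains e where "\<And>f. f \<in> Ldom \<Longrightarrow> f \<bullet> e = 0 \<Longrightarrow> f \<bullet> cscale \<i> e = 0 \<Longrightarrow> 0 \<le> Lop f \<bullet> f"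
proof -
  obtain e0 where e0: "\<forall>i<(1::nat). e0 i \<in> L_dom l0"
    and span: "\<forall>u\<in>L_dom l0. L_op F Q l0 u \<doteq> (\<lambda>x. complex_of_real \<mu> *s u x) \<longrightarrow>
       (\<exists>c. u \<doteq> (\<lambda>x. \<Sum>i<(1::nat). c i *s e0 i x))"
    using \<mu>_simple unfolding simple_eigenvalue_def eigdim_def by blast
  have eL: "e0 0 \<in> L2" using e0 by (simp add: L_dom_def fm_dom_L2)
  have mult: "\<exists>c. v = cscale c (cls (e0 0))" if v: "v \<in> Ldom" "Lop v = \<mu> *\<^sub>R v" for v
  proof -
    have d: "rep v \<in> L_dom l0" using v(1) by (simp add: L_dom_cls)
    have "cls (L_op F Q l0 (rep v)) = cscale (complex_of_real \<mu>) (cls (rep v))"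
      using v(2) by (simp add: L_op_cls(2)[OF d] cscale_of_real)
    then have "L_op F Q l0 (rep v) \<doteq> (\<lambda>x. complex_of_real \<mu> *s rep v x)"
      unfolding cscale_cls[OF rep_L2] cls_eq_iff[OF L_op_cls(1)[OF d] L2_cscale[OF rep_L2]] .
    then obtain c where "rep v \<doteq> (\<lambda>x. \<Sum>i<(1::nat). c i *s e0 i x)" using span d by blast
    then have "rep v \<doteq> (\<lambda>x. c 0 *s e0 0 x)" by simp
    then have "cls (rep v) = cscale (c 0) (cls (e0 0))"
      unfolding cscale_cls[OF eL] cls_eq_iff[OF rep_L2 L2_cscale[OF eL]] .
    then have "v = cscale (c 0) (cls (e0 0))" by simp
    then show ?thesis by blast
  qed
  obtain m1 where low: "\<And>f. f \<in> Ldom \<Longrightarrow> m1 * (f \<bullet> f) \<le> Lop f \<bullet> f" using Lop_bounded_below by blast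
  show ?thesis
  proof (rule that[of "cls (e0 0)"])
    fix f assume f: "f \<in> Ldom" "f \<bullet> cls (e0 0) = 0" "f \<bullet> cscale \<i> (cls (e0 0)) = 0"
    have orth: "f \<bullet> v = 0" if "v \<in> Ldom" "Lop v = \<mu> *\<^sub>R v" for v
    proof -
      obtain c where c: "v = cscale c (cls (e0 0))" using mult[OF \<open>v \<in> Ldom\<close> \<open>Lop v = \<mu> *\<^sub>R v\<close>] by blast
      show ?thesis unfolding c cscale_decomp[of c] inner_add_right inner_scaleR_right f(2,3) by simp
    qed
    show "0 \<le> Lop f \<bullet> f"
    proof (rule nonneg_on_complement_of_negative_eigenspace[where T = Lop and D = Ldom and \<mu> = \<mu>])
      show "lin_on Ldom Lop" by (rule lin_on_Lop)
      show "u \<in> Ldom \<Longrightarrow> v \<in> Ldom \<Longrightarrow> Lop u \<bullet> v = u \<bullet> Lop v" for u v by (rule Lop_sym)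
      show "u \<in> Ldom \<Longrightarrow> m1 * (u \<bullet> u) \<le> Lop u \<bullet> u" for u by (rule low)
      show "\<mu> < 0" by (rule \<mu>_neg)
      show "f \<in> Ldom" by (rule f(1))
      show "v \<in> Ldom \<Longrightarrow> Lop v = \<mu> *\<^sub>R v \<Longrightarrow> f \<bullet> v = 0" for v by (rule orth)
      show "\<exists>K. \<forall>f. \<exists>u\<in>Ldom. Lop u - l *\<^sub>R u = f \<and> norm u \<le> K * norm f" if "l < 0" "l \<noteq> \<mu>" for l
        using that by (rule L_resolvent)
    qed
  qed
qed

end

section \<open>The operators of the transverse model\<close>

context transverse_model
begin

abbreviation Jop :: "real \<Rightarrow> 'd lsq \<Rightarrow> 'd lsq" where "Jop k \<equiv> lift_op (fm (jk k))"

abbreviation Jdom :: "real \<Rightarrow> 'd lsq set" where "Jdom k \<equiv> lift_dom (fm_dom (jk k))"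

abbreviation JSJop :: "real \<Rightarrow> 'd lsq \<Rightarrow> 'd lsq" where "JSJop k \<equiv> lift_op (fm (jk k \<odot> sk k \<odot> jk k))"

abbreviation JSJdom :: "real \<Rightarrow> 'd lsq set" where "JSJdom k \<equiv> lift_dom (fm_dom (jk k \<odot> sk k \<odot> jk k))"

definition Mdom :: "real \<Rightarrow> 'd lsq set" where
  "Mdom k = {f \<in> Jdom k. Jop k f \<in> Ldom \<and> Lop (Jop k f) \<in> Jdom k} \<inter> JSJdom k"

definition Mop :: "real \<Rightarrow> 'd lsq \<Rightarrow> 'd lsq" where
  "Mop k f = Jop k (Lop (Jop k f)) + JSJop k f"

lemma measurable_symbol_j: "measurable_symbol (jk k)" by (rule measurable_symbolI[OF Jk_measurable])
lemma measurable_symbol_s: "measurable_symbol (sk k)" by (rule measurable_symbolI[OF Sk_measurable])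
lemma measurable_symbol_jsj: "measurable_symbol (jk k \<odot> sk k \<odot> jk k)" by (intro measurable_symbol_prod measurable_symbol_j measurable_symbol_s)

lemma MdomD:
  assumes "f \<in> Mdom k"
  shows "f \<in> Jdom k" "Jop k f \<in> Ldom" "Lop (Jop k f) \<in> Jdom k" "f \<in> JSJdom k"
  using assms by (auto simp: Mdom_def)

lemma M_dom_cls:
  assumes u: "u \<in> L2" shows "u \<in> M_dom F Q l0 jk sk k \<longleftrightarrow> cls u \<in> Mdom k"
proof (cases "u \<in> fm_dom (jk k)")
  case True
  let ?w = "fm (jk k) u"
  have w: "?w \<in> L2" by (rule fm_L2[OF measurable_symbol_j True])
  have cw: "cls ?w = Jop k (cls u)" by (rule lift_op_fm_cls[OF u, symmetric])
  show ?thesis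
  proof (cases "?w \<in> L_dom l0")
    case Lw: True
    have "L_op F Q l0 ?w \<in> fm_dom (jk k) \<longleftrightarrow> Lop (Jop k (cls u)) \<in> Jdom k"
      unfolding cw[symmetric] L_op_cls(2)[OF Lw, symmetric] by (rule lift_dom_fm_cls[OF L_op_cls(1)[OF Lw], symmetric])
    then show ?thesis
      using True Lw L_dom_cls[OF w] by (simp add: M_dom_def Mdom_def lift_dom_fm_cls[OF u] cw)
  next
    case False
    then show ?thesis using L_dom_cls[OF w] by (simp add: M_dom_def Mdom_def cw)
  qed
next
  case False
  then show ?thesis by (simp add: M_dom_def Mdom_def lift_dom_fm_cls[OF u])
qed

lemma M_dom_L2: "u \<in> M_dom F Q l0 jk sk k \<Longrightarrow> u \<in> L2"
  using fm_dom_L2[of u "jk k"] by (simp add: M_dom_def)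

lemma M_op_cls:
  assumes u: "u \<in> M_dom F Q l0 jk sk k"
  shows "M_op F Q l0 jk sk k u \<in> L2" "cls (M_op F Q l0 jk sk k u) = Mop k (cls u)"
proof -
  note uL = M_dom_L2[OF u]
  let ?w = "fm (jk k) u"
  have d: "u \<in> fm_dom (jk k)" "?w \<in> L_dom l0" "L_op F Q l0 ?w \<in> fm_dom (jk k)"
    "u \<in> fm_dom (jk k \<odot> sk k \<odot> jk k)" using u by (simp_all add: M_dom_def)
  note a = fm_L2[OF measurable_symbol_j d(3)] and b = fm_L2[OF measurable_symbol_jsj d(4)]
  show "M_op F Q l0 jk sk k u \<in> L2" unfolding M_op_def by (rule L2_add[OF a b])
  show "cls (M_op F Q l0 jk sk k u) = Mop k (cls u)"
    unfolding M_op_def Mop_def cls_add[OF a b, symmetric] lift_op_fm_cls[OF uL] L_op_cls(2)[OF d(2), symmetric]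
      lift_op_fm_cls[OF L_op_cls(1)[OF d(2)]] ..
qed

lemma j_adj: "AE \<xi> in lborel. \<forall>x y. (jk k \<xi> *v x) \<bullet> y = (- 1) * (x \<bullet> (jk k \<xi> *v y))"
  using Jk_skew[of k] by (intro pointwise_adjoint_op[OF measurable_symbol_j]) (simp add: skew_op_def)

lemma s_adj: "AE \<xi> in lborel. \<forall>x y. (sk k \<xi> *v x) \<bullet> y = 1 * (x \<bullet> (sk k \<xi> *v y))"
  using Sk_symmetric[of k] by (intro pointwise_adjoint_op[OF measurable_symbol_s]) (simp add: symmetric_op_def)

lemma jsj_adj: "AE \<xi> in lborel. \<forall>x y. ((jk k \<odot> sk k \<odot> jk k) \<xi> *v x) \<bullet> y = 1 * (x \<bullet> ((jk k \<odot> sk k \<odot> jk k) \<xi> *v y))"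
  using j_adj[of k] s_adj[of k] by eventually_elim (simp add: sym_prod_mult)

lemma Jop_skew: "f \<in> Jdom k \<Longrightarrow> g \<in> Jdom k \<Longrightarrow> Jop k f \<bullet> g = - (f \<bullet> Jop k g)"
  using adj_fm[OF measurable_symbol_j j_adj, of f k g] by simp

lemma Mop_sym: assumes f: "f \<in> Mdom k" and g: "g \<in> Mdom k" shows "Mop k f \<bullet> g = f \<bullet> Mop k g"
proof -
  have "Jop k (Lop (Jop k f)) \<bullet> g = - (Lop (Jop k f) \<bullet> Jop k g)" by (rule Jop_skew[OF MdomD(3)[OF f] MdomD(1)[OF g]])
  also have "\<dots> = - (Jop k f \<bullet> Lop (Jop k g))" by (simp add: Lop_sym[OF MdomD(2)[OF f] MdomD(2)[OF g]])
  also have "\<dots> = f \<bullet> Jop k (Lop (Jop k g))" using Jop_skew[OF MdomD(1)[OF f] MdomD(3)[OF g]] by simp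
  finally show ?thesis using adj_fm[OF measurable_symbol_jsj jsj_adj MdomD(4)[OF f] MdomD(4)[OF g]]
    by (simp add: Mop_def inner_add_left inner_add_right)
qed

lemma lin_on_Mop: "lin_on (Mdom k) (Mop k)"
proof -
  note J = lin_onD[OF lin_on_fm[OF measurable_symbol_j, of k]] and P = lin_onD[OF lin_on_fm[OF measurable_symbol_jsj, of k]]
    and L = lin_onD[OF lin_on_Lop]
  have add: "f + g \<in> Mdom k \<and> Mop k (f + g) = Mop k f + Mop k g" if f: "f \<in> Mdom k" and g: "g \<in> Mdom k" for f g
    using subspace_add[OF J(1) MdomD(1)[OF f] MdomD(1)[OF g]] subspace_add[OF P(1) MdomD(4)[OF f] MdomD(4)[OF g]]
      subspace_add[OF L(1) MdomD(2)[OF f] MdomD(2)[OF g]] subspace_add[OF J(1) MdomD(3)[OF f] MdomD(3)[OF g]]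
    by (simp add: Mdom_def Mop_def J(2)[OF MdomD(1)[OF f] MdomD(1)[OF g]] P(2)[OF MdomD(4)[OF f] MdomD(4)[OF g]]
        L(2)[OF MdomD(2)[OF f] MdomD(2)[OF g]] J(2)[OF MdomD(3)[OF f] MdomD(3)[OF g]])
  have sc: "c *\<^sub>R f \<in> Mdom k \<and> Mop k (c *\<^sub>R f) = c *\<^sub>R Mop k f" if f: "f \<in> Mdom k" for c f
    using subspace_scale[OF J(1) MdomD(1)[OF f], of c] subspace_scale[OF P(1) MdomD(4)[OF f], of c]
      subspace_scale[OF L(1) MdomD(2)[OF f], of c] subspace_scale[OF J(1) MdomD(3)[OF f], of c]
    by (simp add: Mdom_def Mop_def J(3)[OF MdomD(1)[OF f]] P(3)[OF MdomD(4)[OF f]] L(3)[OF MdomD(2)[OF f]] J(3)[OF MdomD(3)[OF f]] scaleR_add_right)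
  have z: "0 \<in> Mdom k" using subspace_0[OF J(1)] subspace_0[OF P(1)] subspace_0[OF L(1)]
    by (simp add: Mdom_def J(5) P(5) L(5))
  show ?thesis unfolding lin_on_def subspace_def using add sc z by blast
qed

lemma cscale_Mop: assumes f: "f \<in> Mdom k" shows "cscale c f \<in> Mdom k" "Mop k (cscale c f) = cscale c (Mop k f)"
  using cscale_fm[OF measurable_symbol_j MdomD(1)[OF f], of c] cscale_fm[OF measurable_symbol_jsj MdomD(4)[OF f], of c] cscale_Lop[OF MdomD(2)[OF f], of c]
    cscale_fm[OF measurable_symbol_j MdomD(3)[OF f], of c] by (simp_all add: Mdom_def Mop_def cscale_add)

text \<open>Pointwise, \<open>(jsj v) \<bullet> v = - (s (j v)) \<bullet> (j v)\<close>; the composition \<open>S(ik)J(ik)\<close> need not be defined on \<open>f\<close>.\<close>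

lemma JSJop_nonpos: assumes f: "f \<in> Jdom k" "f \<in> JSJdom k" shows "JSJop k f \<bullet> f \<le> 0"
proof -
  obtain v where v: "v \<in> L2" "FT f = cls v" by (rule FT_rep)
  have mv: "(\<lambda>\<xi>. jk k \<xi> *v v \<xi>) \<in> L2" using lift_dom_fm_iff[OF measurable_symbol_j v] f by simp
  have pv: "(\<lambda>\<xi>. (jk k \<odot> sk k \<odot> jk k) \<xi> *v v \<xi>) \<in> L2" using lift_dom_fm_iff[OF measurable_symbol_jsj v] f by simp
  have "AE \<xi> in lborel. 0 \<le> (sk k \<xi> *v (jk k \<xi> *v v \<xi>)) \<bullet> (jk k \<xi> *v v \<xi>)"
    by (rule form_nonneg_pointwise[OF measurable_symbol_s Sk_nonneg mv])
  with j_adj[of k] have "AE \<xi> in lborel. ((jk k \<odot> sk k \<odot> jk k) \<xi> *v v \<xi>) \<bullet> v \<xi> \<le> 0"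
    by eventually_elim (simp add: sym_prod_mult)
  then have "AE \<xi> in lborel. 0 \<le> - (((jk k \<odot> sk k \<odot> jk k) \<xi> *v v \<xi>) \<bullet> v \<xi>)" by simp
  from integral_nonneg_AE[OF this] have "(LINT \<xi>|lborel. ((jk k \<odot> sk k \<odot> jk k) \<xi> *v v \<xi>) \<bullet> v \<xi>) \<le> 0" by simp
  then have "2 * pi * (JSJop k f \<bullet> f) \<le> 0"
    unfolding Parseval_lsq[OF pv v(1) FT_lift_op_fm[OF measurable_symbol_jsj f(2) v] v(2)] .
  then show ?thesis using pi_gt_zero by (simp add: mult_le_0_iff not_le)
qed

lemma Mop_form: assumes f: "f \<in> Mdom k" shows "Mop k f \<bullet> f \<le> - (Lop (Jop k f) \<bullet> Jop k f)"
  using Jop_skew[OF MdomD(3)[OF f] MdomD(1)[OF f]] JSJop_nonpos[OF MdomD(1)[OF f] MdomD(4)[OF f]]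
  by (simp add: Mop_def inner_add_left)

lemma j_order_one: "\<exists>B. \<forall>k. \<forall>v\<in>L2. AE \<xi> in lborel. (norm (jk k \<xi> *v v \<xi>))\<^sup>2 \<le> B\<^sup>2 * ((1 + \<xi>\<^sup>2) * (norm (v \<xi>))\<^sup>2)"
proof -
  obtain B where B: "\<forall>k. \<forall>u\<in>sobolev 1. l2_norm (fm (jk k) u) \<le> B * sobolev_norm 1 u" using Jk_bound by blast
  have "AE \<xi> in lborel. (norm (jk k \<xi> *v v \<xi>))\<^sup>2 \<le> B\<^sup>2 * ((1 + \<xi>\<^sup>2) * (norm (v \<xi>))\<^sup>2)" if v: "v \<in> L2" for k v
    by (rule order_one_pointwise[OF measurable_symbol_j Jk_dom _ v]) (use B in blast)
  then show ?thesis by blast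
qed

lemma LINT_norm_sq: assumes "v \<in> L2" "FT f = cls v" shows "(LINT \<xi>|lborel. (norm (v \<xi>))\<^sup>2) = 2 * pi * (f \<bullet> f)"
  using Parseval_lsq[OF assms(1,1,2,2)] by (simp add: power2_norm_eq_inner)

text \<open>Coercivity of \<open>L\<^sub>0\<close> gives \<open>(M f, f) \<le> K \<parallel>J f\<parallel>\<^sup>2 - c \<parallel>J f\<parallel>\<^sub>1\<^sup>2\<close>.  Since \<open>J\<close> is skew and of order one, \<open>\<parallel>J f\<parallel>\<^sup>2 = -(J J f, f)\<close>
  is at most a small multiple of \<open>\<parallel>J f\<parallel>\<^sub>1\<^sup>2\<close> plus a multiple of \<open>\<parallel>f\<parallel>\<^sup>2\<close>; this is done pointwise for the transforms.\<close>

lemma M_estimate: obtains C where "\<And>f. f \<in> Mdom k \<Longrightarrow> Mop k f \<bullet> f + Jop k f \<bullet> Jop k f \<le> C * (f \<bullet> f)"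
proof -
  obtain K where K: "K \<ge> 0" "\<And>f. \<bar>Rop f \<bullet> f\<bar> \<le> K * (f \<bullet> f)" by (rule Rop_form_bound) (rule that)
  obtain c where c: "c > 0" "\<And>f v. f \<in> Ldom \<Longrightarrow> v \<in> L2 \<Longrightarrow> FT f = cls v \<Longrightarrow>
       integrable lborel (\<lambda>\<xi>. (1 + \<xi>\<^sup>2) * (norm (v \<xi>))\<^sup>2) \<and>
       c * (LINT \<xi>|lborel. (1 + \<xi>\<^sup>2) * (norm (v \<xi>))\<^sup>2) \<le> 2 * pi * (lift_op (fm l0) f \<bullet> f)" by (rule L0_coercive) (rule that)
  obtain B where B: "\<And>v. v \<in> L2 \<Longrightarrow> AE \<xi> in lborel. (norm (jk k \<xi> *v v \<xi>))\<^sup>2 \<le> B\<^sup>2 * ((1 + \<xi>\<^sup>2) * (norm (v \<xi>))\<^sup>2)"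
    using j_order_one by blast
  \<comment> \<open>The largest weight, up to the summand \<open>1\<close> that excludes division by zero, with \<open>e B\<^sup>2 \<le> c\<close>.\<close>
  define e where "e = c / (B\<^sup>2 + 1)"
  have B1: "B\<^sup>2 + 1 > 0" by (simp add: add_nonneg_pos)
  have e: "e > 0" using c(1) B1 by (simp add: e_def)
  have eB: "e * B\<^sup>2 \<le> c"
  proof -
    have "c * B\<^sup>2 \<le> c * (B\<^sup>2 + 1)" using c(1) by (intro mult_left_mono) simp_all
    then show ?thesis using B1 by (simp add: e_def divide_le_eq)
  qed
  define D where "D = (K + 1)\<^sup>2 / (4 * e)"
  have "Mop k f \<bullet> f + Jop k f \<bullet> Jop k f \<le> D * (f \<bullet> f)" if f: "f \<in> Mdom k" for f
  proof -
    obtain v where v: "v \<in> L2" "FT f = cls v" by (rule FT_rep)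
    define w where "w = (\<lambda>\<xi>. jk k \<xi> *v v \<xi>)"
    define g where "g = Jop k f"
    have w: "w \<in> L2" unfolding w_def using lift_dom_fm_iff[OF measurable_symbol_j v] MdomD(1)[OF f] by simp
    have g: "FT g = cls w" unfolding g_def w_def by (rule FT_lift_op_fm[OF measurable_symbol_j MdomD(1)[OF f] v])
    have gL: "g \<in> Ldom" unfolding g_def by (rule MdomD(2)[OF f])
    have pt: "AE \<xi> in lborel. (K + 1) * (norm (w \<xi>))\<^sup>2 \<le> c * ((1 + \<xi>\<^sup>2) * (norm (w \<xi>))\<^sup>2) + D * (norm (v \<xi>))\<^sup>2"
      using j_adj[of k] B[OF w]
    proof eventually_elim
      fix \<xi>
      assume adj: "\<forall>x y. (jk k \<xi> *v x) \<bullet> y = (- 1) * (x \<bullet> (jk k \<xi> *v y))"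
        and Bw: "(norm (jk k \<xi> *v w \<xi>))\<^sup>2 \<le> B\<^sup>2 * ((1 + \<xi>\<^sup>2) * (norm (w \<xi>))\<^sup>2)"
      define t where "t = norm (jk k \<xi> *v w \<xi>)"
      define n where "n = norm (v \<xi>)"
      have "(norm (w \<xi>))\<^sup>2 = - ((jk k \<xi> *v w \<xi>) \<bullet> v \<xi>)"
        using adj[rule_format, of "w \<xi>" "v \<xi>"] by (simp add: power2_norm_eq_inner w_def)
      also have "\<dots> \<le> t * n" using Cauchy_Schwarz_ineq2[of "jk k \<xi> *v w \<xi>" "v \<xi>"] unfolding t_def n_def by linarith
      finally have "(K + 1) * (norm (w \<xi>))\<^sup>2 \<le> (K + 1) * (t * n)" using K(1) by (intro mult_left_mono) simp_all
      also have "\<dots> \<le> e * t\<^sup>2 + D * n\<^sup>2"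
      proof -
        \<comment> \<open>Completion of the square, which explains the value of \<open>D\<close>.\<close>
        have "0 \<le> e * (t - (K + 1) / (2 * e) * n)\<^sup>2" using e by simp
        also have "\<dots> = e * t\<^sup>2 + D * n\<^sup>2 - (K + 1) * (t * n)"
          using e by (simp add: D_def power2_eq_square field_simps)
        finally show ?thesis by simp
      qed
      also have "e * t\<^sup>2 \<le> c * ((1 + \<xi>\<^sup>2) * (norm (w \<xi>))\<^sup>2)"
      proof -
        have "e * t\<^sup>2 \<le> e * (B\<^sup>2 * ((1 + \<xi>\<^sup>2) * (norm (w \<xi>))\<^sup>2))"
          using Bw e unfolding t_def by (intro mult_left_mono) simp_all
        also have "\<dots> = (e * B\<^sup>2) * ((1 + \<xi>\<^sup>2) * (norm (w \<xi>))\<^sup>2)" by simp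
        also have "\<dots> \<le> c * ((1 + \<xi>\<^sup>2) * (norm (w \<xi>))\<^sup>2)"
          by (rule mult_right_mono[OF eB]) (simp add: add_nonneg_nonneg)
        finally show ?thesis .
      qed
      finally show "(K + 1) * (norm (w \<xi>))\<^sup>2 \<le> c * ((1 + \<xi>\<^sup>2) * (norm (w \<xi>))\<^sup>2) + D * (norm (v \<xi>))\<^sup>2"
        by (simp add: n_def)
    qed
    have co: "integrable lborel (\<lambda>\<xi>. (1 + \<xi>\<^sup>2) * (norm (w \<xi>))\<^sup>2)"
      "c * (LINT \<xi>|lborel. (1 + \<xi>\<^sup>2) * (norm (w \<xi>))\<^sup>2) \<le> 2 * pi * (lift_op (fm l0) g \<bullet> g)"
      using c(2)[OF gL w g] by blast+
    have "(LINT \<xi>|lborel. (K + 1) * (norm (w \<xi>))\<^sup>2)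
        \<le> (LINT \<xi>|lborel. (c * ((1 + \<xi>\<^sup>2) * (norm (w \<xi>))\<^sup>2) + D * (norm (v \<xi>))\<^sup>2))"
      by (intro integral_mono_AE pt Bochner_Integration.integrable_add integrable_mult_right co(1) L2_integrable v(1) w)
    also have "\<dots> = c * (LINT \<xi>|lborel. (1 + \<xi>\<^sup>2) * (norm (w \<xi>))\<^sup>2) + D * (LINT \<xi>|lborel. (norm (v \<xi>))\<^sup>2)"
      unfolding integral_mult_right_zero[symmetric]
      by (intro Bochner_Integration.integral_add integrable_mult_right co(1) L2_integrable v(1))
    finally have "(K + 1) * (LINT \<xi>|lborel. (norm (w \<xi>))\<^sup>2)
        \<le> c * (LINT \<xi>|lborel. (1 + \<xi>\<^sup>2) * (norm (w \<xi>))\<^sup>2) + D * (LINT \<xi>|lborel. (norm (v \<xi>))\<^sup>2)"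
      unfolding integral_mult_right_zero .
    then have "(K + 1) * (2 * pi * (g \<bullet> g)) \<le> 2 * pi * (lift_op (fm l0) g \<bullet> g) + D * (2 * pi * (f \<bullet> f))"
      unfolding LINT_norm_sq[OF w g] LINT_norm_sq[OF v] using co(2) by linarith
    then have "2 * pi * ((K + 1) * (g \<bullet> g)) \<le> 2 * pi * (lift_op (fm l0) g \<bullet> g + D * (f \<bullet> f))"
      by (simp only: distrib_left mult_ac)
    then have 1: "(K + 1) * (g \<bullet> g) \<le> lift_op (fm l0) g \<bullet> g + D * (f \<bullet> f)"
      by (subst (asm) mult_le_cancel_left_pos) simp_all
    have "lift_op (fm l0) g \<bullet> g - K * (g \<bullet> g) \<le> Lop g \<bullet> g"
      using K(2)[of g] by (simp add: Lop_def inner_add_left)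
    with 1 Mop_form[OF f, folded g_def] have "Mop k f \<bullet> f + g \<bullet> g \<le> D * (f \<bullet> f)" by (simp add: distrib_right)
    then show ?thesis by (simp add: g_def)
  qed
  then show ?thesis using that by blast
qed

lemma Jop_inj: assumes f: "f \<in> Jdom k" "Jop k f = 0" shows "f = 0"
proof -
  have d: "rep f \<in> fm_dom (jk k)" using f(1) by (simp add: lift_dom_def)
  have "cls (fm (jk k) (rep f)) = cls (\<lambda>x. 0)" using f(2) by (simp add: lift_op_def cls_zero)
  then have "fm (jk k) (rep f) \<doteq> (\<lambda>x. 0)" using cls_eq_iff[OF fm_L2[OF measurable_symbol_j d] L2_zero] by simp
  then have "rep f \<doteq> (\<lambda>x. 0)" by (rule Jk_inj[OF d])
  then have "cls (rep f) = cls (\<lambda>x. 0)" by (subst cls_eq_iff) simp_all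
  then show ?thesis by (simp add: cls_zero)
qed

text \<open>Injectivity of the operator on \<open>L\<^sup>2\<close> as injectivity for arbitrary measurable functions, after division by
  their size.\<close>

lemma j_kernel:
  assumes z[measurable]: "z \<in> borel_measurable borel" and jz: "AE \<xi> in lborel. jk k \<xi> *v z \<xi> = 0"
  shows "AE \<xi> in lborel. z \<xi> = 0"
proof -
  note [measurable] = gauss_weight(3)
  let ?y = "\<lambda>\<xi>. (gauss_weight \<xi> / (1 + norm (z \<xi>))) *\<^sub>R z \<xi>"
  have y: "?y \<in> L2"
  proof (rule L2_gauss_weight[where C = 1])
    show "norm (?y \<xi>) \<le> 1 * gauss_weight \<xi>" for \<xi>
    proof -
      have "gauss_weight \<xi> * norm (z \<xi>) \<le> gauss_weight \<xi> * (1 + norm (z \<xi>))" using gauss_weight(1)[of \<xi>] by (intro mult_left_mono) simp_all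
      then show ?thesis using gauss_weight(1)[of \<xi>] by (simp add: divide_le_eq add_pos_nonneg abs_of_pos)
    qed
  qed measurable
  obtain f where f: "FT f = cls ?y" using FT_surj by blast
  have jy: "AE \<xi> in lborel. jk k \<xi> *v ?y \<xi> = 0"
    using jz by (rule eventually_mono) (simp add: mat_scaleR)
  have jy0: "(\<lambda>\<xi>. 0) \<doteq> (\<lambda>\<xi>. jk k \<xi> *v ?y \<xi>)" unfolding ae_eq_def using jy by (rule eventually_mono) simp
  have jyL: "(\<lambda>\<xi>. jk k \<xi> *v ?y \<xi>) \<in> L2"
    by (rule L2_ae_cong[OF L2_zero measurable_symbolD[OF measurable_symbol_j L2_measurable_borel[OF y]] jy0])
  have fd: "f \<in> Jdom k" using lift_dom_fm_iff[OF measurable_symbol_j y f] jyL by simp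
  have "FT (Jop k f) = cls (\<lambda>\<xi>. 0)"
    unfolding FT_lift_op_fm[OF measurable_symbol_j fd y f] cls_eq_iff[OF jyL L2_zero] by (rule ae_eq_sym[OF jy0])
  then have "FT (Jop k f) = FT 0" by (simp add: cls_zero FT_0)
  then have "Jop k f = 0" by (rule FT_inj)
  then have "f = 0" by (rule Jop_inj[OF fd])
  then have "cls ?y = cls (\<lambda>\<xi>. 0)" using f by (simp add: cls_zero FT_0)
  then have "?y \<doteq> (\<lambda>\<xi>. 0)" unfolding cls_eq_iff[OF y L2_zero] .
  then show ?thesis unfolding ae_eq_def
  proof (rule eventually_mono)
    fix \<xi> assume "?y \<xi> = 0"
    moreover have "gauss_weight \<xi> / (1 + norm (z \<xi>)) \<noteq> 0" using gauss_weight(1)[of \<xi>] norm_ge_zero[of "z \<xi>"] by (simp add: add_nonneg_eq_0_iff)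
    ultimately show "z \<xi> = 0" by simp
  qed
qed

text \<open>If \<open>v\<close> is the transform of \<open>f\<close>, the test function with transform \<open>\<rho> (j v)\<close> yields \<open>\<integral> \<rho> |j v|\<^sup>2 = 0\<close>, whence \<open>j v = 0\<close>
  and \<open>v = 0\<close>.\<close>

lemma range_J_orthogonal_trivial:
  assumes orth: "\<And>u. u \<in> Jdom k \<Longrightarrow> f \<bullet> Jop k u = 0" shows "f = 0"
proof -
  obtain v where v: "v \<in> L2" "FT f = cls v" by (rule FT_rep)
  have vm[measurable]: "v \<in> borel_measurable borel" using L2_measurable_borel[OF v(1)] .
  define w where "w \<xi> = jk k \<xi> *v v \<xi>" for \<xi>
  have wm[measurable]: "w \<in> borel_measurable borel" unfolding w_def by (rule measurable_symbolD[OF measurable_symbol_j vm])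
  have jwm[measurable]: "(\<lambda>\<xi>. jk k \<xi> *v w \<xi>) \<in> borel_measurable borel" by (rule measurable_symbolD[OF measurable_symbol_j wm])
  note [measurable] = gauss_weight(3)
  define \<rho> where "\<rho> \<xi> = gauss_weight \<xi> / (1 + norm (w \<xi>) + norm (jk k \<xi> *v w \<xi>))" for \<xi>
  have den: "1 + norm (w \<xi>) + norm (jk k \<xi> *v w \<xi>) > 0" for \<xi>
    using norm_ge_zero[of "w \<xi>"] norm_ge_zero[of "jk k \<xi> *v w \<xi>"] by linarith
  have \<rho>0: "\<rho> \<xi> > 0" for \<xi> using den[of \<xi>] gauss_weight(1)[of \<xi>] by (simp add: \<rho>_def)
  have [measurable]: "\<rho> \<in> borel_measurable borel" unfolding \<rho>_def by measurable
  have \<rho>t: "\<rho> \<xi> * t \<le> 1 * gauss_weight \<xi>" if "t \<le> 1 + norm (w \<xi>) + norm (jk k \<xi> *v w \<xi>)" for t \<xi>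
  proof -
    have "gauss_weight \<xi> * t \<le> gauss_weight \<xi> * (1 + norm (w \<xi>) + norm (jk k \<xi> *v w \<xi>))"
      using that gauss_weight(1)[of \<xi>] by (intro mult_left_mono) simp_all
    then show ?thesis using den[of \<xi>] by (simp add: \<rho>_def divide_le_eq)
  qed
  let ?z = "\<lambda>\<xi>. \<rho> \<xi> *\<^sub>R w \<xi>"
  have z: "?z \<in> L2"
  proof (rule L2_gauss_weight[where C = 1])
    show "norm (?z \<xi>) \<le> 1 * gauss_weight \<xi>" for \<xi> using \<rho>t[of "norm (w \<xi>)" \<xi>] \<rho>0[of \<xi>] by simp
  qed measurable
  have jz: "(\<lambda>\<xi>. jk k \<xi> *v ?z \<xi>) = (\<lambda>\<xi>. \<rho> \<xi> *\<^sub>R (jk k \<xi> *v w \<xi>))" by (simp add: mat_scaleR)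
  have jzL: "(\<lambda>\<xi>. jk k \<xi> *v ?z \<xi>) \<in> L2" unfolding jz
  proof (rule L2_gauss_weight[where C = 1])
    show "norm (\<rho> \<xi> *\<^sub>R (jk k \<xi> *v w \<xi>)) \<le> 1 * gauss_weight \<xi>" for \<xi>
      using \<rho>t[of "norm (jk k \<xi> *v w \<xi>)" \<xi>] \<rho>0[of \<xi>] by simp
  qed measurable
  obtain u where u: "FT u = cls ?z" using FT_surj by blast
  have ud: "u \<in> Jdom k" using lift_dom_fm_iff[OF measurable_symbol_j z u] jzL by simp
  have i: "integrable lborel (\<lambda>\<xi>. v \<xi> \<bullet> (jk k \<xi> *v ?z \<xi>))" by (rule integrable_inner_L2[OF v(1) jzL])
  have int0: "(LINT \<xi>|lborel. v \<xi> \<bullet> (jk k \<xi> *v ?z \<xi>)) = 0"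
    using Parseval_lsq[OF v(1) jzL v(2) FT_lift_op_fm[OF measurable_symbol_j ud z u]] orth[OF ud] by simp
  have pt: "AE \<xi> in lborel. - (v \<xi> \<bullet> (jk k \<xi> *v ?z \<xi>)) = \<rho> \<xi> * (norm (w \<xi>))\<^sup>2"
    using j_adj[of k]
  proof (rule eventually_mono)
    fix \<xi> assume adj: "\<forall>x y. (jk k \<xi> *v x) \<bullet> y = (- 1) * (x \<bullet> (jk k \<xi> *v y))"
    show "- (v \<xi> \<bullet> (jk k \<xi> *v ?z \<xi>)) = \<rho> \<xi> * (norm (w \<xi>))\<^sup>2"
      using adj[rule_format, of "v \<xi>" "?z \<xi>"] by (simp add: w_def[symmetric] power2_norm_eq_inner)
  qed
  have nn: "AE \<xi> in lborel. 0 \<le> - (v \<xi> \<bullet> (jk k \<xi> *v ?z \<xi>))"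
    using pt
  proof (rule eventually_mono)
    fix \<xi> assume e: "- (v \<xi> \<bullet> (jk k \<xi> *v ?z \<xi>)) = \<rho> \<xi> * (norm (w \<xi>))\<^sup>2"
    show "0 \<le> - (v \<xi> \<bullet> (jk k \<xi> *v ?z \<xi>))" unfolding e using \<rho>0[of \<xi>] by simp
  qed
  have "(LINT \<xi>|lborel. - (v \<xi> \<bullet> (jk k \<xi> *v ?z \<xi>))) = 0" using int0 by simp
  then have "AE \<xi> in lborel. - (v \<xi> \<bullet> (jk k \<xi> *v ?z \<xi>)) = 0"
    using integral_nonneg_eq_0_iff_AE[OF Bochner_Integration.integrable_minus[OF i] nn] by blast
  with pt have "AE \<xi> in lborel. jk k \<xi> *v v \<xi> = 0"
  proof eventually_elim
    fix \<xi> assume "- (v \<xi> \<bullet> (jk k \<xi> *v ?z \<xi>)) = \<rho> \<xi> * (norm (w \<xi>))\<^sup>2" "- (v \<xi> \<bullet> (jk k \<xi> *v ?z \<xi>)) = 0"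
    then have "\<rho> \<xi> * (norm (w \<xi>))\<^sup>2 = 0" by linarith
    then show "jk k \<xi> *v v \<xi> = 0" using \<rho>0[of \<xi>] by (simp add: w_def)
  qed
  then have "v \<doteq> (\<lambda>\<xi>. 0)" unfolding ae_eq_def by (rule j_kernel[OF vm])
  then have "cls v = cls (\<lambda>\<xi>. 0)" using cls_eq_iff[OF v(1) L2_zero] by simp
  then have "FT f = FT 0" by (simp add: v(2) cls_zero FT_0)
  then show ?thesis by (rule FT_inj)
qed

text \<open>Let \<open>y\<close>, \<open>v\<close> be the transforms of \<open>L J V\<close> and \<open>V\<close>.  The pencil equation says
  \<open>j (y + s (j v) - \<sigma> v) = 0\<close>, and injectivity removes the outer \<open>j\<close>.  Thus \<open>s (j v) = \<sigma> v - y\<close> is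
  square-integrable, so that \<open>U = J V\<close> belongs to the domain of \<open>S\<close>, and \<open>(L + S)U = \<sigma> V\<close>.\<close>

lemma unstable_mode_of_pencil:
  assumes V: "V \<in> Mdom k" "V \<noteq> 0" "Mop k V = \<sigma> *\<^sub>R Jop k V" and \<sigma>: "\<sigma> > 0"
  shows "unstable_mode F Q l0 jk sk (complex_of_real \<sigma>) k (fm (jk k) (rep V))"
proof -
  note d = MdomD[OF V(1)]
  define U where "U = fm (jk k) (rep V)"
  have Vd: "rep V \<in> fm_dom (jk k)" using d(1) by (simp add: lift_dom_def)
  have U: "U \<in> L2" unfolding U_def by (rule fm_L2[OF measurable_symbol_j Vd])
  have cU: "cls U = Jop k V" by (simp add: U_def lift_op_def)
  have UL: "U \<in> L_dom l0" using L_dom_cls[OF U] d(2) by (simp add: cU)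
  obtain v where v: "v \<in> L2" "FT V = cls v" by (rule FT_rep)
  obtain y where y: "y \<in> L2" "FT (Lop (Jop k V)) = cls y" by (rule FT_rep)
  define w where "w = (\<lambda>\<xi>. jk k \<xi> *v v \<xi>)"
  have w: "w \<in> L2" unfolding w_def using lift_dom_fm_iff[OF measurable_symbol_j v] d(1) by simp
  have FJ: "FT (Jop k V) = cls w" unfolding w_def by (rule FT_lift_op_fm[OF measurable_symbol_j d(1) v])
  have jy: "(\<lambda>\<xi>. jk k \<xi> *v y \<xi>) \<in> L2" using lift_dom_fm_iff[OF measurable_symbol_j y] d(3) by simp
  have pv: "(\<lambda>\<xi>. (jk k \<odot> sk k \<odot> jk k) \<xi> *v v \<xi>) \<in> L2" using lift_dom_fm_iff[OF measurable_symbol_jsj v] d(4) by simp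
  have "cls (\<lambda>\<xi>. jk k \<xi> *v y \<xi> + (jk k \<odot> sk k \<odot> jk k) \<xi> *v v \<xi>) = FT (Mop k V)"
    unfolding Mop_def FT_lin FT_lift_op_fm[OF measurable_symbol_j d(3) y] FT_lift_op_fm[OF measurable_symbol_jsj d(4) v]
    by (rule cls_add[OF jy pv, symmetric])
  also have "\<dots> = cls (\<lambda>\<xi>. \<sigma> *\<^sub>R w \<xi>)" unfolding V(3) FT_lin FJ by (rule cls_scaleR[OF w])
  finally have eq: "AE \<xi> in lborel. jk k \<xi> *v y \<xi> + (jk k \<odot> sk k \<odot> jk k) \<xi> *v v \<xi> = \<sigma> *\<^sub>R w \<xi>"
    unfolding cls_eq_iff[OF L2_add[OF jy pv] L2_scaleR[OF w]] ae_eq_def .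
  have sw: "(\<lambda>\<xi>. sk k \<xi> *v w \<xi>) \<in> borel_measurable borel" by (rule measurable_symbolD[OF measurable_symbol_s L2_measurable_borel[OF w]])
  have z: "(\<lambda>\<xi>. y \<xi> + sk k \<xi> *v w \<xi> - \<sigma> *\<^sub>R v \<xi>) \<in> borel_measurable borel"
    using sw L2_measurable_borel[OF y(1)] L2_measurable_borel[OF v(1)] by measurable
  have "AE \<xi> in lborel. y \<xi> + sk k \<xi> *v w \<xi> - \<sigma> *\<^sub>R v \<xi> = 0"
  proof (rule j_kernel[OF z])
    show "AE \<xi> in lborel. jk k \<xi> *v (y \<xi> + sk k \<xi> *v w \<xi> - \<sigma> *\<^sub>R v \<xi>) = 0"
      using eq
    proof (rule eventually_mono)
      fix \<xi> assume e: "jk k \<xi> *v y \<xi> + (jk k \<odot> sk k \<odot> jk k) \<xi> *v v \<xi> = \<sigma> *\<^sub>R w \<xi>"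
      then show "jk k \<xi> *v (y \<xi> + sk k \<xi> *v w \<xi> - \<sigma> *\<^sub>R v \<xi>) = 0"
        unfolding matrix_vector_mult_diff_distrib matrix_vector_right_distrib mat_scaleR sym_prod_mult w_def by simp
    qed
  qed
  then have seq: "(\<lambda>\<xi>. \<sigma> *\<^sub>R v \<xi> - y \<xi>) \<doteq> (\<lambda>\<xi>. sk k \<xi> *v w \<xi>)"
    unfolding ae_eq_def by (rule eventually_mono) (simp add: algebra_simps)
  have swL: "(\<lambda>\<xi>. sk k \<xi> *v w \<xi>) \<in> L2" by (rule L2_ae_cong[OF L2_diff[OF L2_scaleR[OF v(1)] y(1)] sw seq])
  have Sd: "Jop k V \<in> lift_dom (fm_dom (sk k))" using lift_dom_fm_iff[OF measurable_symbol_s w FJ] swL by simp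
  then have US: "U \<in> fm_dom (sk k)" using lift_dom_fm_cls[OF U] by (simp add: cU)
  have "FT (lift_op (fm (sk k)) (Jop k V)) = cls (\<lambda>\<xi>. sk k \<xi> *v w \<xi>)" by (rule FT_lift_op_fm[OF measurable_symbol_s Sd w FJ])
  also have "\<dots> = cls (\<lambda>\<xi>. \<sigma> *\<^sub>R v \<xi> - y \<xi>)"
    unfolding cls_eq_iff[OF swL L2_diff[OF L2_scaleR[OF v(1)] y(1)]] by (rule ae_eq_sym[OF seq])
  also have "\<dots> = FT (\<sigma> *\<^sub>R V - Lop (Jop k V))"
    unfolding FT_lin v(2) y(2) cls_scaleR[OF v(1)] by (rule cls_diff[OF L2_scaleR[OF v(1)] y(1), symmetric])
  finally have SU: "lift_op (fm (sk k)) (Jop k V) = \<sigma> *\<^sub>R V - Lop (Jop k V)" by (rule FT_inj)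
  define H where "H = (\<lambda>x. L_op F Q l0 U x + fm (sk k) U x)"
  note hl = L_op_cls[OF UL] and hs = fm_L2[OF measurable_symbol_s US]
  have H: "H \<in> L2" unfolding H_def by (rule L2_add[OF hl(1) hs])
  have "cls H = Lop (cls U) + lift_op (fm (sk k)) (cls U)"
    unfolding H_def lift_op_fm_cls[OF U] hl(2)[symmetric] by (rule cls_add[OF hl(1) hs, symmetric])
  then have cH: "cls H = \<sigma> *\<^sub>R V" by (simp add: cU SU)
  note J = lin_onD[OF lin_on_fm[OF measurable_symbol_j, of k]]
  have Hd: "H \<in> fm_dom (jk k)"
    unfolding lift_dom_fm_cls[OF H, symmetric] cH by (rule subspace_scale[OF J(1) d(1)])
  have "cls (\<lambda>x. complex_of_real \<sigma> *s U x) = cscale (complex_of_real \<sigma>) (cls U)" by (rule cscale_cls[OF U, symmetric])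
  also have "\<dots> = cls (fm (jk k) H)"
    unfolding cscale_of_real cU lift_op_fm_cls[OF H, symmetric] cH by (rule J(3)[OF d(1), symmetric])
  finally have eqH: "(\<lambda>x. complex_of_real \<sigma> *s U x) \<doteq> fm (jk k) H"
    unfolding cls_eq_iff[OF L2_cscale[OF U] fm_L2[OF measurable_symbol_j Hd]] .
  have "\<not> U \<doteq> (\<lambda>x. 0)"
  proof
    assume "U \<doteq> (\<lambda>x. 0)"
    then have "cls U = cls (\<lambda>x. 0)" using cls_eq_iff[OF U L2_zero] by simp
    then have "Jop k V = 0" by (simp add: cU cls_zero)
    then show False using Jop_inj[OF d(1)] V(2) by blast
  qed
  then show ?thesis
    unfolding unstable_mode_def U_def[symmetric] H_def[symmetric] using U US UL \<sigma> Hd eqH by simp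
qed

end

section \<open>Real operators and the sign count\<close>

locale real_transverse_model = transverse_model F Q l0 j0 \<mu> \<alpha> \<Sigma> jk sk
  for F :: "real ^ 'd::finite \<Rightarrow> real" and Q l0 j0 \<mu> \<alpha> \<Sigma> jk sk +
  assumes J_real: "\<And>k u. u \<in> fm_dom (jk k) \<Longrightarrow> real_valued u \<Longrightarrow> real_valued (fm (jk k) u)"
    and S_real: "\<And>k u. u \<in> fm_dom (sk k) \<Longrightarrow> real_valued u \<Longrightarrow> real_valued (fm (sk k) u)"
begin

lemma j_conj: "conj_sym (jk k)" by (rule conj_symI[OF measurable_symbol_j J_real])

lemma s_conj: "conj_sym (sk k)" by (rule conj_symI[OF measurable_symbol_s S_real])

lemma jsj_conj: "conj_sym (jk k \<odot> sk k \<odot> jk k)" by (intro conj_sym_prod j_conj s_conj)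

lemmas Conj_Jop = Conj_fm[OF measurable_symbol_j j_conj]

lemma Conj_Mop: assumes f: "f \<in> Mdom k" shows "Conj f \<in> Mdom k" "Mop k (Conj f) = Conj (Mop k f)"
  using Conj_Jop[OF MdomD(1)[OF f]] Conj_fm[OF measurable_symbol_jsj jsj_conj MdomD(4)[OF f]] Conj_Lop[OF MdomD(2)[OF f]]
    Conj_Jop[OF MdomD(3)[OF f]] by (simp_all add: Mdom_def Mop_def Conj_add)

lemma Mop_real_lsq: "f \<in> Mdom k \<Longrightarrow> f \<in> real_lsq \<Longrightarrow> Mop k f \<in> real_lsq"
  using Conj_Mop(2)[of f k] by (simp add: real_lsq_def)

lemma Jop_real_lsq: "f \<in> Jdom k \<Longrightarrow> f \<in> real_lsq \<Longrightarrow> Jop k f \<in> real_lsq"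
  using Conj_Jop(2)[of f k] by (simp add: real_lsq_def)

text \<open>The density of the range carries over to the real subspace because \<open>J\<close> commutes with conjugation.\<close>

lemma range_J_dense:
  assumes f: "f \<in> real_lsq" and e: "0 < e" shows "\<exists>u\<in>Jdom k \<inter> real_lsq. norm (f - Jop k u) < e"
proof -
  let ?S = "Jop k ` (Jdom k \<inter> real_lsq)"
  note J = lin_onD[OF lin_on_fm[OF measurable_symbol_j, of k]]
  have sub: "subspace (Jdom k \<inter> real_lsq)" by (rule subspace_inter[OF J(1) real_lsq_closed_subspace(1)])
  have "lin_on (Jdom k \<inter> real_lsq) (Jop k)" by (rule lin_on_subset[OF lin_on_fm[OF measurable_symbol_j] sub]) simp
  note l = lin_onD[OF this]
  have S: "subspace ?S"
    unfolding subspace_def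
  proof (intro conjI ballI allI)
    show "0 \<in> ?S" using subspace_0[OF sub] l(5) by (metis image_eqI)
    show "x + y \<in> ?S" if xy: "x \<in> ?S" "y \<in> ?S" for x y
    proof -
      obtain a b where ab: "a \<in> Jdom k \<inter> real_lsq" "x = Jop k a" "b \<in> Jdom k \<inter> real_lsq" "y = Jop k b" using xy by blast
      have "x + y = Jop k (a + b)" unfolding ab(2,4) by (rule l(2)[OF ab(1,3), symmetric])
      then show ?thesis using subspace_add[OF sub ab(1,3)] by blast
    qed
    show "c *\<^sub>R x \<in> ?S" if x: "x \<in> ?S" for c x
    proof -
      obtain a where a: "a \<in> Jdom k \<inter> real_lsq" "x = Jop k a" using x by blast
      have "c *\<^sub>R x = Jop k (c *\<^sub>R a)" unfolding a(2) by (rule l(3)[OF a(1), symmetric])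
      then show ?thesis using subspace_scale[OF sub a(1)] by blast
    qed
  qed
  have SX: "?S \<subseteq> real_lsq" using Jop_real_lsq by blast
  have triv: "v = 0" if v: "v \<in> real_lsq" and orth: "\<And>s. s \<in> ?S \<Longrightarrow> v \<bullet> s = 0" for v
  proof (rule range_J_orthogonal_trivial)
    fix u assume u: "u \<in> Jdom k"
    note cu = Conj_Jop[OF u]
    have r: "(1/2) *\<^sub>R (u + Conj u) \<in> Jdom k \<inter> real_lsq"
      using subspace_scale[OF J(1) subspace_add[OF J(1) u cu(1)]] real_part_in_real_lsq by blast
    have "Jop k ((1/2) *\<^sub>R (u + Conj u)) = (1/2) *\<^sub>R (Jop k u + Conj (Jop k u))"
      using J(3)[OF subspace_add[OF J(1) u cu(1)]] J(2)[OF u cu(1)] cu(2) by simp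
    moreover have "v \<bullet> Jop k ((1/2) *\<^sub>R (u + Conj u)) = 0" using orth r by blast
    ultimately have "v \<bullet> Jop k u + v \<bullet> Conj (Jop k u) = 0" by (simp add: inner_add_right)
    moreover have "v \<bullet> Conj (Jop k u) = v \<bullet> Jop k u" using v by (simp add: Conj_adjoint real_lsq_def)
    ultimately show "v \<bullet> Jop k u = 0" by simp
  qed
  show ?thesis using dense_if_trivial_complement[OF S SX real_lsq_closed_subspace triv f e] by blast
qed

text \<open>If \<open>\<phi>\<close> and \<open>w\<close> were two positive directions, a complex combination \<open>f\<close> of them would have \<open>J f\<close> orthogonal to
  the negative eigenspace of \<open>L\<close>, whence \<open>(M f, f) \<le> 0\<close>.  Complex coefficients are necessary, as the eigenspace
  of \<open>L\<close> has real dimension two; they are harmless because \<open>\<phi>\<close> and \<open>w\<close> are real-valued.\<close>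

lemma Mop_one_positive_direction:
  assumes \<phi>: "\<phi> \<in> Mdom k" "\<phi> \<in> real_lsq" "0 < Mop k \<phi> \<bullet> \<phi>"
    and w: "w \<in> Mdom k" "w \<in> real_lsq" "w \<bullet> Mop k \<phi> = 0"
  shows "Mop k w \<bullet> w \<le> 0"
proof (rule ccontr)
  assume "\<not> ?thesis"
  then have pos: "0 < Mop k w \<bullet> w" by simp
  obtain e where e: "\<And>f. f \<in> Ldom \<Longrightarrow> f \<bullet> e = 0 \<Longrightarrow> f \<bullet> cscale \<i> e = 0 \<Longrightarrow> 0 \<le> Lop f \<bullet> f"
    by (rule L_negative_direction) (rule that)
  \<comment> \<open>The complex inner product with \<open>e\<close>, which is complex linear.\<close>
  define pr where "pr f = Complex (f \<bullet> e) (f \<bullet> cscale \<i> e)" for f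
  have pr_add: "pr (f + g) = pr f + pr g" for f g by (simp add: pr_def inner_add_left complex_eq_iff)
  have pr_cscale: "pr (cscale c f) = c * pr f" for c f
  proof -
    have "pr (cscale \<i> f) = \<i> * pr f"
      using cscale_i_skew[of f e] cscale_i_isometry[of f e] by (simp add: pr_def complex_eq_iff)
    then have 1: "cscale \<i> f \<bullet> e = - (f \<bullet> cscale \<i> e)" "cscale \<i> f \<bullet> cscale \<i> e = f \<bullet> e" by (simp_all add: pr_def complex_eq_iff)
    show ?thesis unfolding cscale_decomp[of c f] pr_def inner_add_left inner_scaleR_left 1
      by (simp add: complex_eq_iff)
  qed
  define a where "a = pr (Jop k \<phi>)"
  define b where "b = pr (Jop k w)"
  have "\<exists>c d. c * a + d * b = 0 \<and> (c \<noteq> 0 \<or> d \<noteq> 0)"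
  proof (cases "a = 0")
    case True
    then show ?thesis by (intro exI[of _ 1] exI[of _ 0]) simp
  next
    case False
    then show ?thesis by (intro exI[of _ b] exI[of _ "- a"]) simp
  qed
  then obtain c d where cd: "c * a + d * b = 0" "c \<noteq> 0 \<or> d \<noteq> 0" by blast
  define f where "f = cscale c \<phi> + cscale d w"
  note M = lin_onD[OF lin_on_Mop[of k]]
  have f: "f \<in> Mdom k" unfolding f_def by (rule subspace_add[OF M(1) cscale_Mop(1)[OF \<phi>(1)] cscale_Mop(1)[OF w(1)]])
  note J = lin_onD[OF lin_on_fm[OF measurable_symbol_j, of k]]
  have Jf: "Jop k f = cscale c (Jop k \<phi>) + cscale d (Jop k w)"
    unfolding f_def J(2)[OF cscale_fm(1)[OF measurable_symbol_j MdomD(1)[OF \<phi>(1)]] cscale_fm(1)[OF measurable_symbol_j MdomD(1)[OF w(1)]]]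
      cscale_fm(2)[OF measurable_symbol_j MdomD(1)[OF \<phi>(1)]] cscale_fm(2)[OF measurable_symbol_j MdomD(1)[OF w(1)]] ..
  have "pr (Jop k f) = 0" unfolding Jf pr_add pr_cscale using cd(1) by (simp add: a_def b_def)
  then have "0 \<le> Lop (Jop k f) \<bullet> Jop k f" by (intro e MdomD(2)[OF f]) (simp_all add: pr_def complex_eq_iff)
  then have neg: "Mop k f \<bullet> f \<le> 0" using Mop_form[OF f] by linarith
  have C: "Conj \<phi> = \<phi>" "Conj w = w" "Conj (Mop k \<phi>) = Mop k \<phi>" "Conj (Mop k w) = Mop k w"
    using \<phi>(2) w(2) Mop_real_lsq[OF \<phi>(1,2)] Mop_real_lsq[OF w(1,2)] by (simp_all add: real_lsq_def)
  have x: "Mop k \<phi> \<bullet> w = 0" "Mop k w \<bullet> \<phi> = 0"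
    using w(3) Mop_sym[OF w(1) \<phi>(1)] by (simp_all add: inner_commute)
  have "Mop k f = cscale c (Mop k \<phi>) + cscale d (Mop k w)"
    unfolding f_def M(2)[OF cscale_Mop(1)[OF \<phi>(1)] cscale_Mop(1)[OF w(1)]] cscale_Mop(2)[OF \<phi>(1)] cscale_Mop(2)[OF w(1)] ..
  then have "(Mop k f) \<bullet> f = Re (c * cnj c) * (Mop k \<phi> \<bullet> \<phi>) + Re (d * cnj d) * (Mop k w \<bullet> w)"
    unfolding f_def by (simp add: inner_add_left inner_add_right cscale_inner_real C x)
  moreover have "0 < Re (c * cnj c) * (Mop k \<phi> \<bullet> \<phi>) + Re (d * cnj d) * (Mop k w \<bullet> w)"
  proof -
    have p: "0 \<le> Re (z * cnj z)" "z \<noteq> 0 \<Longrightarrow> 0 < Re (z * cnj z)" for z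
      by (simp_all add: complex_mult_cnj sum_power2_gt_zero_iff complex_eq_iff)
    show ?thesis
    proof (cases "c = 0")
      case True
      then show ?thesis using cd(2) p(2)[of d] pos by simp
    next
      case False
      have "0 < Re (c * cnj c) * (Mop k \<phi> \<bullet> \<phi>)" by (rule mult_pos_pos[OF p(2)[OF False] \<phi>(3)])
      moreover have "0 \<le> Re (d * cnj d) * (Mop k w \<bullet> w)" by (rule mult_nonneg_nonneg[OF p(1) less_imp_le[OF pos]])
      ultimately show ?thesis by linarith
    qed
  qed
  ultimately show False using neg by linarith
qed

end

section \<open>Bifurcation of an unstable mode\<close>

text \<open>Two members of a basis would both be multiples of one vector.\<close>

lemma eigdim_unique_one:
  assumes one: "eigdim D T z 1" and p: "eigdim D T z p" and u: "u \<in> D" "T u \<doteq> (\<lambda>x. z *s u x)" "\<not> u \<doteq> (\<lambda>x. 0)"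
  shows "p = 1"
proof -
  obtain g :: "nat \<Rightarrow> real \<Rightarrow> complex^'a" where
    g: "\<forall>u\<in>D. T u \<doteq> (\<lambda>x. z *s u x) \<longrightarrow> (\<exists>c. u \<doteq> (\<lambda>x. \<Sum>i<(1::nat). c i *s g i x))"
    using one unfolding eigdim_def by (elim exE conjE)
  have g: "\<exists>c. u \<doteq> (\<lambda>x. c *s g 0 x)" if u: "u \<in> D" "T u \<doteq> (\<lambda>x. z *s u x)" for u
  proof -
    have "\<exists>c. u \<doteq> (\<lambda>x. \<Sum>i<(1::nat). c i *s g i x)" by (rule g[rule_format, OF u])
    then obtain c where "u \<doteq> (\<lambda>x. \<Sum>i<(1::nat). c i *s g i x)" ..
    then have "u \<doteq> (\<lambda>x. c 0 *s g 0 x)" by simp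
    then show ?thesis ..
  qed
  obtain e :: "nat \<Rightarrow> real \<Rightarrow> complex^'a" where
    e: "\<forall>i<p. e i \<in> D \<and> T (e i) \<doteq> (\<lambda>x. z *s e i x)"
    and ind: "\<forall>c. (\<lambda>x. \<Sum>i<p. c i *s e i x) \<doteq> (\<lambda>x. 0) \<longrightarrow> (\<forall>i<p. c i = 0)"
    and span: "\<forall>u\<in>D. T u \<doteq> (\<lambda>x. z *s u x) \<longrightarrow> (\<exists>c. u \<doteq> (\<lambda>x. \<Sum>i<p. c i *s e i x))"
    using p unfolding eigdim_def by (elim exE conjE)
  have "p \<noteq> 0"
  proof
    assume "p = 0"
    then show False using span[rule_format, OF u(1,2)] u(3) by simp
  qed
  moreover have "\<not> p \<ge> 2"
  proof
    assume p2: "p \<ge> 2"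
    have comb: "(\<Sum>i<p. (if i = 0 then a else if i = 1 then b else 0) *s e i x) = a *s e 0 x + b *s e 1 x" for a b x
    proof -
      have "(\<Sum>i<p. (if i = 0 then a else if i = 1 then b else 0) *s e i x)
          = (\<Sum>i\<in>{0, 1}. (if i = 0 then a else if i = 1 then b else 0) *s e i x)"
        by (rule sum.mono_neutral_right) (use p2 in auto)
      then show ?thesis by simp
    qed
    have "0 < p" "1 < p" using p2 by simp_all
    note e0 = e[rule_format, OF this(1)] and e1 = e[rule_format, OF this(2)]
    from g[OF conjunct1[OF e0] conjunct2[OF e0]] obtain a where a: "e 0 \<doteq> (\<lambda>x. a *s g 0 x)" ..
    from g[OF conjunct1[OF e1] conjunct2[OF e1]] obtain b where b: "e 1 \<doteq> (\<lambda>x. b *s g 0 x)" ..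
    have "(\<lambda>x. b *s e 0 x + (- a) *s e 1 x) \<doteq> (\<lambda>x. 0)"
      using a b unfolding ae_eq_def by eventually_elim (simp add: vector_smult_assoc mult.commute)
    then have "(\<lambda>x. \<Sum>i<p. (if i = 0 then b else if i = 1 then - a else 0) *s e i x) \<doteq> (\<lambda>x. 0)" unfolding comb .
    from ind[rule_format, OF this, of 1] have "a = 0" using p2 by simp
    then have "(\<lambda>x. 1 *s e 0 x + 0 *s e 1 x) \<doteq> (\<lambda>x. 0)" using a by simp
    then have "(\<lambda>x. \<Sum>i<p. (if i = 0 then 1 else if i = 1 then 0 else 0) *s e i x) \<doteq> (\<lambda>x. 0)" unfolding comb .
    from ind[rule_format, OF this, of 0] show False using p2 by simp
  qed
  ultimately show ?thesis by simp
qed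

lemma cscale_0: "cscale c 0 = 0"
  using cscale_diff[of c 0 0] by simp

context real_transverse_model
begin

lemma rep_M_dom: "f \<in> Mdom k \<Longrightarrow> rep f \<in> M_dom F Q l0 jk sk k"
  by (simp add: M_dom_cls)

lemma M_op_rep: "f \<in> Mdom k \<Longrightarrow> M_op F Q l0 jk sk k (rep f) \<in> L2"
  "f \<in> Mdom k \<Longrightarrow> cls (M_op F Q l0 jk sk k (rep f)) = Mop k f"
  using M_op_cls[OF rep_M_dom] by simp_all

lemma graph_norm_rep: "f \<in> Mdom k \<Longrightarrow> graph_norm (M_op F Q l0 jk sk k) (rep f) = norm f + norm (Mop k f)"
  using cls_norm[OF M_op_rep(1), of f k] cls_norm[OF rep_L2, of f] by (simp add: graph_norm_def M_op_rep(2))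

text \<open>Index zero makes the range a complex hyperplane, and symmetry makes it orthogonal to \<open>\<phi>\<close>.  Then \<open>\<phi>\<close> itself
  spans a complement of the range and the component of \<open>f\<close> along it vanishes; the real part of a solution
  is a real solution.\<close>

lemma real_range_of_index_zero:
  assumes simple: "simple_eigenvalue (M_dom F Q l0 jk sk k) (M_op F Q l0 jk sk k) 0"
    and fred: "fredholm_index (M_dom F Q l0 jk sk k) (M_op F Q l0 jk sk k) 0"
    and \<phi>: "\<phi> \<in> Mdom k" "\<phi> \<in> real_lsq" "Mop k \<phi> = 0" "norm \<phi> = 1"
    and f: "f \<in> real_lsq" "f \<bullet> \<phi> = 0"
  shows "\<exists>u\<in>Mdom k \<inter> real_lsq. Mop k u = f"
proof -
  let ?D = "M_dom F Q l0 jk sk k" and ?T = "M_op F Q l0 jk sk k"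
  note M = lin_onD[OF lin_on_Mop[of k]]
  obtain p q where pq: "eigdim ?D ?T 0 p" "range_codim ?D ?T q" "(0::int) = int p - int q"
    using fred unfolding fredholm_index_def by blast
  have T\<phi>: "?T (rep \<phi>) \<doteq> (\<lambda>x. 0 *s rep \<phi> x)"
  proof -
    have "cls (?T (rep \<phi>)) = cls (\<lambda>x. 0)" using M_op_rep(2)[OF \<phi>(1)] \<phi>(3) by (simp add: cls_zero)
    then show ?thesis using cls_eq_iff[OF M_op_rep(1)[OF \<phi>(1)] L2_zero] by simp
  qed
  have "\<not> rep \<phi> \<doteq> (\<lambda>x. 0)"
  proof
    assume "rep \<phi> \<doteq> (\<lambda>x. 0)"
    then have "cls (rep \<phi>) = cls (\<lambda>x. 0)" unfolding cls_eq_iff[OF rep_L2 L2_zero] .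
    then show False using \<phi>(4) by (simp add: cls_zero)
  qed
  from eigdim_unique_one[OF simple[unfolded simple_eigenvalue_def] pq(1) rep_M_dom[OF \<phi>(1)] T\<phi> this]
  have "q = 1" using pq(3) by simp
  with pq(2) obtain e :: "nat \<Rightarrow> 'd vfun" where e: "\<forall>i<(1::nat). e i \<in> L2"
    and dec: "\<forall>f\<in>L2. \<exists>u\<in>?D. \<exists>c. f \<doteq> (\<lambda>x. ?T u x + (\<Sum>i<(1::nat). c i *s e i x))"
    unfolding range_codim_def by blast
  define E where "E = cls (e 0)"
  have dec: "\<exists>u\<in>Mdom k. \<exists>c. g = Mop k u + cscale c E" for g
  proof -
    obtain u c where u: "u \<in> ?D" "rep g \<doteq> (\<lambda>x. ?T u x + (\<Sum>i<(1::nat). c i *s e i x))" using dec rep_L2 by blast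
    have eL: "e 0 \<in> L2" using e by simp
    have "rep g \<doteq> (\<lambda>x. ?T u x + c 0 *s e 0 x)" using u(2) by simp
    then have "cls (rep g) = cls (\<lambda>x. ?T u x + c 0 *s e 0 x)"
      unfolding cls_eq_iff[OF rep_L2 L2_add[OF M_op_cls(1)[OF u(1)] L2_cscale[OF eL]]] .
    also have "\<dots> = Mop k (cls u) + cscale (c 0) E"
      unfolding E_def cscale_cls[OF eL] M_op_cls(2)[OF u(1), symmetric]
      by (rule cls_add[OF M_op_cls(1)[OF u(1)] L2_cscale[OF eL], symmetric])
    finally have "g = Mop k (cls u) + cscale (c 0) E" by simp
    moreover have "cls u \<in> Mdom k" using M_dom_cls[OF M_dom_L2[OF u(1)]] u(1) by simp
    ultimately show ?thesis by blast
  qed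
  have C\<phi>: "Conj \<phi> = \<phi>" using \<phi>(2) by (simp add: real_lsq_def)
  have perp: "Mop k u \<bullet> cscale d \<phi> = 0" if u: "u \<in> Mdom k" for u d
    using Mop_sym[OF u cscale_Mop(1)[OF \<phi>(1), of d]] cscale_Mop(2)[OF \<phi>(1), of d] \<phi>(3) by (simp add: cscale_0)
  have perp1: "Mop k u \<bullet> \<phi> = 0" if u: "u \<in> Mdom k" for u using Mop_sym[OF u \<phi>(1)] \<phi>(3) by simp
  obtain u1 c1 where 1: "u1 \<in> Mdom k" "\<phi> = Mop k u1 + cscale c1 E" using dec by blast
  have c1: "c1 \<noteq> 0"
  proof
    assume "c1 = 0"
    then have "\<phi> = Mop k u1" using 1(2) cscale_decomp[of 0 E] by simp
    then have "\<phi> \<bullet> \<phi> = 0" using perp1[OF 1(1)] by simp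
    then show False using \<phi>(4) by simp
  qed
  obtain u c where u: "u \<in> Mdom k" "f = Mop k u + cscale c E" using dec by blast
  \<comment> \<open>Replaces the given complement vector \<open>E\<close> of the range by \<open>\<phi>\<close>.\<close>
  define d where "d = c / c1"
  define v where "v = u - cscale d u1"
  have v: "v \<in> Mdom k" unfolding v_def by (rule subspace_diff[OF M(1) u(1) cscale_Mop(1)[OF 1(1)]])
  have "Mop k v = Mop k u - cscale d (Mop k u1)"
    unfolding v_def M(4)[OF u(1) cscale_Mop(1)[OF 1(1)]] cscale_Mop(2)[OF 1(1)] ..
  moreover have "cscale d \<phi> = cscale d (Mop k u1) + cscale c E"
    by (subst 1(2)) (simp add: cscale_add cscale_cscale d_def c1)
  ultimately have fv: "f = Mop k v + cscale d \<phi>" using u(2) by simp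
  have \<phi>\<phi>: "\<phi> \<bullet> \<phi> = 1" using \<phi>(4) by (simp add: norm_eq_1)
  have "f \<bullet> \<phi> = Re d"
    using cscale_inner_real[OF C\<phi> C\<phi>, of d 1] perp1[OF v] cscale_decomp[of 1 \<phi>] by (simp add: fv inner_add_left \<phi>\<phi>)
  moreover have "f \<bullet> cscale \<i> \<phi> = Im d"
    using cscale_inner_real[OF C\<phi> C\<phi>, of d \<i>] perp[OF v, of \<i>] by (simp add: fv inner_add_left \<phi>\<phi>)
  moreover have Cf: "Conj f = f" using f(1) by (simp add: real_lsq_def)
  ultimately have "d = 0" using f(2) real_orth_i[OF Cf C\<phi>] by (simp add: complex_eq_iff)
  then have fM: "f = Mop k v" using fv cscale_decomp[of 0 \<phi>] by simp
  note cv = Conj_Mop[OF v]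
  have sum: "v + Conj v \<in> Mdom k" by (rule subspace_add[OF M(1) v cv(1)])
  have "Mop k ((1/2) *\<^sub>R (v + Conj v)) = (1/2) *\<^sub>R (f + f)"
    unfolding M(3)[OF sum] M(2)[OF v cv(1)] cv(2) fM[symmetric] Cf ..
  also have "\<dots> = f" by (simp add: scaleR_2[symmetric])
  finally have "Mop k ((1/2) *\<^sub>R (v + Conj v)) = f" .
  moreover have "(1/2) *\<^sub>R (v + Conj v) \<in> Mdom k \<inter> real_lsq" using subspace_scale[OF M(1) sum] real_part_in_real_lsq by blast
  ultimately show ?thesis by blast
qed

text \<open>The derivative is given on functions; boundedness makes it well defined on classes, as it annihilates
  differences of equivalent functions.\<close>

lemma bounded_op_ae_cong:
  assumes A: "bounded_op (M_dom F Q l0 jk sk k) (graph_norm (M_op F Q l0 jk sk k)) A"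
    and u: "u \<in> M_dom F Q l0 jk sk k" and v: "v \<in> M_dom F Q l0 jk sk k" and uv: "u \<doteq> v"
  shows "cls (A u) = cls (A v)"
proof -
  let ?D = "M_dom F Q l0 jk sk k" and ?T = "M_op F Q l0 jk sk k"
  obtain C where AL: "\<forall>u\<in>?D. A u \<in> L2" and C: "\<forall>u\<in>?D. l2_norm (A u) \<le> C * graph_norm ?T u"
    and lin: "\<forall>u\<in>?D. \<forall>v\<in>?D. \<forall>a b. A (\<lambda>x. a *s u x + b *s v x) \<doteq> (\<lambda>x. a *s A u x + b *s A v x)"
    using A unfolding bounded_op_def by blast
  note uL = M_dom_L2[OF u] and vL = M_dom_L2[OF v]
  define w where "w = (\<lambda>x. 1 *s u x + (- 1) *s v x)"
  have wL: "w \<in> L2" unfolding w_def by (intro L2_add L2_cscale uL vL)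
  have "w \<doteq> (\<lambda>x. 0)" using uv unfolding ae_eq_def w_def by (rule eventually_mono) simp
  then have w0: "cls w = 0" unfolding cls_zero[symmetric] cls_eq_iff[OF wL L2_zero] .
  note M = lin_onD[OF lin_on_Mop[of k]]
  have wd: "w \<in> ?D" unfolding M_dom_cls[OF wL] w0 by (rule subspace_0[OF M(1)])
  have Tw: "l2_norm (?T w) = 0" unfolding cls_norm[OF M_op_cls(1)[OF wd], symmetric] M_op_cls(2)[OF wd] w0 M(5) by simp
  have "l2_norm w = 0" unfolding cls_norm[OF wL, symmetric] w0 by simp
  then have "l2_norm (A w) \<le> 0" using C[rule_format, OF wd] Tw by (simp add: graph_norm_def)
  then have "norm (cls (A w)) \<le> 0" unfolding cls_norm[OF AL[rule_format, OF wd]] .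
  then have "cls (A w) = 0" by simp
  moreover have "cls (A w) = cls (A u) - cls (A v)"
  proof -
    have Au: "A u \<in> L2" and Av: "A v \<in> L2" and Aw: "A w \<in> L2" using AL u v wd by blast+
    have "A w \<doteq> (\<lambda>x. 1 *s A u x + (- 1) *s A v x)" unfolding w_def using lin u v by blast
    then have "A w \<doteq> (\<lambda>x. A u x - A v x)" by simp
    then show ?thesis unfolding cls_diff[OF Au Av] cls_eq_iff[OF Aw L2_diff[OF Au Av]] .
  qed
  ultimately show ?thesis by simp
qed

text \<open>The derivative \<open>B\<close> maps \<open>\<phi>\<close> to a limit of real-valued functions, so
  the complex number in the non-degeneracy condition is real, and its sign tells on which side of
  \<open>k\<^sub>0\<close> the form of \<open>M\<^sub>k\<close> at \<open>\<phi>\<close> becomes positive.\<close>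

theorem unstable_modes_near_simple_kernel:
  assumes simple: "simple_eigenvalue (M_dom F Q l0 jk sk k0) (M_op F Q l0 jk sk k0) 0"
    and \<phi>_eigenvector: "\<phi> \<in> M_dom F Q l0 jk sk k0" "M_op F Q l0 jk sk k0 \<phi> \<doteq> (\<lambda>x. 0)"
    and \<phi>_real: "real_valued \<phi>" and \<phi>_normalized: "l2_norm \<phi> = 1"
    and fredholm: "fredholm_index (M_dom F Q l0 jk sk k0) (M_op F Q l0 jk sk k0) 0"
    and smooth: "smooth_family_near (M_dom F Q l0 jk sk) (M_op F Q l0 jk sk) k0"
    and derivative: "has_op_derivative (M_dom F Q l0 jk sk k0)
          (graph_norm (M_op F Q l0 jk sk k0)) (M_op F Q l0 jk sk) M' k0"
    and nondegenerate: "l2_inner (M' \<phi>) \<phi> \<noteq> 0" and \<epsilon>: "\<epsilon> > 0"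
  shows "\<exists>k \<sigma>. \<bar>k - k0\<bar> < \<epsilon> \<and> \<sigma> > 0 \<and>
           (\<exists>U. unstable_mode F Q l0 jk sk (complex_of_real \<sigma>) k U)"
proof -
  let ?D0 = "M_dom F Q l0 jk sk k0" and ?T = "M_op F Q l0 jk sk"
  define D where "D = Mdom k0 \<inter> real_lsq"
  obtain r0 where r0: "r0 > 0" "\<And>k. \<bar>k - k0\<bar> < r0 \<Longrightarrow> ?D0 \<subseteq> M_dom F Q l0 jk sk k"
    using smooth unfolding smooth_family_near_def by blast
  have Dk: "f \<in> Mdom (k0 + h)" if "\<bar>h\<bar> < r0" "f \<in> Mdom k0" for f h
    using r0(2)[of "k0 + h"] that rep_M_dom[OF that(2)] M_dom_cls[OF rep_L2, of f "k0 + h"] by auto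
  define p where "p = cls \<phi>"
  note \<phi>L = M_dom_L2[OF \<phi>_eigenvector(1)]
  have p: "p \<in> Mdom k0" using M_dom_cls[OF \<phi>L] \<phi>_eigenvector(1) by (simp add: p_def)
  have pR: "p \<in> real_lsq" using real_valued_iff[OF \<phi>L] \<phi>_real by (simp add: real_lsq_def p_def)
  have Mp: "Mop k0 p = 0"
    using M_op_cls[OF \<phi>_eigenvector(1)] \<phi>_eigenvector(2) cls_eq_iff[OF M_op_cls(1)[OF \<phi>_eigenvector(1)] L2_zero]
    by (simp add: p_def cls_zero)
  have np: "norm p = 1" using cls_norm[OF \<phi>L] \<phi>_normalized by (simp add: p_def)
  have pD: "p \<in> D" using p pR by (simp add: D_def)

  have bM': "bounded_op ?D0 (graph_norm (?T k0)) M'" using derivative by (simp add: has_op_derivative_def)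
  then obtain C where M'L: "\<forall>u\<in>?D0. M' u \<in> L2" and C: "\<forall>u\<in>?D0. l2_norm (M' u) \<le> C * graph_norm (?T k0) u"
    unfolding bounded_op_def by blast
  define B where "B = lift_op M'"
  have Bp: "B p = cls (M' \<phi>)"
  proof -
    have "rep p \<doteq> \<phi>" unfolding p_def by (rule rep_cls[OF \<phi>L])
    from bounded_op_ae_cong[OF bM' rep_M_dom[OF p] \<phi>_eigenvector(1) this] show ?thesis by (simp add: B_def lift_op_def)
  qed
  have Bbd: "norm (B f) \<le> C * (norm f + norm (Mop k0 f))" if f: "f \<in> D" for f
  proof -
    have d: "f \<in> Mdom k0" using f by (simp add: D_def)
    note r = rep_M_dom[OF d]
    show ?thesis using C[rule_format, OF r] cls_norm[OF M'L[rule_format, OF r]] by (simp add: graph_norm_rep[OF d] B_def lift_op_def)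
  qed
  have der: "\<exists>r>0. \<forall>h. 0 < \<bar>h\<bar> \<and> \<bar>h\<bar> < r \<longrightarrow> (\<forall>u\<in>D.
      norm ((1 / h) *\<^sub>R (Mop (k0 + h) u - Mop (k0 + 0) u) - B u) \<le> e * (norm u + norm (Mop (k0 + 0) u)))"
    if e: "e > 0" for e
  proof -
    obtain r where r: "r > 0" "\<And>h u. 0 < \<bar>h\<bar> \<Longrightarrow> \<bar>h\<bar> < r \<Longrightarrow> u \<in> ?D0 \<Longrightarrow>
        l2_norm (\<lambda>x. (1 / h) *\<^sub>R (?T (k0 + h) u x - ?T k0 u x) - M' u x) \<le> e * graph_norm (?T k0) u"
      using derivative e unfolding has_op_derivative_def by blast
    have "norm ((1 / h) *\<^sub>R (Mop (k0 + h) f - Mop (k0 + 0) f) - B f) \<le> e * (norm f + norm (Mop (k0 + 0) f))"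
      if h: "0 < \<bar>h\<bar>" "\<bar>h\<bar> < min r r0" and f: "f \<in> D" for h f
    proof -
      have d: "f \<in> Mdom k0" using f by (simp add: D_def)
      have dh: "f \<in> Mdom (k0 + h)" by (rule Dk[OF _ d]) (use h in simp)
      note a = M_op_rep[OF dh] and b = M_op_rep[OF d] and m = M'L[rule_format, OF rep_M_dom[OF d]]
      note ab = L2_diff[OF a(1) b(1)]
      have "cls (\<lambda>x. (1 / h) *\<^sub>R (?T (k0 + h) (rep f) x - ?T k0 (rep f) x) - M' (rep f) x)
          = (1 / h) *\<^sub>R (Mop (k0 + h) f - Mop k0 f) - B f"
        unfolding B_def lift_op_def a(2)[symmetric] b(2)[symmetric] cls_diff[OF a(1) b(1)] cls_scaleR[OF ab]
        by (rule cls_diff[OF L2_scaleR[OF ab] m, symmetric])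
      then have "norm ((1 / h) *\<^sub>R (Mop (k0 + h) f - Mop k0 f) - B f)
          = l2_norm (\<lambda>x. (1 / h) *\<^sub>R (?T (k0 + h) (rep f) x - ?T k0 (rep f) x) - M' (rep f) x)"
        using cls_norm[OF L2_diff[OF L2_scaleR[OF ab, of "1 / h"] m]] by simp
      also have "\<dots> \<le> e * graph_norm (?T k0) (rep f)" by (rule r(2)[OF h(1) _ rep_M_dom[OF d]]) (use h in simp)
      finally show ?thesis by (simp add: graph_norm_rep[OF d])
    qed
    then show ?thesis using r(1) r0(1) by (intro exI[of _ "min r r0"]) simp
  qed

  have C_p: "Conj p = p" using pR by (simp add: real_lsq_def)
  have im0: "B p \<bullet> cscale \<i> p = 0"
  proof (rule ccontr)
    assume ne: "B p \<bullet> cscale \<i> p \<noteq> 0"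
    define e where "e = \<bar>B p \<bullet> cscale \<i> p\<bar> / 2"
    have e: "e > 0" using ne by (simp add: e_def)
    obtain r where r: "r > 0" "\<forall>h. 0 < \<bar>h\<bar> \<and> \<bar>h\<bar> < r \<longrightarrow> (\<forall>u\<in>D.
      norm ((1 / h) *\<^sub>R (Mop (k0 + h) u - Mop (k0 + 0) u) - B u) \<le> e * (norm u + norm (Mop (k0 + 0) u)))"
      using der[OF e] by blast
    define h where "h = min r r0 / 2"
    have h: "0 < \<bar>h\<bar>" "\<bar>h\<bar> < r" "\<bar>h\<bar> < r0" using r(1) r0(1) by (auto simp: h_def)
    define y where "y = (1 / h) *\<^sub>R (Mop (k0 + h) p - Mop (k0 + 0) p)"
    have "y \<in> real_lsq" unfolding y_def
      using subspace_scale[OF real_lsq_closed_subspace(1) subspace_diff[OF real_lsq_closed_subspace(1) Mop_real_lsq[OF Dk[OF h(3) p] pR] Mop_real_lsq[of p "k0 + 0"]]] p pR by simp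
    then have "y \<bullet> cscale \<i> p = 0" using real_orth_i[of y p] C_p by (simp add: real_lsq_def)
    then have "\<bar>B p \<bullet> cscale \<i> p\<bar> = \<bar>(y - B p) \<bullet> cscale \<i> p\<bar>" by (simp add: inner_diff_left)
    also have "\<dots> \<le> norm (y - B p) * norm (cscale \<i> p)" by (rule Cauchy_Schwarz_ineq2)
    also have "\<dots> = norm (y - B p)" by (simp add: norm_cscale np)
    also have "\<dots> \<le> e * (norm p + norm (Mop (k0 + 0) p))" using r(2) h pD unfolding y_def by blast
    also have "\<dots> = e" using Mp np by simp
    finally show False using e by (simp add: e_def)
  qed
  have nondeg: "B p \<bullet> p \<noteq> 0"
  proof
    assume re0: "B p \<bullet> p = 0"
    have "l2_inner (M' \<phi>) \<phi> = Complex (B p \<bullet> p) (B p \<bullet> cscale \<i> p)"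
      unfolding Bp unfolding p_def by (rule l2_inner_cls[OF M'L[rule_format, OF \<phi>_eigenvector(1)] \<phi>L])
    then show False using nondegenerate unfolding re0 im0 by (simp add: complex_eq_iff)
  qed

  have linM: "lin_on D (Mop (k0 + h))" if "\<bar>h\<bar> < r0" for h
    by (rule lin_on_subset[OF lin_on_Mop]) (use subspace_inter[OF lin_onD(1)[OF lin_on_Mop] real_lsq_closed_subspace(1)] Dk[OF that] in \<open>auto simp: D_def\<close>)
  have "\<exists>r>0. \<forall>h. \<bar>h\<bar> < r \<and> 0 < h * (B p \<bullet> p) \<longrightarrow>
      \<bar>h\<bar> < r0 \<and> 0 < Mop (k0 + h) p \<bullet> p \<and> (\<forall>f\<in>real_lsq. \<exists>u\<in>D. Mop (k0 + h) u = f)"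
  proof (rule surj_after_simple_kernel_splits[where M = "\<lambda>h. Mop (k0 + h)" and D = D and X = real_lsq and M' = B and \<phi> = p and C = C])
    show "subspace (real_lsq :: 'd lsq set)" "closed (real_lsq :: 'd lsq set)" by (rule real_lsq_closed_subspace)+
    show "D \<subseteq> real_lsq" by (simp add: D_def)
    show "0 < r0" by (rule r0)
    show "lin_on D (Mop (k0 + h))" if "\<bar>h\<bar> < r0" for h by (rule linM[OF that])
    show "Mop (k0 + h) u \<in> real_lsq" if "\<bar>h\<bar> < r0" "u \<in> D" for h u
      using that Dk by (intro Mop_real_lsq) (simp_all add: D_def)
    show "Mop (k0 + h) u \<bullet> v = u \<bullet> Mop (k0 + h) v" if "\<bar>h\<bar> < r0" "u \<in> D" "v \<in> D" for h u v
      using that Dk by (intro Mop_sym) (simp_all add: D_def)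
    show "p \<in> D" by (rule pD)
    show "Mop (k0 + 0) p = 0" using Mp by simp
    show "norm p = 1" by (rule np)
    show "\<exists>u\<in>D. Mop (k0 + 0) u = f" if "f \<in> real_lsq" "f \<bullet> p = 0" for f
      using real_range_of_index_zero[OF simple fredholm p pR Mp np that] by (simp add: D_def)
    show "\<exists>r>0. \<forall>h. 0 < \<bar>h\<bar> \<and> \<bar>h\<bar> < r \<longrightarrow> (\<forall>u\<in>D.
      norm ((1 / h) *\<^sub>R (Mop (k0 + h) u - Mop (k0 + 0) u) - B u) \<le> e * (norm u + norm (Mop (k0 + 0) u)))"
      if "0 < e" for e by (rule der[OF that])
    show "norm (B u) \<le> C * (norm u + norm (Mop (k0 + 0) u))" if "u \<in> D" for u using Bbd[OF that] by simp
    show "B p \<bullet> p \<noteq> 0" by (rule nondeg)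
  qed
  then obtain r where r: "r > 0" "\<And>h. \<bar>h\<bar> < r \<Longrightarrow> 0 < h * (B p \<bullet> p) \<Longrightarrow>
      \<bar>h\<bar> < r0 \<and> 0 < Mop (k0 + h) p \<bullet> p \<and> (\<forall>f\<in>real_lsq. \<exists>u\<in>D. Mop (k0 + h) u = f)" by blast
  define h where "h = sgn (B p \<bullet> p) * (min r \<epsilon> / 2)"
  have m: "0 < min r \<epsilon> / 2" "min r \<epsilon> / 2 < r" "min r \<epsilon> / 2 < \<epsilon>" using r(1) \<epsilon> by auto
  have ah: "\<bar>h\<bar> = min r \<epsilon> / 2" using nondeg m(1) by (simp add: h_def abs_mult abs_sgn_eq)
  have "h * (B p \<bullet> p) = \<bar>B p \<bullet> p\<bar> * (min r \<epsilon> / 2)" by (simp add: h_def abs_sgn mult_ac)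
  moreover have "0 < \<bar>B p \<bullet> p\<bar> * (min r \<epsilon> / 2)" by (rule mult_pos_pos[OF _ m(1)]) (use nondeg in simp)
  ultimately have "0 < h * (B p \<bullet> p)" by (simp only:)
  then have hr: "\<bar>h\<bar> < r0" and pos: "0 < Mop (k0 + h) p \<bullet> p" and surj: "\<forall>f\<in>real_lsq. \<exists>u\<in>D. Mop (k0 + h) u = f"
    using r(2)[of h] ah m by auto
  define k where "k = k0 + h"
  have DM: "u \<in> Mdom k" "u \<in> real_lsq" if "u \<in> D" for u using that Dk[OF hr] by (auto simp: D_def k_def)
  obtain Ce where Ce: "\<And>f. f \<in> Mdom k \<Longrightarrow> Mop k f \<bullet> f + Jop k f \<bullet> Jop k f \<le> Ce * (f \<bullet> f)"
    by (rule M_estimate) (rule that)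
  have subJ: "subspace (Jdom k \<inter> real_lsq)" by (rule subspace_inter[OF lin_onD(1)[OF lin_on_fm[OF measurable_symbol_j]] real_lsq_closed_subspace(1)])
  have "\<exists>\<sigma>>0. \<exists>V\<in>D. V \<noteq> 0 \<and> Mop k V = \<sigma> *\<^sub>R Jop k V"
  proof (rule positive_eigenvalue_of_indefinite_pencil[where X = real_lsq and D = D and M = "Mop k" and J = "Jop k"
        and DJ = "Jdom k \<inter> real_lsq" and c = 1 and C = Ce and \<phi> = p])
    show "subspace (real_lsq :: 'd lsq set)" "closed (real_lsq :: 'd lsq set)" by (rule real_lsq_closed_subspace)+
    show "D \<subseteq> real_lsq" by (simp add: D_def)
    show "lin_on D (Mop k)" unfolding k_def by (rule linM[OF hr])
    show "Mop k u \<in> real_lsq" if "u \<in> D" for u by (rule Mop_real_lsq[OF DM[OF that]])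
    show "Mop k u \<bullet> v = u \<bullet> Mop k v" if "u \<in> D" "v \<in> D" for u v by (rule Mop_sym[OF DM(1)[OF that(1)] DM(1)[OF that(2)]])
    show "\<exists>u\<in>D. Mop k u = f" if "f \<in> real_lsq" for f using surj that by (simp add: k_def)
    show "lin_on (Jdom k \<inter> real_lsq) (Jop k)" by (rule lin_on_subset[OF lin_on_fm[OF measurable_symbol_j] subJ]) simp
    show "D \<subseteq> Jdom k \<inter> real_lsq" using DM MdomD(1) by blast
    show "Jop k u \<in> real_lsq" if "u \<in> Jdom k \<inter> real_lsq" for u using that Jop_real_lsq by blast
    show "Jdom k \<inter> real_lsq \<subseteq> real_lsq" by simp
    show "Jop k u \<bullet> v = - (u \<bullet> Jop k v)" if "u \<in> Jdom k \<inter> real_lsq" "v \<in> Jdom k \<inter> real_lsq" for u v using that Jop_skew by blast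
    show "\<exists>u\<in>Jdom k \<inter> real_lsq. norm (f - Jop k u) < e" if "f \<in> real_lsq" "0 < e" for f e by (rule range_J_dense[OF that])
    show "Mop k u \<bullet> u + 1 * (Jop k u \<bullet> Jop k u) \<le> Ce * (u \<bullet> u)" if "u \<in> D" for u using Ce[OF DM(1)[OF that]] by simp
    show "p \<in> D" by (rule pD)
    show "0 < Mop k p \<bullet> p" using pos by (simp add: k_def)
    show "Mop k w \<bullet> w \<le> 0" if "w \<in> D" "w \<bullet> Mop k p = 0" for w
      using Mop_one_positive_direction[OF DM[OF pD] _ DM[OF that(1)] that(2)] pos by (simp add: k_def)
  qed simp
  then obtain \<sigma> V where V: "\<sigma> > 0" "V \<in> D" "V \<noteq> 0" "Mop k V = \<sigma> *\<^sub>R Jop k V" by blast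
  have "unstable_mode F Q l0 jk sk (complex_of_real \<sigma>) k (fm (jk k) (rep V))"
    by (rule unstable_mode_of_pencil[OF DM(1)[OF V(2)] V(3,4,1)])
  moreover have "\<bar>k - k0\<bar> < \<epsilon>" using ah m by (simp add: k_def)
  ultimately show ?thesis using V(1) by blast
qed

end

theorem lemma3p1:
  fixes F :: "real ^ 'd::finite \<Rightarrow> real" and Q :: "real \<Rightarrow> real ^ 'd"
    and l0 j0 :: "'d symbol" and \<mu> \<alpha> :: real and \<Sigma> :: "real set"
    and jk sk :: "real \<Rightarrow> 'd symbol"
    and k0 :: real and \<phi> :: "'d vfun" and M' :: "'d vfun \<Rightarrow> 'd vfun"
  assumes framework: "transverse_model F Q l0 j0 \<mu> \<alpha> \<Sigma> jk sk"
    and J_real: "\<And>k u. u \<in> fm_dom (jk k) \<Longrightarrow> real_valued u \<Longrightarrow> real_valued (fm (jk k) u)"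
    and S_real: "\<And>k u. u \<in> fm_dom (sk k) \<Longrightarrow> real_valued u \<Longrightarrow> real_valued (fm (sk k) u)"
    and k0_nonzero: "k0 \<noteq> 0"
    and zero_simple: "simple_eigenvalue (M_dom F Q l0 jk sk k0) (M_op F Q l0 jk sk k0) 0"
    and \<phi>_eigenvector: "\<phi> \<in> M_dom F Q l0 jk sk k0" "M_op F Q l0 jk sk k0 \<phi> \<doteq> (\<lambda>x. 0)"
    and \<phi>_smooth: "\<phi> \<in> sobolev_inf"
    and \<phi>_real: "real_valued \<phi>"
    and \<phi>_normalized: "l2_norm \<phi> = 1"
    and fredholm: "fredholm_index (M_dom F Q l0 jk sk k0) (M_op F Q l0 jk sk k0) 0"
    and smooth: "smooth_family_near (M_dom F Q l0 jk sk) (M_op F Q l0 jk sk) k0"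
    and derivative: "has_op_derivative (M_dom F Q l0 jk sk k0)
          (graph_norm (M_op F Q l0 jk sk k0)) (M_op F Q l0 jk sk) M' k0"
    and nondegenerate: "l2_inner (M' \<phi>) \<phi> \<noteq> 0"
  shows "\<forall>\<epsilon>>0. \<exists>k \<sigma>. \<bar>k - k0\<bar> < \<epsilon> \<and> \<sigma> > 0 \<and>
           (\<exists>U. unstable_mode F Q l0 jk sk (complex_of_real \<sigma>) k U)"
proof (intro allI impI)
  fix \<epsilon> :: real assume \<epsilon>: "\<epsilon> > 0"
  interpret real_transverse_model F Q l0 j0 \<mu> \<alpha> \<Sigma> jk sk
    by (intro real_transverse_model.intro real_transverse_model_axioms.intro framework J_real S_real)
  show "\<exists>k \<sigma>. \<bar>k - k0\<bar> < \<epsilon> \<and> \<sigma> > 0 \<and> (\<exists>U. unstable_mode F Q l0 jk sk (complex_of_real \<sigma>) k U)"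
    by (rule unstable_modes_near_simple_kernel[OF zero_simple \<phi>_eigenvector \<phi>_real \<phi>_normalized fredholm smooth
          derivative nondegenerate \<epsilon>])
qed

end
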